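(* Let $G$ be an $\mathcal{A}_3$-group with an abelian subgroup of index $p$ and without an $\mathcal{A}_1$-subgroup of index $p$. Then $d(G)=2$ and $c(G)=4$ if and only if $G$ is isomorphic to one of the following pairwise non-isomorphic groups: (F1) $\langle a,b\mid a^{16}=b^{2^m}=1,[a,b]=a^{-2}\rangle$; $|G|=2^{m+4}$, $\Phi(G)=\langle a^2,b^2\rangle\cong C_8\times C_{2^{m-1}}$ if $m>1$, $\Phi(G)\cong C_8$ if $m=1$, $G'=\langle a^2\rangle\cong C_8$, $Z(G)=\langle a^8,b^2\rangle\cong C_2\times C_{2^{m-1}}$ if $m>1$, $Z(G)\cong C_2$ if $m=1$. (F2) $\langle a,b\mid a^{16}=b^{2^m}=1,[a,b]=a^6\rangle$; $|G|=2^{m+4}$, $\Phi(G)=\langle a^2,b^2\rangle\cong C_8\times C_{2^{m-1}}$ if $m>1$, $\Phi(G)\cong C_8$ if $m=1$, $G'=\langle a^2\rangle\cong C_8$, $Z(G)=\langle a^8,b^2\rangle\cong C_2\times C_{2^{m-1}}$ if $m>1$, $Z(G)\cong C_2$ if $m=1$. (F3) $\langle a,b\mid a^{16}=1,b^{2^m}=a^8,[a,b]=a^{-2}\rangle$; $|G|=2^{m+4}$, $\Phi(G)=\langle a^2,b^2\rangle\cong C_{2^3}$ if $m=1$, $\Phi(G)\cong C_{2^3}\times C_2$ if $m=2$, $\Phi(G)\cong C_{2^m}\times C_{2^2}$ if $m>2$, $G'=\langle a^2\rangle\cong C_8$, $Z(G)=\langle b^2\rangle\cong C_{2^m}$. (F4)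 $\langle a_1,b;a_2\mid a_1^9=a_2^9=b^{3^m}=1,[a_1,b]=a_2,[a_2,b]=a_1^{-3}a_2^{3t},[a_1,a_2]=1\rangle$, $t=1,2$; $|G|=3^{m+4}$, $\Phi(G)=\langle a_2,a_1^3,b^3\rangle\cong C_3\times C_9\times C_{3^{m-1}}$ if $m>1$, $\Phi(G)\cong C_3\times C_9$ if $m=1$, $G'=\langle a_2,a_1^3\rangle\cong C_3\times C_9$, $Z(G)=\langle a_2^3,b^3\rangle\cong C_3\times C_{3^{m-1}}$ if $m>1$, $Z(G)\cong C_3$ if $m=1$. (F5) $\langle a_1,b;a_2\mid a_1^9=a_2^9=1,b^{3^m}=a_2^{-3},[a_1,b]=a_2,[a_2,b]=a_1^{-3}a_2^{-3},[a_1,a_2]=1\rangle$; $|G|=3^{m+4}$, $\Phi(G)=\langle a_2,a_1^3,b^3\rangle\cong C_9\times C_3$ if $m=1$, $\Phi(G)\cong C_{3^m}\times C_3\times C_3$ if $m>1$, $G'=\langle a_2,a_1^3\rangle\cong C_9\times C_3$, $Z(G)=\langle b^3\rangle\cong C_{3^m}$. (F6) $\langle a_1,b;a_2,a_3,a_4\mid a_i^p=b^{p^m}=1,[a_j,b]=a_{j+1},[a_4,b]=1,[a_i,a_j]=1\rangle$, $p\ge5$, $1\le i\le4$, $1\le j\le3$; $|G|=p^{m+4}$, $\Phi(G)=\langle a_2,a_3,a_4,b^p\rangle\cong C_p^3\times C_{p^{m-1}}$ if $m>1$, $\Phi(G)\cong C_p^3$ if $m=1$, $G'=\langle a_2,a_3,a_4\rangle\cong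 C_p^3$, $Z(G)=\langle a_4,b^p\rangle\cong C_p\times C_{p^{m-1}}$ if $m>1$, $Z(G)\cong C_p$ if $m=1$. (F7) $\langle a_1,b;a_2,a_3\mid a_i^p=b^{p^{m+1}}=1,[a_j,b]=a_{j+1},[a_3,b]=b^{p^m},[a_i,a_j]=1\rangle$, $p\ge5$, $1\le i\le3$, $1\le j\le2$; $|G|=p^{m+4}$, $\Phi(G)=\langle a_2,a_3,b^p\rangle\cong C_p^2\times C_{p^m}$, $G'=\langle a_2,a_3,b^{p^m}\rangle\cong C_p^3$, $Z(G)=\langle b^p\rangle\cong C_{p^m}$. (F8) $\langle a_1,b;a_2,a_3\mid a_1^{p^2}=a_i^p=b^{p^m}=1,[a_j,b]=a_{j+1},[a_3,b]=a_1^{tp},[a_i,a_j]=1\rangle$, $2\le i\le3$, $1\le j\le2$, $p\ge5$, $t=t_1,t_2,\dots,t_{(3,p-1)}$, where $t_1,\dots,t_{(3,p-1)}$ are coset representatives of the subgroup $(F_p^* )^3$ in $F_p^*$; $|G|=p^{m+4}$, $\Phi(G)=\langle a_2,a_3,a_1^p,b^p\rangle\cong C_p^3\times C_{p^{m-1}}$ if $m>1$, $\Phi(G)\cong C_p^3$ if $m=1$, $G'=\langle a_2,a_3,a_1^p\rangle\cong C_p^3$, $Z(G)=\langle a_1^p,b^p\rangle\cong C_p\times C_{p^{m-1}}$ if $m>1$, $Z(G)\cong C_p$ if $m=1$. Moreover, $(\mu_0,\mu_1,\mu_2)=(1,0,p)$ and $\alpha_1(G)=p^2$.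
   Context: All groups are finite $p$-groups, $p$ a prime. An $\mathcal{A}_0$-group is an abelian group; for $t\ge1$ a finite $p$-group is an $\mathcal{A}_t$-group if all its subgroups of index $p^t$ are abelian and at least one subgroup of index $p^{t-1}$ is non-abelian. An $\mathcal{A}_i$-subgroup is a subgroup that is an $\mathcal{A}_i$-group. $\mu_i$ is the number of subgroups of index $p$ of $G$ that are $\mathcal{A}_i$-groups; $\alpha_1(G)$ is the number of $\mathcal{A}_1$-subgroups of $G$. $d(G)$ is the minimal number of generators, $c(G)$ the nilpotency class, $\Phi(G)$ the Frattini subgroup, $G'$ the derived subgroup, $Z(G)$ the centre. $C_n$ is the cyclic group of order $n$, $C_n^k$ the direct product of $k$ copies. $[x,y]=x^{-1}y^{-1}xy$. $F_p$ is the field of $p$ elements, $(F_p^* )^3$ the subgroup of cubes, $(3,p-1)$ the greatest common divisor. In a presentation all letters listed before the bar (before or after a semicolon) are generators, and relations with indices $i,j$ hold for all indicated values. The exponent parameter $m$ is a positive integer. Different values of parameters give different groups in the list. *)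

theory Defs
  imports
    "HOL-Algebra.Elementary_Groups" "HOL-Algebra.Product_Groups" "HOL-Algebra.Generated_Groups"
    "HOL-Number_Theory.Residues"
begin

section \<open>Finite p-groups and their invariants\<close>

definition finite_p_group :: "nat \<Rightarrow> ('a, 'b) monoid_scheme \<Rightarrow> bool" where
  "finite_p_group p G \<longleftrightarrow>
     prime p \<and> group G \<and> finite (carrier G) \<and> (\<exists>n. order G = p ^ n)"

definition subgroup_index :: "('a, 'b) monoid_scheme \<Rightarrow> 'a set \<Rightarrow> nat" where
  "subgroup_index G H = card (rcosets\<^bsub>G\<^esub> H)"

abbreviation abelian_sub :: "('a, 'b) monoid_scheme \<Rightarrow> 'a set \<Rightarrow> bool" where
  "abelian_sub G H \<equiv> comm_group (G\<lparr>carrier := H\<rparr>)"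

fun A_group :: "nat \<Rightarrow> nat \<Rightarrow> ('a, 'b) monoid_scheme \<Rightarrow> bool" where
  "A_group p 0 G \<longleftrightarrow> finite_p_group p G \<and> comm_group G"
| "A_group p (Suc t) G \<longleftrightarrow> finite_p_group p G \<and>
     (\<forall>H. subgroup H G \<and> subgroup_index G H = p ^ Suc t \<longrightarrow> abelian_sub G H) \<and>
     (\<exists>H. subgroup H G \<and> subgroup_index G H = p ^ t \<and> \<not> abelian_sub G H)"

definition A_subgroups :: "nat \<Rightarrow> nat \<Rightarrow> ('a, 'b) monoid_scheme \<Rightarrow> 'a set set" where
  "A_subgroups p i G = {H. subgroup H G \<and> A_group p i (G\<lparr>carrier := H\<rparr>)}"

definition mu :: "nat \<Rightarrow> nat \<Rightarrow> ('a, 'b) monoid_scheme \<Rightarrow> nat" where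
  "mu p i G = card {H \<in> A_subgroups p i G. subgroup_index G H = p}"

definition alpha1 :: "nat \<Rightarrow> ('a, 'b) monoid_scheme \<Rightarrow> nat" where
  "alpha1 p G = card (A_subgroups p 1 G)"

definition min_gens :: "('a, 'b) monoid_scheme \<Rightarrow> nat" where
  "min_gens G =
     (LEAST n. \<exists>S. S \<subseteq> carrier G \<and> finite S \<and> card S = n \<and> generate G S = carrier G)"

definition commutator :: "('a, 'b) monoid_scheme \<Rightarrow> 'a \<Rightarrow> 'a \<Rightarrow> 'a" where
  "commutator G x y = inv\<^bsub>G\<^esub> x \<otimes>\<^bsub>G\<^esub> inv\<^bsub>G\<^esub> y \<otimes>\<^bsub>G\<^esub> x \<otimes>\<^bsub>G\<^esub> y"

text \<open>The series is indexed from 0, so that the group has class \<open>c\<close> when term \<open>c\<close> is the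
  first trivial one.\<close>

fun lower_central :: "('a, 'b) monoid_scheme \<Rightarrow> nat \<Rightarrow> 'a set" where
  "lower_central G 0 = carrier G"
| "lower_central G (Suc n) =
     generate G {commutator G x y | x y. x \<in> lower_central G n \<and> y \<in> carrier G}"

definition nilp_class :: "('a, 'b) monoid_scheme \<Rightarrow> nat" where
  "nilp_class G = (LEAST c. lower_central G c = {\<one>\<^bsub>G\<^esub>})"

definition maximal_subgroup :: "'a set \<Rightarrow> ('a, 'b) monoid_scheme \<Rightarrow> bool" where
  "maximal_subgroup M G \<longleftrightarrow> subgroup M G \<and> M \<noteq> carrier G \<and>
     (\<forall>K. subgroup K G \<and> M \<subseteq> K \<longrightarrow> K = M \<or> K = carrier G)"

definition frattini :: "('a, 'b) monoid_scheme \<Rightarrow> 'a set" where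
  "frattini G = carrier G \<inter> \<Inter> {M. maximal_subgroup M G}"

definition centre :: "('a, 'b) monoid_scheme \<Rightarrow> 'a set" where
  "centre G = {z \<in> carrier G. \<forall>x \<in> carrier G. z \<otimes>\<^bsub>G\<^esub> x = x \<otimes>\<^bsub>G\<^esub> z}"

text \<open>\<open>cyclic_product [n\<^sub>1, \<dots>, n\<^sub>k]\<close> is the direct product of cyclic groups of orders
  \<open>n\<^sub>1, \<dots>, n\<^sub>k\<close> (all positive).\<close>

definition cyclic_product :: "nat list \<Rightarrow> (nat \<Rightarrow> int) monoid" where
  "cyclic_product ns = product_group {..<length ns} (\<lambda>i. integer_mod_group (ns ! i))"


section \<open>Group presentations\<close>

text \<open>A word is a list of letters \<open>(x, True)\<close>, standing for the generator \<open>x\<close>, and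
  \<open>(x, False)\<close>, standing for its formal inverse. A relation \<open>l = r\<close> is a pair of words.\<close>

type_synonym 'g word = "('g \<times> bool) list"

definition winv :: "'g word \<Rightarrow> 'g word" where
  "winv w = rev (map (\<lambda>(x, s). (x, \<not> s)) w)"

definition wpow :: "'g word \<Rightarrow> int \<Rightarrow> 'g word" where
  "wpow w k = concat (replicate (nat \<bar>k\<bar>) (if k \<ge> 0 then w else winv w))"

definition wcomm :: "'g word \<Rightarrow> 'g word \<Rightarrow> 'g word" where
  "wcomm u v = winv u @ winv v @ u @ v"

inductive word_cong :: "'g set \<Rightarrow> ('g word \<times> 'g word) set \<Rightarrow> 'g word \<Rightarrow> 'g word \<Rightarrow> bool"
  for S R where
  refl: "word_cong S R u u"
| sym: "word_cong S R u v \<Longrightarrow> word_cong S R v u"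
| trans: "word_cong S R u v \<Longrightarrow> word_cong S R v w \<Longrightarrow> word_cong S R u w"
| cancel: "x \<in> S \<Longrightarrow> word_cong S R (u @ [(x, s), (x, \<not> s)] @ v) (u @ v)"
| relation: "(l, r) \<in> R \<Longrightarrow> word_cong S R (u @ l @ v) (u @ r @ v)"

definition word_class :: "'g set \<Rightarrow> ('g word \<times> 'g word) set \<Rightarrow> 'g word \<Rightarrow> 'g word set" where
  "word_class S R w = {v. word_cong S R w v}"

text \<open>The group generated by \<open>S\<close> subject to the relations \<open>R\<close>, which are assumed to be
  relations between words over \<open>S\<close>.\<close>

definition presented_group ::
  "'g set \<Rightarrow> ('g word \<times> 'g word) set \<Rightarrow> 'g word set monoid" where
  "presented_group S R =
     \<lparr>carrier = word_class S R ` lists (S \<times> UNIV),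
      monoid.mult = (\<lambda>X Y. {w. \<exists>x \<in> X. \<exists>y \<in> Y. word_cong S R (x @ y) w}),
      one = word_class S R []\<rparr>"


section \<open>The list of groups\<close>

text \<open>Generators are \<open>a\<^sub>1, a\<^sub>2, \<dots>\<close> and \<open>b\<close>; where there is only one letter \<open>a\<close>, it
  is \<open>a\<^sub>1\<close>.\<close>

datatype letter = GA nat | GB

abbreviation wa :: "nat \<Rightarrow> letter word" where "wa i \<equiv> [(GA i, True)]"
abbreviation wb :: "letter word" where "wb \<equiv> [(GB, True)]"

text \<open>A member of the list is a family together with the values of its parameters: \<open>m\<close> for
  \<open>F1\<close>, \<open>F2\<close>, \<open>F3\<close>, \<open>F5\<close>; \<open>m t\<close> for \<open>F4\<close>; \<open>p m\<close> for \<open>F6\<close>, \<open>F7\<close>; and \<open>p m t\<close>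
  for \<open>F8\<close>.\<close>

datatype entry =
    F1 nat | F2 nat | F3 nat | F4 nat int | F5 nat | F6 nat nat | F7 nat nat | F8 nat nat int

text \<open>\<open>T\<close> is a system of representatives of the cosets of \<open>(F\<^sub>p\<^sup>*)\<^sup>3\<close> in \<open>F\<^sub>p\<^sup>*\<close>, where
  \<open>F\<^sub>p\<close> has carrier \<open>{0..p-1}\<close>; it automatically has \<open>gcd 3 (p - 1)\<close> elements.\<close>

definition cube_coset_reps :: "nat \<Rightarrow> int set \<Rightarrow> bool" where
  "cube_coset_reps p T \<longleftrightarrow>
     (let F = units_of (residue_ring (int p));
          C = {x [^]\<^bsub>F\<^esub> (3::nat) | x. x \<in> carrier F}
      in T \<subseteq> carrier F \<and> (\<forall>K \<in> rcosets\<^bsub>F\<^esub> C. \<exists>!t. t \<in> T \<and> t \<in> K))"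

definition cube_coset_choice :: "(nat \<Rightarrow> int set) \<Rightarrow> bool" where
  "cube_coset_choice T \<longleftrightarrow> (\<forall>p. prime p \<and> p \<ge> 5 \<longrightarrow> cube_coset_reps p (T p))"

text \<open>Admissible parameter values, for a choice \<open>T p\<close> of coset representatives for each
  prime \<open>p \<ge> 5\<close>.\<close>

fun listed :: "(nat \<Rightarrow> int set) \<Rightarrow> entry \<Rightarrow> bool" where
  "listed T (F1 m) \<longleftrightarrow> m \<ge> 1"
| "listed T (F2 m) \<longleftrightarrow> m \<ge> 1"
| "listed T (F3 m) \<longleftrightarrow> m \<ge> 1"
| "listed T (F4 m t) \<longleftrightarrow> m \<ge> 1 \<and> t \<in> {1, 2}"
| "listed T (F5 m) \<longleftrightarrow> m \<ge> 1"
| "listed T (F6 p m) \<longleftrightarrow> prime p \<and> p \<ge> 5 \<and> m \<ge> 1"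
| "listed T (F7 p m) \<longleftrightarrow> prime p \<and> p \<ge> 5 \<and> m \<ge> 1"
| "listed T (F8 p m t) \<longleftrightarrow> prime p \<and> p \<ge> 5 \<and> m \<ge> 1 \<and> t \<in> T p"

fun prime_of :: "entry \<Rightarrow> nat" where
  "prime_of (F1 m) = 2"
| "prime_of (F2 m) = 2"
| "prime_of (F3 m) = 2"
| "prime_of (F4 m t) = 3"
| "prime_of (F5 m) = 3"
| "prime_of (F6 p m) = p"
| "prime_of (F7 p m) = p"
| "prime_of (F8 p m t) = p"

fun exponent_of :: "entry \<Rightarrow> nat" where
  "exponent_of (F1 m) = m"
| "exponent_of (F2 m) = m"
| "exponent_of (F3 m) = m"
| "exponent_of (F4 m t) = m"
| "exponent_of (F5 m) = m"
| "exponent_of (F6 p m) = m"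
| "exponent_of (F7 p m) = m"
| "exponent_of (F8 p m t) = m"

fun gens :: "entry \<Rightarrow> letter set" where
  "gens (F1 m) = {GA 1, GB}"
| "gens (F2 m) = {GA 1, GB}"
| "gens (F3 m) = {GA 1, GB}"
| "gens (F4 m t) = {GA 1, GB, GA 2}"
| "gens (F5 m) = {GA 1, GB, GA 2}"
| "gens (F6 p m) = {GA 1, GB, GA 2, GA 3, GA 4}"
| "gens (F7 p m) = {GA 1, GB, GA 2, GA 3}"
| "gens (F8 p m t) = {GA 1, GB, GA 2, GA 3}"

fun rels :: "entry \<Rightarrow> (letter word \<times> letter word) set" where
  "rels (F1 m) =
     {(wpow (wa 1) 16, []), (wpow wb (2 ^ m), []), (wcomm (wa 1) wb, wpow (wa 1) (-2))}"
| "rels (F2 m) =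
     {(wpow (wa 1) 16, []), (wpow wb (2 ^ m), []), (wcomm (wa 1) wb, wpow (wa 1) 6)}"
| "rels (F3 m) =
     {(wpow (wa 1) 16, []), (wpow wb (2 ^ m), wpow (wa 1) 8), (wcomm (wa 1) wb, wpow (wa 1) (-2))}"
| "rels (F4 m t) =
     {(wpow (wa 1) 9, []), (wpow (wa 2) 9, []), (wpow wb (3 ^ m), []),
      (wcomm (wa 1) wb, wa 2), (wcomm (wa 2) wb, wpow (wa 1) (-3) @ wpow (wa 2) (3 * t)),
      (wcomm (wa 1) (wa 2), [])}"
| "rels (F5 m) =
     {(wpow (wa 1) 9, []), (wpow (wa 2) 9, []), (wpow wb (3 ^ m), wpow (wa 2) (-3)),
      (wcomm (wa 1) wb, wa 2), (wcomm (wa 2) wb, wpow (wa 1) (-3) @ wpow (wa 2) (-3)),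
      (wcomm (wa 1) (wa 2), [])}"
| "rels (F6 p m) =
     {(wpow (wa i) (int p), []) | i. i \<in> {1..4}} \<union> {(wpow wb (int p ^ m), [])} \<union>
     {(wcomm (wa j) wb, wa (j + 1)) | j. j \<in> {1..3}} \<union> {(wcomm (wa 4) wb, [])} \<union>
     {(wcomm (wa i) (wa j), []) | i j. i \<in> {1..4} \<and> j \<in> {1..3}}"
| "rels (F7 p m) =
     {(wpow (wa i) (int p), []) | i. i \<in> {1..3}} \<union> {(wpow wb (int p ^ (m + 1)), [])} \<union>
     {(wcomm (wa j) wb, wa (j + 1)) | j. j \<in> {1..2}} \<union>
     {(wcomm (wa 3) wb, wpow wb (int p ^ m))} \<union>
     {(wcomm (wa i) (wa j), []) | i j. i \<in> {1..3} \<and> j \<in> {1..2}}"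
| "rels (F8 p m t) =
     {(wpow (wa 1) (int p ^ 2), [])} \<union> {(wpow (wa i) (int p), []) | i. i \<in> {2..3}} \<union>
     {(wpow wb (int p ^ m), [])} \<union>
     {(wcomm (wa j) wb, wa (j + 1)) | j. j \<in> {1..2}} \<union>
     {(wcomm (wa 3) wb, wpow (wa 1) (t * int p))} \<union>
     {(wcomm (wa i) (wa j), []) | i j. i \<in> {2..3} \<and> j \<in> {1..2}}"

definition grp :: "entry \<Rightarrow> letter word set monoid" where
  "grp e = presented_group (gens e) (rels e)"

definition span_of :: "entry \<Rightarrow> letter word set \<Rightarrow> letter word set set" where
  "span_of e W = generate (grp e) (word_class (gens e) (rels e) ` W)"

text \<open>The generators of, and the orders of the cyclic factors of, the Frattini subgroup, the
  derived subgroup and the centre, as they are recorded in the list.\<close>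

fun frattini_gens :: "entry \<Rightarrow> letter word set" where
  "frattini_gens (F1 m) = {wpow (wa 1) 2, wpow wb 2}"
| "frattini_gens (F2 m) = {wpow (wa 1) 2, wpow wb 2}"
| "frattini_gens (F3 m) = {wpow (wa 1) 2, wpow wb 2}"
| "frattini_gens (F4 m t) = {wa 2, wpow (wa 1) 3, wpow wb 3}"
| "frattini_gens (F5 m) = {wa 2, wpow (wa 1) 3, wpow wb 3}"
| "frattini_gens (F6 p m) = {wa 2, wa 3, wa 4, wpow wb (int p)}"
| "frattini_gens (F7 p m) = {wa 2, wa 3, wpow wb (int p)}"
| "frattini_gens (F8 p m t) = {wa 2, wa 3, wpow (wa 1) (int p), wpow wb (int p)}"

fun frattini_type :: "entry \<Rightarrow> nat list" where
  "frattini_type (F1 m) = (if m > 1 then [8, 2 ^ (m - 1)] else [8])"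
| "frattini_type (F2 m) = (if m > 1 then [8, 2 ^ (m - 1)] else [8])"
| "frattini_type (F3 m) = (if m = 1 then [2 ^ 3] else if m = 2 then [2 ^ 3, 2] else [2 ^ m, 2 ^ 2])"
| "frattini_type (F4 m t) = (if m > 1 then [3, 9, 3 ^ (m - 1)] else [3, 9])"
| "frattini_type (F5 m) = (if m = 1 then [9, 3] else [3 ^ m, 3, 3])"
| "frattini_type (F6 p m) = (if m > 1 then [p, p, p, p ^ (m - 1)] else [p, p, p])"
| "frattini_type (F7 p m) = [p, p, p ^ m]"
| "frattini_type (F8 p m t) = (if m > 1 then [p, p, p, p ^ (m - 1)] else [p, p, p])"

fun derived_gens :: "entry \<Rightarrow> letter word set" where
  "derived_gens (F1 m) = {wpow (wa 1) 2}"
| "derived_gens (F2 m) = {wpow (wa 1) 2}"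
| "derived_gens (F3 m) = {wpow (wa 1) 2}"
| "derived_gens (F4 m t) = {wa 2, wpow (wa 1) 3}"
| "derived_gens (F5 m) = {wa 2, wpow (wa 1) 3}"
| "derived_gens (F6 p m) = {wa 2, wa 3, wa 4}"
| "derived_gens (F7 p m) = {wa 2, wa 3, wpow wb (int p ^ m)}"
| "derived_gens (F8 p m t) = {wa 2, wa 3, wpow (wa 1) (int p)}"

fun derived_type :: "entry \<Rightarrow> nat list" where
  "derived_type (F1 m) = [8]"
| "derived_type (F2 m) = [8]"
| "derived_type (F3 m) = [8]"
| "derived_type (F4 m t) = [3, 9]"
| "derived_type (F5 m) = [9, 3]"
| "derived_type (F6 p m) = [p, p, p]"
| "derived_type (F7 p m) = [p, p, p]"
| "derived_type (F8 p m t) = [p, p, p]"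

fun centre_gens :: "entry \<Rightarrow> letter word set" where
  "centre_gens (F1 m) = {wpow (wa 1) 8, wpow wb 2}"
| "centre_gens (F2 m) = {wpow (wa 1) 8, wpow wb 2}"
| "centre_gens (F3 m) = {wpow wb 2}"
| "centre_gens (F4 m t) = {wpow (wa 2) 3, wpow wb 3}"
| "centre_gens (F5 m) = {wpow wb 3}"
| "centre_gens (F6 p m) = {wa 4, wpow wb (int p)}"
| "centre_gens (F7 p m) = {wpow wb (int p)}"
| "centre_gens (F8 p m t) = {wpow (wa 1) (int p), wpow wb (int p)}"

fun centre_type :: "entry \<Rightarrow> nat list" where
  "centre_type (F1 m) = (if m > 1 then [2, 2 ^ (m - 1)] else [2])"
| "centre_type (F2 m) = (if m > 1 then [2, 2 ^ (m - 1)] else [2])"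
| "centre_type (F3 m) = [2 ^ m]"
| "centre_type (F4 m t) = (if m > 1 then [3, 3 ^ (m - 1)] else [3])"
| "centre_type (F5 m) = [3 ^ m]"
| "centre_type (F6 p m) = (if m > 1 then [p, p ^ (m - 1)] else [p])"
| "centre_type (F7 p m) = [p ^ m]"
| "centre_type (F8 p m t) = (if m > 1 then [p, p ^ (m - 1)] else [p])"


section \<open>The standing hypothesis\<close>

definition standing_hyp :: "nat \<Rightarrow> ('a, 'b) monoid_scheme \<Rightarrow> bool" where
  "standing_hyp p G \<longleftrightarrow>
     A_group p 3 G \<and>
     (\<exists>H. subgroup H G \<and> subgroup_index G H = p \<and> abelian_sub G H) \<and>
     \<not> (\<exists>H \<in> A_subgroups p 1 G. subgroup_index G H = p)"

end

theory Submission
  imports Defs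
begin

text \<open>A group \<open>G\<close> as in the theorem is generated by some \<open>a\<^sub>1\<close> in the abelian maximal subgroup \<open>A\<close>
  and some \<open>b\<close> outside of it. With \<open>a\<^sub>i\<^sub>+\<^sub>1 = [a\<^sub>i, b]\<close>, class 4 means \<open>a\<^sub>5 = 1 \<noteq> a\<^sub>4\<close>, so that \<open>G\<close> is a
  quotient of the group of all \<open>b ^ k a\<^sub>1 ^ c\<^sub>1 a\<^sub>2 ^ c\<^sub>2 a\<^sub>3 ^ c\<^sub>3 a\<^sub>4 ^ c\<^sub>4\<close> with integer exponents. That subgroups
  of index \<open>p ^ 3\<close> are abelian forces \<open>a\<^sub>4 ^ p = 1\<close> and, after a change of generators, a kernel given by
  \<open>(b a\<^sub>1) ^ p = b ^ p a\<^sub>4 ^ s\<close> and \<open>b ^ (p ^ m) = a\<^sub>4 ^ u\<close> with \<open>s\<close> and \<open>u\<close> modulo \<open>p\<close>. Replacing \<open>b\<close> by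
  \<open>b ^ k\<close> changes \<open>s\<close> by the cube of \<open>k\<close>, and \<open>s\<close>, \<open>u\<close> can be reduced to \<open>(0, 1)\<close> or \<open>(s, 0)\<close>. As \<open>A\<close>
  is the only abelian subgroup of index \<open>p\<close>, any two such descriptions of the same group are related by
  an explicit substitution, which shows that \<open>u\<close> and the class of \<open>s\<close> modulo cubes are invariants.
  For \<open>p = 2\<close>, \<open>p = 3\<close> and \<open>p \<ge> 5\<close> these normal forms are the eight families of presentations, and
  all invariants are read off from the coordinates \<open>(k, c\<^sub>1, c\<^sub>2, c\<^sub>3, c\<^sub>4)\<close>.\<close>

section \<open>A nilpotent group of integer 5-tuples\<close>

text \<open>An element is b^k v with v in the module Z[x]/(x^4), and N = ((1 + x)^p - 1)/x governs
  p-th powers: (b v)^p = b^p N v. Since b^p lies in the abelian A, conjugation by it is trivial, so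
  x N annihilates everything and N a_1 commutes with b. The condition on index p^3 enters once, to
  find a relation whose a_1-exponent is p times a unit: otherwise p^2 | c_1 and p | c_2 would cut
  out a subgroup of index p^3 that contains the non-commuting a_3 and b. That relation turns N a_1
  into a power of b^p times a power of a_4. Keeping the binomials of p inside N lets one argument
  serve all primes. The families for p = 2 and p = 3 look different only because N is 2 + x and 3 +
  3 x + x^2 there, whereas every p \<ge> 5 divides the coefficients of N up to x^3. The presented
  groups are compared with the quotients by homomorphisms in both directions: the relations hold in
  the quotient, and the generators of the kernel are trivial in the presented group. So no order has
  to be found by rewriting words.\<close>

definition B2 :: "int \<Rightarrow> int" where "B2 l = l * (l - 1) div 2"
definition B3 :: "int \<Rightarrow> int" where "B3 l = l * (l - 1) * (l - 2) div 6"
definition B4 :: "int \<Rightarrow> int" where "B4 l = l * (l - 1) * (l - 2) * (l - 3) div 24"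

text \<open>\<open>B2\<close>, \<open>B3\<close>, \<open>B4\<close> are the binomial coefficients of
  l over 2, 3, 4, taken as polynomials so that negative exponents of b are covered too.\<close>

lemma B2_eq: "2 * B2 l = l * (l - 1)"
proof -
  have "2 dvd l * (l - 1)" by (cases "even l") auto
  then show ?thesis by (simp add: B2_def)
qed

lemma B2_Suc: "B2 (l + 1) = B2 l + l"
proof -
  have "2 * (B2 l + l) = 2 * B2 l + 2 * l" by (simp add: algebra_simps)
  also have "\<dots> = 2 * B2 (l + 1)" unfolding B2_eq by (simp add: algebra_simps)
  finally show ?thesis by simp
qed

lemma B3_eq: "6 * B3 l = l * (l - 1) * (l - 2)"
proof -
  \<comment> \<open>The factor 6 is split off as 3 times 2, so that \<open>B2_eq\<close> can replace
    2 * B2 by a polynomial.\<close>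
  have six: "6 * y = 3 * (2 * y)" for y :: int by simp
  have "6 dvd l * (l - 1) * (l - 2)"
  proof (induction l rule: int_induct[where k = 0])
    case (step1 i)
    have "(i + 1) * (i + 1 - 1) * (i + 1 - 2) = i * (i - 1) * (i - 2) + 6 * B2 i"
      unfolding six B2_eq by (simp add: algebra_simps)
    then show ?case using step1 by simp
  next
    case (step2 i)
    have "(i - 1) * (i - 1 - 1) * (i - 1 - 2) = i * (i - 1) * (i - 2) - 6 * B2 (i - 1)"
      unfolding six B2_eq by (simp add: algebra_simps)
    then show ?case using step2 by simp
  qed simp
  then show ?thesis by (simp add: B3_def)
qed

lemma B3_Suc: "B3 (l + 1) = B3 l + B2 l"
proof -
  have "6 * (B3 l + B2 l) = 6 * B3 l + 3 * (2 * B2 l)" by (simp add: algebra_simps)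
  also have "\<dots> = 6 * B3 (l + 1)" unfolding B2_eq B3_eq by (simp add: algebra_simps)
  finally show ?thesis by simp
qed

lemma B4_eq: "24 * B4 l = l * (l - 1) * (l - 2) * (l - 3)"
proof -
  have six: "24 * y = 4 * (6 * y)" for y :: int by simp
  have "24 dvd l * (l - 1) * (l - 2) * (l - 3)"
  proof (induction l rule: int_induct[where k = 0])
    case (step1 i)
    have "(i + 1) * (i + 1 - 1) * (i + 1 - 2) * (i + 1 - 3) = i * (i - 1) * (i - 2) * (i - 3) + 24 * B3 i"
      unfolding six B3_eq by (simp add: algebra_simps)
    then show ?case using step1 by simp
  next
    case (step2 i)
    have "(i - 1) * (i - 1 - 1) * (i - 1 - 2) * (i - 1 - 3)
        = i * (i - 1) * (i - 2) * (i - 3) - 24 * B3 (i - 1)"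
      unfolding six B3_eq by (simp add: algebra_simps)
    then show ?case using step2 by simp
  qed simp
  then show ?thesis by (simp add: B4_def)
qed

lemma B4_Suc: "B4 (l + 1) = B4 l + B3 l"
proof -
  have "24 * (B4 l + B3 l) = 24 * B4 l + 4 * (6 * B3 l)" by (simp add: algebra_simps)
  also have "\<dots> = 24 * B4 (l + 1)" unfolding B2_eq B3_eq B4_eq by (simp add: algebra_simps)
  finally show ?thesis by simp
qed

lemma B_0 [simp]: "B2 0 = 0" "B3 0 = 0" "B4 0 = 0"
  by (simp_all add: B2_def B3_def B4_def)

lemma B_1 [simp]: "B2 1 = 0" "B3 1 = 0" "B4 1 = 0"
  by (simp_all add: B2_def B3_def B4_def)

text \<open>Vandermonde: compare x^2 in (1 + x)^(k + l) = (1 + x)^k (1 + x)^l. Together with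
  \<open>B3_add\<close> this makes \<open>hmul\<close> associative.\<close>

lemma B2_add: "B2 (k + l) = B2 k + k * l + B2 l"
proof -
  have "2 * (B2 k + k * l + B2 l) = 2 * B2 k + 2 * (k * l) + 2 * B2 l" by (simp add: algebra_simps)
  also have "\<dots> = 2 * B2 (k + l)" unfolding B2_eq B3_eq B4_eq by (simp add: algebra_simps)
  finally show ?thesis by simp
qed

lemma B3_add: "B3 (k + l) = B3 k + B2 k * l + k * B2 l + B3 l"
proof -
  have "6 * (B3 k + B2 k * l + k * B2 l + B3 l) = 6 * B3 k + 3 * (2 * B2 k) * l + 3 * k * (2 * B2 l) + 6 * B3 l" by (simp add: algebra_simps)
  also have "\<dots> = 6 * B3 (k + l)" unfolding B2_eq B3_eq B4_eq by (simp add: algebra_simps)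
  finally show ?thesis by simp
qed

text \<open>Compare x^2 in (1 + x)^(k l) = ((1 + x)^k)^l, expanded in powers of (1 + x)^k - 1;
  \<open>B3_mult\<close> is the same for x^3.\<close>

lemma B2_mult: "B2 (k * l) = l * B2 k + B2 l * k * k"
proof -
  have "2 * (l * B2 k + B2 l * k * k) = l * (2 * B2 k) + (2 * B2 l) * k * k" by (simp add: algebra_simps)
  also have "\<dots> = 2 * B2 (k * l)" unfolding B2_eq B3_eq B4_eq by (simp add: algebra_simps)
  finally show ?thesis by simp
qed

lemma B3_mult: "B3 (k * l) = l * B3 k + B2 l * 2 * k * B2 k + B3 l * k * k * k"
proof -
  have "6 * (l * B3 k + B2 l * 2 * k * B2 k + B3 l * k * k * k) = l * (6 * B3 k) + 3 * (2 * B2 l) * k * (2 * B2 k) + (6 * B3 l) * k * k * k" by (simp add: algebra_simps)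
  also have "\<dots> = 6 * B3 (k * l)" unfolding B2_eq B3_eq B4_eq by (simp add: algebra_simps)
  finally show ?thesis by simp
qed

lemma B2_neg: "B2 (- l) = l + B2 l"
proof -
  have "2 * (l + B2 l) = 2 * l + 2 * B2 l" by (simp add: algebra_simps)
  also have "\<dots> = 2 * B2 (- l)" unfolding B2_eq B3_eq B4_eq by (simp add: algebra_simps)
  finally show ?thesis by simp
qed

text \<open>\<open>(k, c\<^sub>1, c\<^sub>2, c\<^sub>3, c\<^sub>4)\<close> stands for \<open>b ^ k a\<^sub>1 ^ c\<^sub>1 a\<^sub>2 ^ c\<^sub>2 a\<^sub>3 ^ c\<^sub>3 a\<^sub>4 ^ c\<^sub>4\<close>, where the \<open>a\<^sub>i\<close> commute,
  \<open>[a\<^sub>i, b] = a\<^sub>i\<^sub>+\<^sub>1\<close> and \<open>a\<^sub>5 = 1\<close>. The \<open>a\<^sub>i\<close> span \<open>Z[x]/(x ^ 4)\<close>, with \<open>a\<^sub>i\<close> at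
  \<open>x ^ (i - 1)\<close>, on which conjugation by \<open>b\<close> is multiplication by \<open>1 + x\<close>.\<close>

type_synonym coords = "int \<times> int \<times> int \<times> int \<times> int"

text \<open>Moving b^l of the second factor to the left, past the a-part of the first, multiplies
  that part by (1 + x)^l.\<close>

fun hmul :: "coords \<Rightarrow> coords \<Rightarrow> coords" where
  "hmul (k, c1, c2, c3, c4) (l, d1, d2, d3, d4) =
     (k + l, c1 + d1, c2 + l * c1 + d2, c3 + l * c2 + B2 l * c1 + d3,
      c4 + l * c3 + B2 l * c2 + B3 l * c1 + d4)"

definition HG :: "coords monoid" where
  "HG = \<lparr>carrier = UNIV, monoid.mult = hmul, one = (0, 0, 0, 0, 0)\<rparr>"

lemma carrier_HG [simp]: "carrier HG = UNIV" and mult_HG [simp]: "monoid.mult HG = hmul"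
  and one_HG [simp]: "one HG = (0, 0, 0, 0, 0)"
  by (simp_all add: HG_def)

text \<open>The inverse of b^k v is b^(-k) times the inverse of v conjugated by b^(-k).\<close>

fun hinv :: "coords \<Rightarrow> coords" where
  "hinv (k, c1, c2, c3, c4) = (- k, - c1, - (c2 - k * c1), - (c3 - k * c2 + B2 (- k) * c1),
     - (c4 - k * c3 + B2 (- k) * c2 + B3 (- k) * c1))"

lemma hmul_hinv: "hmul (hinv h) h = (0, 0, 0, 0, 0)"
proof (cases h)
  case (fields k c1 c2 c3 c4)
  have 2: "B2 k + (- k) * k + B2 (- k) = 0" using B2_add[of "k" "- k"] by (simp add: algebra_simps)
  have 3: "B3 k + B2 k * (- k) + k * B2 (- k) + B3 (- k) = 0" using B3_add[of k "- k"] by simp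
  have "- (c3 - k * c2 + B2 (- k) * c1) + k * (- (c2 - k * c1)) + B2 k * (- c1) + c3
      = - c1 * (B2 k + (- k) * k + B2 (- k))"
    by (simp add: algebra_simps)
  moreover have "- (c4 - k * c3 + B2 (- k) * c2 + B3 (- k) * c1) + k * - (c3 - k * c2 + B2 (- k) * c1)
        + B2 k * - (c2 - k * c1) + B3 k * - c1 + c4
      = - c2 * (B2 k + (- k) * k + B2 (- k)) - c1 * (B3 k + B2 k * (- k) + k * B2 (- k) + B3 (- k))"
    by (simp add: algebra_simps)
  ultimately show ?thesis using 2 3 by (simp add: fields)
qed

lemma group_HG [simp]: "group HG"
proof (rule groupI)
  fix x y z assume "x \<in> carrier HG" "y \<in> carrier HG" "z \<in> carrier HG"
  show "x \<otimes>\<^bsub>HG\<^esub> y \<otimes>\<^bsub>HG\<^esub> z = x \<otimes>\<^bsub>HG\<^esub> (y \<otimes>\<^bsub>HG\<^esub> z)"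
    by (cases x, cases y, cases z) (simp add: B2_add B3_add algebra_simps)
next
  fix x assume "x \<in> carrier HG"
  show "\<one>\<^bsub>HG\<^esub> \<otimes>\<^bsub>HG\<^esub> x = x" by (cases x) simp
  show "\<exists>y\<in>carrier HG. y \<otimes>\<^bsub>HG\<^esub> x = \<one>\<^bsub>HG\<^esub>"
    by (intro bexI[of _ "hinv x"]) (simp_all add: hmul_hinv)
qed auto

lemma inv_HG [simp]: "inv\<^bsub>HG\<^esub> h = hinv h"
  using group.inv_equality[OF group_HG, of "hinv h" h] hmul_hinv by simp

text \<open>\<open>Lat p s\<close> is the ideal of \<open>Z[x]/(x ^ 4)\<close> generated by \<open>N - s x ^ 3\<close> for
  \<open>N = ((1 + x) ^ p - 1) / x\<close>, which encodes \<open>(b a\<^sub>1) ^ p = b ^ p a\<^sub>4 ^ s\<close>; in \<open>K\<close> the relation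
  \<open>b ^ (p ^ m) = a\<^sub>4 ^ u\<close> is added.\<close>

definition Lat :: "nat \<Rightarrow> int \<Rightarrow> (int \<times> int \<times> int \<times> int) set" where
  "Lat p s = {(c1, c2, c3, c4). \<exists>n1 n2 n3 n4. c1 = int p * n1 \<and> c2 = int p * n2 + B2 p * n1 \<and>
     c3 = int p * n3 + B2 p * n2 + B3 p * n1 \<and>
     c4 = int p * n4 + B2 p * n3 + B3 p * n2 + (B4 p - s) * n1}"

definition K :: "nat \<Rightarrow> nat \<Rightarrow> int \<Rightarrow> int \<Rightarrow> coords set" where
  "K p m s u = {(k, c1, c2, c3, c4). \<exists>j. k = int p ^ m * j \<and> (c1, c2, c3, c4 + u * j) \<in> Lat p s}"

lemma LatI: "(int p * n1, int p * n2 + B2 p * n1, int p * n3 + B2 p * n2 + B3 p * n1,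
     int p * n4 + B2 p * n3 + B3 p * n2 + (B4 p - s) * n1) \<in> Lat p s"
  unfolding Lat_def by blast

lemma LatE:
  assumes "(c1, c2, c3, c4) \<in> Lat p s"
  obtains n1 n2 n3 n4 where "c1 = int p * n1" "c2 = int p * n2 + B2 p * n1"
    "c3 = int p * n3 + B2 p * n2 + B3 p * n1"
    "c4 = int p * n4 + B2 p * n3 + B3 p * n2 + (B4 p - s) * n1"
  using assms unfolding Lat_def by blast

lemma Lat_add:
  assumes "(c1, c2, c3, c4) \<in> Lat p s" "(d1, d2, d3, d4) \<in> Lat p s"
  shows "(c1 + d1, c2 + d2, c3 + d3, c4 + d4) \<in> Lat p s"
proof -
  obtain n1 n2 n3 n4 where n: "c1 = int p * n1" "c2 = int p * n2 + B2 p * n1"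
    "c3 = int p * n3 + B2 p * n2 + B3 p * n1"
    "c4 = int p * n4 + B2 p * n3 + B3 p * n2 + (B4 p - s) * n1" using assms(1) by (rule LatE)
  obtain n1' n2' n3' n4' where n': "d1 = int p * n1'" "d2 = int p * n2' + B2 p * n1'"
    "d3 = int p * n3' + B2 p * n2' + B3 p * n1'"
    "d4 = int p * n4' + B2 p * n3' + B3 p * n2' + (B4 p - s) * n1'" using assms(2) by (rule LatE)
  show ?thesis
    using LatI[of p "n1 + n1'" "n2 + n2'" "n3 + n3'" "n4 + n4'" s]
    unfolding n n' by (simp add: algebra_simps)
qed

lemma Lat_scale:
  assumes "(c1, c2, c3, c4) \<in> Lat p s"
  shows "(l * c1, l * c2, l * c3, l * c4) \<in> Lat p s"
proof -
  obtain n1 n2 n3 n4 where n: "c1 = int p * n1" "c2 = int p * n2 + B2 p * n1"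
    "c3 = int p * n3 + B2 p * n2 + B3 p * n1"
    "c4 = int p * n4 + B2 p * n3 + B3 p * n2 + (B4 p - s) * n1" using assms(1) by (rule LatE)
  show ?thesis
    using LatI[of p "l * n1" "l * n2" "l * n3" "l * n4" s]
    unfolding n by (simp add: algebra_simps)
qed

text \<open>An ideal is closed under multiplication by x; the top coefficient drops out because x^4
  = 0.\<close>

lemma Lat_shift:
  assumes "(c1, c2, c3, c4) \<in> Lat p s"
  shows "(0, c1, c2, c3) \<in> Lat p s"
proof -
  obtain n1 n2 n3 n4 where n: "c1 = int p * n1" "c2 = int p * n2 + B2 p * n1"
    "c3 = int p * n3 + B2 p * n2 + B3 p * n1"
    "c4 = int p * n4 + B2 p * n3 + B3 p * n2 + (B4 p - s) * n1" using assms(1) by (rule LatE)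
  show ?thesis
    using LatI[of p "0" "n1" "n2" "n3" s]
    unfolding n by (simp add: algebra_simps)
qed

text \<open>The multiplier that produces x c has constant term 0, so it can be divided by x. Only
  the top coefficient, which the shift has lost, stays undetermined.\<close>

lemma Lat_unshift:
  assumes "(0, c1, c2, c3) \<in> Lat p s" "p > 0"
  obtains c4 where "(c1, c2, c3, c4) \<in> Lat p s"
proof -
  obtain n1 n2 n3 n4 where n: "0 = int p * n1" "c1 = int p * n2 + B2 p * n1"
    "c2 = int p * n3 + B2 p * n2 + B3 p * n1"
    "c3 = int p * n4 + B2 p * n3 + B3 p * n2 + (B4 p - s) * n1" using assms(1) by (rule LatE)
  have "n1 = 0" using n(1) assms(2) by simp
  then show ?thesis
    using that LatI[of p "n2" "n3" "n4" 0 s] n(2-4) by simp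
qed

lemma Lat_zero [simp]: "(0, 0, 0, 0) \<in> Lat p s"
  using LatI[of p 0 0 0 0 s] by simp

text \<open>Conjugation by b^l is multiplication by (1 + x)^l, hence a combination of the three
  shifts.\<close>

lemma Lat_conj:
  assumes "(c1, c2, c3, c4) \<in> Lat p s"
  shows "(c1, c2 + l * c1, c3 + l * c2 + B2 l * c1, c4 + l * c3 + B2 l * c2 + B3 l * c1) \<in> Lat p s"
proof -
  note s1 = Lat_shift[OF assms] note s2 = Lat_shift[OF s1] note s3 = Lat_shift[OF s2]
  show ?thesis
    using Lat_add[OF Lat_add[OF Lat_add[OF assms Lat_scale[OF s1, of l]] Lat_scale[OF s2, of "B2 l"]]
        Lat_scale[OF s3, of "B3 l"]]
    by (simp add: algebra_simps)
qed

text \<open>This makes the order of a_4 exactly p in every quotient, independently of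
  \<open>s\<close>.\<close>

lemma Lat_last: "(0, 0, 0, c) \<in> Lat p s \<longleftrightarrow> int p dvd c" if "p > 0"
proof
  assume "(0, 0, 0, c) \<in> Lat p s"
  then show "int p dvd c" using that by (elim LatE) auto
next
  assume "int p dvd c"
  then obtain j where "c = int p * j" by auto
  then show "(0, 0, 0, c) \<in> Lat p s" using LatI[of p 0 0 0 j s] by simp
qed

text \<open>Conjugation by \<open>b ^ p\<close> is trivial modulo the lattice: \<open>(1 + x) ^ p - 1 = x * N x\<close>.\<close>

lemma Lat_power_p: "(0, p * j, B2 (p * j), B3 (p * j)) \<in> Lat p s"
  \<comment> \<open>With y = x N, (1 + x)^(p j) - 1 is the sum of the binomials of j times the
    powers of y. Dividing by N leaves x (j + B2 j x N + B3 j (x N)^2), whose coefficients are the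
    witnesses.\<close>
  using LatI[of p 0 j "B2 j * p" "B2 j * B2 p + B3 j * p * p" s]
  unfolding B2_mult B3_mult by (simp add: algebra_simps)

lemma K_iff: "(k, c1, c2, c3, c4) \<in> K p m s u \<longleftrightarrow>
   (\<exists>j. k = int p ^ m * j \<and> (c1, c2, c3, c4 + u * j) \<in> Lat p s)"
  by (simp add: K_def)

lemma K_zero: "p > 0 \<Longrightarrow> (0, c1, c2, c3, c4) \<in> K p m s u \<longleftrightarrow> (c1, c2, c3, c4) \<in> Lat p s"
  by (auto simp: K_iff)

lemma K_mult:
  assumes "g \<in> K p m s u" "h \<in> K p m s u"
  shows "hmul g h \<in> K p m s u"
proof -
  obtain k c1 c2 c3 c4 l d1 d2 d3 d4 where gh: "g = (k, c1, c2, c3, c4)" "h = (l, d1, d2, d3, d4)"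
    by (metis surj_pair)
  obtain i j where ij: "k = int p ^ m * i" "(c1, c2, c3, c4 + u * i) \<in> Lat p s"
    "l = int p ^ m * j" "(d1, d2, d3, d4 + u * j) \<in> Lat p s"
    using assms gh by (auto simp: K_iff)
  show ?thesis
    using Lat_add[OF Lat_conj[OF ij(2), of l] ij(4)] ij(1,3)
    unfolding gh hmul.simps K_iff by (intro exI[of _ "i + j"]) (simp add: algebra_simps)
qed

lemma K_inv:
  assumes "g \<in> K p m s u"
  shows "hinv g \<in> K p m s u"
proof -
  obtain k c1 c2 c3 c4 where g: "g = (k, c1, c2, c3, c4)" by (metis surj_pair)
  obtain i where i: "k = int p ^ m * i" "(c1, c2, c3, c4 + u * i) \<in> Lat p s"
    using assms g by (auto simp: K_iff)
  show ?thesis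
    using Lat_scale[OF Lat_conj[OF i(2), of "-k"], of "-1"] i(1)
    unfolding g hinv.simps K_iff by (intro exI[of _ "- i"]) (simp add: algebra_simps)
qed

text \<open>Conjugating b^k c by the vector d adds d times (1 + x)^k - 1 to c. Because
  \<open>m \<ge> 1\<close>, p divides k, so this lies in the ideal by
  \<open>Lat_power_p\<close>.\<close>

lemma K_conj_a:
  assumes "m \<ge> 1" "(k, c1, c2, c3, c4) \<in> K p m s u"
  shows "hmul (hmul (0, d1, d2, d3, d4) (k, c1, c2, c3, c4)) (0, - d1, - d2, - d3, - d4) \<in> K p m s u"
proof -
  obtain i where i: "k = int p ^ m * i" "(c1, c2, c3, c4 + u * i) \<in> Lat p s"
    using assms by (auto simp: K_iff)
  define j where "j = int p ^ (m - 1) * i"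
  have k: "k = int p * j" using i(1) assms(1) by (simp add: j_def power_eq_if)
  note s1 = Lat_power_p[of p j s, folded k] note s2 = Lat_shift[OF s1] note s3 = Lat_shift[OF s2]
  show ?thesis
    using Lat_add[OF Lat_add[OF Lat_add[OF i(2) Lat_scale[OF s1, of d1]] Lat_scale[OF s2, of "d2"]]
        Lat_scale[OF s3, of "d3"]] i(1)
    unfolding hmul.simps K_iff by (intro exI[of _ i]) (simp add: algebra_simps)
qed

lemma K_conj_b:
  assumes "(k, c1, c2, c3, c4) \<in> K p m s u"
  shows "hmul (hmul (l, 0, 0, 0, 0) (k, c1, c2, c3, c4)) (- l, 0, 0, 0, 0) \<in> K p m s u"
proof -
  obtain i where i: "k = int p ^ m * i" "(c1, c2, c3, c4 + u * i) \<in> Lat p s"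
    using assms by (auto simp: K_iff)
  show ?thesis
    using Lat_conj[OF i(2), of "- l"] i(1)
    unfolding hmul.simps K_iff by (intro exI[of _ i]) (simp add: algebra_simps)
qed

lemma normal_K:
  assumes "m \<ge> 1"
  shows "K p m s u \<lhd> HG"
proof -
  have sub: "subgroup (K p m s u) HG"
  proof
    show "\<one>\<^bsub>HG\<^esub> \<in> K p m s u" by (auto simp: K_iff)
  qed (auto simp: K_mult K_inv)
  have "g \<otimes>\<^bsub>HG\<^esub> h \<otimes>\<^bsub>HG\<^esub> inv\<^bsub>HG\<^esub> g \<in> K p m s u" if h: "h \<in> K p m s u" for g h
  proof -
    obtain l d1 d2 d3 d4 k c1 c2 c3 c4 where
      gh: "g = (l, d1, d2, d3, d4)" "h = (k, c1, c2, c3, c4)" by (metis surj_pair)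
    interpret HG: group HG by simp
    \<comment> \<open>g is split into its power of b and its a-part, for which closure under
      conjugation is known separately.\<close>
    have g: "g = hmul (l, 0, 0, 0, 0) (0, d1, d2, d3, d4)" by (simp add: gh)
    have "inv\<^bsub>HG\<^esub> g = inv\<^bsub>HG\<^esub> (0, d1, d2, d3, d4) \<otimes>\<^bsub>HG\<^esub> inv\<^bsub>HG\<^esub> (l, 0, 0, 0, 0)"
      using HG.inv_mult_group[of "(l, 0, 0, 0, 0)" "(0, d1, d2, d3, d4)"] g by simp
    then have ig: "hinv g = hmul (0, - d1, - d2, - d3, - d4) (- l, 0, 0, 0, 0)" by simp
    have "hmul (hmul g h) (hinv g) = hmul (hmul (l, 0, 0, 0, 0)
        (hmul (hmul (0, d1, d2, d3, d4) h) (0, - d1, - d2, - d3, - d4))) (- l, 0, 0, 0, 0)"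
      unfolding ig unfolding g using HG.m_assoc by (simp only: mult_HG carrier_HG UNIV_I)
    moreover have "hmul (hmul (0, d1, d2, d3, d4) h) (0, - d1, - d2, - d3, - d4) \<in> K p m s u"
      using K_conj_a[OF assms] h gh by blast
    ultimately show ?thesis
      using K_conj_b by (metis surj_pair inv_HG mult_HG)
  qed
  then show ?thesis
    using sub group.normal_inv_iff[OF group_HG] by auto
qed

section \<open>Homomorphisms from \<open>HG\<close> to other groups\<close>

context group
begin

lemma conj_int_pow:
  assumes "x \<in> carrier G" "b \<in> carrier G" "y \<in> carrier G" "x \<otimes> b = b \<otimes> y"
  shows "x [^] (n::int) \<otimes> b = b \<otimes> y [^] n"
proof -
  have y: "y = inv b \<otimes> x \<otimes> b"
    using assms by (metis inv_closed inv_solve_left m_assoc m_closed)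
  have "(\<lambda>z. inv b \<otimes> z \<otimes> b) \<in> hom G G"
  proof (rule homI)
    fix z w assume zw: "z \<in> carrier G" "w \<in> carrier G"
    have "inv b \<otimes> z \<otimes> b \<otimes> (inv b \<otimes> w \<otimes> b) = inv b \<otimes> z \<otimes> (b \<otimes> inv b) \<otimes> w \<otimes> b"
      using zw assms(2) by (simp only: m_assoc m_closed inv_closed)
    then show "inv b \<otimes> (z \<otimes> w) \<otimes> b = inv b \<otimes> z \<otimes> b \<otimes> (inv b \<otimes> w \<otimes> b)"
      using zw assms(2) by (simp add: m_assoc)
  qed (use assms in auto)
  then interpret c: group_hom G G "\<lambda>z. inv b \<otimes> z \<otimes> b"
    by unfold_locales (use \<open>_ \<in> hom G G\<close> in auto)
  have "y [^] n = inv b \<otimes> x [^] n \<otimes> b"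
    using c.hom_int_pow[of x n] assms(1) y by simp
  then have "b \<otimes> y [^] n = b \<otimes> inv b \<otimes> (x [^] n \<otimes> b)"
    using assms by (simp only: m_assoc inv_closed m_closed int_pow_closed)
  then show ?thesis using assms by simp
qed

definition helmap :: "'a \<Rightarrow> 'a \<Rightarrow> 'a \<Rightarrow> 'a \<Rightarrow> 'a \<Rightarrow> coords \<Rightarrow> 'a" where
  "helmap a1 a2 a3 a4 b = (\<lambda>(k, c1, c2, c3, c4).
     b [^] k \<otimes> (a1 [^] c1 \<otimes> (a2 [^] c2 \<otimes> (a3 [^] c3 \<otimes> a4 [^] c4))))"

text \<open>Universal property of \<open>HG\<close>: commuting elements on which b acts by these
  four relations define a homomorphism. The formula for moving b^l to the left follows by induction
  on l, its coefficients growing by Pascal's rule.\<close>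

lemma helmap_hom:
  assumes A: "subgroup A G" and comm: "\<And>x y. x \<in> A \<Longrightarrow> y \<in> A \<Longrightarrow> x \<otimes> y = y \<otimes> x"
    and a: "a1 \<in> A" "a2 \<in> A" "a3 \<in> A" "a4 \<in> A" and b: "b \<in> carrier G"
    and rel: "a1 \<otimes> b = b \<otimes> (a1 \<otimes> a2)" "a2 \<otimes> b = b \<otimes> (a2 \<otimes> a3)"
      "a3 \<otimes> b = b \<otimes> (a3 \<otimes> a4)" "a4 \<otimes> b = b \<otimes> a4"
  shows "helmap a1 a2 a3 a4 b \<in> hom HG G"
proof (rule homI)
  interpret A: subgroup A G by fact
  note sub = A.mem_carrier
  have lcomm: "x \<otimes> (y \<otimes> z) = y \<otimes> (x \<otimes> z)" if "x \<in> A" "y \<in> A" "z \<in> A" for x y z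
    using comm[OF that(1,2)] that sub by (metis m_assoc)
  have pA: "x [^] (n::int) \<in> A" if "x \<in> A" for x n
    using that A by (simp add: subgroup_int_pow_closed)
  have pm: "x [^] (i + j :: int) = x [^] i \<otimes> x [^] j" if "x \<in> A" for x i j
    using that sub int_pow_mult by auto
  have pp: "(x [^] (i::int)) [^] (j::int) = x [^] (j * i)" if "x \<in> A" for x i j
    using that sub int_pow_pow by (simp add: mult.commute)
  define al where "al c1 c2 c3 c4 = a1 [^] c1 \<otimes> (a2 [^] c2 \<otimes> (a3 [^] c3 \<otimes> a4 [^] c4))"
    for c1 c2 c3 c4 :: int
  have alA: "al c1 c2 c3 c4 \<in> A" for c1 c2 c3 c4 unfolding al_def using a pA by simp
  have al_add: "al c1 c2 c3 c4 \<otimes> al d1 d2 d3 d4 = al (c1 + d1) (c2 + d2) (c3 + d3) (c4 + d4)"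
    for c1 c2 c3 c4 d1 d2 d3 d4
    unfolding al_def using a pA by (simp add: pm m_assoc sub lcomm comm)
  have distr: "(x \<otimes> y) [^] (n::int) = x [^] n \<otimes> y [^] n" if "x \<in> A" "y \<in> A" for x y n
    by (rule int_pow_mult_distrib[OF comm[OF that] sub[OF that(1)] sub[OF that(2)]])
  have step: "al c1 c2 c3 c4 \<otimes> b = b \<otimes> al c1 (c2 + c1) (c3 + c2) (c4 + c3)" for c1 c2 c3 c4
  proof -
    have 1: "a1 [^] c1 \<otimes> b = b \<otimes> (a1 [^] c1 \<otimes> a2 [^] c1)"
      unfolding distr[OF a(1,2), symmetric]
      by (intro conj_int_pow sub[OF a(1)] b rel(1) sub[OF A.m_closed[OF a(1,2)]])
    have 2: "a2 [^] c2 \<otimes> b = b \<otimes> (a2 [^] c2 \<otimes> a3 [^] c2)"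
      unfolding distr[OF a(2,3), symmetric]
      by (intro conj_int_pow sub[OF a(2)] b rel(2) sub[OF A.m_closed[OF a(2,3)]])
    have 3: "a3 [^] c3 \<otimes> b = b \<otimes> (a3 [^] c3 \<otimes> a4 [^] c3)"
      unfolding distr[OF a(3,4), symmetric]
      by (intro conj_int_pow sub[OF a(3)] b rel(3) sub[OF A.m_closed[OF a(3,4)]])
    have 4: "a4 [^] c4 \<otimes> b = b \<otimes> a4 [^] c4"
      by (intro conj_int_pow sub[OF a(4)] b rel(4))
    have move: "(x \<otimes> y) \<otimes> b = b \<otimes> (x' \<otimes> y')"
      if "x \<otimes> b = b \<otimes> x'" "y \<otimes> b = b \<otimes> y'" "x \<in> A" "y \<in> A" "x' \<in> A" "y' \<in> A" for x y x' y'
      using that sub b by (metis m_assoc)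
    have "al c1 c2 c3 c4 \<otimes> b = b \<otimes> ((a1 [^] c1 \<otimes> a2 [^] c1) \<otimes> ((a2 [^] c2 \<otimes> a3 [^] c2) \<otimes>
         ((a3 [^] c3 \<otimes> a4 [^] c3) \<otimes> a4 [^] c4)))"
      unfolding al_def by (intro move 1 2 3 4) (use a pA in auto)
    also have "\<dots> = b \<otimes> al c1 (c2 + c1) (c3 + c2) (c4 + c3)"
      unfolding al_def using a pA by (simp add: pm m_assoc sub lcomm comm)
    finally show ?thesis .
  qed
  have steps: "al c1 c2 c3 c4 \<otimes> b [^] l =
      b [^] l \<otimes> al c1 (c2 + l * c1) (c3 + l * c2 + B2 l * c1) (c4 + l * c3 + B2 l * c2 + B3 l * c1)"
    for c1 c2 c3 c4 and l :: int
  proof (induction l arbitrary: c1 c2 c3 c4 rule: int_induct[where k = 0])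
    case base
    then show ?case using alA sub b by simp
  next
    case (step1 l)
    have "al c1 c2 c3 c4 \<otimes> b [^] (l + 1) = (al c1 c2 c3 c4 \<otimes> b [^] l) \<otimes> b"
      using b alA sub by (simp add: int_pow_mult m_assoc)
    also have "\<dots> = b [^] l \<otimes> (al c1 (c2 + l * c1) (c3 + l * c2 + B2 l * c1)
        (c4 + l * c3 + B2 l * c2 + B3 l * c1) \<otimes> b)"
      unfolding step1 using b alA sub by (simp add: m_assoc)
    also have "\<dots> = b [^] (l + 1) \<otimes> al c1 (c2 + l * c1 + c1)
        (c3 + l * c2 + B2 l * c1 + (c2 + l * c1))
        (c4 + l * c3 + B2 l * c2 + B3 l * c1 + (c3 + l * c2 + B2 l * c1))"
      unfolding step using b alA sub by (simp add: int_pow_mult m_assoc)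
    finally show ?case unfolding B2_Suc B3_Suc by (simp add: algebra_simps)
  next
    case (step2 l)
    \<comment> \<open>For the downward induction c is written as (1 + x) d, so that
      \<open>step\<close> for d pulls out one b, which can then be cancelled.\<close>
    define d2 d3 d4 where "d2 = c2 - c1" and "d3 = c3 - d2" and "d4 = c4 - d3"
    have c: "c2 = d2 + c1" "c3 = d3 + d2" "c4 = d4 + d3" by (simp_all add: d2_def d3_def d4_def)
    have B: "B2 l = B2 (l - 1) + (l - 1)" "B3 l = B3 (l - 1) + B2 (l - 1)"
      using B2_Suc[of "l - 1"] B3_Suc[of "l - 1"] by simp_all
    have "b [^] l = b \<otimes> b [^] (l - 1)"
      using b int_pow_mult[of b 1 "l - 1"] by simp
    then have "b \<otimes> (al c1 c2 c3 c4 \<otimes> b [^] (l - 1)) = al c1 d2 d3 d4 \<otimes> b [^] l"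
      using step[of c1 d2 d3 d4] b alA sub unfolding c by (simp add: m_assoc[symmetric])
    also have "\<dots> = b \<otimes> (b [^] (l - 1) \<otimes> al c1 (d2 + l * c1) (d3 + l * d2 + B2 l * c1)
        (d4 + l * d3 + B2 l * d2 + B3 l * c1))"
      unfolding step2 using b alA sub \<open>b [^] l = b \<otimes> b [^] (l - 1)\<close> by (simp add: m_assoc)
    finally have "al c1 c2 c3 c4 \<otimes> b [^] (l - 1) = b [^] (l - 1) \<otimes> al c1 (d2 + l * c1)
        (d3 + l * d2 + B2 l * c1) (d4 + l * d3 + B2 l * d2 + B3 l * c1)"
      using b alA sub Units_l_cancel[of b] by simp
    then show ?case unfolding c B by (simp add: algebra_simps)
  qed
  fix x y :: coords
  show "helmap a1 a2 a3 a4 b x \<in> carrier G"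
    using alA sub b by (cases x) (simp add: helmap_def al_def)
  obtain k l :: int and c1 c2 c3 c4 d1 d2 d3 d4
    where xy: "x = (k, c1, c2, c3, c4)" "y = (l, d1, d2, d3, d4)"
    by (metis surj_pair)
  have "b [^] k \<otimes> al c1 c2 c3 c4 \<otimes> (b [^] l \<otimes> al d1 d2 d3 d4) =
      b [^] k \<otimes> (al c1 c2 c3 c4 \<otimes> b [^] l) \<otimes> al d1 d2 d3 d4"
    using b alA sub by (simp add: m_assoc)
  also have "\<dots> = b [^] (k + l) \<otimes> (al c1 (c2 + l * c1) (c3 + l * c2 + B2 l * c1)
      (c4 + l * c3 + B2 l * c2 + B3 l * c1) \<otimes> al d1 d2 d3 d4)"
    unfolding steps using b alA sub by (simp add: m_assoc int_pow_mult)
  finally show "helmap a1 a2 a3 a4 b (x \<otimes>\<^bsub>HG\<^esub> y) = helmap a1 a2 a3 a4 b x \<otimes> helmap a1 a2 a3 a4 b y"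
    unfolding xy helmap_def al_add by (simp add: al_def)
qed

lemma helmap_gens:
  assumes "a1 \<in> carrier G" "a2 \<in> carrier G" "a3 \<in> carrier G" "a4 \<in> carrier G" "b \<in> carrier G"
  shows "helmap a1 a2 a3 a4 b (k, 0, 0, 0, 0) = b [^] k"
    "helmap a1 a2 a3 a4 b (0, c1, c2, c3, c4) = a1 [^] c1 \<otimes> a2 [^] c2 \<otimes> a3 [^] c3 \<otimes> a4 [^] c4"
    "helmap a1 a2 a3 a4 b (k, 0, 0, 0, c4) = b [^] k \<otimes> a4 [^] c4"
  using assms by (simp_all add: helmap_def m_assoc)

end

lemma group_hom_HG: "group G \<Longrightarrow> \<phi> \<in> hom HG G \<Longrightarrow> group_hom HG G \<phi>"
  by (simp add: group_hom_def group_hom_axioms_def)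

lemma HG_pow_b: "(1, 0, 0, 0, 0) [^]\<^bsub>HG\<^esub> (k::int) = (k, 0, 0, 0, 0)"
proof -
  interpret HG: group HG by simp
  have n: "(1, 0, 0, 0, 0) [^]\<^bsub>HG\<^esub> (n::nat) = (int n, 0, 0, 0, 0)" for n
    by (induction n) auto
  show ?thesis by (cases k rule: int_cases2) (simp_all add: HG.int_pow_neg int_pow_int n)
qed

lemma HG_pow_vec:
  "(0, c1, c2, c3, c4) [^]\<^bsub>HG\<^esub> (k::int) = (0, k * c1, k * c2, k * c3, k * c4)"
proof -
  interpret HG: group HG by simp
  have n: "(0, c1, c2, c3, c4) [^]\<^bsub>HG\<^esub> (n::nat) = (0, n * c1, n * c2, n * c3, n * c4)" for n
    by (induction n) (auto simp: algebra_simps)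
  show ?thesis by (cases k rule: int_cases2) (simp_all add: HG.int_pow_neg int_pow_int n)
qed

lemma B3_m1: "B3 (- 1) = - 1"
  by (simp add: B3_def)

lemma commutator_HG_shift:
  "commutator HG (0, c1, c2, c3, c4) (1, 0, 0, 0, 0) = (0, 0, c1, c2, c3)"
  by (simp add: commutator_def B2_neg[of 1, simplified] B3_m1)

lemma (in group_hom) hom_commutator:
  assumes "x \<in> carrier G" "y \<in> carrier G"
  shows "h (commutator G x y) = commutator H (h x) (h y)"
  using assms by (simp add: commutator_def)

text \<open>a_2, a_3, a_4 are iterated commutators of a_1 with b, so these two elements
  generate.\<close>

lemma HG_generated:
  assumes "subgroup S HG" "(0, 1, 0, 0, 0) \<in> S" "(1, 0, 0, 0, 0) \<in> S"
  shows "S = UNIV"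
proof -
  interpret HG: group HG by simp
  interpret S: subgroup S HG by fact
  have com: "commutator HG x y \<in> S" if "x \<in> S" "y \<in> S" for x y
    unfolding commutator_def using that by blast
  have a2: "(0, 0, 1, 0, 0) \<in> S" using com[OF assms(2,3)] unfolding commutator_HG_shift .
  have a3: "(0, 0, 0, 1, 0) \<in> S" using com[OF a2 assms(3)] unfolding commutator_HG_shift .
  have a4: "(0, 0, 0, 0, 1) \<in> S" using com[OF a3 assms(3)] unfolding commutator_HG_shift .
  have pw: "x [^]\<^bsub>HG\<^esub> (n::int) \<in> S" if "x \<in> S" for x n
    using HG.subgroup_int_pow_closed[OF assms(1) that] .
  have "h \<in> S" for h
  proof -
    obtain k c1 c2 c3 c4 where h: "h = (k, c1, c2, c3, c4)" by (metis surj_pair)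
    have "h = (k, 0, 0, 0, 0) \<otimes>\<^bsub>HG\<^esub> ((0, c1, 0, 0, 0) \<otimes>\<^bsub>HG\<^esub> ((0, 0, c2, 0, 0) \<otimes>\<^bsub>HG\<^esub>
        ((0, 0, 0, c3, 0) \<otimes>\<^bsub>HG\<^esub> (0, 0, 0, 0, c4))))"
      by (simp add: h)
    also have "\<dots> \<in> S"
      using pw[OF assms(2), of c1] pw[OF assms(3), of k] pw[OF a2, of c2] pw[OF a3, of c3] pw[OF a4, of c4]
      unfolding HG_pow_b HG_pow_vec by (simp del: mult_HG)
    finally show ?thesis .
  qed
  then show ?thesis by auto
qed

lemma hom_HG_image:
  assumes "group G" "\<phi> \<in> hom HG G"
  shows "range \<phi> = generate G {\<phi> (0, 1, 0, 0, 0), \<phi> (1, 0, 0, 0, 0)}"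
proof -
  interpret group_hom HG G \<phi> using assms by (rule group_hom_HG)
  have "generate HG {(0, 1, 0, 0, 0), (1, 0, 0, 0, 0)} = UNIV"
    by (intro HG_generated G.generate_is_subgroup) (auto intro: generate.incl)
  then show ?thesis using generate_img[of "{(0, 1, 0, 0, 0), (1, 0, 0, 0, 0)}"] by simp
qed

lemma hom_HG_eqI:
  assumes "group G" "\<phi> \<in> hom HG G" "\<psi> \<in> hom HG G"
    "\<phi> (0, 1, 0, 0, 0) = \<psi> (0, 1, 0, 0, 0)" "\<phi> (1, 0, 0, 0, 0) = \<psi> (1, 0, 0, 0, 0)"
  shows "\<phi> = \<psi>"
proof -
  interpret p: group_hom HG G \<phi> using assms by (intro group_hom_HG)
  interpret q: group_hom HG G \<psi> using assms by (intro group_hom_HG)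
  have "subgroup {h. \<phi> h = \<psi> h} HG"
  proof (rule p.G.subgroupI)
    fix x y assume "x \<in> {h. \<phi> h = \<psi> h}" "y \<in> {h. \<phi> h = \<psi> h}"
    then show "x \<otimes>\<^bsub>HG\<^esub> y \<in> {h. \<phi> h = \<psi> h}" "inv\<^bsub>HG\<^esub> x \<in> {h. \<phi> h = \<psi> h}"
      using p.hom_mult[of x y] q.hom_mult[of x y] p.hom_inv[of x] q.hom_inv[of x]
      by (simp_all del: mult_HG inv_HG)
  qed (use p.hom_one q.hom_one in \<open>auto intro!: exI[of _ 0]\<close>)
  then show ?thesis using HG_generated assms by fast
qed

text \<open>The generators of \<open>K\<close> as a normal subgroup: the lattice generators are the shifts of the
  first one.\<close>

lemma hom_HG_kills_K:
  assumes "group G" "\<phi> \<in> hom HG G"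
    and r: "\<phi> (0, p, B2 p, B3 p, B4 p - s) = \<one>\<^bsub>G\<^esub>" and b: "\<phi> (int p ^ m, 0, 0, 0, - u) = \<one>\<^bsub>G\<^esub>"
    and h: "h \<in> K p m s u"
  shows "\<phi> h = \<one>\<^bsub>G\<^esub>"
proof -
  interpret group_hom HG G \<phi> using assms by (intro group_hom_HG)
  have shift: "\<phi> (0, 0, c1, c2, c3) = \<one>\<^bsub>G\<^esub>" if "\<phi> (0, c1, c2, c3, c4) = \<one>\<^bsub>G\<^esub>" for c1 c2 c3 c4
    using hom_commutator[of "(0, c1, c2, c3, c4)" "(1, 0, 0, 0, 0)"] that
    unfolding commutator_HG_shift by (simp add: commutator_def)
  note r2 = shift[OF r] note r3 = shift[OF r2] note r4 = shift[OF r3]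
  have pw: "\<phi> (x [^]\<^bsub>HG\<^esub> (n::int)) = \<one>\<^bsub>G\<^esub>" if "\<phi> x = \<one>\<^bsub>G\<^esub>" for x n
    using that hom_int_pow[of x n] by simp
  have mu: "\<phi> (hmul x y) = \<one>\<^bsub>G\<^esub>" if "\<phi> x = \<one>\<^bsub>G\<^esub>" "\<phi> y = \<one>\<^bsub>G\<^esub>" for x y
    using that hom_mult[of x y] by simp
  obtain k c1 c2 c3 c4 where kc: "h = (k, c1, c2, c3, c4)" by (metis surj_pair)
  obtain j where k: "k = int p ^ m * j" and L: "(c1, c2, c3, c4 + u * j) \<in> Lat p s"
    using h unfolding kc K_iff by blast
  obtain n1 n2 n3 n4 where n: "c1 = int p * n1" "c2 = int p * n2 + B2 p * n1"
    "c3 = int p * n3 + B2 p * n2 + B3 p * n1"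
    "c4 + u * j = int p * n4 + B2 p * n3 + B3 p * n2 + (B4 p - s) * n1" using L by (rule LatE)
  have bpow: "(int p ^ m, 0, 0, 0, - u) [^]\<^bsub>HG\<^esub> j = (int p ^ m * j, 0, 0, 0, - u * j)"
  proof -
    have nat: "(int p ^ m, 0, 0, 0, - u) [^]\<^bsub>HG\<^esub> (i::nat) = (int p ^ m * i, 0, 0, 0, - u * i)" for i
      by (induction i) (auto simp: algebra_simps)
    show ?thesis by (cases j rule: int_cases2) (simp_all add: G.int_pow_neg int_pow_int nat)
  qed
  \<comment> \<open>h is the j-th power of the relator for b^(p^m), times the powers n_1, ..., n_4
    of the lattice relator and its three shifts.\<close>
  have "h = hmul (int p ^ m * j, 0, 0, 0, - u * j) (hmul (0, n1 * p, n1 * B2 p, n1 * B3 p, n1 * (B4 p - s))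
      (hmul (0, n2 * 0, n2 * p, n2 * B2 p, n2 * B3 p) (hmul (0, n3 * 0, n3 * 0, n3 * p, n3 * B2 p)
        (0, n4 * 0, n4 * 0, n4 * 0, n4 * p))))"
    using n k kc by (simp add: algebra_simps)
  also have "\<phi> \<dots> = \<one>\<^bsub>G\<^esub>"
    unfolding HG_pow_vec[symmetric] bpow[symmetric] by (intro mu pw r r2 r3 r4 b)
  finally show ?thesis .
qed

section \<open>Quotients of the group of 5-tuples\<close>

text \<open>A marking amounts to a choice of a_1 and b for which the kernel is exactly
  \<open>K p m s u\<close>. One group has many markings, possibly with different parameters, so
  \<open>s\<close> and \<open>u\<close> are not yet invariants of \<open>G\<close>.\<close>

locale marked = group G for G :: "('a, 'b) monoid_scheme" (structure) +
  fixes p m :: nat and s u :: int and \<phi> :: "coords \<Rightarrow> 'a"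
  assumes prime: "prime p" and m: "m \<ge> 1" and hom: "\<phi> \<in> hom HG G"
    and surj: "range \<phi> = carrier G" and ker: "\<And>h. \<phi> h = \<one> \<longleftrightarrow> h \<in> K p m s u"
begin

sublocale phi: group_hom HG G \<phi>
  using group_hom_HG[OF is_group hom] .

lemma p_pos: "p > 0" "int p > 0" "p \<ge> 2" "int p \<ge> 2" "int p \<noteq> 0"
  using prime_gt_0_nat[OF prime] prime_ge_2_nat[OF prime] by auto

lemma prime_int: "Factorial_Ring.prime (int p)" using prime by simp

lemma phi_closed [simp]: "\<phi> h \<in> carrier G" using surj by auto

lemma phi_mult [simp]: "\<phi> g \<otimes> \<phi> h = \<phi> (hmul g h)"
  using phi.hom_mult[of g h] by simp

lemma phi_inv [simp]: "inv (\<phi> h) = \<phi> (hinv h)"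
  using phi.hom_inv[of h] by simp

lemma phi_one: "\<phi> (0, 0, 0, 0, 0) = \<one>"
  using phi.hom_one by simp

lemma phi_commutator: "commutator G (\<phi> g) (\<phi> h) = \<phi> (commutator HG g h)"
  by (simp add: commutator_def)

lemma carrier_cases:
  assumes "x \<in> carrier G"
  obtains k c1 c2 c3 c4 where "x = \<phi> (k, c1, c2, c3, c4)"
  using assms surj by (metis imageE surj_pair)

lemma phi_eq_0: "\<phi> (0, c1, c2, c3, c4) = \<one> \<longleftrightarrow> (c1, c2, c3, c4) \<in> Lat p s"
  using ker K_zero[OF p_pos(1)] by auto

lemma phi_eq_same: "\<phi> (k, c1, c2, c3, c4) = \<phi> (k, d1, d2, d3, d4) \<longleftrightarrow>
    (c1 - d1, c2 - d2, c3 - d3, c4 - d4) \<in> Lat p s"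
proof -
  have eq: "\<phi> (k, c1, c2, c3, c4) = \<phi> (k, d1, d2, d3, d4) \<otimes> \<phi> (0, c1 - d1, c2 - d2, c3 - d3, c4 - d4)"
    by simp
  show ?thesis
    unfolding eq phi_eq_0[symmetric] by (rule l_cancel_one[OF phi_closed phi_closed])
qed

text \<open>The relation b^(p^m) = a_4^u acts as a carry from the first coordinate into the last
  one.\<close>

lemma phi_carry: "\<phi> (k + int p ^ m * j, c1, c2, c3, c4) = \<phi> (k, c1, c2, c3, c4 + u * j)"
proof -
  have "\<phi> (int p ^ m * j, 0, 0, 0, - u * j) = \<one>"
    unfolding ker K_iff by (intro exI[of _ j]) simp
  moreover have "\<phi> (k + int p ^ m * j, c1, c2, c3, c4) =
      \<phi> (int p ^ m * j, 0, 0, 0, - u * j) \<otimes> \<phi> (k, c1, c2, c3, c4 + u * j)"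
    by (simp add: algebra_simps)
  ultimately show ?thesis by (simp only: l_one phi_closed)
qed

lemma phi_eq_dvd:
  assumes "\<phi> (k, c1, c2, c3, c4) = \<phi> (l, d1, d2, d3, d4)"
  shows "int p ^ m dvd k - l" "int p dvd c1 - d1"
proof -
  define e where "e = hmul (hinv (l, d1, d2, d3, d4)) (k, c1, c2, c3, c4)"
  obtain e2 e3 e4 where e: "e = (k - l, c1 - d1, e2, e3, e4)" by (auto simp: e_def)
  have "\<phi> e = inv (\<phi> (l, d1, d2, d3, d4)) \<otimes> \<phi> (k, c1, c2, c3, c4)"
    by (simp add: e_def del: hmul.simps hinv.simps)
  then have "\<phi> e = \<one>" unfolding assms by (simp only: l_inv phi_closed)
  then have "e \<in> K p m s u" using ker by simp
  then show "int p ^ m dvd k - l" "int p dvd c1 - d1"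
    unfolding e K_iff by (auto elim: LatE)
qed

text \<open>Subtracting a multiple of the generator of the ideal reduces c_1 modulo p at the cost of
  later coordinates only. \<open>reduce2\<close> to \<open>reduce4\<close> do this for the shifts;
  applied from left to right they give a normal form.\<close>

lemma reduce1: obtains d2 d3 d4 where "\<phi> (k, c1, c2, c3, c4) = \<phi> (k, c1 mod p, d2, d3, d4)"
proof -
  let ?n = "c1 div p"
  have "\<phi> (k, c1, c2, c3, c4) =
      \<phi> (k, c1 mod p, c2 - ?n * B2 p, c3 - ?n * B3 p, c4 - ?n * (B4 p - s))"
    unfolding phi_eq_same using LatI[of p ?n 0 0 0 s]
    by (simp add: algebra_simps minus_mod_eq_mult_div)
  then show ?thesis by (rule that)
qed

lemma reduce2: obtains d3 d4 where "\<phi> (k, c1, c2, c3, c4) = \<phi> (k, c1, c2 mod p, d3, d4)"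
proof -
  let ?n = "c2 div p"
  have "\<phi> (k, c1, c2, c3, c4) = \<phi> (k, c1, c2 mod p, c3 - ?n * B2 p, c4 - ?n * B3 p)"
    unfolding phi_eq_same using LatI[of p 0 ?n 0 0 s]
    by (simp add: algebra_simps minus_mod_eq_mult_div)
  then show ?thesis by (rule that)
qed

lemma reduce3: obtains d4 where "\<phi> (k, c1, c2, c3, c4) = \<phi> (k, c1, c2, c3 mod p, d4)"
proof -
  let ?n = "c3 div p"
  have "\<phi> (k, c1, c2, c3, c4) = \<phi> (k, c1, c2, c3 mod p, c4 - ?n * B2 p)"
    unfolding phi_eq_same using LatI[of p 0 0 ?n 0 s]
    by (simp add: algebra_simps minus_mod_eq_mult_div)
  then show ?thesis by (rule that)
qed

lemma reduce4: "\<phi> (k, c1, c2, c3, c4) = \<phi> (k, c1, c2, c3, c4 mod p)"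
  unfolding phi_eq_same using LatI[of p 0 0 0 "c4 div p" s]
  by (simp add: minus_mod_eq_mult_div)

text \<open>Only the values \<open>j \<in> {1..4}\<close> are relevant: \<open>filt j r\<close> is cut out by the vanishing of
  the first \<open>j - 1\<close> coordinates and the divisibility of the exponent of \<open>b\<close> by \<open>p ^ r\<close>.\<close>

definition filt :: "nat \<Rightarrow> nat \<Rightarrow> coords set" where
  "filt j r = {(k, c1, c2, c3, c4). int p ^ r dvd k \<and>
     (2 \<le> j \<longrightarrow> c1 = 0) \<and> (3 \<le> j \<longrightarrow> c2 = 0) \<and> (4 \<le> j \<longrightarrow> c3 = 0)}"

text \<open>The normal forms: one representative for each element of \<open>G\<close>.\<close>

definition box :: "coords set" where
  "box = {0..<int p ^ m} \<times> {0..<int p} \<times> {0..<int p} \<times> {0..<int p} \<times> {0..<int p}"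

text \<open>Reduction from left to right never disturbs leading zeros, and reducing k modulo p^m
  keeps it divisible by p^r as \<open>r \<le> m\<close>. So normal forms of elements of
  \<open>filt j r\<close> stay inside.\<close>

lemma phi_filt_box:
  assumes "r \<le> m"
  shows "\<phi> ` filt j r = \<phi> ` (filt j r \<inter> box)"
proof (intro equalityI subsetI)
  fix x assume "x \<in> \<phi> ` filt j r"
  then obtain k c1 c2 c3 c4 where x: "x = \<phi> (k, c1, c2, c3, c4)" and k: "int p ^ r dvd k"
    and c: "2 \<le> j \<longrightarrow> c1 = 0" "3 \<le> j \<longrightarrow> c2 = 0" "4 \<le> j \<longrightarrow> c3 = 0"
    by (auto simp: filt_def)
  let ?k = "k mod int p ^ m"
  have "int p ^ r dvd ?k" using k assms by (simp add: dvd_mod le_imp_power_dvd)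
  have k': "x = \<phi> (?k, c1, c2, c3, c4 + u * (k div int p ^ m))"
    using phi_carry[of ?k "k div int p ^ m" c1 c2 c3 c4] unfolding x by simp
  obtain c2' c3' c4' where x1: "x = \<phi> (?k, c1 mod p, c2', c3', c4')" "3 \<le> j \<longrightarrow> c2' = 0" "4 \<le> j \<longrightarrow> c3' = 0"
  proof (cases "2 \<le> j")
    case True
    then show ?thesis using that[of c2 c3] k' c by auto
  next
    case False
    then have nj: "\<not> 3 \<le> j" "\<not> 4 \<le> j" by auto
    obtain d2 d3 d4 where "\<phi> (?k, c1, c2, c3, c4 + u * (k div int p ^ m)) = \<phi> (?k, c1 mod p, d2, d3, d4)"
      by (rule reduce1)
    then show ?thesis using that[of d2 d3 d4] k' nj by simp
  qed
  obtain c3'' c4'' where x2: "x = \<phi> (?k, c1 mod p, c2' mod p, c3'', c4'')" "4 \<le> j \<longrightarrow> c3'' = 0"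
  proof (cases "3 \<le> j")
    case True
    then show ?thesis using that[of c3'] x1 by auto
  next
    case False
    then have "\<not> 4 \<le> j" by simp
    obtain d3 d4 where "\<phi> (?k, c1 mod p, c2', c3', c4') = \<phi> (?k, c1 mod p, c2' mod p, d3, d4)"
      by (rule reduce2)
    then show ?thesis using that[of d3 d4] x1(1) \<open>\<not> 4 \<le> j\<close> by simp
  qed
  obtain e4 where x3: "x = \<phi> (?k, c1 mod p, c2' mod p, c3'' mod p, e4)"
    unfolding x2(1) by (rule reduce3)
  have x4: "x = \<phi> (?k, c1 mod p, c2' mod p, c3'' mod p, e4 mod p)"
    unfolding x3 by (rule reduce4)
  have "(?k, c1 mod p, c2' mod p, c3'' mod p, e4 mod p) \<in> filt j r \<inter> box"
    using \<open>int p ^ r dvd ?k\<close> c x1(2) x2(2) p_pos by (simp add: filt_def box_def)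
  then show "x \<in> \<phi> ` (filt j r \<inter> box)" using x4 by blast
qed auto

lemma small_dvd: "c = 0" if "int p dvd c" "- int p < c" "c < int p"
proof (rule ccontr)
  assume "c \<noteq> 0"
  then have "int p \<le> \<bar>c\<bar>" using that(1) dvd_imp_le_int by force
  then show False using that by auto
qed

text \<open>The ideal is triangular with p on the diagonal: once the earlier coordinates agree, the
  next one is determined modulo p.\<close>

lemma inj_box: "inj_on \<phi> box"
proof (rule inj_onI)
  fix x y assume xy: "x \<in> box" "y \<in> box" "\<phi> x = \<phi> y"
  obtain k c1 c2 c3 c4 where x: "x = (k, c1, c2, c3, c4)" by (metis surj_pair)
  obtain l d1 d2 d3 d4 where y: "y = (l, d1, d2, d3, d4)" by (metis surj_pair)
  have b: "k \<in> {0..<int p ^ m}" "l \<in> {0..<int p ^ m}"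
    "c1 \<in> {0..<int p}" "c2 \<in> {0..<int p}" "c3 \<in> {0..<int p}" "c4 \<in> {0..<int p}"
    "d1 \<in> {0..<int p}" "d2 \<in> {0..<int p}" "d3 \<in> {0..<int p}" "d4 \<in> {0..<int p}"
    using xy(1,2) by (auto simp: x y box_def)
  have "int p ^ m dvd k - l" using phi_eq_dvd(1) xy(3) x y by blast
  then have "k mod int p ^ m = l mod int p ^ m" by (simp add: mod_eq_dvd_iff)
  then have kl: "k = l" using b(1,2) by simp
  have "(c1 - d1, c2 - d2, c3 - d3, c4 - d4) \<in> Lat p s"
    using xy(3) unfolding x y kl phi_eq_same .
  then obtain n1 n2 n3 n4 where n: "c1 - d1 = int p * n1" "c2 - d2 = int p * n2 + B2 p * n1"
    "c3 - d3 = int p * n3 + B2 p * n2 + B3 p * n1"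
    "c4 - d4 = int p * n4 + B2 p * n3 + B3 p * n2 + (B4 p - s) * n1" by (rule LatE)
  have 1: "c1 - d1 = 0"
  proof (rule small_dvd)
    show "int p dvd c1 - d1" unfolding n(1) by simp
  qed (use b in auto)
  then have n1: "n1 = 0" using n(1) p_pos by simp
  have 2: "c2 - d2 = 0"
  proof (rule small_dvd)
    show "int p dvd c2 - d2" unfolding n(2) n1 by simp
  qed (use b in auto)
  then have n2: "n2 = 0" using n(2) n1 p_pos by simp
  have 3: "c3 - d3 = 0"
  proof (rule small_dvd)
    show "int p dvd c3 - d3" unfolding n(3) n1 n2 by simp
  qed (use b in auto)
  then have n3: "n3 = 0" using n(3) n1 n2 p_pos by simp
  have 4: "c4 - d4 = 0"
  proof (rule small_dvd)
    show "int p dvd c4 - d4" unfolding n(4) n1 n2 n3 by simp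
  qed (use b in auto)
  show "x = y" using 1 2 3 4 kl x y by simp
qed

lemma card_multiples:
  assumes "r \<le> m"
  shows "card {k \<in> {0..<int p ^ m}. int p ^ r dvd k} = p ^ (m - r)"
proof -
  have "{k \<in> {0..<int p ^ m}. int p ^ r dvd k} = (\<lambda>i. int p ^ r * i) ` {0..<int p ^ (m - r)}"
  proof (intro equalityI subsetI)
    fix k assume k: "k \<in> {k \<in> {0..<int p ^ m}. int p ^ r dvd k}"
    then obtain i where i: "k = int p ^ r * i" by auto
    have "int p ^ r * i < int p ^ r * int p ^ (m - r)" "0 \<le> int p ^ r * i"
      using k i assms by (simp_all flip: power_add)
    moreover have "0 < int p ^ r" using p_pos by simp
    ultimately have "i \<in> {0..<int p ^ (m - r)}"
      using zero_le_mult_iff[of "int p ^ r" i] by auto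
    then show "k \<in> (\<lambda>i. int p ^ r * i) ` {0..<int p ^ (m - r)}" using i by blast
  next
    fix k assume "k \<in> (\<lambda>i. int p ^ r * i) ` {0..<int p ^ (m - r)}"
    then obtain i where "k = int p ^ r * i" "i \<in> {0..<int p ^ (m - r)}" by blast
    then have i: "k = int p ^ r * i" "0 \<le> i" "i < int p ^ (m - r)" by auto
    have "int p ^ r * i < int p ^ r * int p ^ (m - r)" using i p_pos by simp
    then show "k \<in> {k \<in> {0..<int p ^ m}. int p ^ r dvd k}" using i assms p_pos
      by (simp flip: power_add)
  qed
  moreover have "inj_on (\<lambda>i. int p ^ r * i) {0..<int p ^ (m - r)}"
    using p_pos by (auto simp: inj_on_def)
  moreover have "nat (int p ^ (m - r)) = p ^ (m - r)" by (metis nat_int of_nat_power)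
  ultimately show ?thesis by (simp add: card_image)
qed

lemma card_phi_filt:
  assumes "r \<le> m" "j \<in> {1..4}"
  shows "card (\<phi> ` filt j r) = p ^ (m - r) * p ^ (5 - j)" "finite (\<phi> ` filt j r)"
proof -
  \<comment> \<open>\<open>D i\<close> is the range of the coordinate c_(i - 1) inside the box; the
    indices match the bounds on \<open>j\<close> in \<open>filt\<close>.\<close>
  define D where "D i = (if i \<le> j then {0..<1::int} else {0..<int p})" for i :: nat
  have D: "card (D i) = (if i \<le> j then 1 else p)" "finite (D i)" for i by (auto simp: D_def)
  have "filt j r \<inter> box = {k \<in> {0..<int p ^ m}. int p ^ r dvd k} \<times> D 2 \<times> D 3 \<times> D 4 \<times> {0..<int p}"
    using p_pos by (auto simp: filt_def box_def D_def)
  then have "card (filt j r \<inter> box) = p ^ (m - r) * (card (D 2) * (card (D 3) * (card (D 4) * p)))"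
    using assms by (simp only: card_cartesian_product card_multiples) simp
  also have "card (D 2) * (card (D 3) * (card (D 4) * p)) = p ^ (5 - j)"
  proof -
    have "j = 1 \<or> j = 2 \<or> j = 3 \<or> j = 4" using assms(2) by auto
    then show ?thesis by (auto simp: D numeral_eq_Suc)
  qed
  finally show "card (\<phi> ` filt j r) = p ^ (m - r) * p ^ (5 - j)"
    unfolding phi_filt_box[OF assms(1)]
    using card_image[OF inj_on_subset[OF inj_box, of "filt j r \<inter> box"]] by simp
  have "finite box" by (simp add: box_def)
  then show "finite (\<phi> ` filt j r)" unfolding phi_filt_box[OF assms(1)] by blast
qed

lemma carrier_filt: "carrier G = \<phi> ` filt 1 0"
proof -
  have "h \<in> filt 1 0" for h by (cases h) (simp add: filt_def)
  then have "filt 1 0 = UNIV" by blast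
  then show ?thesis using surj by simp
qed

lemma order_G: "order G = p ^ (m + 4)" and finite_G: "finite (carrier G)"
proof -
  have c: "card (\<phi> ` filt 1 0) = p ^ (m - 0) * p ^ (5 - 1)"
    by (rule card_phi_filt(1)) auto
  have f: "finite (\<phi> ` filt 1 0)"
    by (rule card_phi_filt(2)) auto
  show "order G = p ^ (m + 4)" unfolding order_def carrier_filt c by (simp add: power_add)
  show "finite (carrier G)" unfolding carrier_filt by (rule f)
qed

end

section \<open>Transport, uniqueness and existence of marked groups\<close>

lemma marked_iso:
  assumes "marked G p m s u \<phi>" "\<theta> \<in> iso G H" "group H"
  shows "marked H p m s u (\<theta> \<circ> \<phi>)"
proof -
  interpret marked G p m s u \<phi> by fact
  interpret H: group H by fact
  have th: "\<theta> \<in> hom G H" "inj_on \<theta> (carrier G)" "\<theta> ` carrier G = carrier H"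
    using assms(2) by (auto simp: iso_def bij_betw_def)
  interpret th: group_hom G H \<theta> using th by unfold_locales auto
  show ?thesis
  proof
    show "\<theta> \<circ> \<phi> \<in> hom HG H" using hom th(1) by (rule Group.hom_compose)
    show "range (\<theta> \<circ> \<phi>) = carrier H" using th(3) surj by (simp only: image_comp[symmetric])
    show "(\<theta> \<circ> \<phi>) h = \<one>\<^bsub>H\<^esub> \<longleftrightarrow> h \<in> K p m s u" for h
      using ker[of h] th(2) th.hom_one by (metis comp_apply inj_onD one_closed phi_closed)
  qed (use prime m in auto)
qed

text \<open>Both groups are \<open>HG\<close> modulo the same kernel.\<close>

lemma marked_unique:
  assumes "marked G p m s u \<phi>" "marked H p m s u \<psi>"
  shows "G \<cong> H"
proof -
  interpret g: marked G p m s u \<phi> by fact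
  interpret h: marked H p m s u \<psi> by fact
  have "kernel HG G \<phi> = K p m s u" "kernel HG H \<psi> = K p m s u"
    using g.ker h.ker by (auto simp: kernel_def)
  then have "HG Mod K p m s u \<cong> G" "HG Mod K p m s u \<cong> H"
    using g.phi.FactGroup_iso h.phi.FactGroup_iso g.surj h.surj by auto
  moreover have "group (HG Mod K p m s u)" using normal.factorgroup_is_group normal_K g.m by blast
  ultimately show ?thesis using group.iso_sym iso_trans by blast
qed

text \<open>All parameters occur; this is what bounds the order of the presented groups from
  below.\<close>

lemma marked_model:
  assumes "prime p" "m \<ge> 1"
  shows "marked (HG Mod K p m s u) p m s u (\<lambda>h. K p m s u #>\<^bsub>HG\<^esub> h)"
proof -
  interpret normal "K p m s u" HG using normal_K[OF assms(2)] .
  show ?thesis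
  proof (intro marked.intro marked_axioms.intro factorgroup_is_group assms)
    show "(\<lambda>h. K p m s u #>\<^bsub>HG\<^esub> h) \<in> hom HG (HG Mod K p m s u)" by (rule r_coset_hom_Mod)
    show "range (\<lambda>h. K p m s u #>\<^bsub>HG\<^esub> h) = carrier (HG Mod K p m s u)"
      by (auto simp: FactGroup_def RCOSETS_def)
    show "(K p m s u #>\<^bsub>HG\<^esub> h = \<one>\<^bsub>HG Mod K p m s u\<^esub>) = (h \<in> K p m s u)" for h
    proof -
      have "K p m s u #>\<^bsub>HG\<^esub> h = K p m s u \<longleftrightarrow> h \<in> K p m s u"
        using coset_join1[of "K p m s u" h] coset_join2[of h "K p m s u"] subgroup_axioms carrier_HG
        by blast
      then show ?thesis by (simp add: FactGroup_def)
    qed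
  qed
qed

section \<open>Powers and commutators in coordinates\<close>

lemma HG_pow_fst:
  obtains d2 d3 d4 where "(k, c1, c2, c3, c4) [^]\<^bsub>HG\<^esub> (n::nat) = (int n * k, int n * c1, d2, d3, d4)"
proof -
  have "\<exists>d2 d3 d4. (k, c1, c2, c3, c4) [^]\<^bsub>HG\<^esub> (n::nat) = (int n * k, int n * c1, d2, d3, d4)"
    by (induction n) (auto simp: algebra_simps)
  then show ?thesis using that by blast
qed

text \<open>(b v)^n is b^n times v multiplied by 1 + (1 + x) + ... + (1 + x)^(n - 1) = ((1 + x)^n -
  1)/x, whose coefficients are n, B2 n, B3 n, B4 n.\<close>

lemma HG_pow_1: "(1, c1, c2, c3, c4) [^]\<^bsub>HG\<^esub> (n::nat) =
    (int n, n * c1, n * c2 + B2 n * c1, n * c3 + B2 n * c2 + B3 n * c1,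
     n * c4 + B2 n * c3 + B3 n * c2 + B4 n * c1)"
proof (induction n)
  case (Suc n)
  have "B2 (1 + int n) = B2 n + n" "B3 (1 + int n) = B3 n + B2 n" "B4 (1 + int n) = B4 n + B3 n"
    using B2_Suc[of n] B3_Suc[of n] B4_Suc[of n] by (simp_all add: add.commute)
  then show ?case using Suc by (simp add: algebra_simps)
qed simp

lemma inverse_mod_prime:
  assumes "prime p" and "\<not> int p dvd k"
  obtains k' :: nat where "k' > 0" "[k * int k' = 1] (mod int p ^ n)"
proof -
  have "coprime k (int p ^ n)"
    using assms prime_imp_coprime[of "int p" k] by (simp add: coprime_commute)
  then obtain i where i: "[k * i = 1] (mod int p ^ n)" using cong_solve_coprime_int by blast
  \<comment> \<open>Adding p^n makes the inverse positive, so that it can serve as a natural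
    exponent.\<close>
  let ?k = "i mod (int p ^ n) + int p ^ n"
  have pos: "?k > 0" using prime_gt_0_nat[OF assms(1)] by (simp add: add_nonneg_pos)
  have "[k * ?k = k * i] (mod int p ^ n)"
    by (simp add: cong_def distrib_left mod_mult_right_eq)
  then have "[k * ?k = 1] (mod int p ^ n)" using i cong_trans by blast
  then show ?thesis using that[of "nat ?k"] pos by simp
qed

text \<open>[v, b^k w] is v times (1 + x)^k - 1, whatever w is, because the vectors commute with
  each other.\<close>

lemma commutator_HG_vec: "commutator HG (0, c1, c2, c3, c4) (k, d1, d2, d3, d4) =
    (0, 0, k * c1, k * c2 + B2 k * c1, k * c3 + B2 k * c2 + B3 k * c1)" (is "commutator HG ?y ?x = ?z")
proof -
  interpret HG: group HG by simp
  have "hmul (hmul ?x ?y) ?z = hmul ?y ?x" by (simp add: algebra_simps)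
  then have eq: "?x \<otimes>\<^bsub>HG\<^esub> ?y \<otimes>\<^bsub>HG\<^esub> ?z = ?y \<otimes>\<^bsub>HG\<^esub> ?x" by simp
  have "commutator HG ?y ?x = inv\<^bsub>HG\<^esub> ?y \<otimes>\<^bsub>HG\<^esub> inv\<^bsub>HG\<^esub> ?x \<otimes>\<^bsub>HG\<^esub> (?x \<otimes>\<^bsub>HG\<^esub> ?y \<otimes>\<^bsub>HG\<^esub> ?z)"
    unfolding eq commutator_def by (rule HG.m_assoc) auto
  also have "\<dots> = inv\<^bsub>HG\<^esub> (?x \<otimes>\<^bsub>HG\<^esub> ?y) \<otimes>\<^bsub>HG\<^esub> (?x \<otimes>\<^bsub>HG\<^esub> ?y) \<otimes>\<^bsub>HG\<^esub> ?z"
    using HG.inv_mult_group[of ?x ?y] HG.m_assoc by (simp del: mult_HG inv_HG)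
  also have "\<dots> = ?z" using HG.l_inv[of "?x \<otimes>\<^bsub>HG\<^esub> ?y"] HG.l_one by (simp del: mult_HG inv_HG)
  finally show ?thesis .
qed

lemma (in group) commutator_central:
  assumes "z \<in> centre G" "x \<in> carrier G" "y \<in> carrier G"
  shows "commutator G (z \<otimes> y) x = commutator G y x"
proof -
  have z: "z \<in> carrier G" "\<And>w. w \<in> carrier G \<Longrightarrow> z \<otimes> w = w \<otimes> z" using assms(1) by (auto simp: centre_def)
  have "commutator G (z \<otimes> y) x = inv y \<otimes> (inv z \<otimes> (inv x \<otimes> (z \<otimes> (y \<otimes> x))))"
    using assms z(1) by (simp add: commutator_def inv_mult_group m_assoc)
  also have "inv x \<otimes> (z \<otimes> (y \<otimes> x)) = z \<otimes> (inv x \<otimes> (y \<otimes> x))"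
    using z(2)[of "inv x"] z(1) assms by (simp flip: m_assoc)
  also have "inv z \<otimes> (z \<otimes> (inv x \<otimes> (y \<otimes> x))) = inv x \<otimes> (y \<otimes> x)"
    using z(1) assms by (simp flip: m_assoc)
  finally show ?thesis using assms by (simp add: commutator_def m_assoc)
qed

section \<open>The subgroups given by \<open>filt\<close>, the centre and the p-th power map\<close>

context marked
begin

lemma filtI: "int p ^ r dvd k \<Longrightarrow> \<phi> (k, c1, c2, c3, c4) \<in> \<phi> ` filt 1 r"
    "int p ^ r dvd k \<Longrightarrow> \<phi> (k, 0, c2, c3, c4) \<in> \<phi> ` filt 2 r"
    "int p ^ r dvd k \<Longrightarrow> \<phi> (k, 0, 0, c3, c4) \<in> \<phi> ` filt 3 r"
    "int p ^ r dvd k \<Longrightarrow> \<phi> (k, 0, 0, 0, c4) \<in> \<phi> ` filt 4 r"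
  by (rule imageI, simp add: filt_def)+

lemma filtE1:
  assumes "x \<in> \<phi> ` filt 1 r"
  obtains j c1 c2 c3 c4 where "x = \<phi> (int p ^ r * j, c1, c2, c3, c4)"
  using assms unfolding filt_def by (auto elim!: dvdE)

lemma filtE2:
  assumes "x \<in> \<phi> ` filt 2 r"
  obtains j c2 c3 c4 where "x = \<phi> (int p ^ r * j, 0, c2, c3, c4)"
  using assms unfolding filt_def by (auto elim!: dvdE)

lemma filtE3:
  assumes "x \<in> \<phi> ` filt 3 r"
  obtains j c3 c4 where "x = \<phi> (int p ^ r * j, 0, 0, c3, c4)"
  using assms unfolding filt_def by (auto elim!: dvdE)

lemma filtE4:
  assumes "x \<in> \<phi> ` filt 4 r"
  obtains j c4 where "x = \<phi> (int p ^ r * j, 0, 0, 0, c4)"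
  using assms unfolding filt_def by (auto elim!: dvdE)

lemma filt_mono: "i \<le> j \<Longrightarrow> \<phi> ` filt j r \<subseteq> \<phi> ` filt i r"
  unfolding filt_def by (intro image_mono) auto

lemma subgroup_filt: "subgroup (\<phi> ` filt j r) G"
proof -
  have "subgroup (filt j r) HG"
  proof (rule group.subgroupI[OF group_HG])
    show "filt j r \<noteq> {}" by (auto simp: filt_def intro!: exI[of _ 0])
    fix x y assume "x \<in> filt j r" "y \<in> filt j r"
    then show "x \<otimes>\<^bsub>HG\<^esub> y \<in> filt j r" by (cases x; cases y) (simp add: filt_def)
  next
    fix x assume "x \<in> filt j r"
    then show "inv\<^bsub>HG\<^esub> x \<in> filt j r" by (cases x) (simp add: filt_def)
  qed simp
  then show ?thesis by (rule phi.subgroup_img_is_subgroup)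
qed

text \<open>Divisibility of k by p does not depend on the coordinates chosen, since k is determined
  modulo p^m and \<open>m \<ge> 1\<close>. The image of \<open>filt 1 1\<close> is the abelian
  maximal subgroup A; those of \<open>filt 2 1\<close>, \<open>filt 2 m\<close> and
  \<open>filt 4 1\<close> will be the Frattini subgroup, the derived subgroup and the centre, and
  that of \<open>filt 3 1\<close> decides whether a subgroup outside of A is abelian.\<close>

lemma in_A_iff: "\<phi> (k, c1, c2, c3, c4) \<in> \<phi> ` filt 1 1 \<longleftrightarrow> int p dvd k"
proof
  assume "\<phi> (k, c1, c2, c3, c4) \<in> \<phi> ` filt 1 1"
  then obtain j d1 d2 d3 d4 where "\<phi> (k, c1, c2, c3, c4) = \<phi> (int p ^ 1 * j, d1, d2, d3, d4)"
    by (rule filtE1)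
  then have "int p ^ m dvd k - int p * j" using phi_eq_dvd(1) by simp
  then have "int p dvd k - int p * j" using m by (metis dvd_power dvd_trans less_eq_Suc_le One_nat_def)
  then show "int p dvd k" by (simp add: dvd_diff_left_iff)
qed (use filtI(1)[of 1 k] in simp)

text \<open>This is c times (1 + x)^l - 1: its vanishing says that b^l commutes with the
  a-part.\<close>

lemma Lat_twist:
  assumes "int p dvd l"
  shows "(0, l * c1, l * c2 + B2 l * c1, l * c3 + B2 l * c2 + B3 l * c1) \<in> Lat p s"
proof -
  obtain j where l: "l = int p * j" using assms by auto
  note s1 = Lat_power_p[of p j s, folded l] note s2 = Lat_shift[OF s1] note s3 = Lat_shift[OF s2]
  show ?thesis
    using Lat_add[OF Lat_add[OF Lat_scale[OF s1, of c1] Lat_scale[OF s2, of c2]] Lat_scale[OF s3, of c3]]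
    by (simp add: algebra_simps)
qed

lemma A_comm:
  assumes "x \<in> \<phi> ` filt 1 1" "y \<in> \<phi> ` filt 1 1"
  shows "x \<otimes> y = y \<otimes> x"
proof -
  obtain i c1 c2 c3 c4 where x: "x = \<phi> (int p ^ 1 * i, c1, c2, c3, c4)" using assms(1) by (rule filtE1)
  obtain j d1 d2 d3 d4 where y: "y = \<phi> (int p ^ 1 * j, d1, d2, d3, d4)" using assms(2) by (rule filtE1)
  let ?k = "int p ^ 1 * i" and ?l = "int p ^ 1 * j"
  have k: "int p dvd ?k" and l: "int p dvd ?l" by auto
  show ?thesis
    unfolding x y phi_mult hmul.simps add.commute[of ?k ?l] phi_eq_same
    using Lat_add[OF Lat_twist[OF l, of c1 c2 c3] Lat_scale[OF Lat_twist[OF k, of d1 d2 d3], of "- 1"]]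
    by (simp add: algebra_simps)
qed

lemma central_elem:
  assumes "int p dvd l"
  shows "\<phi> (l, 0, 0, 0, e) \<otimes> \<phi> (k, c1, c2, c3, c4) = \<phi> (k, c1, c2, c3, c4) \<otimes> \<phi> (l, 0, 0, 0, e)"
  unfolding phi_mult hmul.simps add.commute[of k l] phi_eq_same
  using Lat_scale[OF Lat_twist[OF assms, of c1 c2 c3], of "- 1"]
  by (simp add: algebra_simps)

lemma Z_central: "x \<in> \<phi> ` filt 4 1 \<Longrightarrow> x \<in> centre G"
  unfolding centre_def
  by (auto elim!: filtE4 carrier_cases simp: central_elem simp del: phi_mult)

text \<open>Commuting with a_1 forces p to divide k. Commuting with b puts x c into the ideal, so by
  \<open>Lat_unshift\<close> c is in the ideal up to a power of a_4.\<close>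

lemma centre_eq: "centre G = \<phi> ` filt 4 1"
proof (intro equalityI subsetI)
  fix x assume x: "x \<in> centre G"
  then obtain k c1 c2 c3 c4 where x': "x = \<phi> (k, c1, c2, c3, c4)"
    unfolding centre_def using carrier_cases by blast
  have "x \<otimes> \<phi> (0, 1, 0, 0, 0) = \<phi> (0, 1, 0, 0, 0) \<otimes> x" "x \<otimes> \<phi> (1, 0, 0, 0, 0) = \<phi> (1, 0, 0, 0, 0) \<otimes> x"
    using x by (auto simp: centre_def simp del: phi_mult)
  then have a: "\<phi> (k, c1 + 1, c2, c3, c4) = \<phi> (k, 1 + c1, k + c2, B2 k + c3, B3 k + c4)"
    and b: "\<phi> (1 + k, c1, c2 + c1, c3 + c2, c4 + c3) = \<phi> (1 + k, c1, c2, c3, c4)"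
    unfolding x' by (simp_all add: algebra_simps)
  have "(0, - k, - B2 k, - B3 k) \<in> Lat p s" using a unfolding phi_eq_same by simp
  then have "int p dvd k" using p_pos by (elim LatE) (simp, metis dvd_minus_iff dvd_triv_left)
  have "(0, c1, c2, c3) \<in> Lat p s" using b unfolding phi_eq_same by simp
  then obtain e where "(c1, c2, c3, e) \<in> Lat p s" using p_pos(1) by (rule Lat_unshift)
  then have "x = \<phi> (k, 0, 0, 0, c4 - e)" unfolding x' phi_eq_same by simp
  then show "x \<in> \<phi> ` filt 4 1" using \<open>int p dvd k\<close> filtI(4)[of 1 k] by simp
qed (rule Z_central)

lemma phi_pow: "\<phi> h [^] (n::nat) = \<phi> (h [^]\<^bsub>HG\<^esub> n)"
  using phi.hom_nat_pow[of h n] by simp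

text \<open>(b v)^p = b^p N v, and N acts as s x^3 modulo the ideal, which sees only the first
  coefficient of v.\<close>

lemma pow_p_1: "\<phi> (1, c1, c2, c3, c4) [^] p = \<phi> (int p, 0, 0, 0, s * c1)"
  unfolding phi_pow HG_pow_1 phi_eq_same using LatI[of p c1 c2 c3 c4 s] by (simp add: algebra_simps)

lemma inverse_mod:
  assumes "\<not> int p dvd k"
  obtains k' :: nat where "k' > 0" "[k * int k' = 1] (mod int p ^ n)"
  using inverse_mod_prime[OF prime assms] .

lemma pow_order: "x \<in> carrier G \<Longrightarrow> x [^] (p ^ (m + 4)) = \<one>"
  using pow_order_eq_1[of x] order_G by simp

text \<open>An element outside of A is the k-th power of one with b-exponent 1, to which
  \<open>pow_p_1\<close> applies; raising the result to the power k gives the formula.\<close>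

lemma pow_p:
  assumes "\<not> int p dvd k"
  shows "\<phi> (k, c1, c2, c3, c4) [^] p = \<phi> (int p * k, 0, 0, 0, s * c1)"
proof -
  let ?g = "\<phi> (k, c1, c2, c3, c4)"
  \<comment> \<open>The modulus is the order of the group, so that the exponent k' k returns the
    element itself.\<close>
  obtain k' where k': "k' > 0" "[k * int k' = 1] (mod int p ^ (m + 4))"
    using assms by (rule inverse_mod)
  then have "int p ^ (m + 4) dvd k * int k' - 1" by (simp add: cong_iff_dvd_diff)
  then obtain j where j: "k * int k' = 1 + int p ^ (m + 4) * j"
    unfolding dvd_def by (metis add.commute diff_add_cancel)
  obtain d2 d3 d4 where "(k, c1, c2, c3, c4) [^]\<^bsub>HG\<^esub> k' = (int k' * k, int k' * c1, d2, d3, d4)"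
    by (rule HG_pow_fst)
  then have "?g [^] k' = \<phi> (1 + int p ^ m * (int p ^ 4 * j), int k' * c1, d2, d3, d4)"
    using j by (simp add: phi_pow power_add ac_simps)
  then have g1: "?g [^] k' = \<phi> (1, int k' * c1, d2, d3, d4 + u * (int p ^ 4 * j))"
    unfolding phi_carry .
  have kk: "?g [^] (int k' * k) = ?g"
  proof -
    have "?g [^] (int k' * k) = ?g [^] (1::int) \<otimes> ?g [^] (int (p ^ (m + 4)) * j)"
      using j by (simp add: int_pow_mult mult.commute)
    also have "?g [^] (int (p ^ (m + 4)) * j) = (?g [^] int (p ^ (m + 4))) [^] j"
      by (simp add: int_pow_pow)
    also have "?g [^] int (p ^ (m + 4)) = \<one>" using pow_order[of ?g] by (simp only: int_pow_int phi_closed)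
    finally show ?thesis by simp
  qed
  have "?g [^] int p = (?g [^] (int k' * k)) [^] int p" by (simp only: kk)
  also have "\<dots> = ((?g [^] k') [^] p) [^] k"
    by (simp add: int_pow_pow ac_simps flip: int_pow_int)
  also have "\<dots> = \<phi> (int p, 0, 0, 0, s * (int k' * c1)) [^] k"
    unfolding g1 pow_p_1 ..
  also have "\<dots> = \<phi> ((int p, 0, 0, 0, s * (int k' * c1)) [^]\<^bsub>HG\<^esub> k)"
    using phi.hom_int_pow[of "(int p, 0, 0, 0, s * (int k' * c1))" k] by simp
  also have "(int p, 0, 0, 0, s * (int k' * c1)) [^]\<^bsub>HG\<^esub> k = (int p * k, 0, 0, 0, s * c1 * (int k' * k))"
  proof -
      have nat: "(int p, 0, 0, 0, c) [^]\<^bsub>HG\<^esub> (i::nat) = (int p * i, 0, 0, 0, c * i)" for i c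
      by (induction i) (auto simp: algebra_simps)
    show ?thesis by (cases k rule: int_cases2) (simp_all add: phi.G.int_pow_neg int_pow_int nat)
  qed
  also have "\<phi> \<dots> = \<phi> (int p * k, 0, 0, 0, s * c1)"
  proof -
    have "s * c1 * (int k' * k) - s * c1 = int p * (s * c1 * int p ^ (m + 3) * j)"
      using j by (simp add: algebra_simps power_add numeral_eq_Suc)
    then show ?thesis unfolding phi_eq_same using Lat_last[OF p_pos(1)] by simp
  qed
  finally show ?thesis by (simp only: int_pow_int)
qed

lemma split_b: "\<phi> (k, c1, c2, c3, c4) = \<phi> (k, 0, 0, 0, 0) \<otimes> \<phi> (0, c1, c2, c3, c4)"
  by simp

text \<open>b^l is central when p divides l, so only the a-part of the first argument
  counts.\<close>

lemma commutator_A: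
  assumes "int p dvd l"
  shows "commutator G (\<phi> (l, c1, c2, c3, c4)) (\<phi> (k, d1, d2, d3, d4)) =
    \<phi> (0, 0, k * c1, k * c2 + B2 k * c1, k * c3 + B2 k * c2 + B3 k * c1)"
proof -
  have "\<phi> (l, 0, 0, 0, 0) \<in> centre G" using assms filtI(4)[of 1 l 0] Z_central by simp
  note central = this
  show ?thesis
    unfolding split_b[of l c1 c2 c3 c4] commutator_central[OF central phi_closed phi_closed]
      phi_commutator commutator_HG_vec ..
qed

lemma phi_vec_pow: "\<phi> (0, c1, c2, c3, c4) [^] (n::int) = \<phi> (0, n * c1, n * c2, n * c3, n * c4)"
  using phi.hom_int_pow[of "(0, c1, c2, c3, c4)" n] by (simp add: HG_pow_vec)

lemma phi_b_pow: "\<phi> (1, 0, 0, 0, 0) [^] (n::int) = \<phi> (n, 0, 0, 0, 0)"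
  using phi.hom_int_pow[of "(1, 0, 0, 0, 0)" n] by (simp add: HG_pow_b)

end

section \<open>Subgroups and invariants of the quotients\<close>

lemma (in group) abelian_sub_iff:
  assumes "subgroup S G"
  shows "abelian_sub G S \<longleftrightarrow> (\<forall>x\<in>S. \<forall>y\<in>S. x \<otimes> y = y \<otimes> x)"
proof
  assume "abelian_sub G S"
  then show "\<forall>x\<in>S. \<forall>y\<in>S. x \<otimes> y = y \<otimes> x" using comm_groupE(4) by fastforce
next
  assume c: "\<forall>x\<in>S. \<forall>y\<in>S. x \<otimes> y = y \<otimes> x"
  have "group (G\<lparr>carrier := S\<rparr>)" using assms by (rule subgroup_imp_group)
  then show "abelian_sub G S" by (rule group.group_comm_groupI) (use c in auto)
qed

lemma unit_mult_prime:
  assumes "prime p" and "\<not> int p dvd i"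
  obtains n t where "n * i = c + int p * t"
proof -
  obtain i' where i': "i' > 0" "[i * int i' = 1] (mod int p ^ 1)" using inverse_mod_prime[OF assms, of 1] by blast
  then have "int p dvd i * int i' - 1" by (simp add: cong_iff_dvd_diff)
  then obtain t where "i * int i' - 1 = int p * t" by (rule dvdE)
  then have "(c * int i') * i = c + int p * (c * t)" by (simp add: algebra_simps)
  then show ?thesis by (rule that)
qed

section \<open>What a subgroup outside of A contains\<close>

context marked
begin

text \<open>Raising an element outside of A to the inverse of its b-exponent modulo p^m gives
  b-exponent 1, up to a carry into a_4.\<close>

lemma unit_b:
  assumes S: "subgroup S G" and "\<not> S \<subseteq> \<phi> ` filt 1 1"
  obtains w1 w2 w3 w4 where "\<phi> (1, w1, w2, w3, w4) \<in> S"
proof -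
  obtain x where x: "x \<in> S" "x \<notin> \<phi> ` filt 1 1" using assms by auto
  obtain k c1 c2 c3 c4 where x': "x = \<phi> (k, c1, c2, c3, c4)"
    using x(1) S subgroup.mem_carrier carrier_cases by metis
  have "\<not> int p dvd k" using x(2) in_A_iff x' by simp
  then obtain k' where k': "k' > 0" "[k * int k' = 1] (mod int p ^ m)" by (rule inverse_mod)
  then have "int p ^ m dvd k * int k' - 1" by (simp add: cong_iff_dvd_diff)
  then obtain j where "k * int k' - 1 = int p ^ m * j" by (rule dvdE)
  then have j: "int k' * k = 1 + int p ^ m * j" by (simp add: mult.commute)
  obtain d2 d3 d4 where "(k, c1, c2, c3, c4) [^]\<^bsub>HG\<^esub> k' = (int k' * k, int k' * c1, d2, d3, d4)"
    by (rule HG_pow_fst)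
  then have "x [^] k' = \<phi> (1, int k' * c1, d2, d3, d4 + u * j)"
    unfolding x' phi_pow by (simp only: j phi_carry)
  moreover have "x [^] k' \<in> S" using S x(1) subgroup_int_pow_closed[of S x "int k'"] by (simp add: int_pow_int)
  ultimately show ?thesis using that by metis
qed

lemma pm_dvd: "int p ^ m dvd z \<Longrightarrow> int p dvd z"
  using m by (metis dvd_power dvd_trans less_eq_Suc_le One_nat_def)

lemma A_E:
  assumes "x \<in> \<phi> ` filt 1 1"
  obtains k c1 c2 c3 c4 where "x = \<phi> (k, c1, c2, c3, c4)" "int p dvd k"
proof -
  obtain j c1 c2 c3 c4 where "x = \<phi> (int p ^ 1 * j, c1, c2, c3, c4)" using assms by (rule filtE1)
  then show ?thesis by (rule that) simp
qed

lemma sub_pow: "subgroup S G \<Longrightarrow> x \<in> S \<Longrightarrow> x [^] (n::int) \<in> S"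
  using subgroup_int_pow_closed by blast

lemma sub_commutator: "subgroup S G \<Longrightarrow> x \<in> S \<Longrightarrow> y \<in> S \<Longrightarrow> commutator G x y \<in> S"
  unfolding commutator_def by (intro subgroup.m_closed subgroup.m_inv_closed)

lemma sub_shift:
  assumes "subgroup S G" "\<phi> (1, w1, w2, w3, w4) \<in> S" "\<phi> (l, c1, c2, c3, c4) \<in> S" "int p dvd l"
  shows "\<phi> (0, 0, c1, c2, c3) \<in> S"
  using sub_commutator[OF assms(1,3,2)] unfolding commutator_A[OF assms(4)] by simp

lemma unit_mult:
  assumes "\<not> int p dvd i"
  obtains n t where "n * i = c + int p * t"
  using unit_mult_prime[OF prime assms] .

text \<open>The commutator with the element of b-exponent 1 gives a_4; the p-th power of that
  element then gives b^p; removing both from v leaves a_3.\<close>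

lemma contains_W:
  assumes S: "subgroup S G" "\<phi> (1, w1, w2, w3, w4) \<in> S" and l: "int p dvd l"
    and v: "\<phi> (l, 0, 0, i, e) \<in> S" and i: "\<not> int p dvd i"
  shows "\<phi> ` filt 3 1 \<subseteq> S"
proof -
  note mult = subgroup.m_closed[OF S(1)]
  have a4: "\<phi> (0, 0, 0, 0, f) \<in> S" for f
  proof -
    obtain n t where n: "n * i = f + int p * t" using i by (rule unit_mult)
    have "\<phi> (0, 0, 0, 0, i) [^] n \<in> S" using sub_shift[OF S v l] S(1) by (rule sub_pow[rotated])
    moreover have "\<phi> (0, 0, 0, 0, i) [^] n = \<phi> (0, 0, 0, 0, f)"
      unfolding phi_vec_pow phi_eq_same n using Lat_last[OF p_pos(1)] by simp
    ultimately show ?thesis by simp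
  qed
  have "\<phi> (1, w1, w2, w3, w4) [^] int p \<in> S" using S by (rule sub_pow)
  then have "\<phi> (int p, 0, 0, 0, s * w1) \<in> S" by (simp only: int_pow_int pow_p_1)
  from mult[OF this a4[of "- s * w1"]] have "\<phi> (int p, 0, 0, 0, 0) \<in> S" by simp
  then have "\<phi> (int p, 0, 0, 0, 0) [^] j \<in> S" for j :: int using S(1) by (rule sub_pow[rotated])
  moreover have "\<phi> (int p, 0, 0, 0, 0) [^] j = \<phi> (int p * j, 0, 0, 0, 0)" for j :: int
    using int_pow_pow[of "\<phi> (1, 0, 0, 0, 0)" "int p" j] by (simp add: phi_b_pow)
  ultimately have bp: "\<phi> (int p * j, 0, 0, 0, 0) \<in> S" for j by simp
  have Z: "\<phi> (int p * j, 0, 0, 0, f) \<in> S" for j f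
    using mult[OF bp[of j] a4[of f]] by simp
  obtain j where l': "l = int p * j" using l by auto
  from mult[OF v Z[of "- j" "l * i - e"]] have a3i: "\<phi> (0, 0, 0, i, 0) \<in> S"
    by (simp add: l')
  have a3: "\<phi> (0, 0, 0, c, 0) \<in> S" for c
  proof -
    obtain n t where n: "n * i = c + int p * t" using i by (rule unit_mult)
    have "\<phi> (0, 0, 0, i, 0) [^] n \<in> S" using a3i S(1) by (rule sub_pow[rotated])
    moreover have "\<phi> (0, 0, 0, i, 0) [^] n = \<phi> (0, 0, 0, c, - B2 p * t)"
      unfolding phi_vec_pow phi_eq_same n using LatI[of p 0 0 t 0 s] by simp
    ultimately have "\<phi> (0, 0, 0, c, - B2 p * t) \<in> S" by simp
    from mult[OF this a4[of "B2 p * t"]] show ?thesis by simp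
  qed
  show ?thesis
  proof
    fix x assume "x \<in> \<phi> ` filt 3 1"
    then obtain j c3 c4 where x: "x = \<phi> (int p ^ 1 * j, 0, 0, c3, c4)" by (rule filtE3)
    show "x \<in> S" using mult[OF Z[of j c4] a3[of c3]] by (simp add: x)
  qed
qed

text \<open>Two commutators move the unit i from a_1 to a_3, so \<open>contains_W\<close> applies;
  modulo what it yields, the first commutator is a power of a_2 with exponent i.\<close>

lemma contains_Frat:
  assumes S: "subgroup S G" "\<phi> (1, w1, w2, w3, w4) \<in> S" and l: "int p dvd l"
    and v: "\<phi> (l, i, c2, c3, c4) \<in> S" and i: "\<not> int p dvd i"
  shows "\<phi> ` filt 2 1 \<subseteq> S"
proof -
  note mult = subgroup.m_closed[OF S(1)]
  note v2 = sub_shift[OF S v l]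
  note v3 = sub_shift[OF S v2 dvd_0_right]
  note W = contains_W[OF S dvd_0_right v3 i]
  have W0: "\<phi> (int p * j, 0, 0, e, f) \<in> S" for j e f
    using W filtI(3)[of 1 "int p * j" e f] by auto
  from mult[OF v2 W0[of 0 "- c2" "- c3"]] have a2i: "\<phi> (0, 0, i, 0, 0) \<in> S" by simp
  have a2: "\<phi> (0, 0, c, 0, 0) \<in> S" for c
  proof -
    obtain n t where n: "n * i = c + int p * t" using i by (rule unit_mult)
    have "\<phi> (0, 0, i, 0, 0) [^] n \<in> S" using a2i S(1) by (rule sub_pow[rotated])
    moreover have "\<phi> (0, 0, i, 0, 0) [^] n = \<phi> (0, 0, c, - B2 p * t, - B3 p * t)"
      unfolding phi_vec_pow phi_eq_same n using LatI[of p 0 t 0 0 s] by simp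
    ultimately have "\<phi> (0, 0, c, - B2 p * t, - B3 p * t) \<in> S" by simp
    from mult[OF this W0[of 0 "B2 p * t" "B3 p * t"]] show ?thesis by simp
  qed
  show ?thesis
  proof
    fix x assume "x \<in> \<phi> ` filt 2 1"
    then obtain j c2 c3 c4 where x: "x = \<phi> (int p ^ 1 * j, 0, c2, c3, c4)" by (rule filtE2)
    show "x \<in> S" using mult[OF W0[of j c3 c4] a2[of c2]] by (simp add: x)
  qed
qed

text \<open>Coordinates divisible by p are reduced to 0 until a unit appears. It appears at a_1, a_2
  or a_3 since v is not central, and commutators shift it to a_3.\<close>

lemma noncentral_contains_W:
  assumes S: "subgroup S G" "\<phi> (1, w1, w2, w3, w4) \<in> S"
    and v: "v \<in> S" "v \<in> \<phi> ` filt 1 1" "v \<notin> \<phi> ` filt 4 1"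
  shows "\<phi> ` filt 3 1 \<subseteq> S"
proof -
  obtain j c1 c2 c3 c4 where v': "v = \<phi> (int p ^ 1 * j, c1, c2, c3, c4)" using v(2) by (rule filtE1)
  let ?l = "int p ^ 1 * j"
  have l: "int p dvd ?l" by simp
  show ?thesis
  proof (cases "int p dvd c1")
    case False
    then have "\<phi> ` filt 2 1 \<subseteq> S" using contains_Frat[OF S l] v(1) v' by simp
    then show ?thesis using filt_mono[of 2 3 1] by simp
  next
    case True
    obtain d2 d3 d4 where "\<phi> (?l, c1, c2, c3, c4) = \<phi> (?l, c1 mod p, d2, d3, d4)" by (rule reduce1)
    then have v1: "v = \<phi> (?l, 0, d2, d3, d4)" using v' True by simp
    show ?thesis
    proof (cases "int p dvd d2")
      case False
      have "\<phi> (?l, 0, d2, d3, d4) \<in> S" using v(1) v1 by simp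
      from contains_W[OF S dvd_0_right sub_shift[OF S this l] False] show ?thesis .
    next
      case True
      obtain e3 e4 where "\<phi> (?l, 0, d2, d3, d4) = \<phi> (?l, 0, d2 mod p, e3, e4)" by (rule reduce2)
      then have v2: "v = \<phi> (?l, 0, 0, e3, e4)" using v1 True by simp
      show ?thesis
      proof (cases "int p dvd e3")
        case False
        then show ?thesis using contains_W[OF S l] v(1) v2 by simp
      next
        case True
        obtain f4 where "\<phi> (?l, 0, 0, e3, e4) = \<phi> (?l, 0, 0, e3 mod p, f4)" by (rule reduce3)
        then have "v = \<phi> (?l, 0, 0, 0, f4)" using v2 True by simp
        then show ?thesis using v(3) filtI(4)[of 1 ?l f4] by simp
      qed
    qed
  qed
qed

lemma split_pow:
  assumes S: "subgroup S G" "\<phi> (1, w1, w2, w3, w4) \<in> S" and y: "y = \<phi> (l, c1, c2, c3, c4)" "y \<in> S"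
  obtains z where "z \<in> S" "z \<in> \<phi> ` filt 1 1" "y = \<phi> (1, w1, w2, w3, w4) [^] l \<otimes> z"
proof -
  let ?x = "\<phi> (1, w1, w2, w3, w4)"
  have cx: "?x [^] l \<in> S" using S by (rule sub_pow)
  then obtain z where z: "z = inv (?x [^] l) \<otimes> y" "z \<in> S"
    using S(1) y(2) by (simp add: subgroup.m_closed subgroup.m_inv_closed)
  have "\<exists>d1 d2 d3 d4. (1, w1, w2, w3, w4) [^]\<^bsub>HG\<^esub> l = (l, d1, d2, d3, d4)"
  proof -
    have nat: "\<exists>d1 d2 d3 d4. (1, w1, w2, w3, w4) [^]\<^bsub>HG\<^esub> (n::nat) = (int n, d1, d2, d3, d4)" for n
      unfolding HG_pow_1 by blast
    show ?thesis
      using nat by (cases l rule: int_cases2) (auto simp: phi.G.int_pow_neg int_pow_int, metis hinv.simps)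
  qed
  then obtain d1 d2 d3 d4 where dd: "(1, w1, w2, w3, w4) [^]\<^bsub>HG\<^esub> l = (l, d1, d2, d3, d4)" by blast
  have d: "?x [^] l = \<phi> (l, d1, d2, d3, d4)"
    unfolding dd[symmetric] using phi.hom_int_pow[of "(1, w1, w2, w3, w4)" l] by simp
  have "z \<in> \<phi> ` filt 1 1"
    unfolding z(1) d y(1) phi_inv hinv.simps phi_mult hmul.simps in_A_iff by simp
  moreover have "y = ?x [^] l \<otimes> z" unfolding z(1) using y by (simp add: m_assoc[symmetric])
  ultimately show ?thesis using that z(2) by blast
qed

lemma W_not_abelian:
  assumes S: "subgroup S G" "\<phi> (1, w1, w2, w3, w4) \<in> S" "\<phi> ` filt 3 1 \<subseteq> S"
  shows "\<not> abelian_sub G S"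
proof
  assume "abelian_sub G S"
  moreover have "\<phi> (0, 0, 0, 1, 0) \<in> S" using S(3) filtI(3)[of 1 0 1 0] by auto
  ultimately have "\<phi> (0, 0, 0, 1, 0) \<otimes> \<phi> (1, w1, w2, w3, w4) = \<phi> (1, w1, w2, w3, w4) \<otimes> \<phi> (0, 0, 0, 1, 0)"
    using S abelian_sub_iff by blast
  then have "int p dvd 1" unfolding phi_mult hmul.simps
    using Lat_last[OF p_pos(1)] by (simp add: phi_eq_same)
  then show False using p_pos by simp
qed

text \<open>If a subgroup S outside of A does not contain the image of \<open>filt 3 1\<close>, all
  of its elements in A are central, so S is generated by one element and central ones and is
  abelian. Conversely a_3 does not commute with an element of b-exponent 1.\<close>

lemma nonabelian_iff:
  assumes S: "subgroup S G"
  shows "\<not> abelian_sub G S \<longleftrightarrow> \<not> S \<subseteq> \<phi> ` filt 1 1 \<and> \<phi> ` filt 3 1 \<subseteq> S"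
proof
  assume na: "\<not> abelian_sub G S"
  have nA: "\<not> S \<subseteq> \<phi> ` filt 1 1"
    using na A_comm abelian_sub_iff[OF S] by blast
  obtain w1 w2 w3 w4 where x: "\<phi> (1, w1, w2, w3, w4) \<in> S" using S nA by (rule unit_b)
  have "\<phi> ` filt 3 1 \<subseteq> S"
  proof (rule ccontr)
    assume nW: "\<not> \<phi> ` filt 3 1 \<subseteq> S"
    have central: "z \<in> centre G" if "z \<in> S" "z \<in> \<phi> ` filt 1 1" for z
      using noncentral_contains_W[OF S x that] nW centre_eq by blast
    let ?x = "\<phi> (1, w1, w2, w3, w4)"
    have "y \<otimes> y' = y' \<otimes> y" if yy: "y \<in> S" "y' \<in> S" for y y'
    proof -
      obtain l c1 c2 c3 c4 where y: "y = \<phi> (l, c1, c2, c3, c4)"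
        using yy(1) S subgroup.mem_carrier carrier_cases by metis
      obtain l' c1' c2' c3' c4' where y': "y' = \<phi> (l', c1', c2', c3', c4')"
        using yy(2) S subgroup.mem_carrier carrier_cases by metis
      obtain z where z: "z \<in> S" "z \<in> \<phi> ` filt 1 1" "y = ?x [^] l \<otimes> z"
        using split_pow[OF S x y yy(1)] by blast
      obtain z' where z': "z' \<in> S" "z' \<in> \<phi> ` filt 1 1" "y' = ?x [^] l' \<otimes> z'"
        using split_pow[OF S x y' yy(2)] by blast
      have c: "z \<in> carrier G" "\<And>w. w \<in> carrier G \<Longrightarrow> z \<otimes> w = w \<otimes> z"
        "z' \<in> carrier G" "\<And>w. w \<in> carrier G \<Longrightarrow> z' \<otimes> w = w \<otimes> z'"
        using central[OF z(1,2)] central[OF z'(1,2)] by (auto simp: centre_def)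
      have px: "?x [^] l \<in> carrier G" "?x [^] l' \<in> carrier G" by simp_all
      have "y \<otimes> y' = ?x [^] l \<otimes> (z \<otimes> ?x [^] l') \<otimes> z'"
        unfolding z(3) z'(3) using c(1,3) px by (simp only: m_assoc m_closed)
      also have "\<dots> = (?x [^] l \<otimes> ?x [^] l') \<otimes> (z \<otimes> z')"
        unfolding c(2)[OF px(2)] using c(1,3) px by (simp only: m_assoc m_closed)
      also have "?x [^] l \<otimes> ?x [^] l' = ?x [^] l' \<otimes> ?x [^] l"
        by (simp add: int_pow_mult[symmetric] add.commute del: phi_mult)
      also have "z \<otimes> z' = z' \<otimes> z" using c(2)[OF c(3)] .
      also have "?x [^] l' \<otimes> ?x [^] l \<otimes> (z' \<otimes> z) = ?x [^] l' \<otimes> (?x [^] l \<otimes> z') \<otimes> z"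
        using c(1,3) px by (simp only: m_assoc m_closed)
      also have "\<dots> = y' \<otimes> y"
        unfolding c(4)[OF px(1), symmetric] z(3) z'(3) using c(1,3) px by (simp only: m_assoc m_closed)
      finally show ?thesis .
    qed
    then show False using na abelian_sub_iff[OF S] by blast
  qed
  then show "\<not> S \<subseteq> \<phi> ` filt 1 1 \<and> \<phi> ` filt 3 1 \<subseteq> S" using nA by blast
next
  assume a: "\<not> S \<subseteq> \<phi> ` filt 1 1 \<and> \<phi> ` filt 3 1 \<subseteq> S"
  obtain w1 w2 w3 w4 where x: "\<phi> (1, w1, w2, w3, w4) \<in> S" using S conjunct1[OF a] by (rule unit_b)
  show "\<not> abelian_sub G S" using S x conjunct2[OF a] by (rule W_not_abelian)
qed

lemma abelian_cap_central:
  assumes S: "subgroup S G" "\<not> S \<subseteq> \<phi> ` filt 1 1" "abelian_sub G S"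
  shows "S \<inter> \<phi> ` filt 1 1 \<subseteq> \<phi> ` filt 4 1"
proof -
  obtain w1 w2 w3 w4 where x: "\<phi> (1, w1, w2, w3, w4) \<in> S" using S(1,2) by (rule unit_b)
  show ?thesis using noncentral_contains_W[OF S(1) x] W_not_abelian[OF S(1) x] S(3) by blast
qed

lemma finite_sub: "subgroup S G \<Longrightarrow> finite S"
  using finite_G subgroup.subset finite_subset by blast

text \<open>The powers n < p of an element of b-exponent 1 represent the cosets of the intersection
  with A.\<close>

lemma card_not_in_A:
  assumes S: "subgroup S G" "\<not> S \<subseteq> \<phi> ` filt 1 1"
  shows "card S = p * card (S \<inter> \<phi> ` filt 1 1)"
proof -
  obtain w1 w2 w3 w4 where x: "\<phi> (1, w1, w2, w3, w4) \<in> S" using S by (rule unit_b)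
  let ?x = "\<phi> (1, w1, w2, w3, w4)" and ?A = "\<phi> ` filt 1 1"
  have xl: "\<exists>d1 d2 d3 d4. ?x [^] n = \<phi> (int n, d1, d2, d3, d4)" for n :: nat
    unfolding phi_pow HG_pow_1 by blast
  have inv_in: "inv (?x [^] n) \<otimes> \<phi> (l, c1, c2, c3, c4) \<in> ?A \<longleftrightarrow> int p dvd l - int n" for n :: nat and l c1 c2 c3 c4
  proof -
    obtain d1 d2 d3 d4 where d: "?x [^] n = \<phi> (int n, d1, d2, d3, d4)" using xl by blast
    show ?thesis unfolding d phi_inv hinv.simps phi_mult hmul.simps in_A_iff by simp
  qed
  have "bij_betw (\<lambda>(n, v). ?x [^] n \<otimes> v) ({..<p} \<times> (S \<inter> ?A)) S"
    unfolding bij_betw_def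
  proof
    show "inj_on (\<lambda>(n, v). ?x [^] n \<otimes> v) ({..<p} \<times> (S \<inter> ?A))"
    proof (rule inj_onI)
      fix q q' assume q: "q \<in> {..<p} \<times> (S \<inter> ?A)" "q' \<in> {..<p} \<times> (S \<inter> ?A)"
        "(case q of (n, v) \<Rightarrow> ?x [^] n \<otimes> v) = (case q' of (n, v) \<Rightarrow> ?x [^] n \<otimes> v)"
      obtain n v n' v' where nv: "q = (n, v)" "q' = (n', v')" by (metis surj_pair)
      have a: "n < p" "n' < p" "v \<in> S" "v' \<in> S" "?x [^] n \<otimes> v = ?x [^] n' \<otimes> v'"
        "v \<in> ?A" "v' \<in> ?A" using q unfolding nv by simp_all
      obtain k c1 c2 c3 c4 where v: "v = \<phi> (k, c1, c2, c3, c4)" "int p dvd k"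
        using a(6) by (rule A_E)
      obtain k' d1 d2 d3 d4 where v': "v' = \<phi> (k', d1, d2, d3, d4)" "int p dvd k'"
        using a(7) by (rule A_E)
      obtain e1 e2 e3 e4 where e: "?x [^] n = \<phi> (int n, e1, e2, e3, e4)" using xl by blast
      obtain f1 f2 f3 f4 where f: "?x [^] n' = \<phi> (int n', f1, f2, f3, f4)" using xl by blast
      have "int p ^ m dvd (int n + k) - (int n' + k')"
        using a(5) unfolding v v' e f phi_mult hmul.simps by (rule phi_eq_dvd(1))
      then have "int p dvd (int n + k) - (int n' + k')" by (rule pm_dvd)
      from dvd_diff[OF this dvd_diff[OF v(2) v'(2)]] have "int p dvd int n - int n'"
        by (simp add: algebra_simps)
      then have "int n - int n' = 0" using a(1,2) by (intro small_dvd) auto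
      then have nn: "n = n'" by simp
      have vc: "v \<in> carrier G" "v' \<in> carrier G" "?x [^] n' \<in> Units G" using v v' by simp_all
      have "v = v'" using a(5) Units_l_cancel[OF vc(3,1,2)] unfolding nn by simp
      then show "q = q'" using nn nv by simp
    qed
    show "(\<lambda>(n, v). ?x [^] n \<otimes> v) ` ({..<p} \<times> (S \<inter> ?A)) = S"
    proof (intro equalityI subsetI)
      fix y assume "y \<in> (\<lambda>(n, v). ?x [^] n \<otimes> v) ` ({..<p} \<times> (S \<inter> ?A))"
      then show "y \<in> S"
        using S(1) sub_pow[OF S(1) x] by (auto simp: subgroup.m_closed int_pow_int[symmetric])
    next
      fix y assume y: "y \<in> S"
      obtain l c1 c2 c3 c4 where y': "y = \<phi> (l, c1, c2, c3, c4)"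
        using y S subgroup.mem_carrier carrier_cases by metis
      let ?n = "nat (l mod int p)" and ?v = "inv (?x [^] nat (l mod int p)) \<otimes> y"
      have n: "?n < p" "int ?n = l mod int p" using p_pos by (simp_all add: nat_less_iff)
      have "?v \<in> ?A" unfolding y' inv_in n(2) by (simp add: minus_mod_eq_mult_div)
      moreover have "?x [^] ?n \<in> S" using sub_pow[OF S(1) x, of "int ?n"] by (simp only: int_pow_int)
      then have "?v \<in> S" using S(1) y by (simp add: subgroup.m_closed subgroup.m_inv_closed)
      moreover have "y = ?x [^] ?n \<otimes> ?v" using y' by (simp add: m_assoc[symmetric] del: phi_mult phi_inv)
      ultimately show "y \<in> (\<lambda>(n, v). ?x [^] n \<otimes> v) ` ({..<p} \<times> (S \<inter> ?A))"
        using n(1) by (intro image_eqI[of _ _ "(?n, ?v)"]) auto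
    qed
  qed
  then have "card S = card ({..<p} \<times> (S \<inter> ?A))" by (metis bij_betw_same_card)
  then show ?thesis by (simp add: card_cartesian_product)
qed

end

section \<open>Counting subgroups by their intersection with A\<close>

context marked
begin

lemma image_phiE:
  assumes "x \<in> \<phi> ` S"
  obtains k c1 c2 c3 c4 where "x = \<phi> (k, c1, c2, c3, c4)" "(k, c1, c2, c3, c4) \<in> S"
proof -
  obtain h where h: "x = \<phi> h" "h \<in> S" using assms by blast
  obtain k c1 c2 c3 c4 where "h = (k, c1, c2, c3, c4)" by (cases h)
  then show ?thesis using that h by blast
qed

lemma conj_filt:
  assumes "v \<in> \<phi> ` filt j 1" "g \<in> carrier G"
  shows "inv g \<otimes> v \<otimes> g \<in> \<phi> ` filt j 1"
proof -
  obtain k c1 c2 c3 c4 where v: "v = \<phi> (k, c1, c2, c3, c4)" "(k, c1, c2, c3, c4) \<in> filt j 1"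
    using assms(1) by (rule image_phiE)
  obtain l d1 d2 d3 d4 where g: "g = \<phi> (l, d1, d2, d3, d4)" using assms(2) by (rule carrier_cases)
  have k: "int p dvd k" using v(2) by (simp add: filt_def)
  have "commutator G v g \<in> \<phi> ` filt j 1"
    unfolding v(1) g commutator_A[OF k] using v(2) by (intro imageI) (simp add: filt_def)
  then have "v \<otimes> commutator G v g \<in> \<phi> ` filt j 1"
    using assms(1) subgroup.m_closed[OF subgroup_filt] by blast
  moreover have "v \<otimes> commutator G v g = inv g \<otimes> v \<otimes> g"
  proof -
    have c: "v \<in> carrier G" using v by simp
    have "v \<otimes> commutator G v g = (v \<otimes> inv v) \<otimes> (inv g \<otimes> v \<otimes> g)"
      unfolding commutator_def using c assms(2) by (simp only: m_assoc m_closed inv_closed)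
    then show ?thesis using c assms(2) by simp
  qed
  ultimately show ?thesis by simp
qed

definition ext :: "'a \<Rightarrow> nat \<Rightarrow> 'a set" where
  "ext x j = {x [^] (n::int) \<otimes> v | n v. v \<in> \<phi> ` filt j 1}"

text \<open>It turns out that \<open>offA 2\<close> consists of the non-abelian subgroups of index p
  and \<open>offA 3\<close> of the minimal non-abelian subgroups.\<close>

definition offA :: "nat \<Rightarrow> 'a set set" where
  "offA j = {S. subgroup S G \<and> \<not> S \<subseteq> \<phi> ` filt 1 1 \<and> S \<inter> \<phi> ` filt 1 1 = \<phi> ` filt j 1}"

lemma x_int_pow: "\<exists>d1 d2 d3 d4. \<phi> (1, w1, w2, w3, w4) [^] (l::int) = \<phi> (l, d1, d2, d3, d4)"
proof -
  have nat: "\<exists>d1 d2 d3 d4. (1, w1, w2, w3, w4) [^]\<^bsub>HG\<^esub> (n::nat) = (int n, d1, d2, d3, d4)" for n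
    unfolding HG_pow_1 by blast
  have "\<exists>d1 d2 d3 d4. (1, w1, w2, w3, w4) [^]\<^bsub>HG\<^esub> l = (l, d1, d2, d3, d4)"
    using nat by (cases l rule: int_cases2) (auto simp: phi.G.int_pow_neg int_pow_int, metis hinv.simps)
  then obtain d1 d2 d3 d4 where dd: "(1, w1, w2, w3, w4) [^]\<^bsub>HG\<^esub> l = (l, d1, d2, d3, d4)" by blast
  have "\<phi> (1, w1, w2, w3, w4) [^] l = \<phi> (l, d1, d2, d3, d4)"
    unfolding dd[symmetric] using phi.hom_int_pow[of "(1, w1, w2, w3, w4)" l] by simp
  then show ?thesis by blast
qed

lemma ext_subgroup: "subgroup (ext (\<phi> (1, w1, w2, w3, w4)) j) G"
proof (rule subgroupI)
  let ?x = "\<phi> (1, w1, w2, w3, w4)" and ?V = "\<phi> ` filt j 1"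
  interpret V: subgroup ?V G by (rule subgroup_filt)
  show "ext ?x j \<subseteq> carrier G" unfolding ext_def by auto
  have "?x [^] (0::int) \<otimes> \<one> \<in> ext ?x j" unfolding ext_def using V.one_closed by blast
  then show "ext ?x j \<noteq> {}" by blast
  fix y assume "y \<in> ext ?x j"
  then obtain n v where y: "y = ?x [^] (n::int) \<otimes> v" "v \<in> ?V" unfolding ext_def by blast
  have c: "v \<in> carrier G" "?x [^] n \<in> carrier G" "?x [^] (- n) \<in> carrier G" using y(2) V.mem_carrier by simp_all
  have "inv (?x [^] (- n)) \<otimes> inv v \<otimes> ?x [^] (- n) \<in> ?V"
    using conj_filt[OF V.m_inv_closed[OF y(2)] c(3)] .
  then have "?x [^] (- n) \<otimes> (inv (?x [^] (- n)) \<otimes> inv v \<otimes> ?x [^] (- n)) \<in> ext ?x j"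
    unfolding ext_def by blast
  moreover have "?x [^] (- n) \<otimes> (inv (?x [^] (- n)) \<otimes> inv v \<otimes> ?x [^] (- n)) =
      (?x [^] (- n) \<otimes> inv (?x [^] (- n))) \<otimes> (inv v \<otimes> ?x [^] (- n))"
    using c by (simp only: m_assoc m_closed inv_closed)
  moreover have "\<dots> = inv y" unfolding y(1) using c by (simp add: inv_mult_group int_pow_neg)
  ultimately show "inv y \<in> ext ?x j" by simp
  fix z assume "z \<in> ext ?x j"
  then obtain k u where z: "z = ?x [^] (k::int) \<otimes> u" "u \<in> ?V" unfolding ext_def by blast
  have d: "u \<in> carrier G" "?x [^] k \<in> carrier G" using z(2) V.mem_carrier by simp_all
  have "(inv (?x [^] k) \<otimes> v \<otimes> ?x [^] k) \<otimes> u \<in> ?V"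
    using conj_filt[OF y(2) d(2)] z(2) by blast
  then have "?x [^] (n + k) \<otimes> ((inv (?x [^] k) \<otimes> v \<otimes> ?x [^] k) \<otimes> u) \<in> ext ?x j"
    unfolding ext_def by blast
  moreover have "?x [^] (n + k) \<otimes> ((inv (?x [^] k) \<otimes> v \<otimes> ?x [^] k) \<otimes> u) =
      ?x [^] n \<otimes> (?x [^] k \<otimes> inv (?x [^] k)) \<otimes> (v \<otimes> ?x [^] k \<otimes> u)"
    using c d by (simp only: int_pow_mult[OF phi_closed] m_assoc m_closed inv_closed)
  moreover have "\<dots> = y \<otimes> z" unfolding y z using c d by (simp add: m_assoc)
  ultimately show "y \<otimes> z \<in> ext ?x j" by simp
qed

lemma ext_contains: "\<phi> (1, w1, w2, w3, w4) \<in> ext (\<phi> (1, w1, w2, w3, w4)) j"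
    "\<phi> ` filt j 1 \<subseteq> ext (\<phi> (1, w1, w2, w3, w4)) j"
proof -
  let ?x = "\<phi> (1, w1, w2, w3, w4)"
  have "?x [^] (1::int) \<otimes> \<one> \<in> ext ?x j"
    unfolding ext_def using subgroup.one_closed[OF subgroup_filt] by blast
  then show "?x \<in> ext ?x j" by (simp add: int_pow_1)
  show "\<phi> ` filt j 1 \<subseteq> ext ?x j"
  proof
    fix v assume v: "v \<in> \<phi> ` filt j 1"
    then have "?x [^] (0::int) \<otimes> v \<in> ext ?x j" unfolding ext_def by blast
    then show "v \<in> ext ?x j" using v subgroup.mem_carrier[OF subgroup_filt] by simp
  qed
qed

lemma x_not_A: "\<phi> (1, w1, w2, w3, w4) \<notin> \<phi> ` filt 1 1"
  unfolding in_A_iff using p_pos by simp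

text \<open>The intersection with A is not larger than required because the p-th power of x is
  central by \<open>pow_p_1\<close>, hence already in the image of \<open>filt j 1\<close>.\<close>

lemma ext_offA:
  assumes "1 \<le> j" "j \<le> 4"
  shows "ext (\<phi> (1, w1, w2, w3, w4)) j \<in> offA j"
proof -
  let ?x = "\<phi> (1, w1, w2, w3, w4)" and ?V = "\<phi> ` filt j 1" and ?A = "\<phi> ` filt 1 1"
  have VA: "?V \<subseteq> ?A" "\<phi> ` filt 4 1 \<subseteq> ?V" using filt_mono[of 1 j 1] filt_mono[of j 4 1] assms by auto
  have "ext ?x j \<inter> ?A \<subseteq> ?V"
  proof
    fix y assume y: "y \<in> ext ?x j \<inter> ?A"
    then obtain n v where nv: "y = ?x [^] (n::int) \<otimes> v" "v \<in> ?V" unfolding ext_def by blast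
    have v: "v \<in> ?A" using nv(2) VA by blast
    obtain k c1 c2 c3 c4 where v': "v = \<phi> (k, c1, c2, c3, c4)" "int p dvd k" using v by (rule A_E)
    obtain d1 d2 d3 d4 where d: "?x [^] n = \<phi> (n, d1, d2, d3, d4)" using x_int_pow by blast
    have "y \<in> ?A" using y by blast
    then have "int p dvd n + k" unfolding nv(1) d v'(1) phi_mult hmul.simps in_A_iff .
    then have "int p dvd n" using v'(2) dvd_add_left_iff by blast
    then obtain t where t: "n = int p * t" by (rule dvdE)
    have "?x [^] n = (?x [^] p) [^] t" unfolding t by (simp add: int_pow_pow flip: int_pow_int)
    also have "\<dots> \<in> \<phi> ` filt 4 1"
      unfolding pow_p_1 by (intro sub_pow subgroup_filt filtI) simp
    finally have "?x [^] n \<in> ?V" using VA by blast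
    then show "y \<in> ?V" unfolding nv(1) using nv(2) subgroup.m_closed[OF subgroup_filt] by blast
  qed
  moreover have "?V \<subseteq> ext ?x j \<inter> ?A" using ext_contains(2) VA(1) by (rule Int_greatest)
  ultimately have "ext ?x j \<inter> ?A = ?V" by (rule equalityI)
  moreover have "\<not> ext ?x j \<subseteq> ?A" 
  proof
    assume "ext ?x j \<subseteq> ?A"
    from subsetD[OF this ext_contains(1)] show False using x_not_A by simp
  qed
  ultimately show ?thesis unfolding offA_def using ext_subgroup by simp
qed

lemma offA_eq_ext:
  assumes "S \<in> offA j" and x: "\<phi> (1, w1, w2, w3, w4) \<in> S"
  shows "S = ext (\<phi> (1, w1, w2, w3, w4)) j"
proof
  let ?x = "\<phi> (1, w1, w2, w3, w4)"
  have S: "subgroup S G" "S \<inter> \<phi> ` filt 1 1 = \<phi> ` filt j 1" using assms(1) by (auto simp: offA_def)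
  show "ext ?x j \<subseteq> S"
    unfolding ext_def using S sub_pow[OF S(1) x] subgroup.m_closed[OF S(1)] by blast
  show "S \<subseteq> ext ?x j"
  proof
    fix y assume y: "y \<in> S"
    obtain l c1 c2 c3 c4 where y': "y = \<phi> (l, c1, c2, c3, c4)"
      using subgroup.mem_carrier[OF S(1) y] by (rule carrier_cases)
    obtain z where z: "z \<in> S" "z \<in> \<phi> ` filt 1 1" "y = ?x [^] l \<otimes> z"
      using S(1) x y' y by (rule split_pow)
    then have "z \<in> \<phi> ` filt j 1" using S(2) by blast
    then show "y \<in> ext ?x j" unfolding ext_def z(3) by blast
  qed
qed

text \<open>A coset of the image of \<open>filt 1 m\<close>, of size p^4, and not of the whole of A:
  with the b-exponent fixed at 1 the count below does not involve m.\<close>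

definition bcoset :: "'a set" where
  "bcoset = {\<phi> (1, w1, w2, w3, w4) | w1 w2 w3 w4. True}"

lemma bcoset_cap:
  assumes "S \<in> offA j" and x: "\<phi> (1, w1, w2, w3, w4) \<in> S"
  shows "S \<inter> bcoset = (\<lambda>v. \<phi> (1, w1, w2, w3, w4) \<otimes> v) ` (\<phi> ` filt j m)"
proof (intro equalityI subsetI)
  let ?x = "\<phi> (1, w1, w2, w3, w4)"
  have S: "subgroup S G" "S \<inter> \<phi> ` filt 1 1 = \<phi> ` filt j 1" using assms(1) by (auto simp: offA_def)
  { fix y assume y: "y \<in> S \<inter> bcoset"
    then obtain v1 v2 v3 v4 where y': "y = \<phi> (1, v1, v2, v3, v4)" unfolding bcoset_def by blast
    have "inv ?x \<otimes> y \<in> S" using S(1) x y by (simp add: subgroup.m_closed subgroup.m_inv_closed del: phi_inv phi_mult)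
    moreover obtain e1 e2 e3 e4 where e: "inv ?x \<otimes> y = \<phi> (0, e1, e2, e3, e4)"
      unfolding y' by simp
    moreover have "\<phi> (0, e1, e2, e3, e4) \<in> \<phi> ` filt 1 1" unfolding in_A_iff by simp
    ultimately have "\<phi> (0, e1, e2, e3, e4) \<in> \<phi> ` filt j 1" using S(2) by auto
    then obtain k c1 c2 c3 c4 where k: "\<phi> (0, e1, e2, e3, e4) = \<phi> (k, c1, c2, c3, c4)"
      "(k, c1, c2, c3, c4) \<in> filt j 1" by (rule image_phiE)
    have "int p ^ m dvd k" using phi_eq_dvd(1)[OF k(1)] by simp
    then have "(k, c1, c2, c3, c4) \<in> filt j m" using k(2) by (simp add: filt_def)
    then have "inv ?x \<otimes> y \<in> \<phi> ` filt j m" unfolding e k(1) by (rule imageI)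
    moreover have "y = ?x \<otimes> (inv ?x \<otimes> y)" using y' by (simp add: m_assoc[symmetric] del: phi_inv phi_mult)
    ultimately show "y \<in> (\<lambda>v. ?x \<otimes> v) ` (\<phi> ` filt j m)" by blast }
  { fix y assume "y \<in> (\<lambda>v. ?x \<otimes> v) ` (\<phi> ` filt j m)"
    then obtain v where v: "v \<in> \<phi> ` filt j m" "y = ?x \<otimes> v" by blast
    then obtain k c1 c2 c3 c4 where k: "v = \<phi> (k, c1, c2, c3, c4)"
      "(k, c1, c2, c3, c4) \<in> filt j m" using image_phiE[OF v(1)] by metis
    have pk: "int p ^ m dvd k" using k(2) by (simp add: filt_def)
    then obtain i where i: "k = 0 + int p ^ m * i" by auto
    have "(k, c1, c2, c3, c4) \<in> filt j 1" using k(2) pm_dvd[OF pk] by (simp add: filt_def)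
    then have "v \<in> S" unfolding k(1) using S(2) by blast
    then have "y \<in> S" unfolding v(2) using S(1) x by (simp add: subgroup.m_closed del: phi_mult)
    moreover have "v = \<phi> (0, c1, c2, c3, c4 + u * i)" unfolding k(1) i phi_carry ..
    then have "y \<in> bcoset" unfolding v(2) bcoset_def by auto
    ultimately show "y \<in> S \<inter> bcoset" by blast }
qed

lemma card_coset:
  assumes "j \<in> {1..4}" and "x \<in> carrier G"
  shows "card ((\<lambda>v. x \<otimes> v) ` (\<phi> ` filt j m)) = p ^ (5 - j)"
proof -
  have "inj_on (\<lambda>v. x \<otimes> v) (\<phi> ` filt j m)" using assms(2) by (auto simp: inj_on_def simp del: phi_mult)
  then show ?thesis using card_phi_filt(1)[of m j] assms(1) by (simp add: card_image)
qed

text \<open>Each element of \<open>bcoset\<close> lies in exactly one member of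
  \<open>offA j\<close>, namely the one it generates with \<open>filt j 1\<close>, and each member
  contains p^(5 - j) of the p^4 elements.\<close>

lemma card_offA:
  assumes j: "j \<in> {1..4}"
  shows "card (offA j) = p ^ (j - 1)"
proof -
  have j': "1 \<le> j" "j \<le> 4" using j by auto
  have "\<not> carrier G \<subseteq> \<phi> ` filt 1 1" using x_not_A[of 0 0 0 0] phi_closed by blast
  then have whole: "carrier G \<in> offA 1"
    unfolding offA_def using subgroup_self subgroup.subset[OF subgroup_filt, of 1 1] by blast
  have c: "card bcoset = p ^ 4"
  proof -
    have "carrier G \<inter> bcoset = (\<lambda>v. \<phi> (1, 0, 0, 0, 0) \<otimes> v) ` (\<phi> ` filt 1 m)"
      by (rule bcoset_cap[OF whole]) simp
    moreover have "carrier G \<inter> bcoset = bcoset" by (auto simp: bcoset_def)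
    ultimately show ?thesis using card_coset[of 1 "\<phi> (1, 0, 0, 0, 0)"] by simp
  qed
  have fin: "finite (offA j)"
    by (rule finite_subset[of _ "Pow (carrier G)"]) (auto simp: offA_def finite_G dest: subgroup.subset)
  have un: "bcoset = (\<Union>S\<in>offA j. S \<inter> bcoset)"
  proof (intro equalityI subsetI)
    fix x assume x: "x \<in> bcoset"
    then obtain w1 w2 w3 w4 where x': "x = \<phi> (1, w1, w2, w3, w4)" unfolding bcoset_def by blast
    have "x \<in> ext x j \<inter> bcoset" unfolding x' using ext_contains(1) x[unfolded x'] by (rule IntI)
    moreover have "ext x j \<in> offA j" unfolding x' by (rule ext_offA[OF j'])
    ultimately show "x \<in> (\<Union>S\<in>offA j. S \<inter> bcoset)" by (rule UN_I[rotated])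
  qed auto
  have each: "card (S \<inter> bcoset) = p ^ (5 - j)" if S: "S \<in> offA j" for S
  proof -
    have "subgroup S G" "\<not> S \<subseteq> \<phi> ` filt 1 1" using S by (auto simp: offA_def)
    then obtain w1 w2 w3 w4 where "\<phi> (1, w1, w2, w3, w4) \<in> S" by (rule unit_b)
    then show ?thesis using bcoset_cap[OF S] card_coset[OF j] by simp
  qed
  have "card bcoset = (\<Sum>S\<in>offA j. card (S \<inter> bcoset))"
  proof (subst un, rule card_UN_disjoint[OF fin])
    show "\<forall>S\<in>offA j. finite (S \<inter> bcoset)" using finite_sub by (auto simp: offA_def)
    show "\<forall>S\<in>offA j. \<forall>S'\<in>offA j. S \<noteq> S' \<longrightarrow> (S \<inter> bcoset) \<inter> (S' \<inter> bcoset) = {}"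
    proof (intro ballI impI, rule ccontr)
      fix S S' assume S: "S \<in> offA j" "S' \<in> offA j" "S \<noteq> S'" "(S \<inter> bcoset) \<inter> (S' \<inter> bcoset) \<noteq> {}"
      then obtain w1 w2 w3 w4 where "\<phi> (1, w1, w2, w3, w4) \<in> S" "\<phi> (1, w1, w2, w3, w4) \<in> S'"
        unfolding bcoset_def by blast
      then show False using offA_eq_ext S by metis
    qed
  qed
  then have "p ^ 4 = card (offA j) * p ^ (5 - j)" using c each by simp
  also have "p ^ 4 = p ^ (j - 1) * p ^ (5 - j)"
  proof -
    have "j - 1 + (5 - j) = 4" using j' by simp
    then show ?thesis by (simp flip: power_add)
  qed
  finally show ?thesis using p_pos by simp
qed

lemma card_filt1: "j \<in> {1..4} \<Longrightarrow> card (\<phi> ` filt j 1) = p ^ (m + 4 - j)"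
proof -
  assume j: "j \<in> {1..4}"
  then have "m - 1 + (5 - j) = m + 4 - j" using m by auto
  then show ?thesis using card_phi_filt(1)[OF m j] by (simp flip: power_add)
qed

lemma card_offA_mem:
  assumes "S \<in> offA j" "j \<in> {1..4}"
  shows "card S = p ^ (m + 5 - j)"
proof -
  have "card S = p * p ^ (m + 4 - j)"
    using assms card_not_in_A[of S] card_filt1[of j] by (simp add: offA_def)
  moreover have "Suc (m + 4 - j) = m + 5 - j" using assms(2) by auto
  ultimately show ?thesis by (metis power_Suc)
qed

lemma offA_nonabelian:
  assumes "S \<in> offA j" "j \<le> 3"
  shows "\<not> abelian_sub G S"
proof -
  have "subgroup S G" "\<not> S \<subseteq> \<phi> ` filt 1 1" "\<phi> ` filt j 1 \<subseteq> S" using assms by (auto simp: offA_def)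
  then show ?thesis using nonabelian_iff[of S] filt_mono[OF assms(2), of 1] by blast
qed

lemma pow_p_le: "p ^ i \<le> p ^ j \<longleftrightarrow> i \<le> j" and pow_p_eq: "p ^ i = p ^ j \<longleftrightarrow> i = j"
  using prime_gt_1_nat[OF prime] by simp_all

lemma card_sub_pow:
  assumes "subgroup S G"
  obtains e where "card S = p ^ e" "e \<le> m + 4"
proof -
  have "card S dvd p ^ (m + 4)" using lagrange[OF assms] order_G by (metis dvd_triv_right)
  then show ?thesis using that prime by (metis divides_primepow_nat)
qed

lemma card_nonabelian:
  assumes "subgroup S G" "\<not> abelian_sub G S"
  shows "card S = p * card (S \<inter> \<phi> ` filt 1 1)" "p ^ (m + 2) \<le> card S"
proof -
  have S: "\<not> S \<subseteq> \<phi> ` filt 1 1" "\<phi> ` filt 3 1 \<subseteq> S \<inter> \<phi> ` filt 1 1"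
    using nonabelian_iff[OF assms(1)] assms(2) filt_mono[of 1 3 1] by auto
  show *: "card S = p * card (S \<inter> \<phi> ` filt 1 1)" using assms(1) S(1) by (rule card_not_in_A)
  have "p ^ (m + 1) \<le> card (S \<inter> \<phi> ` filt 1 1)"
    using card_mono[OF _ S(2)] card_filt1[of 3] finite_sub[OF assms(1)] by simp
  then show "p ^ (m + 2) \<le> card S" unfolding * by simp
qed

text \<open>A non-abelian subgroup contains the image of \<open>filt 3 1\<close>, of order p^(m +
  1), with index at least p; these are the ones where the bound is attained.\<close>

lemma offA_3_iff: "S \<in> offA 3 \<longleftrightarrow> subgroup S G \<and> \<not> abelian_sub G S \<and> card S = p ^ (m + 2)"
proof
  assume S: "S \<in> offA 3"
  then show "subgroup S G \<and> \<not> abelian_sub G S \<and> card S = p ^ (m + 2)"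
    using offA_nonabelian[OF S] card_offA_mem[OF S] by (simp add: offA_def)
next
  assume S: "subgroup S G \<and> \<not> abelian_sub G S \<and> card S = p ^ (m + 2)"
  have W: "\<not> S \<subseteq> \<phi> ` filt 1 1" "\<phi> ` filt 3 1 \<subseteq> S \<inter> \<phi> ` filt 1 1"
    using nonabelian_iff[of S] S filt_mono[of 1 3 1] by auto
  have "card (S \<inter> \<phi> ` filt 1 1) = p ^ (m + 1)" using S card_nonabelian(1)[of S] p_pos by simp
  then have "\<phi> ` filt 3 1 = S \<inter> \<phi> ` filt 1 1"
    using card_filt1[of 3] finite_sub[of S] S by (intro card_subset_eq W) auto
  then show "S \<in> offA 3" using S W by (simp add: offA_def)
qed

text \<open>The intersection with A has the order of the image of \<open>filt 2 1\<close>. Either it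
  lies in that subgroup, or it has an element with a unit at a_1 and contains that subgroup by
  \<open>contains_Frat\<close>; equal orders give equality.\<close>

lemma offA_2_iff: "S \<in> offA 2 \<longleftrightarrow> subgroup S G \<and> \<not> abelian_sub G S \<and> card S = p ^ (m + 3)"
proof
  assume S: "S \<in> offA 2"
  then show "subgroup S G \<and> \<not> abelian_sub G S \<and> card S = p ^ (m + 3)"
    using offA_nonabelian[OF S] card_offA_mem[OF S] by (simp add: offA_def add.commute)
next
  assume S: "subgroup S G \<and> \<not> abelian_sub G S \<and> card S = p ^ (m + 3)"
  have W: "\<not> S \<subseteq> \<phi> ` filt 1 1" using nonabelian_iff[of S] S by auto
  have "p * card (S \<inter> \<phi> ` filt 1 1) = p * p ^ (m + 2)"
    using card_nonabelian(1)[of S] S by (auto simp: numeral_3_eq_3)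
  then have c: "card (S \<inter> \<phi> ` filt 1 1) = p ^ (m + 2)" using p_pos by simp
  have c2: "card (\<phi> ` filt 2 1) = p ^ (m + 2)" using card_filt1[of 2] by simp
  have fin: "finite (S \<inter> \<phi> ` filt 1 1)" "finite (\<phi> ` filt 2 1)"
    using finite_sub[of S] finite_sub[OF subgroup_filt] S by auto
  obtain w1 w2 w3 w4 where x: "\<phi> (1, w1, w2, w3, w4) \<in> S" using conjunct1[OF S] W by (rule unit_b)
  have "\<phi> ` filt 2 1 = S \<inter> \<phi> ` filt 1 1"
  proof (cases "S \<inter> \<phi> ` filt 1 1 \<subseteq> \<phi> ` filt 2 1")
    case True
    then show ?thesis using card_subset_eq[OF fin(2) True] c c2 by simp
  next
    case False
    then obtain v where v: "v \<in> S" "v \<in> \<phi> ` filt 1 1" "v \<notin> \<phi> ` filt 2 1" by blast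
    obtain k c1 c2 c3 c4 where v': "v = \<phi> (k, c1, c2, c3, c4)" "int p dvd k" using v(2) by (rule A_E)
    have "\<not> int p dvd c1"
    proof
      assume "int p dvd c1"
      moreover obtain d2 d3 d4 where "v = \<phi> (k, c1 mod p, d2, d3, d4)" unfolding v'(1) by (rule reduce1)
      ultimately show False using v(3) filtI(2)[of 1 k] v'(2) by simp
    qed
    then have "\<phi> ` filt 2 1 \<subseteq> S" using contains_Frat[OF conjunct1[OF S] x v'(2)] v(1) v'(1) by simp
    then have "\<phi> ` filt 2 1 \<subseteq> S \<inter> \<phi> ` filt 1 1" using filt_mono[of 1 2 1] by simp
    then show ?thesis using card_subset_eq[OF fin(1)] c c2 by simp
  qed
  then show "S \<in> offA 2" using S W by (simp add: offA_def)
qed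

end

lemma (in group) subgroup_index_iff:
  assumes "finite (carrier G)" "subgroup H G"
  shows "subgroup_index G H = n \<longleftrightarrow> n * card H = order G"
proof -
  have l: "subgroup_index G H * card H = order G"
    unfolding subgroup_index_def by (rule lagrange[OF assms(2)])
  have "finite H" using assms subgroup.subset finite_subset by blast
  then have "card H > 0" using subgroup.one_closed[OF assms(2)] card_gt_0_iff by blast
  then show ?thesis using l by (metis mult_right_cancel less_numeral_extra(3))
qed

text \<open>Stated for an arbitrary image of \<open>HG\<close>, because it is also needed before the
  kernel has been determined.\<close>

lemma lower_central_HG:
  assumes "group G" "\<phi> \<in> hom HG G" and surj: "range \<phi> = carrier G"
  shows
  "lower_central G 1 \<subseteq> {\<phi> (0, 0, c2, c3, c4) | c2 c3 c4. True}"
  "lower_central G 2 \<subseteq> {\<phi> (0, 0, 0, c3, c4) | c3 c4. True}"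
  "lower_central G 3 \<subseteq> {\<phi> (0, 0, 0, 0, c4) | c4. True}"
  "lower_central G 4 \<subseteq> {\<one>\<^bsub>G\<^esub>}"
proof -
  interpret phi: group_hom HG G \<phi> using assms(1,2) by (rule group_hom_HG)
  have phi_commutator: "commutator G (\<phi> g) (\<phi> h) = \<phi> (commutator HG g h)" for g h
    using phi.hom_commutator[of g h] by simp
  have carrier_cases: "\<And>P. (\<And>k c1 c2 c3 c4. x = \<phi> (k, c1, c2, c3, c4) \<Longrightarrow> P) \<Longrightarrow> P" if "x \<in> carrier G" for x
    using that surj by (metis imageE surj_pair)
  have step: "lower_central G (Suc n) \<subseteq> S"
    if "subgroup S G" "\<And>x y. x \<in> lower_central G n \<Longrightarrow> y \<in> carrier G \<Longrightarrow> commutator G x y \<in> S" for n S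
    unfolding lower_central.simps by (rule phi.H.generate_subgroup_incl[OF _ that(1)]) (use that(2) in blast)
  have sub: "subgroup (\<phi> ` T) G" if "subgroup T HG" for T
    using that by (rule phi.subgroup_img_is_subgroup)
  have T: "subgroup {(0, 0, c2, c3, c4) | c2 c3 c4. True} HG"
    "subgroup {(0, 0, 0, c3, c4) | c3 c4. True} HG" "subgroup {(0, 0, 0, 0, c4) | c4. True} HG"
    by (rule group.subgroupI[OF group_HG], auto)+
  have E: "{\<phi> (0, 0, c2, c3, c4) | c2 c3 c4. True} = \<phi> ` {(0, 0, c2, c3, c4) | c2 c3 c4. True}"
    "{\<phi> (0, 0, 0, c3, c4) | c3 c4. True} = \<phi> ` {(0, 0, 0, c3, c4) | c3 c4. True}"
    "{\<phi> (0, 0, 0, 0, c4) | c4. True} = \<phi> ` {(0, 0, 0, 0, c4) | c4. True}" by auto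
  show 1: "lower_central G 1 \<subseteq> {\<phi> (0, 0, c2, c3, c4) | c2 c3 c4. True}"
    unfolding One_nat_def E
  proof (rule step[OF sub[OF T(1)]])
    fix x y assume "x \<in> lower_central G 0" "y \<in> carrier G"
    then have "x \<in> carrier G" "y \<in> carrier G" by auto
    obtain k c1 c2 c3 c4 where x: "x = \<phi> (k, c1, c2, c3, c4)" using \<open>x \<in> carrier G\<close> by (rule carrier_cases)
    obtain l d1 d2 d3 d4 where y: "y = \<phi> (l, d1, d2, d3, d4)" using \<open>y \<in> carrier G\<close> by (rule carrier_cases)
    show "commutator G x y \<in> \<phi> ` {(0, 0, c2, c3, c4) | c2 c3 c4. True}"
      unfolding x y phi_commutator by (rule imageI) (simp add: commutator_def)
  qed
  show 2: "lower_central G 2 \<subseteq> {\<phi> (0, 0, 0, c3, c4) | c3 c4. True}"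
    unfolding numeral_2_eq_2 E
  proof (rule step[OF sub[OF T(2)]])
    fix x y assume xy: "x \<in> lower_central G (Suc 0)" "y \<in> carrier G"
    obtain c2 c3 c4 where x: "x = \<phi> (0, 0, c2, c3, c4)" using 1 xy(1) by auto
    obtain l d1 d2 d3 d4 where y: "y = \<phi> (l, d1, d2, d3, d4)" using xy(2) by (rule carrier_cases)
    show "commutator G x y \<in> \<phi> ` {(0, 0, 0, c3, c4) | c3 c4. True}"
      unfolding x y phi_commutator commutator_HG_vec by (rule imageI) simp
  qed
  show 3: "lower_central G 3 \<subseteq> {\<phi> (0, 0, 0, 0, c4) | c4. True}"
    unfolding numeral_3_eq_3 E
  proof (rule step[OF sub[OF T(3)]])
    fix x y assume xy: "x \<in> lower_central G (Suc (Suc 0))" "y \<in> carrier G"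
    obtain c3 c4 where x: "x = \<phi> (0, 0, 0, c3, c4)" using 2 xy(1) unfolding numeral_2_eq_2 by blast
    obtain l d1 d2 d3 d4 where y: "y = \<phi> (l, d1, d2, d3, d4)" using xy(2) by (rule carrier_cases)
    show "commutator G x y \<in> \<phi> ` {(0, 0, 0, 0, c4) | c4. True}"
      unfolding x y phi_commutator commutator_HG_vec by (rule imageI) simp
  qed
  have "lower_central G (Suc 3) \<subseteq> {\<one>\<^bsub>G\<^esub>}"
  proof (rule step[OF phi.H.triv_subgroup])
    fix x y assume xy: "x \<in> lower_central G 3" "y \<in> carrier G"
    obtain c4 where x: "x = \<phi> (0, 0, 0, 0, c4)" using 3 xy(1) by blast
    obtain l d1 d2 d3 d4 where y: "y = \<phi> (l, d1, d2, d3, d4)" using xy(2) by (rule carrier_cases)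
    show "commutator G x y \<in> {\<one>\<^bsub>G\<^esub>}"
      unfolding x y phi_commutator commutator_HG_vec using phi.hom_one by simp
  qed
  then show "lower_central G 4 \<subseteq> {\<one>\<^bsub>G\<^esub>}" by (simp add: numeral_eq_Suc)
qed

section \<open>A_t-subgroups, Frattini and derived subgroup, class and number of generators\<close>

context marked
begin

lemma fpg_sub:
  assumes "subgroup H G"
  shows "finite_p_group p (G\<lparr>carrier := H\<rparr>)"
proof -
  obtain e where "card H = p ^ e" using assms by (rule card_sub_pow)
  then show ?thesis
    using prime finite_sub[OF assms] subgroup_imp_group[OF assms] unfolding finite_p_group_def
    by (auto simp: order_def)
qed

lemma index_iff: "subgroup H G \<Longrightarrow> subgroup_index G H = n \<longleftrightarrow> n * card H = p ^ (m + 4)"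
  using subgroup_index_iff[OF finite_G] order_G by simp

lemma sub_index_iff:
  assumes H: "subgroup H G"
  shows "subgroup Q (G\<lparr>carrier := H\<rparr>) \<and> subgroup_index (G\<lparr>carrier := H\<rparr>) Q = n \<longleftrightarrow>
    subgroup Q G \<and> Q \<subseteq> H \<and> n * card Q = card H"
proof -
  interpret H: group "G\<lparr>carrier := H\<rparr>" using H by (rule subgroup_imp_group)
  have 1: "subgroup Q (G\<lparr>carrier := H\<rparr>) \<longleftrightarrow> subgroup Q G \<and> Q \<subseteq> H"
    using incl_subgroup[OF H] subgroup_incl[OF _ H] subgroup.subset[of Q "G\<lparr>carrier := H\<rparr>"] by auto
  have "finite (carrier (G\<lparr>carrier := H\<rparr>))" using finite_sub[OF H] by simp
  then show ?thesis using 1 H.subgroup_index_iff[of Q n] by (auto simp: order_def)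
qed

lemma A_group_sub_iff:
  assumes H: "subgroup H G"
  shows "A_group p (Suc t) (G\<lparr>carrier := H\<rparr>) \<longleftrightarrow>
    (\<forall>Q. subgroup Q G \<and> Q \<subseteq> H \<and> p ^ Suc t * card Q = card H \<longrightarrow> abelian_sub G Q) \<and>
    (\<exists>Q. subgroup Q G \<and> Q \<subseteq> H \<and> p ^ t * card Q = card H \<and> \<not> abelian_sub G Q)"
  using fpg_sub[OF H] unfolding A_group.simps conj_assoc[symmetric] sub_index_iff[OF H] by simp

lemma ext_subset:
  assumes "subgroup S G" "\<phi> (1, w1, w2, w3, w4) \<in> S" "\<phi> ` filt j 1 \<subseteq> S"
  shows "ext (\<phi> (1, w1, w2, w3, w4)) j \<subseteq> S"
proof
  fix y assume "y \<in> ext (\<phi> (1, w1, w2, w3, w4)) j"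
  then obtain n v where y: "y = \<phi> (1, w1, w2, w3, w4) [^] (n::int) \<otimes> v" "v \<in> \<phi> ` filt j 1"
    unfolding ext_def by blast
  show "y \<in> S" unfolding y(1)
    by (rule subgroup.m_closed[OF assms(1) sub_pow[OF assms(1,2)] subsetD[OF assms(3) y(2)]])
qed

lemma nonabelian_contains_offA3:
  assumes "subgroup H G" "\<not> abelian_sub G H"
  obtains Q where "Q \<in> offA 3" "Q \<subseteq> H"
proof -
  have H: "\<not> H \<subseteq> \<phi> ` filt 1 1" "\<phi> ` filt 3 1 \<subseteq> H" using nonabelian_iff[OF assms(1)] assms(2) by auto
  obtain w1 w2 w3 w4 where x: "\<phi> (1, w1, w2, w3, w4) \<in> H" using assms(1) H(1) by (rule unit_b)
  show ?thesis by (rule that[OF ext_offA ext_subset[OF assms(1) x H(2)]]) auto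
qed

lemma small_abelian:
  assumes "subgroup Q G" "p ^ i * card Q = p ^ j" "j < m + 2 + i"
  shows "abelian_sub G Q"
proof (rule ccontr)
  assume "\<not> abelian_sub G Q"
  then have "p ^ i * p ^ (m + 2) \<le> p ^ i * card Q" using card_nonabelian(2)[OF assms(1)] by simp
  then have "p ^ (i + (m + 2)) \<le> p ^ j" unfolding assms(2) power_add .
  then show False using assms(3) unfolding pow_p_le by simp
qed

text \<open>A non-abelian subgroup of order above the minimum p^(m + 2) has a non-abelian subgroup
  of index p: a member of \<open>offA 3\<close> if its order is p^(m + 3), one of
  \<open>offA 2\<close> if it is the whole group.\<close>

lemma A1_iff:
  assumes H: "subgroup H G"
  shows "A_group p 1 (G\<lparr>carrier := H\<rparr>) \<longleftrightarrow> H \<in> offA 3"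
proof
  assume "A_group p 1 (G\<lparr>carrier := H\<rparr>)"
  then have A: "\<And>Q. subgroup Q G \<Longrightarrow> Q \<subseteq> H \<Longrightarrow> p * card Q = card H \<Longrightarrow> abelian_sub G Q"
    and E: "\<exists>Q. subgroup Q G \<and> Q \<subseteq> H \<and> card Q = card H \<and> \<not> abelian_sub G Q"
    using A_group_sub_iff[OF H, of 0] by simp_all
  obtain Q where Q: "subgroup Q G" "Q \<subseteq> H" "card Q = card H" "\<not> abelian_sub G Q" using E by blast
  have "Q = H" using card_subset_eq[OF finite_sub[OF H] Q(2,3)] .
  then have na: "\<not> abelian_sub G H" using Q(4) by simp
  obtain e where e: "card H = p ^ e" "e \<le> m + 4" using H by (rule card_sub_pow)
  have "p ^ (m + 2) \<le> p ^ e" using card_nonabelian(2)[OF H na] e(1) by simp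
  then have "m + 2 \<le> e" unfolding pow_p_le .
  then consider "e = m + 2" | "e = m + 3" | "e = m + 4" using e(2) by linarith
  then show "H \<in> offA 3"
  proof cases
    case 1
    then show ?thesis using H na e(1) unfolding offA_3_iff by simp
  next
    case 2
    obtain L where L: "L \<in> offA 3" "L \<subseteq> H" using H na by (rule nonabelian_contains_offA3)
    have "abelian_sub G L"
      using A[of L] L e(1) unfolding offA_3_iff 2 by (simp add: numeral_eq_Suc)
    then show ?thesis using L(1) unfolding offA_3_iff by simp
  next
    case 3
    have "carrier G = H" using card_subset_eq[OF finite_G subgroup.subset[OF H]] e(1) order_G
      by (simp add: 3 order_def)
    define L where "L = ext (\<phi> (1, 0, 0, 0, 0)) 2"
    have L: "L \<in> offA 2" unfolding L_def by (rule ext_offA) auto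
    have "L \<subseteq> H" unfolding \<open>carrier G = H\<close>[symmetric] using L subgroup.subset unfolding offA_2_iff by blast
    then have "abelian_sub G L"
      using A[of L] L e(1) unfolding offA_2_iff 3 by (simp add: numeral_eq_Suc)
    then show ?thesis using L unfolding offA_2_iff by simp
  qed
next
  assume "H \<in> offA 3"
  then have h: "\<not> abelian_sub G H" "card H = p ^ (m + 2)" unfolding offA_3_iff by auto
  have "abelian_sub G Q" if "subgroup Q G" "p ^ Suc 0 * card Q = card H" for Q
    using small_abelian[OF that(1), of "Suc 0" "m + 2"] that(2) h(2) by simp
  moreover have "\<exists>Q. subgroup Q G \<and> Q \<subseteq> H \<and> p ^ 0 * card Q = card H \<and> \<not> abelian_sub G Q"
    using H h by auto
  ultimately show "A_group p 1 (G\<lparr>carrier := H\<rparr>)"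
    unfolding One_nat_def A_group_sub_iff[OF H] by blast
qed

lemma A2_iff:
  assumes H: "subgroup H G" and c: "card H = p ^ (m + 3)"
  shows "A_group p 2 (G\<lparr>carrier := H\<rparr>) \<longleftrightarrow> H \<in> offA 2"
proof
  assume "A_group p 2 (G\<lparr>carrier := H\<rparr>)"
  then obtain Q where Q: "subgroup Q G" "Q \<subseteq> H" "\<not> abelian_sub G Q"
    unfolding numeral_2_eq_2 A_group_sub_iff[OF H] by blast
  have "\<not> abelian_sub G H"
    using Q(2,3) unfolding abelian_sub_iff[OF H] abelian_sub_iff[OF Q(1)] by blast
  then show "H \<in> offA 2" using H c unfolding offA_2_iff by simp
next
  assume "H \<in> offA 2"
  then have na: "\<not> abelian_sub G H" unfolding offA_2_iff by auto
  have "abelian_sub G Q" if "subgroup Q G" "p ^ Suc 1 * card Q = card H" for Q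
    using small_abelian[OF that(1), of "Suc 1" "m + 3"] that(2) c by simp
  moreover obtain L where L: "L \<in> offA 3" "L \<subseteq> H" using H na by (rule nonabelian_contains_offA3)
  have "p ^ 1 * card L = card H" using L(1) c unfolding offA_3_iff by (simp add: numeral_eq_Suc)
  then have "\<exists>Q. subgroup Q G \<and> Q \<subseteq> H \<and> p ^ 1 * card Q = card H \<and> \<not> abelian_sub G Q"
    using L unfolding offA_3_iff by blast
  ultimately have "A_group p (Suc 1) (G\<lparr>carrier := H\<rparr>)"
    unfolding A_group_sub_iff[OF H] by blast
  then show "A_group p 2 (G\<lparr>carrier := H\<rparr>)" by (simp only: Suc_1)
qed

lemma card_A: "card (\<phi> ` filt 1 1) = p ^ (m + 3)"
  using card_filt1[of 1] by (simp add: numeral_eq_Suc)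

lemma abelian_A: "abelian_sub G (\<phi> ` filt 1 1)"
  unfolding abelian_sub_iff[OF subgroup_filt] using A_comm by blast

lemma index_p_iff: "subgroup H G \<Longrightarrow> subgroup_index G H = p \<longleftrightarrow> card H = p ^ (m + 3)"
  using p_pos(1) by (simp add: index_iff numeral_eq_Suc)

lemma alpha1: "alpha1 p G = p ^ 2"
proof -
  have "A_subgroups p 1 G = offA 3"
    unfolding A_subgroups_def using A1_iff offA_3_iff by blast
  then show ?thesis unfolding alpha1_def using card_offA[of 3] by (simp add: numeral_eq_Suc)
qed

text \<open>An abelian subgroup outside of A meets A in central elements, so its order is at most p
  * p^m, too small for index p.\<close>

lemma mu0: "mu p 0 G = 1"
proof -
  have "{H \<in> A_subgroups p 0 G. subgroup_index G H = p} = {\<phi> ` filt 1 1}" (is "?L = ?R")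
  proof (intro equalityI subsetI)
    fix H assume "H \<in> ?L"
    then have H: "subgroup H G" "abelian_sub G H" "subgroup_index G H = p" by (auto simp: A_subgroups_def)
    then have c: "card H = p ^ (m + 3)" using index_p_iff by simp
    have "H \<subseteq> \<phi> ` filt 1 1"
    proof (rule ccontr)
      assume n: "\<not> H \<subseteq> \<phi> ` filt 1 1"
      have "card (H \<inter> \<phi> ` filt 1 1) \<le> card (\<phi> ` filt 4 1)"
        by (rule card_mono[OF finite_sub[OF subgroup_filt] abelian_cap_central[OF H(1) n H(2)]])
      then have "card H \<le> p * p ^ m" using card_filt1[of 4] card_not_in_A[OF H(1) n] by simp
      then have "p ^ (m + 3) \<le> p ^ Suc m" unfolding c by simp
      then show False unfolding pow_p_le by simp
    qed
    then show "H \<in> ?R" using card_subset_eq[OF finite_sub[OF subgroup_filt]] c card_A by simp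
  next
    fix H assume "H \<in> ?R"
    then show "H \<in> ?L"
      using subgroup_filt[of 1 1] abelian_A fpg_sub[OF subgroup_filt, of 1 1] index_p_iff card_A
      by (simp add: A_subgroups_def)
  qed
  then show ?thesis unfolding mu_def by simp
qed

lemma no_A1_index_p: "H \<in> A_subgroups p 1 G \<Longrightarrow> subgroup_index G H \<noteq> p"
proof
  assume H: "H \<in> A_subgroups p 1 G" "subgroup_index G H = p"
  then have s: "subgroup H G" "A_group p 1 (G\<lparr>carrier := H\<rparr>)" by (auto simp: A_subgroups_def)
  have "p ^ (m + 3) = p ^ (m + 2)"
    using A1_iff[OF s(1)] s(2) index_p_iff[OF s(1)] H(2) unfolding offA_3_iff by metis
  then show False unfolding pow_p_eq by simp
qed

lemma mu1: "mu p 1 G = 0"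
proof -
  have "{H \<in> A_subgroups p 1 G. subgroup_index G H = p} = {}" using no_A1_index_p by blast
  then show ?thesis unfolding mu_def by (simp only: card.empty)
qed

lemma mu2: "mu p 2 G = p"
proof -
  have "{H \<in> A_subgroups p 2 G. subgroup_index G H = p} = offA 2" (is "?L = ?R")
  proof (intro equalityI subsetI)
    fix H assume "H \<in> ?L"
    then have H: "subgroup H G" "A_group p 2 (G\<lparr>carrier := H\<rparr>)" "subgroup_index G H = p"
      by (auto simp: A_subgroups_def)
    then show "H \<in> ?R" using A2_iff[OF H(1)] index_p_iff[OF H(1)] by simp
  next
    fix H assume H: "H \<in> ?R"
    then have s: "subgroup H G" "card H = p ^ (m + 3)" unfolding offA_2_iff by auto
    then show "H \<in> ?L" using H A2_iff[OF s] index_p_iff[OF s(1)] by (simp add: A_subgroups_def)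
  qed
  then show ?thesis unfolding mu_def using card_offA[of 2] by simp
qed

lemma standing: "standing_hyp p G"
  unfolding standing_hyp_def
proof (intro conjI)
  have "G\<lparr>carrier := carrier G\<rparr> = G" by simp
  then have fp: "finite_p_group p G" using fpg_sub[OF subgroup_self] by simp
  have ab: "abelian_sub G H" if "subgroup H G" "subgroup_index G H = p ^ Suc 2" for H
    using small_abelian[OF that(1), of "Suc 2" "m + 4"] that(2) index_iff[OF that(1)] by simp
  define L where "L = ext (\<phi> (1, 0, 0, 0, 0)) 3"
  have L: "L \<in> offA 3" unfolding L_def by (rule ext_offA) auto
  then have "subgroup L G" "subgroup_index G L = p ^ 2" "\<not> abelian_sub G L"
    unfolding offA_3_iff by (auto simp: index_iff numeral_eq_Suc)
  then have "A_group p (Suc 2) G" unfolding A_group.simps using fp ab by blast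
  then show "A_group p 3 G" by (simp add: numeral_3_eq_3 numeral_2_eq_2)
  show "\<exists>H. subgroup H G \<and> subgroup_index G H = p \<and> abelian_sub G H"
    using subgroup_filt[of 1 1] abelian_A index_p_iff[OF subgroup_filt] card_A by blast
  show "\<not> (\<exists>H\<in>A_subgroups p 1 G. subgroup_index G H = p)" using no_A1_index_p by blast
qed

lemma maximal_if:
  assumes M: "subgroup M G" "card M = p ^ (m + 3)"
  shows "maximal_subgroup M G"
  unfolding maximal_subgroup_def
proof (intro conjI allI impI M)
  show "M \<noteq> carrier G"
  proof
    assume "M = carrier G"
    then have "p ^ (m + 3) = p ^ (m + 4)" using M(2) order_G by (simp add: order_def)
    then show False unfolding pow_p_eq by simp
  qed
  fix Q assume Q: "subgroup Q G \<and> M \<subseteq> Q"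
  obtain e where e: "card Q = p ^ e" "e \<le> m + 4" using conjunct1[OF Q] by (rule card_sub_pow)
  have "p ^ (m + 3) \<le> p ^ e" using card_mono[OF finite_sub[OF conjunct1[OF Q]] conjunct2[OF Q]] e M by simp
  then have "m + 3 \<le> e" unfolding pow_p_le .
  then consider "e = m + 3" | "e = m + 4" using e(2) by linarith
  then show "Q = M \<or> Q = carrier G"
  proof cases
    case 1
    then show ?thesis using card_subset_eq[OF finite_sub[OF conjunct1[OF Q]] conjunct2[OF Q]] e M by simp
  next
    case 2
    then show ?thesis using card_subset_eq[OF finite_G subgroup.subset[OF conjunct1[OF Q]]] e order_G
      by (simp add: order_def)
  qed
qed

text \<open>One inclusion intersects A with a single member of \<open>offA 2\<close>. For the other,
  a maximal M outside of A either meets A inside \<open>filt 2 1\<close>, and is then the proper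
  subgroup \<open>ext x 2\<close>, or contains \<open>filt 2 1\<close> by
  \<open>contains_Frat\<close>.\<close>

lemma frattini_eq: "frattini G = \<phi> ` filt 2 1"
proof (intro equalityI subsetI)
  fix y assume y: "y \<in> frattini G"
  define L where "L = ext (\<phi> (1, 0, 0, 0, 0)) 2"
  have L: "L \<in> offA 2" unfolding L_def by (rule ext_offA) auto
  have "maximal_subgroup L G" using L maximal_if unfolding offA_2_iff by blast
  moreover have "maximal_subgroup (\<phi> ` filt 1 1) G" by (rule maximal_if[OF subgroup_filt card_A])
  ultimately have "y \<in> L \<inter> \<phi> ` filt 1 1" using y unfolding frattini_def by blast
  then show "y \<in> \<phi> ` filt 2 1" using L unfolding offA_def by blast
next
  fix y assume y: "y \<in> \<phi> ` filt 2 1"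
  have "y \<in> M" if "maximal_subgroup M G" for M
  proof -
    have M: "subgroup M G" "M \<noteq> carrier G" "\<And>Q. subgroup Q G \<Longrightarrow> M \<subseteq> Q \<Longrightarrow> Q = M \<or> Q = carrier G"
      using that unfolding maximal_subgroup_def by auto
    show ?thesis
    proof (cases "M \<subseteq> \<phi> ` filt 1 1")
      case True
      then have "\<phi> ` filt 1 1 = M \<or> \<phi> ` filt 1 1 = carrier G" using M(3)[OF subgroup_filt] by blast
      moreover have "\<phi> ` filt 1 1 \<noteq> carrier G" using x_not_A[of 0 0 0 0] phi_closed by blast
      ultimately show ?thesis using y filt_mono[of 1 2 1] by auto
    next
      case False
      obtain w1 w2 w3 w4 where x: "\<phi> (1, w1, w2, w3, w4) \<in> M" using M(1) False by (rule unit_b)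
      let ?x = "\<phi> (1, w1, w2, w3, w4)"
      show ?thesis
      proof (cases "M \<inter> \<phi> ` filt 1 1 \<subseteq> \<phi> ` filt 2 1")
        case True
        have "M \<subseteq> ext ?x 2"
        proof
          fix z assume z: "z \<in> M"
          obtain l c1 c2 c3 c4 where z': "z = \<phi> (l, c1, c2, c3, c4)"
            using subgroup.mem_carrier[OF M(1) z] by (rule carrier_cases)
          obtain v where v: "v \<in> M" "v \<in> \<phi> ` filt 1 1" "z = ?x [^] l \<otimes> v"
            using M(1) x z' z by (rule split_pow)
          then have "v \<in> \<phi> ` filt 2 1" using True by blast
          then show "z \<in> ext ?x 2" unfolding ext_def v(3) by blast
        qed
        then have "ext ?x 2 = M \<or> ext ?x 2 = carrier G" using M(3)[OF ext_subgroup] by blast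
        moreover have "ext ?x 2 \<noteq> carrier G"
        proof
          assume "ext ?x 2 = carrier G"
          moreover have "ext ?x 2 \<in> offA 2" by (rule ext_offA) auto
          ultimately have "p ^ (m + 3) = p ^ (m + 4)" using order_G unfolding offA_2_iff by (simp add: order_def)
          then show False unfolding pow_p_eq by simp
        qed
        ultimately show ?thesis using y ext_contains(2)[of 2] by blast
      next
        case False
        then obtain v where v: "v \<in> M" "v \<in> \<phi> ` filt 1 1" "v \<notin> \<phi> ` filt 2 1" by blast
        obtain k c1 c2 c3 c4 where v': "v = \<phi> (k, c1, c2, c3, c4)" "int p dvd k" using v(2) by (rule A_E)
        have "\<not> int p dvd c1"
        proof
          assume "int p dvd c1"
          moreover obtain d2 d3 d4 where "v = \<phi> (k, c1 mod p, d2, d3, d4)" unfolding v'(1) by (rule reduce1)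
          ultimately show False using v(3) filtI(2)[of 1 k] v'(2) by simp
        qed
        then have "\<phi> ` filt 2 1 \<subseteq> M" using contains_Frat[OF M(1) x v'(2)] v(1) v'(1) by simp
        then show ?thesis using y by blast
      qed
    qed
  qed
  then show "y \<in> frattini G"
    unfolding frattini_def using subgroup.mem_carrier[OF subgroup_filt y] by blast
qed

lemma derived_elem:
  assumes "x \<in> \<phi> ` filt 2 m"
  obtains c2 c3 c4 where "x = \<phi> (0, 0, c2, c3, c4)"
proof -
  obtain j c2 c3 c4 where "x = \<phi> (int p ^ m * j, 0, c2, c3, c4)" using assms by (rule filtE2)
  then have "x = \<phi> (0 + int p ^ m * j, 0, c2, c3, c4)" by simp
  then show ?thesis unfolding phi_carry by (rule that)
qed

text \<open>Every element with vanishing first two coordinates is a single commutator with b; the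
  powers of b^(p^m) add nothing new, as they are carried into a_4.\<close>

lemma derived_eq: "derived G (carrier G) = \<phi> ` filt 2 m"
proof
  show "derived G (carrier G) \<subseteq> \<phi> ` filt 2 m"
    unfolding derived_def
  proof (rule generate_subgroup_incl[OF _ subgroup_filt])
    show "derived_set G (carrier G) \<subseteq> \<phi> ` filt 2 m"
    proof
      fix y assume "y \<in> derived_set G (carrier G)"
      then obtain g h where gh: "g \<in> carrier G" "h \<in> carrier G" "y = g \<otimes> h \<otimes> inv g \<otimes> inv h" by blast
      obtain k c1 c2 c3 c4 where g: "g = \<phi> (k, c1, c2, c3, c4)" using gh(1) by (rule carrier_cases)
      obtain l d1 d2 d3 d4 where h: "h = \<phi> (l, d1, d2, d3, d4)" using gh(2) by (rule carrier_cases)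
      obtain e2 e3 e4 where "y = \<phi> (0, 0, e2, e3, e4)" unfolding gh(3) g h by simp
      then show "y \<in> \<phi> ` filt 2 m" using filtI(2)[of m 0] by simp
    qed
  qed
  show "\<phi> ` filt 2 m \<subseteq> derived G (carrier G)"
  proof
    fix y assume "y \<in> \<phi> ` filt 2 m"
    then obtain c2 c3 c4 where y: "y = \<phi> (0, 0, c2, c3, c4)" by (rule derived_elem)
    \<comment> \<open>The inverses translate between the two conventions: \<open>derived_set\<close>
      consists of g h g^(-1) h^(-1), while \<open>commutator\<close> is g^(-1) h^(-1) g h.\<close>
    let ?g = "inv (\<phi> (0, c2, c3, c4, 0))" and ?h = "inv (\<phi> (1, 0, 0, 0, 0))"
    have "y = commutator G (\<phi> (0, c2, c3, c4, 0)) (\<phi> (1, 0, 0, 0, 0))"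
      unfolding phi_commutator commutator_HG_shift y ..
    then have "y = ?g \<otimes> ?h \<otimes> inv ?g \<otimes> inv ?h"
      by (simp add: commutator_def del: phi_inv phi_mult)
    then have "y \<in> derived_set G (carrier G)" using inv_closed phi_closed by blast
    then show "y \<in> derived G (carrier G)" unfolding derived_def by (rule generate.incl)
  qed
qed

lemmas lower_central_subset = lower_central_HG[OF is_group hom surj]

lemma class_4: "nilp_class G = 4"
proof -
  have step: "commutator G x y \<in> lower_central G (Suc n)"
    if "x \<in> lower_central G n" "y \<in> carrier G" for x y n
    unfolding lower_central.simps by (rule generate.incl) (use that in blast)
  have shift: "\<phi> (0, 0, c1, c2, c3) \<in> lower_central G (Suc n)"
    if "\<phi> (0, c1, c2, c3, c4) \<in> lower_central G n" for c1 c2 c3 c4 n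
    using step[OF that phi_closed[of "(1, 0, 0, 0, 0)"]] unfolding phi_commutator commutator_HG_shift .
  have 0: "\<phi> (0, 1, 0, 0, 0) \<in> lower_central G 0" by simp
  note 1 = shift[OF 0] note 2 = shift[OF 1] note 3 = shift[OF 2]
  have p1: "\<not> int p dvd 1" using p_pos by simp
  have ne: "\<phi> (0, 1, 0, 0, 0) \<noteq> \<one>" "\<phi> (0, 0, 1, 0, 0) \<noteq> \<one>" "\<phi> (0, 0, 0, 1, 0) \<noteq> \<one>" "\<phi> (0, 0, 0, 0, 1) \<noteq> \<one>"
  proof -
    show n4: "\<phi> (0, 0, 0, 0, 1) \<noteq> \<one>" unfolding phi_eq_0 using Lat_last[OF p_pos(1)] p1 by simp
    show n3: "\<phi> (0, 0, 0, 1, 0) \<noteq> \<one>" using Lat_shift n4 unfolding phi_eq_0 by blast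
    show n2: "\<phi> (0, 0, 1, 0, 0) \<noteq> \<one>" using Lat_shift n3 unfolding phi_eq_0 by blast
    show "\<phi> (0, 1, 0, 0, 0) \<noteq> \<one>" using Lat_shift n2 unfolding phi_eq_0 by blast
  qed
  have one: "\<one> \<in> lower_central G 4" by (simp add: numeral_eq_Suc generate.one)
  show ?thesis unfolding nilp_class_def
  proof (rule Least_equality)
    show "lower_central G 4 = {\<one>}" using lower_central_subset(4) one by blast
    fix c assume c: "lower_central G c = {\<one>}"
    show "4 \<le> c"
    proof (rule ccontr)
      assume "\<not> 4 \<le> c"
      then consider "c = 0" | "c = Suc 0" | "c = Suc (Suc 0)" | "c = Suc (Suc (Suc 0))" by linarith
      then show False using 0 1 2 3 ne c by cases blast+
    qed
  qed
qed

lemma generate_ab: "generate G {\<phi> (0, 1, 0, 0, 0), \<phi> (1, 0, 0, 0, 0)} = carrier G"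
  using hom_HG_image[OF is_group hom] surj by simp

text \<open>Fewer than two generators would make the group cyclic, but a_1 and b do not
  commute.\<close>

lemma min_gens_2: "min_gens G = 2"
  unfolding min_gens_def
proof (rule Least_equality)
  let ?S = "{\<phi> (0, 1, 0, 0, 0), \<phi> (1, 0, 0, 0, 0)}"
  have nc: "\<phi> (0, 1, 0, 0, 0) \<otimes> \<phi> (1, 0, 0, 0, 0) \<noteq> \<phi> (1, 0, 0, 0, 0) \<otimes> \<phi> (0, 1, 0, 0, 0)"
  proof
    assume "\<phi> (0, 1, 0, 0, 0) \<otimes> \<phi> (1, 0, 0, 0, 0) = \<phi> (1, 0, 0, 0, 0) \<otimes> \<phi> (0, 1, 0, 0, 0)"
    then have "(0, 1, 0, 0) \<in> Lat p s" by (simp add: phi_eq_same)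
    from Lat_shift[OF Lat_shift[OF this]] show False using Lat_last[OF p_pos(1)] p_pos by simp
  qed
  then have "card ?S = 2" by (metis card_2_iff)
  then show "\<exists>S\<subseteq>carrier G. finite S \<and> card S = 2 \<and> generate G S = carrier G"
    using generate_ab by (intro exI[of _ ?S]) simp
  fix n assume "\<exists>S\<subseteq>carrier G. finite S \<and> card S = n \<and> generate G S = carrier G"
  then obtain S where S: "S \<subseteq> carrier G" "finite S" "card S = n" "generate G S = carrier G" by blast
  show "2 \<le> n"
  proof (rule ccontr)
    assume "\<not> 2 \<le> n"
    then have "n = 0 \<or> n = 1" by linarith
    then have "\<exists>x\<in>carrier G. S \<subseteq> {x}"
    proof
      assume "n = 0" then show ?thesis using S(2,3) one_closed by auto
    next
      assume "n = 1" then show ?thesis using S(1,3) card_1_singletonE by blast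
    qed
    then obtain x where x: "x \<in> carrier G" "S \<subseteq> {x}" by blast
    have "subgroup {x [^] (i::int) | i. i \<in> UNIV} G"
      using generate_pow[OF x(1)] generate_is_subgroup[of "{x}"] x(1) by simp
    then have "generate G S \<subseteq> {x [^] (i::int) | i. i \<in> UNIV}"
    proof (rule generate_subgroup_incl[rotated])
      have "x [^] (1::int) = x" using x(1) by (rule int_pow_1)
      then show "S \<subseteq> {x [^] (i::int) | i. i \<in> UNIV}" using x(2) by (metis (mono_tags, lifting) UNIV_I mem_Collect_eq singletonD subsetD subsetI)
    qed
    then have all: "y \<in> carrier G \<Longrightarrow> \<exists>i::int. y = x [^] i" for y using S(4) by blast
    obtain i j :: int where "\<phi> (0, 1, 0, 0, 0) = x [^] i" "\<phi> (1, 0, 0, 0, 0) = x [^] j"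
      using all[OF phi_closed] by metis
    then show False using nc x(1) by (simp add: int_pow_mult[symmetric] add.commute del: phi_mult)
  qed
qed

end

section \<open>Presentations\<close>

definition letter_val :: "('a, 'b) monoid_scheme \<Rightarrow> ('g \<Rightarrow> 'a) \<Rightarrow> 'g \<times> bool \<Rightarrow> 'a" where
  "letter_val G f x = (if snd x then f (fst x) else inv\<^bsub>G\<^esub> (f (fst x)))"

definition weval :: "('a, 'b) monoid_scheme \<Rightarrow> ('g \<Rightarrow> 'a) \<Rightarrow> 'g word \<Rightarrow> 'a" where
  "weval G f w = foldr (\<lambda>x y. letter_val G f x \<otimes>\<^bsub>G\<^esub> y) w \<one>\<^bsub>G\<^esub>"

context group
begin

context
  fixes f :: "'g \<Rightarrow> 'a"
  assumes f [simp]: "\<And>x. f x \<in> carrier G"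
begin

lemma letter_val_closed [simp]: "letter_val G f x \<in> carrier G"
  by (simp add: letter_val_def)

lemma weval_Nil [simp]: "weval G f [] = \<one>"
  by (simp add: weval_def)

lemma weval_Cons [simp]: "weval G f (x # w) = letter_val G f x \<otimes> weval G f w"
  by (simp add: weval_def)

lemma weval_closed [simp]: "weval G f w \<in> carrier G"
  by (induction w) auto

lemma weval_append [simp]: "weval G f (v @ w) = weval G f v \<otimes> weval G f w"
  by (induction v) (simp_all add: m_assoc)

lemma weval_letter: "weval G f [(x, True)] = f x"
  by (simp add: letter_val_def)

lemma weval_winv [simp]: "weval G f (winv w) = inv (weval G f w)"
proof (induction w)
  case (Cons x w)
  have "winv (x # w) = winv w @ [(fst x, \<not> snd x)]" by (simp add: winv_def split_beta)
  moreover have "letter_val G f (fst x, \<not> snd x) = inv (letter_val G f x)"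
    by (simp add: letter_val_def)
  ultimately show ?case using Cons by (simp add: inv_mult_group)
qed (simp add: winv_def)

lemma weval_wcomm [simp]: "weval G f (wcomm v w) = commutator G (weval G f v) (weval G f w)"
  by (simp add: wcomm_def commutator_def m_assoc)

lemma weval_replicate: "weval G f (concat (replicate n w)) = weval G f w [^] n"
proof (induction n)
  case (Suc n)
  then show ?case using nat_pow_Suc2[OF weval_closed, of w n] by simp
qed simp

lemma weval_wpow [simp]: "weval G f (wpow w k) = weval G f w [^] k"
proof (cases k rule: int_cases2)
  case (nonneg n)
  then show ?thesis by (simp add: wpow_def weval_replicate int_pow_int)
next
  case (nonpos n)
  show ?thesis
  proof (cases "n = 0")
    case True
    then show ?thesis using nonpos by (simp add: wpow_def)
  next
    case False
    then have "wpow w k = concat (replicate n (winv w))" using nonpos by (simp add: wpow_def)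
    then show ?thesis using nonpos by (simp add: weval_replicate int_pow_neg int_pow_int nat_pow_inv)
  qed
qed

lemma weval_word_cong:
  assumes "word_cong S R v w" "\<And>l r. (l, r) \<in> R \<Longrightarrow> weval G f l = weval G f r"
  shows "weval G f v = weval G f w"
  using assms(1)
proof induction
  case (cancel x u s v)
  have "letter_val G f (x, s) \<otimes> (letter_val G f (x, \<not> s) \<otimes> weval G f v) = weval G f v"
    by (cases s) (simp_all add: letter_val_def flip: m_assoc)
  then show ?case by simp
next
  case (relation l r u v)
  then show ?case using assms(2) by simp
qed auto

end

end

section \<open>The presented group and von Dyck's theorem\<close>

lemma word_cong_append:
  assumes "word_cong S R u u'" "word_cong S R v v'"
  shows "word_cong S R (u @ v) (u' @ v')"
proof -
  have left: "word_cong S R (w @ v) (w @ v')" for w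
    using assms(2)
  proof induction
    case (cancel x u s v)
    then show ?case using word_cong.cancel[of x S R "w @ u" s v] by simp
  next
    case (relation l r u v)
    then show ?case using word_cong.relation[of l r R S "w @ u" v] by simp
  qed (auto intro: word_cong.intros)
  have right: "word_cong S R (u @ w) (u' @ w)" for w
    using assms(1)
  proof induction
    case (cancel x u s v)
    then show ?case using word_cong.cancel[of x S R u s "v @ w"] by simp
  next
    case (relation l r u v)
    then show ?case using word_cong.relation[of l r R S u "v @ w"] by simp
  qed (auto intro: word_cong.intros)
  show ?thesis using right left by (rule word_cong.trans)
qed

lemma word_class_eq_iff: "word_class S R u = word_class S R v \<longleftrightarrow> word_cong S R u v"
  unfolding word_class_def
  by (auto intro: word_cong.intros dest: word_cong.sym word_cong.trans)

lemma word_class_self: "w \<in> word_class S R w"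
  unfolding word_class_def by (auto intro: word_cong.refl)

lemma word_class_mult:
  "word_class S R u \<otimes>\<^bsub>presented_group S R\<^esub> word_class S R v = word_class S R (u @ v)"
proof -
  have "(\<exists>x\<in>word_class S R u. \<exists>y\<in>word_class S R v. word_cong S R (x @ y) w) \<longleftrightarrow> word_cong S R (u @ v) w" for w
  proof
    assume "\<exists>x\<in>word_class S R u. \<exists>y\<in>word_class S R v. word_cong S R (x @ y) w"
    then obtain x y where xy: "word_cong S R u x" "word_cong S R v y" "word_cong S R (x @ y) w"
      unfolding word_class_def by blast
    from word_cong_append[OF xy(1,2)] xy(3) show "word_cong S R (u @ v) w" by (rule word_cong.trans)
  next
    assume "word_cong S R (u @ v) w"
    then show "\<exists>x\<in>word_class S R u. \<exists>y\<in>word_class S R v. word_cong S R (x @ y) w"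
      using word_class_self by blast
  qed
  then show ?thesis unfolding presented_group_def word_class_def by simp
qed

lemma winv_cancel:
  assumes "w \<in> lists (S \<times> UNIV)"
  shows "word_cong S R (winv w @ w) []"
  using assms
proof (induction w)
  case Nil
  then show ?case by (simp add: winv_def word_cong.refl)
next
  case (Cons x w)
  obtain y s where x: "x = (y, s)" by (cases x)
  have "y \<in> S" using Cons(1) x by simp
  then have "word_cong S R (winv w @ [(y, \<not> s), (y, \<not> \<not> s)] @ w) (winv w @ w)"
    by (rule word_cong.cancel)
  moreover have "winv (x # w) @ (x # w) = winv w @ [(y, \<not> s), (y, \<not> \<not> s)] @ w" by (simp add: winv_def x)
  ultimately show ?case using Cons.IH word_cong.trans by metis
qed

lemma winv_lists: "w \<in> lists (S \<times> UNIV) \<Longrightarrow> winv w \<in> lists (S \<times> UNIV)"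
  unfolding winv_def by (induction w) auto

lemma presented_carrier: "carrier (presented_group S R) = word_class S R ` lists (S \<times> UNIV)"
    and presented_one: "\<one>\<^bsub>presented_group S R\<^esub> = word_class S R []"
  by (simp_all add: presented_group_def)

lemma presented_group_group [simp]: "group (presented_group S R)"
proof (rule groupI)
  let ?P = "presented_group S R"
  fix x y z assume xyz: "x \<in> carrier ?P" "y \<in> carrier ?P" "z \<in> carrier ?P"
  obtain u where u: "x = word_class S R u" "u \<in> lists (S \<times> UNIV)" using xyz(1) unfolding presented_carrier by blast
  obtain v where v: "y = word_class S R v" "v \<in> lists (S \<times> UNIV)" using xyz(2) unfolding presented_carrier by blast
  obtain w where w: "z = word_class S R w" "w \<in> lists (S \<times> UNIV)" using xyz(3) unfolding presented_carrier by blast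
  show "x \<otimes>\<^bsub>?P\<^esub> y \<in> carrier ?P" unfolding u v word_class_mult presented_carrier using u(2) v(2) by auto
  show "x \<otimes>\<^bsub>?P\<^esub> y \<otimes>\<^bsub>?P\<^esub> z = x \<otimes>\<^bsub>?P\<^esub> (y \<otimes>\<^bsub>?P\<^esub> z)" unfolding u v w word_class_mult by simp
next
  let ?P = "presented_group S R"
  show "\<one>\<^bsub>?P\<^esub> \<in> carrier ?P" unfolding presented_one presented_carrier by auto
  fix x assume "x \<in> carrier ?P"
  then obtain u where u: "x = word_class S R u" "u \<in> lists (S \<times> UNIV)" unfolding presented_carrier by blast
  show "\<one>\<^bsub>?P\<^esub> \<otimes>\<^bsub>?P\<^esub> x = x" unfolding u presented_one word_class_mult by simp
  have "word_class S R (winv u) \<otimes>\<^bsub>?P\<^esub> x = \<one>\<^bsub>?P\<^esub>"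
    unfolding u presented_one word_class_mult word_class_eq_iff by (rule winv_cancel[OF u(2)])
  moreover have "word_class S R (winv u) \<in> carrier ?P"
    unfolding presented_carrier using winv_lists[OF u(2)] by blast
  ultimately show "\<exists>y\<in>carrier ?P. y \<otimes>\<^bsub>?P\<^esub> x = \<one>\<^bsub>?P\<^esub>" by blast
qed

lemma von_dyck:
  assumes "group H" and f: "\<And>x. f x \<in> carrier H"
    and R: "\<And>l r. (l, r) \<in> R \<Longrightarrow> weval H f l = weval H f r"
  obtains \<theta> where "\<theta> \<in> hom (presented_group S R) H" "\<And>w. \<theta> (word_class S R w) = weval H f w"
proof -
  interpret H: group H by fact
  \<comment> \<open>The value on a class is computed from an arbitrary representative;
    \<open>weval_word_cong\<close> shows independence of the choice.\<close>
  define \<theta> where "\<theta> X = weval H f (SOME w. w \<in> X)" for X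
  have th: "\<theta> (word_class S R w) = weval H f w" for w
  proof -
    have "(SOME v. v \<in> word_class S R w) \<in> word_class S R w" using word_class_self by (rule someI)
    then have "word_cong S R w (SOME v. v \<in> word_class S R w)" by (simp add: word_class_def)
    then show ?thesis unfolding \<theta>_def using H.weval_word_cong[of f] f R by metis
  qed
  have "\<theta> \<in> hom (presented_group S R) H"
  proof (rule homI)
    fix x y assume "x \<in> carrier (presented_group S R)" "y \<in> carrier (presented_group S R)"
    then obtain u v where uv: "x = word_class S R u" "y = word_class S R v" unfolding presented_carrier by blast
    show "\<theta> x \<in> carrier H" unfolding uv th using H.weval_closed[of f] f by blast
    show "\<theta> (x \<otimes>\<^bsub>presented_group S R\<^esub> y) = \<theta> x \<otimes>\<^bsub>H\<^esub> \<theta> y"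
      unfolding uv th word_class_mult using H.weval_append[of f] f by blast
  qed
  then show ?thesis using th by (rule that)
qed

text \<open>A generator outside of \<open>S\<close> is sent to the neutral element, to have a total assignment.\<close>

definition gen_class :: "'g set \<Rightarrow> ('g word \<times> 'g word) set \<Rightarrow> 'g \<Rightarrow> 'g word set" where
  "gen_class S R x = (if x \<in> S then word_class S R [(x, True)] else word_class S R [])"

lemma gen_class_closed: "gen_class S R x \<in> carrier (presented_group S R)"
  unfolding gen_class_def presented_carrier by auto

lemma weval_presented:
  assumes "w \<in> lists (S \<times> UNIV)"
  shows "weval (presented_group S R) (gen_class S R) w = word_class S R w"
  using assms
proof (induction w)
  interpret P: group "presented_group S R" by simp
  case Nil
  then show ?case by (simp add: weval_def presented_one)
next
  interpret P: group "presented_group S R" by simp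
  case (Cons x w)
  obtain y s where x: "x = (y, s)" by (cases x)
  have y: "y \<in> S" using Cons(1) x by simp
  have "letter_val (presented_group S R) (gen_class S R) x = word_class S R [x]"
  proof (cases s)
    case True
    then show ?thesis using y by (simp add: letter_val_def x gen_class_def)
  next
    case False
    have "word_cong S R ([] @ [(y, False), (y, \<not> False)] @ []) ([] @ [])" using y by (rule word_cong.cancel)
    then have "word_class S R [(y, False)] \<otimes>\<^bsub>presented_group S R\<^esub> word_class S R [(y, True)] = \<one>\<^bsub>presented_group S R\<^esub>"
      unfolding word_class_mult presented_one word_class_eq_iff by simp
    then have "inv\<^bsub>presented_group S R\<^esub> (word_class S R [(y, True)]) = word_class S R [(y, False)]"
      using y by (intro P.inv_equality) (auto simp: presented_carrier)
    then show ?thesis using False y by (simp add: letter_val_def x gen_class_def)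
  qed
  then show ?case
    using Cons P.weval_Cons[of "gen_class S R" x w] gen_class_closed[of S R] word_class_mult[of S R "[x]" w]
    by simp
qed

lemma presented_relation:
  assumes "(l, r) \<in> R" "l \<in> lists (S \<times> UNIV)" "r \<in> lists (S \<times> UNIV)"
  shows "weval (presented_group S R) (gen_class S R) l = weval (presented_group S R) (gen_class S R) r"
  unfolding weval_presented[OF assms(2)] weval_presented[OF assms(3)] word_class_eq_iff
  using word_cong.relation[OF assms(1), of S "[]" "[]"] by simp

lemma presented_generated:
  assumes "subgroup H (presented_group S R)" "\<And>x. x \<in> S \<Longrightarrow> gen_class S R x \<in> H"
  shows "carrier (presented_group S R) \<subseteq> H"
proof
  interpret P: group "presented_group S R" by simp
  interpret H: subgroup H "presented_group S R" by fact
  fix X assume "X \<in> carrier (presented_group S R)"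
  then obtain w where w: "X = word_class S R w" "w \<in> lists (S \<times> UNIV)" unfolding presented_carrier by blast
  have "weval (presented_group S R) (gen_class S R) w \<in> H" using w(2)
  proof (induction w)
    case Nil
    then show ?case by (simp add: weval_def)
  next
    case (Cons x w)
    have "letter_val (presented_group S R) (gen_class S R) x \<in> H"
      using assms(2)[of "fst x"] Cons(1) by (auto simp: letter_val_def)
    then show ?case
      using Cons P.weval_Cons[of "gen_class S R" x w] gen_class_closed[of S R] by simp
  qed
  then show "X \<in> H" unfolding w(1) weval_presented[OF w(2)] .
qed

text \<open>Von Dyck's theorem, applied to the presentation and to \<open>HG\<close>, gives homomorphisms in both
  directions; \<open>g\<close> assigns elements of \<open>HG\<close> to the generators of the presentation.\<close>

lemma marked_presented:
  fixes S R and g :: "'g \<Rightarrow> coords"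
  assumes p: "prime p" "m \<ge> 1"
    and g: "x \<in> S" "g x = (0, 1, 0, 0, 0)" "y \<in> S" "g y = (1, 0, 0, 0, 0)"
    and model: "\<And>l r. (l, r) \<in> R \<Longrightarrow>
      weval (HG Mod K p m s u) (\<lambda>z. K p m s u #>\<^bsub>HG\<^esub> g z) l = weval (HG Mod K p m s u) (\<lambda>z. K p m s u #>\<^bsub>HG\<^esub> g z) r"
    and psi: "\<psi> \<in> hom HG (presented_group S R)" "\<And>z. z \<in> S \<Longrightarrow> \<psi> (g z) = gen_class S R z"
      "\<psi> (0, int p, B2 p, B3 p, B4 p - s) = \<one>\<^bsub>presented_group S R\<^esub>"
      "\<psi> (int p ^ m, 0, 0, 0, - u) = \<one>\<^bsub>presented_group S R\<^esub>"
  shows "marked (presented_group S R) p m s u \<psi>"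
proof -
  let ?P = "presented_group S R" and ?M = "HG Mod K p m s u" and ?c = "\<lambda>h. K p m s u #>\<^bsub>HG\<^esub> h"
  interpret M: marked ?M p m s u ?c using p by (rule marked_model)
  interpret P: group ?P by simp
  interpret psi: group_hom HG ?P \<psi> using psi(1) by (intro group_hom_HG) simp
  obtain \<theta> where th: "\<theta> \<in> hom ?P ?M" "\<And>w. \<theta> (word_class S R w) = weval ?M (\<lambda>z. ?c (g z)) w"
    using von_dyck[OF M.is_group, of "\<lambda>z. ?c (g z)" R S] model by auto
  have tg: "\<theta> (gen_class S R z) = ?c (g z)" if "z \<in> S" for z
    using that th(2)[of "[(z, True)]"] M.weval_letter[of "\<lambda>z. ?c (g z)" z] by (simp add: gen_class_def)
  \<comment> \<open>The composite agrees with the projection on a_1 and b, hence everywhere; so the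
    kernel of \<open>\<psi>\<close> is contained in \<open>K\<close>. The reverse inclusion comes
    from \<open>hom_HG_kills_K\<close>.\<close>
  have comp: "\<theta> \<circ> \<psi> = ?c"
  proof (rule hom_HG_eqI[OF M.is_group])
    show "\<theta> \<circ> \<psi> \<in> hom HG ?M" using psi(1) th(1) by (rule Group.hom_compose)
    show "?c \<in> hom HG ?M" by (rule M.hom)
    show "(\<theta> \<circ> \<psi>) (0, 1, 0, 0, 0) = ?c (0, 1, 0, 0, 0)" "(\<theta> \<circ> \<psi>) (1, 0, 0, 0, 0) = ?c (1, 0, 0, 0, 0)"
      using psi(2)[OF g(1)] psi(2)[OF g(3)] tg[OF g(1)] tg[OF g(3)] g(2,4) by simp_all
  qed
  interpret th: group_hom ?P ?M \<theta> using th(1) by unfold_locales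
  show ?thesis
  proof
    have "subgroup (range \<psi>) ?P" using psi.img_is_subgroup by simp
    moreover have "gen_class S R z \<in> range \<psi>" if "z \<in> S" for z using psi(2)[OF that] by (metis rangeI)
    ultimately have "carrier ?P \<subseteq> range \<psi>" by (rule presented_generated)
    then show "range \<psi> = carrier ?P" using psi.hom_closed by auto
    show "\<psi> h = \<one>\<^bsub>?P\<^esub> \<longleftrightarrow> h \<in> K p m s u" for h
    proof
      assume "\<psi> h = \<one>\<^bsub>?P\<^esub>"
      then have "\<theta> (\<psi> h) = \<one>\<^bsub>?M\<^esub>" using th.hom_one by simp
      then have "?c h = \<one>\<^bsub>?M\<^esub>" using fun_cong[OF comp, of h] by simp
      then show "h \<in> K p m s u" using M.ker by simp
    next
      assume "h \<in> K p m s u"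
      then show "\<psi> h = \<one>\<^bsub>?P\<^esub>" by (rule hom_HG_kills_K[OF P.is_group psi(1) psi(3,4)])
    qed
  qed (use p psi(1) in auto)
qed

section \<open>The listed presentations as quotients\<close>

lemma B_prime:
  assumes "prime p" "p \<ge> (5::nat)"
  shows "int p dvd B2 (int p)" "int p dvd B3 (int p)" "int p dvd B4 (int p)"
proof -
  have pr: "Factorial_Ring.prime (int p)" using assms by simp
  have small: "\<not> int p dvd n" if "n \<in> {2, 3, 4}" for n
    using that assms(2) zdvd_imp_le[of "int p" n] by auto
  have c: "coprime (int p) 2" "coprime (int p) 6" "coprime (int p) 24"
  proof -
    show 2: "coprime (int p) 2" by (rule prime_imp_coprime[OF pr small]) simp
    have 3: "coprime (int p) 3" by (rule prime_imp_coprime[OF pr small]) simp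
    have "coprime (int p) (2 * 3)" using 2 3 by (simp only: coprime_mult_right_iff)
    then show "coprime (int p) 6" by simp
    have "coprime (int p) (2 * (2 * (2 * 3)))" using 2 3 by (simp only: coprime_mult_right_iff)
    then show "coprime (int p) 24" by simp
  qed
  have "int p dvd 2 * B2 p" "int p dvd 6 * B3 p" "int p dvd 24 * B4 p"
    unfolding B2_eq B3_eq B4_eq by simp_all
  then show "int p dvd B2 (int p)" "int p dvd B3 (int p)" "int p dvd B4 (int p)"
    using c by (simp_all only: coprime_dvd_mult_right_iff)
qed

text \<open>Used for F7, where b^(p^m) has to be moved past a_1 and a_2.\<close>

lemma B_prime_power:
  assumes "prime p" "p \<ge> (5::nat)" "m \<ge> 1"
  shows "int p dvd B2 (int p ^ m)" "int p dvd B3 (int p ^ m)"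
proof -
  obtain n where m: "m = Suc n" using assms(3) by (cases m) auto
  have "B2 (int p ^ m) = int p ^ n * B2 p + B2 (int p ^ n) * p * p"
    "B3 (int p ^ m) = int p ^ n * B3 p + B2 (int p ^ n) * 2 * p * B2 p + B3 (int p ^ n) * p * p * p"
    unfolding m power_Suc B2_mult B3_mult by simp_all
  then show "int p dvd B2 (int p ^ m)" "int p dvd B3 (int p ^ m)"
    using B_prime[OF assms(1,2)] by simp_all
qed

text \<open>For p = 2 the norm N is 2 + x.\<close>

lemma LatI2:
  assumes "c1 = 2 * n1" "c2 = 2 * n2 + n1" "c3 = 2 * n3 + n2" "c4 = 2 * n4 + n3 - s * n1"
  shows "(c1, c2, c3, c4) \<in> Lat 2 s"
  using LatI[of 2 n1 n2 n3 n4 s] by (simp add: assms B2_def B3_def B4_def)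

text \<open>For p = 3 the norm N is 3 + 3 x + x^2.\<close>

lemma LatI3:
  assumes "c1 = 3 * n1" "c2 = 3 * n2 + 3 * n1" "c3 = 3 * n3 + 3 * n2 + n1" "c4 = 3 * n4 + 3 * n3 + n2 - s * n1"
  shows "(c1, c2, c3, c4) \<in> Lat 3 s"
  using LatI[of 3 n1 n2 n3 n4 s] by (simp add: assms B2_def B3_def B4_def)

text \<open>For p \<ge> 5 all binomials in N are divisible by p, so N contributes only the relation
  that the p-th power of a_1 is a_4^s, besides the p-th powers of the other a_i.\<close>

lemma LatI5:
  assumes p: "prime p" "p \<ge> 5"
    and c: "c1 = int p * n1" "int p dvd c2" "int p dvd c3" "int p dvd c4 + s * n1"
  shows "(c1, c2, c3, c4) \<in> Lat p s"
proof -
  have "int p dvd c2 - B2 p * n1" using B_prime[OF p] c by simp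
  then obtain n2 where n2: "c2 - B2 p * n1 = int p * n2" by (rule dvdE)
  have "int p dvd c3 - B2 p * n2 - B3 p * n1" using B_prime[OF p] c by simp
  then obtain n3 where n3: "c3 - B2 p * n2 - B3 p * n1 = int p * n3" by (rule dvdE)
  have "int p dvd c4 + s * n1 - B2 p * n3 - B3 p * n2 - B4 p * n1" using B_prime[OF p] c by simp
  then obtain n4 where n4: "c4 + s * n1 - B2 p * n3 - B3 p * n2 - B4 p * n1 = int p * n4" by (rule dvdE)
  have "c2 = int p * n2 + B2 p * n1" "c3 = int p * n3 + B2 p * n2 + B3 p * n1"
    "c4 = int p * n4 + B2 p * n3 + B3 p * n2 + (B4 p - s) * n1"
    using n2 n3 n4 by (simp_all add: algebra_simps)
  then show ?thesis using LatI[of p n1 n2 n3 n4 s] c(1) by simp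
qed

lemma fermat_int:
  assumes "prime p" "\<not> int p dvd t"
  shows "int p dvd t ^ (p - 1) - 1"
proof -
  define a where "a = nat (t mod int p)"
  have a: "int a = t mod int p" using prime_gt_0_nat[OF assms(1)] by (simp add: a_def)
  have "\<not> int p dvd int a" unfolding a using assms(2) by (simp add: dvd_mod_iff)
  then have "\<not> p dvd a" by simp
  then have "[a ^ (p - 1) = 1] (mod p)" by (rule fermat_theorem[OF assms(1)])
  then have 1: "[int a ^ (p - 1) = 1] (mod int p)" using cong_int_iff[of "a ^ (p - 1)" 1 p] by simp
  have "[t ^ (p - 1) = int a ^ (p - 1)] (mod int p)" unfolding a by (rule cong_pow) (simp add: cong_def)
  then have "[t ^ (p - 1) = 1] (mod int p)" using 1 by (rule cong_trans)
  then show ?thesis by (simp add: cong_iff_dvd_diff)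
qed

section \<open>The relations of the list hold in the quotients\<close>

fun letter_coords :: "letter \<Rightarrow> coords" where
  "letter_coords (GA i) = (0, if i = 1 then 1 else 0, if i = 2 then 1 else 0, if i = 3 then 1 else 0, if i = 4 then 1 else 0)"
| "letter_coords GB = (1, 0, 0, 0, 0)"

text \<open>The parameters \<open>s\<close> and \<open>u\<close> of the members of the list. In \<open>F8\<close>, \<open>a\<^sub>4 = a\<^sub>1 ^ (t p)\<close> gives
  \<open>a\<^sub>1 ^ p = a\<^sub>4 ^ s\<close> for the inverse \<open>s\<close> of \<open>t\<close>, which is \<open>t ^ (p - 2)\<close> by Fermat.\<close>

fun s_of :: "entry \<Rightarrow> int" where
  "s_of (F2 m) = 1"
| "s_of (F4 m t) = (if t = 2 then 0 else 1)"
| "s_of (F8 p m t) = t ^ (p - 2)"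
| "s_of e = 0"

fun u_of :: "entry \<Rightarrow> int" where
  "u_of (F3 m) = 1"
| "u_of (F5 m) = 1"
| "u_of (F7 p m) = 1"
| "u_of e = 0"

context marked
begin

lemma phi_bm: "\<phi> (int p ^ m, 0, 0, 0, 0) = \<phi> (0, 0, 0, 0, u)"
  using phi_carry[of 0 1 0 0 0 0] by simp

abbreviation ev :: "letter word \<Rightarrow> 'a" where "ev w \<equiv> weval G (\<lambda>z. \<phi> (letter_coords z)) w"

lemma ev_simps:
  "ev (wpow w k) = ev w [^] k" "ev (wcomm v w) = commutator G (ev v) (ev w)"
  "ev (v @ w) = ev v \<otimes> ev w" "ev [] = \<one>" "ev [(z, True)] = \<phi> (letter_coords z)"
proof -
  note c = phi_closed
  show "ev (wpow w k) = ev w [^] k" by (rule weval_wpow) simp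
  show "ev (wcomm v w) = commutator G (ev v) (ev w)" by (rule weval_wcomm) simp
  show "ev (v @ w) = ev v \<otimes> ev w" by (rule weval_append) simp
  show "ev [] = \<one>" by (simp add: weval_def)
  show "ev [(z, True)] = \<phi> (letter_coords z)" by (rule weval_letter) simp
qed

lemmas model_simps = ev_simps letter_coords.simps phi_vec_pow phi_b_pow phi_commutator commutator_HG_vec

end

text \<open>The relation 2 + x = s x^3 makes the a-part cyclic of order 16, with x acting as -2 for
  s = 0 and as 6 for s = 1; a_4 is the power 8 of a_1.\<close>

lemma model_2:
  fixes G (structure)
  assumes "marked G 2 m s u \<phi>" and e: "e \<in> {F1 m, F2 m, F3 m}" "s = s_of e" "u = u_of e"
    and rel: "(l, r) \<in> rels e"
  shows "weval G (\<lambda>z. \<phi> (letter_coords z)) l = weval G (\<lambda>z. \<phi> (letter_coords z)) r"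
proof -
  interpret marked G 2 m s u \<phi> by fact
  \<comment> \<open>Here and below, the numbers given to the rule are the coefficients n_1, ..., n_4
    of the multiplier of 2 + x - s x^3.\<close>
  have 16: "\<phi> (0, 16, 0, 0, 0) = \<one>"
    unfolding phi_eq_0 by (rule LatI2[of _ 8 _ "-4" _ 2 _ "4 * s - 1"]) auto
  have b: "\<phi> (2 ^ m, 0, 0, 0, 0) = \<phi> (0, 0, 0, 0, u)" using phi_bm by simp
  have c2: "\<phi> (0, 0, 1, 0, 0) = \<phi> (0, - 2, 0, 0, 0)" if "s = 0"
    unfolding phi_eq_same by (rule LatI2[of _ 1 _ 0 _ 0 _ 0]) (use that in auto)
  have c6: "\<phi> (0, 0, 1, 0, 0) = \<phi> (0, 6, 0, 0, 0)" if "s = 1"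
    unfolding phi_eq_same by (rule LatI2[of _ "-3" _ 2 _ "-1" _ "-1"]) (use that in auto)
  have c8: "\<phi> (0, 0, 0, 0, 1) = \<phi> (0, 8, 0, 0, 0)" if "s = 0"
    unfolding phi_eq_same by (rule LatI2[of _ "-4" _ 2 _ "-1" _ 1]) (use that in auto)
  show ?thesis using e rel 16 b c2 c6 c8 phi_one by (auto simp: model_simps)
qed

text \<open>From 3 + 3 x + x^2 = s x^3 and its multiples by x follow 3 x^2 = 0 and x^3 = -3 x. So
  a_4 is the power -3 of a_2, and a_3 is expressed by a_1 and a_2 with t = -1 - s modulo 3.\<close>

lemma model_3:
  fixes G (structure)
  assumes "marked G 3 m s u \<phi>" and e: "e \<in> {F4 m 1, F4 m 2, F5 m}" "s = s_of e" "u = u_of e"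
    and rel: "(l, r) \<in> rels e"
  shows "weval G (\<lambda>z. \<phi> (letter_coords z)) l = weval G (\<lambda>z. \<phi> (letter_coords z)) r"
proof -
  interpret marked G 3 m s u \<phi> by fact
  have 9: "\<phi> (0, 9, 0, 0, 0) = \<one>" "\<phi> (0, 0, 9, 0, 0) = \<one>"
    unfolding phi_eq_0 by (rule LatI3[of _ 3 _ "-3" _ 2 _ "s - 1"]; simp)
      (rule LatI3[of _ 0 _ 3 _ "-3" _ 2]; simp)
  have b: "\<phi> (3 ^ m, 0, 0, 0, 0) = \<phi> (0, 0, 0, 0, u)" using phi_bm by simp
  have c3: "\<phi> (0, 0, 0, 1, 0) = \<phi> (0, - 3, 3, 0, 0)" if "s = 1"
    unfolding phi_eq_same by (rule LatI3[of _ 1 _ "-2" _ 2 _ "-1"]) (use that in auto)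
  have c6: "\<phi> (0, 0, 0, 1, 0) = \<phi> (0, - 3, 6, 0, 0)" if "s = 0"
    unfolding phi_eq_same by (rule LatI3[of _ 1 _ "-3" _ 3 _ "-2"]) (use that in auto)
  have c0: "\<phi> (0, 0, 0, 1, 0) = \<phi> (0, - 3, - 3, 0, 0)" if "s = 0"
    unfolding phi_eq_same by (rule LatI3[of _ 1 _ 0 _ 0 _ 0]) (use that in auto)
  have c4: "\<phi> (0, 0, 0, 0, 1) = \<phi> (0, 0, - 3, 0, 0)"
    unfolding phi_eq_same by (rule LatI3[of _ 0 _ 1 _ "-1" _ 1]) auto
  show ?thesis using e rel 9 b c3 c6 c0 c4 phi_one by (auto simp: model_simps)
qed

text \<open>Here a_2, a_3, a_4 have order p and the p-th power of a_1 is a_4^s. In F8, s t = 1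
  modulo p by Fermat, which turns this into the listed relation for a_4.\<close>

lemma model_5:
  fixes G (structure)
  assumes "marked G p m s u \<phi>" and p: "p \<ge> 5"
    and e: "e = F6 p m \<or> e = F7 p m \<or> (e = F8 p m t \<and> \<not> int p dvd t)" "s = s_of e" "u = u_of e"
    and rel: "(l, r) \<in> rels e"
  shows "weval G (\<lambda>z. \<phi> (letter_coords z)) l = weval G (\<lambda>z. \<phi> (letter_coords z)) r"
proof -
  interpret marked G p m s u \<phi> by fact
  note L = LatI5[OF prime p]
  have pow: "\<phi> (0, int p * c1, int p * c2, int p * c3, int p * c4 - s * c1) = \<one>" for c1 c2 c3 c4
    unfolding phi_eq_0 by (rule L) auto
  have pa: "\<phi> (0, 0, int p, 0, 0) = \<one>" "\<phi> (0, 0, 0, int p, 0) = \<one>" "\<phi> (0, 0, 0, 0, int p) = \<one>"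
    "s = 0 \<Longrightarrow> \<phi> (0, int p, 0, 0, 0) = \<one>" "\<phi> (0, (int p)\<^sup>2, 0, 0, 0) = \<one>"
    using pow[of 0 1 0 0] pow[of 0 0 1 0] pow[of 0 0 0 1] pow[of 1 0 0 0] pow[of p 0 0 s]
    by (simp_all add: power2_eq_square mult.commute)
  have pow0: "\<phi> (0, int p * c1, int p * c2, int p * c3, int p * c4) = \<one>" if "s = 0" for c1 c2 c3 c4
    using pow[of c1 c2 c3 c4] that by simp
  have one: "\<phi> (0, 0, 0, 0, 0) = \<one>" by (rule phi_one)
  have b: "\<phi> (int p * int p ^ m, 0, 0, 0, 0) = \<phi> (0, 0, 0, 0, u * p)"
    using phi_carry[of 0 p 0 0 0 0] by (simp add: mult.commute)
  show ?thesis
    using e(1)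
  proof (elim disjE conjE)
    assume e6: "e = F6 p m"
    have j3: "i = 1 \<or> i = 2 \<or> i = 3" if "Suc 0 \<le> i" "i \<le> 3" for i :: nat using that by auto
    show ?thesis using rel e(2,3) pa one phi_bm pow0 unfolding e6
      by (auto simp: model_simps dest!: j3)
  next
    assume e7: "e = F7 p m"
    have j2: "i = 1 \<or> i = 2" if "Suc 0 \<le> i" "i \<le> 2" for i :: nat using that by auto
    show ?thesis using rel e(2,3) pa one phi_bm b pow0[of _ _ _ 0, simplified mult_zero_right] unfolding e7
      by (auto simp: model_simps dest!: j2)
  next
    assume e8: "e = F8 p m t" and t: "\<not> int p dvd t"
    have "int p dvd t ^ (p - 1) - 1" by (rule fermat_int[OF prime t])
    moreover have "p - 1 = Suc (p - 2)" using p by simp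
    ultimately have "int p dvd t * s - 1" using e(2) unfolding e8 by simp
    then have "int p dvd 1 - t * s" by (simp add: dvd_diff_commute)
    then have c: "\<phi> (0, 0, 0, 0, 1) = \<phi> (0, t * int p, 0, 0, 0)"
      unfolding phi_eq_same by (intro L[of _ "- t"]) (simp_all add: mult.commute)
    have sets: "{2..3} = {2, 3::nat}" "{1..2} = {1, 2::nat}" by auto
    have "u = 0" using e(3) unfolding e8 by simp
    then have bm: "\<phi> (int p ^ m, 0, 0, 0, 0) = \<one>" using phi_bm one by simp
    from rel[unfolded e8 rels.simps sets] show ?thesis
      by (elim UnE CollectE exE conjE insertE emptyE)
        (simp_all add: model_simps pa(1,2,5) one bm c)
  qed
qed

section \<open>Consequences of the relations in an arbitrary group\<close>

context group
begin

lemma generate_commute: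
  assumes X: "X \<subseteq> carrier G" and comm: "\<And>x y. x \<in> X \<Longrightarrow> y \<in> X \<Longrightarrow> x \<otimes> y = y \<otimes> x"
    and "x \<in> generate G X" "y \<in> generate G X"
  shows "x \<otimes> y = y \<otimes> x"
proof -
  have cent: "subgroup {z \<in> carrier G. w \<otimes> z = z \<otimes> w} G" if w: "w \<in> carrier G" for w
  proof (rule subgroupI)
    show "{z \<in> carrier G. w \<otimes> z = z \<otimes> w} \<noteq> {}" using w by (auto intro!: exI[of _ \<one>])
    fix z z' assume z: "z \<in> {z \<in> carrier G. w \<otimes> z = z \<otimes> w}" "z' \<in> {z \<in> carrier G. w \<otimes> z = z \<otimes> w}"
    then have "w \<otimes> (z \<otimes> z') = (z \<otimes> w) \<otimes> z'" using w by (simp add: m_assoc[symmetric])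
    also have "\<dots> = (z \<otimes> z') \<otimes> w" using z w by (simp add: m_assoc)
    finally show "z \<otimes> z' \<in> {z \<in> carrier G. w \<otimes> z = z \<otimes> w}" using z by simp
  next
    fix z assume z: "z \<in> {z \<in> carrier G. w \<otimes> z = z \<otimes> w}"
    then have "inv z \<otimes> w = w \<otimes> inv z" using w
      by (metis (mono_tags, lifting) inv_closed inv_solve_left inv_solve_right m_assoc m_closed mem_Collect_eq)
    then show "inv z \<in> {z \<in> carrier G. w \<otimes> z = z \<otimes> w}" using z by simp
  qed auto
  have 1: "w \<otimes> z = z \<otimes> w" if "w \<in> X" "z \<in> generate G X" for w z
  proof -
    have w: "w \<in> carrier G" using that X by blast
    have "generate G X \<subseteq> {z \<in> carrier G. w \<otimes> z = z \<otimes> w}"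
      by (rule generate_subgroup_incl[OF _ cent[OF w]]) (use that X comm in auto)
    then show ?thesis using that by blast
  qed
  have x: "x \<in> carrier G" using assms(3) generate_in_carrier[OF X] by blast
  have "generate G X \<subseteq> {z \<in> carrier G. x \<otimes> z = z \<otimes> x}"
    by (rule generate_subgroup_incl[OF _ cent[OF x]]) (use X 1[OF _ assms(3)] in fastforce)
  then show ?thesis using assms(4) by blast
qed

lemma commutator_closed [simp]:
  "x \<in> carrier G \<Longrightarrow> y \<in> carrier G \<Longrightarrow> commutator G x y \<in> carrier G"
  by (simp add: commutator_def)

lemma commutator_conj:
  assumes "x \<in> carrier G" "y \<in> carrier G" "z \<in> carrier G"
  shows "commutator G x y = z \<longleftrightarrow> x \<otimes> y = y \<otimes> (x \<otimes> z)"
proof -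
  have "commutator G x y = inv (y \<otimes> x) \<otimes> (x \<otimes> y)"
    using assms by (simp add: commutator_def inv_mult_group m_assoc)
  moreover have "\<dots> = z \<longleftrightarrow> x \<otimes> y = (y \<otimes> x) \<otimes> z"
    using assms inv_solve_left'[of z "y \<otimes> x" "x \<otimes> y"] by blast
  ultimately show ?thesis using assms by (simp add: m_assoc)
qed

lemma commutator_one_iff:
  assumes "x \<in> carrier G" "y \<in> carrier G"
  shows "commutator G x y = \<one> \<longleftrightarrow> x \<otimes> y = y \<otimes> x"
  using commutator_conj[OF assms one_closed] assms by simp

text \<open>The universal property of \<open>HG\<close> in terms of commutators: the abelian
  subgroup that \<open>helmap_hom\<close> asks for is the one generated by the four commuting
  elements.\<close>

lemma HG_lift:
  assumes c: "a1 \<in> carrier G" "b \<in> carrier G"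
    and a: "a2 = commutator G a1 b" "a3 = commutator G a2 b" "a4 = commutator G a3 b" "commutator G a4 b = \<one>"
    and comm: "a1 \<otimes> a2 = a2 \<otimes> a1" "a1 \<otimes> a3 = a3 \<otimes> a1" "a1 \<otimes> a4 = a4 \<otimes> a1"
      "a2 \<otimes> a3 = a3 \<otimes> a2" "a2 \<otimes> a4 = a4 \<otimes> a2" "a3 \<otimes> a4 = a4 \<otimes> a3"
  obtains \<psi> where "\<psi> \<in> hom HG G" "\<psi> (0, 1, 0, 0, 0) = a1" "\<psi> (0, 0, 1, 0, 0) = a2"
    "\<psi> (0, 0, 0, 1, 0) = a3" "\<psi> (0, 0, 0, 0, 1) = a4" "\<psi> (1, 0, 0, 0, 0) = b"
    "\<And>c1 c2 c3 c4. \<psi> (0, c1, c2, c3, c4) = a1 [^] c1 \<otimes> a2 [^] c2 \<otimes> a3 [^] c3 \<otimes> a4 [^] c4"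
    "\<And>k c4. \<psi> (k, 0, 0, 0, c4) = b [^] k \<otimes> a4 [^] c4"
proof -
  let ?X = "{a1, a2, a3, a4}"
  have cc: "a1 \<in> carrier G" "a2 \<in> carrier G" "a3 \<in> carrier G" "a4 \<in> carrier G" using c a by auto
  have X: "?X \<subseteq> carrier G" using cc by simp
  have "x \<otimes> y = y \<otimes> x" if "x \<in> ?X" "y \<in> ?X" for x y using that comm by auto
  note gc = generate_commute[OF X this]
  have rel: "a1 \<otimes> b = b \<otimes> (a1 \<otimes> a2)" "a2 \<otimes> b = b \<otimes> (a2 \<otimes> a3)"
      "a3 \<otimes> b = b \<otimes> (a3 \<otimes> a4)" "a4 \<otimes> b = b \<otimes> a4"
    using commutator_conj[OF cc(1) c(2) cc(2)] commutator_conj[OF cc(2) c(2) cc(3)]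
      commutator_conj[OF cc(3) c(2) cc(4)] commutator_one_iff[OF cc(4) c(2)] a by blast+
  have "helmap a1 a2 a3 a4 b \<in> hom HG G"
    by (rule helmap_hom[OF generate_is_subgroup[OF X] gc _ _ _ _ c(2) rel]) (auto intro: generate.incl)
  then show ?thesis
    by (rule that) (use helmap_gens[OF cc c(2)] cc c in \<open>simp_all add: helmap_def int_pow_1\<close>)
qed

lemma pow_dvd_one:
  assumes "x \<in> carrier G" "x [^] (k::int) = \<one>" "k dvd l"
  shows "x [^] (l::int) = \<one>"
proof -
  obtain j where "l = k * j" using assms(3) by (rule dvdE)
  then have "x [^] l = (x [^] k) [^] j" using assms(1) by (simp add: int_pow_pow)
  then show ?thesis using assms(2) by simp
qed

lemma pow_commute_int:
  "x \<in> carrier G \<Longrightarrow> x [^] (i::int) \<otimes> x [^] (j::int) = x [^] j \<otimes> x [^] i"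
  by (simp add: int_pow_mult[symmetric] add.commute)

lemma commute_pow_int:
  assumes "x \<in> carrier G" "y \<in> carrier G" "x \<otimes> y = y \<otimes> x"
  shows "x [^] (i::int) \<otimes> y = y \<otimes> x [^] i"
  by (rule conj_int_pow[OF assms(1,2,1,3)])

text \<open>On the cyclic group generated by a, x acts as multiplication by e, so a_2, a_3, a_4 are
  the powers e, e^2, e^3 of a. The two divisibilities by 16 are x^4 = 0 and 2 + x = s x^3.\<close>

lemma pres_2:
  assumes c: "a \<in> carrier G" "b \<in> carrier G"
    and r: "a [^] (16::int) = \<one>" "commutator G a b = a [^] (e::int)"
    and e: "16 dvd e ^ 4" "16 dvd 2 + e - s * e ^ 3" and bm: "b [^] (2 ^ m :: int) = a [^] (u * e ^ 3)"
  obtains \<psi> where "\<psi> \<in> hom HG G" "\<psi> (0, 1, 0, 0, 0) = a" "\<psi> (1, 0, 0, 0, 0) = b"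
    "\<psi> (0, int 2, B2 (int 2), B3 (int 2), B4 (int 2) - s) = \<one>" "\<psi> (int 2 ^ m, 0, 0, 0, - u) = \<one>"
proof -
  have step: "commutator G (a [^] (n::int)) b = a [^] (e * n)" for n
  proof -
    have "a \<otimes> b = b \<otimes> (a \<otimes> a [^] e)" using r(2) commutator_conj[OF c, of "a [^] e"] c by simp
    then have "a \<otimes> b = b \<otimes> a [^] (1 + e)" using c by (simp add: int_pow_mult int_pow_1)
    from conj_int_pow[OF c _ this, of n] have "a [^] n \<otimes> b = b \<otimes> a [^] ((1 + e) * n)"
      using c by (simp add: int_pow_pow)
    also have "a [^] ((1 + e) * n) = a [^] n \<otimes> a [^] (e * n)"
      using c by (simp add: int_pow_mult[symmetric] algebra_simps)
    finally show ?thesis using commutator_conj[of "a [^] n" b "a [^] (e * n)"] c by simp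
  qed
  let ?a2 = "a [^] e" and ?a3 = "a [^] (e * e)" and ?a4 = "a [^] (e * (e * e))"
  have e4: "e * (e * (e * e)) = e ^ 4" "e * (e * e) = e ^ 3" by (simp_all add: numeral_eq_Suc)
  have a1: "a = a [^] (1::int)" using c by (simp add: int_pow_1)
  have a5: "commutator G ?a4 b = \<one>"
    unfolding step e4(1) by (rule pow_dvd_one[OF c(1) r(1) e(1)])
  have "?a2 = commutator G a b" using r(2) by simp
  moreover have "?a3 = commutator G ?a2 b" "?a4 = commutator G ?a3 b" unfolding step by simp_all
  moreover have "a \<otimes> a [^] i = a [^] i \<otimes> a" for i :: int using commute_pow_int[OF c(1,1)] by metis
  moreover note a5 pow_commute_int[OF c(1)]
  ultimately obtain \<psi> where psi: "\<psi> \<in> hom HG G" "\<psi> (0, 1, 0, 0, 0) = a" "\<psi> (1, 0, 0, 0, 0) = b"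
    "\<And>c1 c2 c3 c4. \<psi> (0, c1, c2, c3, c4) = a [^] c1 \<otimes> ?a2 [^] c2 \<otimes> ?a3 [^] c3 \<otimes> ?a4 [^] c4"
    "\<And>k c4. \<psi> (k, 0, 0, 0, c4) = b [^] k \<otimes> ?a4 [^] c4"
    using HG_lift[OF c, of ?a2 ?a3 ?a4] by metis
  show ?thesis
  proof (rule that[OF psi(1-3)])
    have "\<psi> (0, int 2, B2 (int 2), B3 (int 2), B4 (int 2) - s) = a [^] (2 + e - s * e ^ 3)"
      unfolding psi(4) using c e4(2) by (simp add: int_pow_pow int_pow_mult[symmetric] B2_def B3_def B4_def algebra_simps)
    then show "\<psi> (0, int 2, B2 (int 2), B3 (int 2), B4 (int 2) - s) = \<one>"
      using pow_dvd_one[OF c(1) r(1) e(2)] by simp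
    show "\<psi> (int 2 ^ m, 0, 0, 0, - u) = \<one>"
      unfolding psi(5) e4 using c bm by (simp add: int_pow_pow int_pow_mult[symmetric] algebra_simps)
  qed
qed

text \<open>x sends a to d and d to a^(-3) d^(3 t); as both have exponent 9, x^3 sends a to d^(-3).
  The relator 3 + 3 x + x^2 - s x^3 then sends a to d^(3 + 3 t + 3 s), whence the condition on
  s.\<close>

lemma pres_3:
  assumes c: "a \<in> carrier G" "d \<in> carrier G" "b \<in> carrier G"
    and r: "a [^] (9::int) = \<one>" "d [^] (9::int) = \<one>" "commutator G a b = d"
      "commutator G d b = a [^] (-3::int) \<otimes> d [^] (3 * t :: int)" "commutator G a d = \<one>"
    and s: "3 dvd 1 + t + s" and bm: "b [^] (3 ^ m :: int) = d [^] (-3 * u :: int)"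
  obtains \<psi> where "\<psi> \<in> hom HG G" "\<psi> (0, 1, 0, 0, 0) = a" "\<psi> (0, 0, 1, 0, 0) = d" "\<psi> (1, 0, 0, 0, 0) = b"
    "\<psi> (0, int 3, B2 (int 3), B3 (int 3), B4 (int 3) - s) = \<one>" "\<psi> (int 3 ^ m, 0, 0, 0, - u) = \<one>"
proof -
  define mu where "mu i j = a [^] i \<otimes> d [^] j" for i j :: int
  have muc [simp]: "mu i j \<in> carrier G" for i j using c by (simp add: mu_def)
  have ad: "a \<otimes> d = d \<otimes> a" using r(5) commutator_one_iff c by simp
  have adp: "d [^] (j::int) \<otimes> a [^] (i::int) = a [^] i \<otimes> d [^] j" for i j
  proof -
    have "a [^] i \<otimes> d = d \<otimes> a [^] i" by (rule commute_pow_int[OF c(1,2) ad])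
    then have "d \<otimes> a [^] i = a [^] i \<otimes> d" by simp
    then show ?thesis using commute_pow_int[of d "a [^] i" j] c by simp
  qed
  have mu_mult: "mu i j \<otimes> mu k l = mu (i + k) (j + l)" for i j k l
  proof -
    have "mu i j \<otimes> mu k l = a [^] i \<otimes> (d [^] j \<otimes> a [^] k) \<otimes> d [^] l"
      unfolding mu_def using c by (simp add: m_assoc)
    also have "\<dots> = (a [^] i \<otimes> a [^] k) \<otimes> (d [^] j \<otimes> d [^] l)"
      unfolding adp using c by (simp add: m_assoc)
    finally show ?thesis unfolding mu_def using c by (simp add: int_pow_mult)
  qed
  have mu_comm: "mu i j \<otimes> mu k l = mu k l \<otimes> mu i j" for i j k l
    unfolding mu_mult by (simp add: add.commute)
  have mu_pow: "mu i j [^] (n::int) = mu (i * n) (j * n)" for i j n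
    using int_pow_mult_distrib[of "a [^] i" "d [^] j" n] adp[of j i] c by (simp add: mu_def int_pow_pow)
  have mu9: "mu (9 * i) (9 * j) = \<one>" for i j
    unfolding mu_def using pow_dvd_one[OF c(1) r(1)] pow_dvd_one[OF c(2) r(2)] by simp
  have mu_red: "mu i j = mu k l" if d: "9 dvd i - k" "9 dvd j - l" for i j k l
  proof -
    obtain x where x: "i - k = 9 * x" using d(1) by (rule dvdE)
    obtain y where y: "j - l = 9 * y" using d(2) by (rule dvdE)
    have "mu i j = mu (9 * x) (9 * y) \<otimes> mu k l" unfolding mu_mult using x y by (simp add: algebra_simps)
    then show ?thesis unfolding mu9 by simp
  qed
  have am: "a = mu 1 0" "d = mu 0 1" "\<one> = mu 0 0" using c by (simp_all add: mu_def int_pow_1)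
  have r3: "commutator G d b = mu (-3) (3 * t)" using r(4) by (simp add: mu_def)
  have conj: "mu i j \<otimes> b = b \<otimes> mu (i - 3 * j) (j + i + 3 * t * j)" for i j
  proof -
    have "a \<otimes> b = b \<otimes> (a \<otimes> d)" using commutator_conj[OF c(1,3,2)] r(3) by simp
    then have 1: "a \<otimes> b = b \<otimes> mu 1 1" using c by (simp add: mu_def int_pow_1)
    have "d \<otimes> b = b \<otimes> (d \<otimes> mu (-3) (3 * t))"
      using commutator_conj[OF c(2,3) muc] r3 by blast
    then have 2: "d \<otimes> b = b \<otimes> mu (- 3) (1 + 3 * t)" unfolding am(2) mu_mult by simp
    have "mu i j \<otimes> b = a [^] i \<otimes> (d [^] j \<otimes> b)" unfolding mu_def using c by (simp add: m_assoc)
    also have "d [^] j \<otimes> b = b \<otimes> mu (- 3 * j) ((1 + 3 * t) * j)"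
      using conj_int_pow[OF c(2,3) muc 2, of j] unfolding mu_pow .
    also have "a [^] i \<otimes> (b \<otimes> mu (- 3 * j) ((1 + 3 * t) * j)) = (a [^] i \<otimes> b) \<otimes> mu (- 3 * j) ((1 + 3 * t) * j)"
      using c by (simp add: m_assoc)
    also have "a [^] i \<otimes> b = b \<otimes> mu (1 * i) (1 * i)"
      using conj_int_pow[OF c(1,3) muc 1, of i] unfolding mu_pow .
    also have "b \<otimes> mu (1 * i) (1 * i) \<otimes> mu (- 3 * j) ((1 + 3 * t) * j) =
        b \<otimes> (mu (1 * i) (1 * i) \<otimes> mu (- 3 * j) ((1 + 3 * t) * j))" using c by (simp add: m_assoc)
    finally show ?thesis unfolding mu_mult by (simp add: algebra_simps)
  qed
  have com: "commutator G (mu i j) b = mu k l" if "9 dvd - 3 * j - k" "9 dvd i + 3 * t * j - l" for i j k l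
  proof -
    have "mu i j \<otimes> mu k l = mu (i - 3 * j) (j + i + 3 * t * j)"
      unfolding mu_mult by (rule mu_red)
        (use that in \<open>simp_all add: algebra_simps, simp_all add: dvd_diff_commute algebra_simps\<close>)
    then show ?thesis using commutator_conj[OF muc c(3) muc] conj by simp
  qed
  let ?a3 = "mu (-3) (3 * t)" and ?a4 = "mu 0 (-3)"
  have "d = commutator G a b" "?a3 = commutator G d b" using r r3 by simp_all
  moreover have "?a4 = commutator G ?a3 b"
    by (rule com[symmetric]) (simp_all add: algebra_simps)
  moreover have "commutator G ?a4 b = \<one>" unfolding am(3) by (rule com) (simp_all add: algebra_simps)
  moreover have "a \<otimes> mu i j = mu i j \<otimes> a" "d \<otimes> mu i j = mu i j \<otimes> d" for i j
    unfolding am(1,2) by (rule mu_comm)+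
  moreover note mu_comm ad
  ultimately obtain \<psi> where psi: "\<psi> \<in> hom HG G" "\<psi> (0, 1, 0, 0, 0) = a" "\<psi> (0, 0, 1, 0, 0) = d" "\<psi> (1, 0, 0, 0, 0) = b"
    "\<And>c1 c2 c3 c4. \<psi> (0, c1, c2, c3, c4) = a [^] c1 \<otimes> d [^] c2 \<otimes> ?a3 [^] c3 \<otimes> ?a4 [^] c4"
    "\<And>k c4. \<psi> (k, 0, 0, 0, c4) = b [^] k \<otimes> ?a4 [^] c4"
    using HG_lift[OF c(1,3), of d ?a3 ?a4] by metis
  show ?thesis
  proof (rule that[OF psi(1-4)])
    have "\<psi> (0, int 3, B2 (int 3), B3 (int 3), B4 (int 3) - s) = mu 3 3 \<otimes> ?a3 [^] (1::int) \<otimes> ?a4 [^] (- s)"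
      unfolding psi(5) by (simp add: mu_def B2_def B3_def B4_def)
    also have "\<dots> = mu 0 (3 + 3 * t + 3 * s)" unfolding mu_pow mu_mult by simp
    also have "\<dots> = mu 0 0" by (rule mu_red) (use mult_dvd_mono[OF dvd_refl[of 3] s] in \<open>simp_all add: algebra_simps\<close>)
    finally show "\<psi> (0, int 3, B2 (int 3), B3 (int 3), B4 (int 3) - s) = \<one>" unfolding am(3) .
    have "\<psi> (int 3 ^ m, 0, 0, 0, - u) = mu 0 (-3 * u) \<otimes> ?a4 [^] (- u)"
      unfolding psi(6) using bm c by (simp add: mu_def)
    then show "\<psi> (int 3 ^ m, 0, 0, 0, - u) = \<one>" unfolding mu_pow mu_mult am(3) by simp
  qed
qed

text \<open>Common core of F6, F7 and F8, with a_4 a commutator rather than a generator: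
  divisibility of the binomials by p kills every term of the lattice relator except those of a_1^p
  and a_4^(-s).\<close>

lemma pres_6:
  assumes p: "prime p" "p \<ge> 5"
    and c: "a1 \<in> carrier G" "b \<in> carrier G"
    and a: "a2 = commutator G a1 b" "a3 = commutator G a2 b" "a4 = commutator G a3 b" "commutator G a4 b = \<one>"
    and comm: "commutator G a1 a2 = \<one>" "commutator G a1 a3 = \<one>" "commutator G a4 a1 = \<one>"
      "commutator G a2 a3 = \<one>" "commutator G a4 a2 = \<one>" "commutator G a4 a3 = \<one>"
    and pw: "a2 [^] int p = \<one>" "a3 [^] int p = \<one>" "a4 [^] int p = \<one>"
      and r: "a1 [^] int p = a4 [^] s" and bm: "b [^] (int p ^ m) = a4 [^] u"
  obtains \<psi> where "\<psi> \<in> hom HG G" "\<psi> (0, 1, 0, 0, 0) = a1" "\<psi> (0, 0, 1, 0, 0) = a2"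
    "\<psi> (0, 0, 0, 1, 0) = a3" "\<psi> (0, 0, 0, 0, 1) = a4" "\<psi> (1, 0, 0, 0, 0) = b"
    "\<psi> (0, int p, B2 (int p), B3 (int p), B4 (int p) - s) = \<one>" "\<psi> (int p ^ m, 0, 0, 0, - u) = \<one>"
proof -
  have cc: "a1 \<in> carrier G" "a2 \<in> carrier G" "a3 \<in> carrier G" "a4 \<in> carrier G" using c a by auto
  have co: "a1 \<otimes> a2 = a2 \<otimes> a1" "a1 \<otimes> a3 = a3 \<otimes> a1" "a1 \<otimes> a4 = a4 \<otimes> a1"
      "a2 \<otimes> a3 = a3 \<otimes> a2" "a2 \<otimes> a4 = a4 \<otimes> a2" "a3 \<otimes> a4 = a4 \<otimes> a3"
    using comm commutator_one_iff cc by metis+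
  obtain \<psi> where psi: "\<psi> \<in> hom HG G" "\<psi> (0, 1, 0, 0, 0) = a1" "\<psi> (0, 0, 1, 0, 0) = a2"
    "\<psi> (0, 0, 0, 1, 0) = a3" "\<psi> (0, 0, 0, 0, 1) = a4" "\<psi> (1, 0, 0, 0, 0) = b"
    "\<And>c1 c2 c3 c4. \<psi> (0, c1, c2, c3, c4) = a1 [^] c1 \<otimes> a2 [^] c2 \<otimes> a3 [^] c3 \<otimes> a4 [^] c4"
    "\<And>k c4. \<psi> (k, 0, 0, 0, c4) = b [^] k \<otimes> a4 [^] c4"
    using HG_lift[OF c a co] by metis
  note B = B_prime[OF p]
  show ?thesis
  proof (rule that[OF psi(1-6)])
    have "a2 [^] B2 (int p) = \<one>" "a3 [^] B3 (int p) = \<one>" "a4 [^] B4 (int p) = \<one>"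
      using pow_dvd_one[OF cc(2) pw(1) B(1)] pow_dvd_one[OF cc(3) pw(2) B(2)] pow_dvd_one[OF cc(4) pw(3) B(3)]
      by blast+
    moreover have "a4 [^] (B4 (int p) - s) = a4 [^] B4 (int p) \<otimes> a4 [^] (- s)"
      using int_pow_mult[OF cc(4), of "B4 (int p)" "- s"] by simp
    ultimately show "\<psi> (0, int p, B2 (int p), B3 (int p), B4 (int p) - s) = \<one>"
      unfolding psi(7) r using cc by (simp add: int_pow_mult[symmetric])
    show "\<psi> (int p ^ m, 0, 0, 0, - u) = \<one>"
      unfolding psi(8) bm using cc by (simp add: int_pow_mult[symmetric])
  qed
qed

text \<open>In \<open>F7\<close> the centrality of \<open>b ^ (p ^ m)\<close> has to be derived from the relations.\<close>

lemma pres_7_central: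
  assumes p: "prime p" "p \<ge> 5" "m \<ge> 1"
    and c: "a1 \<in> carrier G" "b \<in> carrier G"
    and a: "a2 = commutator G a1 b" "a3 = commutator G a2 b" "z = commutator G a3 b"
      "z = b [^] (int p ^ m)"
    and comm: "a1 \<otimes> a2 = a2 \<otimes> a1" "a1 \<otimes> a3 = a3 \<otimes> a1" "a2 \<otimes> a3 = a3 \<otimes> a2"
    and pw: "a2 [^] int p = \<one>" "a3 [^] int p = \<one>" "b [^] (int p ^ (m + 1)) = \<one>"
  shows "a1 \<otimes> z = z \<otimes> a1" "a2 \<otimes> z = z \<otimes> a2" "a3 \<otimes> z = z \<otimes> a3"
    "commutator G z b = \<one>" "z [^] int p = \<one>"
proof -
  have cc: "a1 \<in> carrier G" "a2 \<in> carrier G" "a3 \<in> carrier G" "z \<in> carrier G" using c a(1-3) by auto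
  have zb: "z \<otimes> b = b \<otimes> z" unfolding a(4) by (rule commute_pow_int[OF c(2,2) HOL.refl])
  then show "commutator G z b = \<one>" using commutator_one_iff cc c by simp
  show zp: "z [^] int p = \<one>" using pw(3) c by (simp add: a(4) int_pow_pow mult.commute)
  have rel: "a1 \<otimes> b = b \<otimes> (a1 \<otimes> a2)" "a2 \<otimes> b = b \<otimes> (a2 \<otimes> a3)" "a3 \<otimes> b = b \<otimes> (a3 \<otimes> z)"
    using commutator_conj[OF cc(1) c(2) cc(2)] commutator_conj[OF cc(2) c(2) cc(3)]
      commutator_conj[OF cc(3) c(2) cc(4)] a by blast+
  have bzi: "b \<otimes> inv z = inv z \<otimes> b"
    using commute_pow_int[OF cc(4) c(2) zb, of "-1"] cc by (simp add: int_pow_neg int_pow_1)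
  \<comment> \<open>a_3 conjugates b to b z^(-1). Since z commutes with b and z^p = 1, raising to
    the power p^m shows that a_3 fixes z.\<close>
  have "a3 \<otimes> (b \<otimes> inv z) = (a3 \<otimes> b) \<otimes> inv z" using cc c by (simp add: m_assoc)
  also have "\<dots> = b \<otimes> a3" unfolding rel(3) using cc c by (simp add: m_assoc)
  finally have "b \<otimes> a3 = a3 \<otimes> (b \<otimes> inv z)" by simp
  from conj_int_pow[OF c(2) cc(3) _ this, of "int p ^ m"]
  have "z \<otimes> a3 = a3 \<otimes> (b \<otimes> inv z) [^] (int p ^ m)" using cc c a(4) by simp
  also have "(b \<otimes> inv z) [^] (int p ^ m) = z \<otimes> inv z [^] (int p ^ m)"
    using int_pow_mult_distrib[OF bzi c(2), of "int p ^ m"] cc a(4) by simp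
  also have "inv z [^] (int p ^ m) = \<one>"
    using pow_dvd_one[of "inv z" "int p" "int p ^ m"] zp cc p(3)
    by (simp add: int_pow_inv dvd_power)
  finally show a3z: "a3 \<otimes> z = z \<otimes> a3" using cc by simp
  have pp: "x [^] int n = \<one>" if "x \<in> carrier G" "x [^] int p = \<one>" "int p dvd int n" for x n
    using pow_dvd_one[OF that] .
  have P3: "a3 [^] n \<otimes> b = b \<otimes> (a3 [^] n \<otimes> z [^] n)" for n :: int
    using conj_int_pow[OF cc(3) c(2) _ rel(3), of n] int_pow_mult_distrib[OF a3z cc(3,4), of n] cc by simp
  have a3z': "a3 [^] i \<otimes> z [^] j = z [^] j \<otimes> a3 [^] i" for i j :: int
    using commute_pow_int[of a3 "z [^] j" i] commute_pow_int[OF cc(4,3) a3z[symmetric], of j] cc by simp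
  have a23: "a2 [^] i \<otimes> a3 [^] j = a3 [^] j \<otimes> a2 [^] i" for i j :: int
    using commute_pow_int[of a2 "a3 [^] j" i] commute_pow_int[OF cc(3,2) comm(3)[symmetric], of j] cc by simp
  have P2: "a2 [^] n \<otimes> b = b \<otimes> (a2 [^] n \<otimes> a3 [^] n)" for n :: int
    using conj_int_pow[OF cc(2) c(2) _ rel(2), of n] int_pow_mult_distrib[OF comm(3) cc(2,3), of n] cc by simp
  have Pz: "z [^] n \<otimes> b = b \<otimes> z [^] n" for n :: int by (rule commute_pow_int[OF cc(4) c(2) zb])
  \<comment> \<open>b^n is collected past a_2. At n = p^m the exponents n and B2 n are multiples of
    p, so the correction vanishes and a_2 commutes with z; \<open>A1\<close> repeats this for a_1
    with B3.\<close>
  have A2: "a2 \<otimes> b [^] int n = b [^] int n \<otimes> (a2 \<otimes> (a3 [^] int n \<otimes> z [^] B2 (int n)))" for n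
  proof (induction n)
    case (Suc n)
    let ?n = "int n"
    have "a2 \<otimes> b [^] (?n + 1) = (a2 \<otimes> b [^] ?n) \<otimes> b" using cc c by (simp add: int_pow_mult int_pow_1 m_assoc)
    also have "\<dots> = b [^] ?n \<otimes> (a2 \<otimes> (a3 [^] ?n \<otimes> (z [^] B2 ?n \<otimes> b)))"
      unfolding Suc using cc c by (simp add: m_assoc)
    also have "\<dots> = b [^] ?n \<otimes> (a2 \<otimes> ((a3 [^] ?n \<otimes> b) \<otimes> z [^] B2 ?n))"
      unfolding Pz using cc c by (simp add: m_assoc)
    also have "\<dots> = b [^] ?n \<otimes> ((a2 \<otimes> b) \<otimes> (a3 [^] ?n \<otimes> (z [^] ?n \<otimes> z [^] B2 ?n)))"
      unfolding P3 using cc c by (simp add: m_assoc)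
    also have "\<dots> = (b [^] ?n \<otimes> b) \<otimes> (a2 \<otimes> ((a3 \<otimes> a3 [^] ?n) \<otimes> (z [^] ?n \<otimes> z [^] B2 ?n)))"
      unfolding rel(2) using cc c by (simp add: m_assoc)
    also have "b [^] ?n \<otimes> b = b [^] (?n + 1)" using c by (simp add: int_pow_mult int_pow_1)
    also have "a3 \<otimes> a3 [^] ?n = a3 [^] (?n + 1)" using cc int_pow_mult[of a3 1 ?n] by (simp add: int_pow_1 add.commute)
    also have "z [^] ?n \<otimes> z [^] B2 ?n = z [^] B2 (?n + 1)" unfolding B2_Suc using cc int_pow_mult[of z ?n "B2 ?n"] by (simp add: add.commute)
    finally show ?case by (simp add: add.commute)
  qed (use cc in simp)
  have pm: "int p dvd int (p ^ m)" using p(3) by (simp add: dvd_power)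
  have Bpm: "int p dvd B2 (int (p ^ m))" "int p dvd B3 (int (p ^ m))"
    using B_prime_power[OF p] by simp_all
  have zpm: "b [^] int (p ^ m) = z" using a(4) by simp
  show a2z: "a2 \<otimes> z = z \<otimes> a2"
    using A2[of "p ^ m"] pow_dvd_one[OF cc(3) pw(2) pm] pow_dvd_one[OF cc(4) zp Bpm(1)] cc
    unfolding zpm by simp
  have A1: "a1 \<otimes> b [^] int n = b [^] int n \<otimes> (a1 \<otimes> (a2 [^] int n \<otimes> (a3 [^] B2 (int n) \<otimes> z [^] B3 (int n))))" for n
  proof (induction n)
    case (Suc n)
    let ?n = "int n"
    have "a1 \<otimes> b [^] (?n + 1) = (a1 \<otimes> b [^] ?n) \<otimes> b" using cc c by (simp add: int_pow_mult int_pow_1 m_assoc)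
    also have "\<dots> = b [^] ?n \<otimes> (a1 \<otimes> (a2 [^] ?n \<otimes> (a3 [^] B2 ?n \<otimes> (z [^] B3 ?n \<otimes> b))))"
      unfolding Suc using cc c by (simp add: m_assoc)
    also have "\<dots> = b [^] ?n \<otimes> (a1 \<otimes> (a2 [^] ?n \<otimes> ((a3 [^] B2 ?n \<otimes> b) \<otimes> z [^] B3 ?n)))"
      unfolding Pz using cc c by (simp add: m_assoc)
    also have "\<dots> = b [^] ?n \<otimes> (a1 \<otimes> ((a2 [^] ?n \<otimes> b) \<otimes> (a3 [^] B2 ?n \<otimes> (z [^] B2 ?n \<otimes> z [^] B3 ?n))))"
      unfolding P3 using cc c by (simp add: m_assoc)
    also have "\<dots> = b [^] ?n \<otimes> ((a1 \<otimes> b) \<otimes> (a2 [^] ?n \<otimes> ((a3 [^] ?n \<otimes> a3 [^] B2 ?n) \<otimes> (z [^] B2 ?n \<otimes> z [^] B3 ?n))))"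
      unfolding P2 using cc c by (simp add: m_assoc)
    also have "\<dots> = (b [^] ?n \<otimes> b) \<otimes> (a1 \<otimes> ((a2 \<otimes> a2 [^] ?n) \<otimes> ((a3 [^] ?n \<otimes> a3 [^] B2 ?n) \<otimes> (z [^] B2 ?n \<otimes> z [^] B3 ?n))))"
      unfolding rel(1) using cc c by (simp add: m_assoc)
    also have "b [^] ?n \<otimes> b = b [^] (?n + 1)" using c by (simp add: int_pow_mult int_pow_1)
    also have "a2 \<otimes> a2 [^] ?n = a2 [^] (?n + 1)" using cc int_pow_mult[of a2 1 ?n] by (simp add: int_pow_1 add.commute)
    also have "a3 [^] ?n \<otimes> a3 [^] B2 ?n = a3 [^] B2 (?n + 1)" unfolding B2_Suc using cc int_pow_mult[of a3 ?n "B2 ?n"] by (simp add: add.commute)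
    also have "z [^] B2 ?n \<otimes> z [^] B3 ?n = z [^] B3 (?n + 1)" unfolding B3_Suc using cc int_pow_mult[of z "B2 ?n" "B3 ?n"] by (simp add: add.commute)
    finally show ?case by (simp add: add.commute)
  qed (use cc in simp)
  show "a1 \<otimes> z = z \<otimes> a1"
    using A1[of "p ^ m"] pow_dvd_one[OF cc(2) pw(1) pm] pow_dvd_one[OF cc(3) pw(2) Bpm(1)]
      pow_dvd_one[OF cc(4) zp Bpm(2)] cc
    unfolding zpm by simp
qed

end

text \<open>Like \<open>listed\<close>, but without a choice of coset representatives: in F8 any t
  prime to p is allowed, since only distinctness and completeness need the representatives.\<close>

fun admissible :: "entry \<Rightarrow> bool" where
  "admissible (F1 m) \<longleftrightarrow> m \<ge> 1"
| "admissible (F2 m) \<longleftrightarrow> m \<ge> 1"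
| "admissible (F3 m) \<longleftrightarrow> m \<ge> 1"
| "admissible (F4 m t) \<longleftrightarrow> m \<ge> 1 \<and> t \<in> {1, 2}"
| "admissible (F5 m) \<longleftrightarrow> m \<ge> 1"
| "admissible (F6 p m) \<longleftrightarrow> prime p \<and> p \<ge> 5 \<and> m \<ge> 1"
| "admissible (F7 p m) \<longleftrightarrow> prime p \<and> p \<ge> 5 \<and> m \<ge> 1"
| "admissible (F8 p m t) \<longleftrightarrow> prime p \<and> p \<ge> 5 \<and> m \<ge> 1 \<and> \<not> int p dvd t"

lemma wpow_lists: "w \<in> lists (S \<times> UNIV) \<Longrightarrow> wpow w k \<in> lists (S \<times> UNIV)"
  using winv_lists[of w S] by (auto simp: wpow_def)

lemma wcomm_lists: "v \<in> lists (S \<times> UNIV) \<Longrightarrow> w \<in> lists (S \<times> UNIV) \<Longrightarrow> wcomm v w \<in> lists (S \<times> UNIV)"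
  using winv_lists[of v S] winv_lists[of w S] by (simp add: wcomm_def)

lemma letter_lists: "z \<in> S \<Longrightarrow> [(z, b)] \<in> lists (S \<times> UNIV)"
  by simp

lemma append_lists: "v \<in> lists A \<Longrightarrow> w \<in> lists A \<Longrightarrow> v @ w \<in> lists A"
  by simp

lemma rels_lists:
  assumes "(l, r) \<in> rels e"
  shows "l \<in> lists (gens e \<times> UNIV)" "r \<in> lists (gens e \<times> UNIV)"
proof -
  have sets: "{1..4} = {1, 2, 3, 4::nat}" "{1..3} = {1, 2, 3::nat}" "{2..3} = {2, 3::nat}"
    "{1..2} = {1, 2::nat}" by auto
  have num: "1 + 1 = (2::nat)" "2 + 1 = (3::nat)" "3 + 1 = (4::nat)" by simp_all
  have nil: "[] \<in> lists A" for A by simp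
  note I = wpow_lists wcomm_lists letter_lists append_lists nil
  have "l \<in> lists (gens e \<times> UNIV) \<and> r \<in> lists (gens e \<times> UNIV)"
    using assms
    by (cases e; simp only: rels.simps gens.simps sets;
        elim UnE CollectE exE conjE insertE emptyE; simp only: prod.inject num;
        intro conjI I; simp)
  then show "l \<in> lists (gens e \<times> UNIV)" "r \<in> lists (gens e \<times> UNIV)" by blast+
qed

text \<open>Only the relations are used of the group, so this applies to the presented group itself.
  It provides the homomorphism from \<open>HG\<close> and the two trivial relators that
  \<open>marked_presented\<close> asks for.\<close>

lemma (in group) pres_entry:
  assumes f: "\<And>x. f x \<in> carrier G" and R: "\<And>l r. (l, r) \<in> rels e \<Longrightarrow> weval G f l = weval G f r"
    and e: "admissible e"
  obtains \<psi> where "\<psi> \<in> hom HG G" "\<And>z. z \<in> gens e \<Longrightarrow> \<psi> (letter_coords z) = f z"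
    "\<psi> (0, int (prime_of e), B2 (int (prime_of e)), B3 (int (prime_of e)), B4 (int (prime_of e)) - s_of e) = \<one>"
    "\<psi> (int (prime_of e) ^ exponent_of e, 0, 0, 0, - u_of e) = \<one>"
proof -
  let ?a = "f (GA 1)" and ?a2 = "f (GA 2)" and ?a3 = "f (GA 3)" and ?a4 = "f (GA 4)" and ?b = "f GB"
  note ev = weval_wpow[of f, OF f] weval_wcomm[of f, OF f] weval_letter[of f, OF f] weval_Nil[of f, OF f] weval_append[of f, OF f]
  have aa: "?a [^] (1::int) = ?a" by (rule int_pow_1[OF f])
  show ?thesis
  proof (cases e)
    case (F1 m)
    have r: "?a [^] (16::int) = \<one>" "?b [^] (2 ^ m :: int) = \<one>" "commutator G ?a ?b = ?a [^] (-2::int)"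
      using R[of "wpow (wa 1) 16" "[]"] R[of "wpow wb (2 ^ m)" "[]"] R[of "wcomm (wa 1) wb" "wpow (wa 1) (-2)"]
      unfolding F1 ev by simp_all
    obtain \<psi> where psi: "\<psi> \<in> hom HG G" "\<psi> (0, 1, 0, 0, 0) = ?a" "\<psi> (1, 0, 0, 0, 0) = ?b"
      "\<psi> (0, int 2, B2 (int 2), B3 (int 2), B4 (int 2) - 0) = \<one>" "\<psi> (int 2 ^ m, 0, 0, 0, - 0) = \<one>"
      by (rule pres_2[OF f f r(1,3), of 0 m 0]) (use r(2) in simp_all)
    show ?thesis by (rule that[OF psi(1)]) (use psi in \<open>auto simp: F1\<close>)
  next
    case (F2 m)
    have r: "?a [^] (16::int) = \<one>" "?b [^] (2 ^ m :: int) = \<one>" "commutator G ?a ?b = ?a [^] (6::int)"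
      using R[of "wpow (wa 1) 16" "[]"] R[of "wpow wb (2 ^ m)" "[]"] R[of "wcomm (wa 1) wb" "wpow (wa 1) 6"]
      unfolding F2 ev by simp_all
    obtain \<psi> where psi: "\<psi> \<in> hom HG G" "\<psi> (0, 1, 0, 0, 0) = ?a" "\<psi> (1, 0, 0, 0, 0) = ?b"
      "\<psi> (0, int 2, B2 (int 2), B3 (int 2), B4 (int 2) - 1) = \<one>" "\<psi> (int 2 ^ m, 0, 0, 0, - 0) = \<one>"
      by (rule pres_2[OF f f r(1,3), of 1 m 0]) (use r(2) in simp_all)
    show ?thesis by (rule that[OF psi(1)]) (use psi in \<open>auto simp: F2\<close>)
  next
    case (F3 m)
    have r: "?a [^] (16::int) = \<one>" "?b [^] (2 ^ m :: int) = ?a [^] (8::int)" "commutator G ?a ?b = ?a [^] (-2::int)"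
      using R[of "wpow (wa 1) 16" "[]"] R[of "wpow wb (2 ^ m)" "wpow (wa 1) 8"] R[of "wcomm (wa 1) wb" "wpow (wa 1) (-2)"]
      unfolding F3 ev by simp_all
    \<comment> \<open>In F3 a_4 is the power (-2)^3 = -8 of a, whereas the relation names the power
      8; they agree as a has exponent 16.\<close>
    have "?a [^] (8::int) = ?a [^] (-8::int)"
      using int_pow_mult[OF f, of "GA 1" "-8" 16] r(1) f by simp
    then have bm: "?b [^] (2 ^ m :: int) = ?a [^] (1 * (-2) ^ 3 :: int)" using r(2) by simp
    obtain \<psi> where psi: "\<psi> \<in> hom HG G" "\<psi> (0, 1, 0, 0, 0) = ?a" "\<psi> (1, 0, 0, 0, 0) = ?b"
      "\<psi> (0, int 2, B2 (int 2), B3 (int 2), B4 (int 2) - 0) = \<one>" "\<psi> (int 2 ^ m, 0, 0, 0, - 1) = \<one>"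
      by (rule pres_2[OF f f r(1,3) _ _ bm, of 0]) simp_all
    show ?thesis by (rule that[OF psi(1)]) (use psi in \<open>auto simp: F3\<close>)
  next
    case (F4 m t)
    have r: "?a [^] (9::int) = \<one>" "?a2 [^] (9::int) = \<one>" "?b [^] (3 ^ m :: int) = \<one>"
      "commutator G ?a ?b = ?a2" "commutator G ?a2 ?b = ?a [^] (-3::int) \<otimes> ?a2 [^] (3 * t)"
      "commutator G ?a ?a2 = \<one>"
      using R[of "wpow (wa 1) 9" "[]"] R[of "wpow (wa 2) 9" "[]"] R[of "wpow wb (3 ^ m)" "[]"]
        R[of "wcomm (wa 1) wb" "wa 2"] R[of "wcomm (wa 2) wb" "wpow (wa 1) (-3) @ wpow (wa 2) (3 * t)"]
        R[of "wcomm (wa 1) (wa 2)" "[]"]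
      unfolding F4 ev by simp_all
    have "t = 1 \<or> t = 2" using e F4 by simp
    then have s: "3 dvd 1 + t + s_of e" using F4 by auto
    obtain \<psi> where psi: "\<psi> \<in> hom HG G" "\<psi> (0, 1, 0, 0, 0) = ?a" "\<psi> (0, 0, 1, 0, 0) = ?a2" "\<psi> (1, 0, 0, 0, 0) = ?b"
      "\<psi> (0, int 3, B2 (int 3), B3 (int 3), B4 (int 3) - s_of e) = \<one>" "\<psi> (int 3 ^ m, 0, 0, 0, - 0) = \<one>"
      by (rule pres_3[OF f f f r(1,2,4,5,6) s, of m 0]) (use r(3) in simp_all)
    show ?thesis by (rule that[OF psi(1)]) (use psi in \<open>auto simp: F4\<close>)
  next
    case (F5 m)
    have r: "?a [^] (9::int) = \<one>" "?a2 [^] (9::int) = \<one>" "?b [^] (3 ^ m :: int) = ?a2 [^] (-3 * 1 :: int)"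
      "commutator G ?a ?b = ?a2" "commutator G ?a2 ?b = ?a [^] (-3::int) \<otimes> ?a2 [^] (3 * (-1) :: int)"
      "commutator G ?a ?a2 = \<one>"
      using R[of "wpow (wa 1) 9" "[]"] R[of "wpow (wa 2) 9" "[]"] R[of "wpow wb (3 ^ m)" "wpow (wa 2) (-3)"]
        R[of "wcomm (wa 1) wb" "wa 2"] R[of "wcomm (wa 2) wb" "wpow (wa 1) (-3) @ wpow (wa 2) (-3)"]
        R[of "wcomm (wa 1) (wa 2)" "[]"]
      unfolding F5 ev by simp_all
    obtain \<psi> where psi: "\<psi> \<in> hom HG G" "\<psi> (0, 1, 0, 0, 0) = ?a" "\<psi> (0, 0, 1, 0, 0) = ?a2" "\<psi> (1, 0, 0, 0, 0) = ?b"
      "\<psi> (0, int 3, B2 (int 3), B3 (int 3), B4 (int 3) - 0) = \<one>" "\<psi> (int 3 ^ m, 0, 0, 0, - 1) = \<one>"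
      by (rule pres_3[OF f f f r(1,2,4,5,6) _ r(3), of 0]) simp
    show ?thesis by (rule that[OF psi(1)]) (use psi in \<open>auto simp: F5\<close>)
  next
    case (F6 p m)
    have p: "prime p" "p \<ge> 5" using e F6 by simp_all
    have pw: "f (GA i) [^] int p = \<one>" if "i \<in> {1..4}" for i
    proof -
      have "(wpow (wa i) (int p), []) \<in> rels e" unfolding F6 rels.simps using that by blast
      from R[OF this] show ?thesis unfolding ev .
    qed
    have st: "commutator G (f (GA j)) ?b = f (GA (j + 1))" if "j \<in> {1..3}" for j
    proof -
      have "(wcomm (wa j) wb, wa (j + 1)) \<in> rels e" unfolding F6 rels.simps using that by blast
      from R[OF this] show ?thesis unfolding ev .
    qed
    have co: "commutator G (f (GA i)) (f (GA j)) = \<one>" if "i \<in> {1..4}" "j \<in> {1..3}" for i j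
    proof -
      have "(wcomm (wa i) (wa j), []) \<in> rels e" unfolding F6 rels.simps using that by blast
      from R[OF this] show ?thesis unfolding ev .
    qed
    have x: "(wcomm (wa 4) wb, []) \<in> rels e" "(wpow wb (int p ^ m), []) \<in> rels e"
      unfolding F6 rels.simps by blast+
    have a5: "commutator G ?a4 ?b = \<one>" and bm: "?b [^] (int p ^ m) = \<one>"
      using R[OF x(1)] R[OF x(2)] unfolding ev by simp_all
    have a: "?a2 = commutator G ?a ?b" "?a3 = commutator G ?a2 ?b" "?a4 = commutator G ?a3 ?b"
      using st[of 1] st[of 2] st[of 3] by (simp_all add: numeral_eq_Suc)
    obtain \<psi> where psi: "\<psi> \<in> hom HG G" "\<psi> (0, 1, 0, 0, 0) = ?a" "\<psi> (0, 0, 1, 0, 0) = ?a2"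
      "\<psi> (0, 0, 0, 1, 0) = ?a3" "\<psi> (0, 0, 0, 0, 1) = ?a4" "\<psi> (1, 0, 0, 0, 0) = ?b"
      "\<psi> (0, int p, B2 (int p), B3 (int p), B4 (int p) - 0) = \<one>" "\<psi> (int p ^ m, 0, 0, 0, - 0) = \<one>"
      by (rule pres_6[OF p f f a a5 co co co co co co pw pw pw, of 0 m 0]) (use bm pw[of 1] in simp_all)
    show ?thesis by (rule that[OF psi(1)]) (use psi in \<open>auto simp: F6\<close>)
  next
    case (F7 p m)
    have p: "prime p" "p \<ge> 5" "m \<ge> 1" using e F7 by simp_all
    have pw: "f (GA i) [^] int p = \<one>" if "i \<in> {1..3}" for i
    proof -
      have "(wpow (wa i) (int p), []) \<in> rels e" unfolding F7 rels.simps using that by blast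
      from R[OF this] show ?thesis unfolding ev .
    qed
    have st: "commutator G (f (GA j)) ?b = f (GA (j + 1))" if "j \<in> {1..2}" for j
    proof -
      have "(wcomm (wa j) wb, wa (j + 1)) \<in> rels e" unfolding F7 rels.simps using that by blast
      from R[OF this] show ?thesis unfolding ev .
    qed
    have co: "f (GA i) \<otimes> f (GA j) = f (GA j) \<otimes> f (GA i)" if "i \<in> {1..3}" "j \<in> {1..2}" for i j
    proof -
      have "(wcomm (wa i) (wa j), []) \<in> rels e" unfolding F7 rels.simps using that by blast
      from R[OF this] show ?thesis unfolding ev commutator_one_iff[OF f f] .
    qed
    have x: "(wcomm (wa 3) wb, wpow wb (int p ^ m)) \<in> rels e" "(wpow wb (int p ^ (m + 1)), []) \<in> rels e"
      unfolding F7 rels.simps by blast+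
    have z: "commutator G ?a3 ?b = ?b [^] (int p ^ m)" and bm: "?b [^] (int p ^ (m + 1)) = \<one>"
      using R[OF x(1)] R[OF x(2)] unfolding ev by simp_all
    have a: "?a2 = commutator G ?a ?b" "?a3 = commutator G ?a2 ?b"
      using st[of 1] st[of 2] by (simp_all add: numeral_eq_Suc)
    \<comment> \<open>F7 has no fourth a-generator; a_4 is the commutator z, which the relation
      identifies with b^(p^m).\<close>
    define z where "z = commutator G ?a3 ?b"
    have zb: "z = ?b [^] (int p ^ m)" unfolding z_def by (rule z)
    have zc: "z \<in> carrier G" unfolding z_def using f by simp
    have c12: "?a \<otimes> ?a2 = ?a2 \<otimes> ?a" and c13: "?a \<otimes> ?a3 = ?a3 \<otimes> ?a" and c23: "?a2 \<otimes> ?a3 = ?a3 \<otimes> ?a2"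
      using co[of 1 2] co[of 3 1] co[of 3 2] by simp_all
    note central = pres_7_central[OF p f f a z_def zb c12 c13 c23 pw pw bm]
    have zz: "?a \<otimes> z = z \<otimes> ?a" "?a2 \<otimes> z = z \<otimes> ?a2" "?a3 \<otimes> z = z \<otimes> ?a3" "commutator G z ?b = \<one>" "z [^] int p = \<one>"
      using central by simp_all
    obtain \<psi> where psi: "\<psi> \<in> hom HG G" "\<psi> (0, 1, 0, 0, 0) = ?a" "\<psi> (0, 0, 1, 0, 0) = ?a2"
      "\<psi> (0, 0, 0, 1, 0) = ?a3" "\<psi> (0, 0, 0, 0, 1) = z" "\<psi> (1, 0, 0, 0, 0) = ?b"
      "\<psi> (0, int p, B2 (int p), B3 (int p), B4 (int p) - 0) = \<one>" "\<psi> (int p ^ m, 0, 0, 0, - 1) = \<one>"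
      by (rule pres_6[OF p(1,2) f f a z_def zz(4), of 0 m 1])
        (use c12 c13 c23 zz zb zc pw[of 1] pw[of 2] pw[of 3] commutator_one_iff f in \<open>simp_all add: int_pow_1\<close>)
    show ?thesis by (rule that[OF psi(1)]) (use psi in \<open>auto simp: F7\<close>)
  next
    case (F8 p m t)
    have p: "prime p" "p \<ge> 5" "m \<ge> 1" "\<not> int p dvd t" using e F8 by simp_all
    have pw: "f (GA i) [^] int p = \<one>" if "i \<in> {2..3}" for i
    proof -
      have "(wpow (wa i) (int p), []) \<in> rels e" unfolding F8 rels.simps using that by blast
      from R[OF this] show ?thesis unfolding ev .
    qed
    have st: "commutator G (f (GA j)) ?b = f (GA (j + 1))" if "j \<in> {1..2}" for j
    proof -
      have "(wcomm (wa j) wb, wa (j + 1)) \<in> rels e" unfolding F8 rels.simps using that by blast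
      from R[OF this] show ?thesis unfolding ev .
    qed
    have co: "f (GA i) \<otimes> f (GA j) = f (GA j) \<otimes> f (GA i)" if "i \<in> {2..3}" "j \<in> {1..2}" for i j
    proof -
      have "(wcomm (wa i) (wa j), []) \<in> rels e" unfolding F8 rels.simps using that by blast
      from R[OF this] show ?thesis unfolding ev commutator_one_iff[OF f f] .
    qed
    have x: "(wcomm (wa 3) wb, wpow (wa 1) (t * int p)) \<in> rels e" "(wpow wb (int p ^ m), []) \<in> rels e"
      "(wpow (wa 1) (int p ^ 2), []) \<in> rels e"
      unfolding F8 rels.simps by blast+
    have z: "commutator G ?a3 ?b = ?a [^] (t * int p)" and bm: "?b [^] (int p ^ m) = \<one>"
      and app: "?a [^] (int p ^ 2) = \<one>"
      using R[OF x(1)] R[OF x(2)] R[OF x(3)] unfolding ev by simp_all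
    have a: "?a2 = commutator G ?a ?b" "?a3 = commutator G ?a2 ?b"
      using st[of 1] st[of 2] by (simp_all add: numeral_eq_Suc)
    define z where "z = commutator G ?a3 ?b"
    have za: "z = ?a [^] (t * int p)" unfolding z_def by (rule z)
    have zc: "z \<in> carrier G" unfolding z_def using f by simp
    have c12: "?a \<otimes> ?a2 = ?a2 \<otimes> ?a" and c13: "?a \<otimes> ?a3 = ?a3 \<otimes> ?a" and c23: "?a2 \<otimes> ?a3 = ?a3 \<otimes> ?a2"
      using co[of 2 1] co[of 3 1] co[of 3 2] by simp_all
    have zz: "z \<otimes> ?a = ?a \<otimes> z" "z \<otimes> ?a2 = ?a2 \<otimes> z" "z \<otimes> ?a3 = ?a3 \<otimes> z"
      unfolding za by (rule commute_pow_int[OF f f], rule HOL.refl c12 c13)+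
    have zp: "z [^] int p = \<one>"
      unfolding za int_pow_pow[OF f] by (rule pow_dvd_one[OF f app]) (simp add: power2_eq_square)
    \<comment> \<open>Conjugation by b sends z = a^(t p) to (a a_2)^(t p) = z a_2^(t p), and a_2 has
      exponent p. So z commutes with b.\<close>
    have "?a \<otimes> ?b = ?b \<otimes> (?a \<otimes> ?a2)" using commutator_conj[OF f f f] a(1) by metis
    from conj_int_pow[OF f f _ this, of "t * int p"]
    have "z \<otimes> ?b = ?b \<otimes> (?a \<otimes> ?a2) [^] (t * int p)" unfolding za using f by simp
    also have "(?a \<otimes> ?a2) [^] (t * int p) = z \<otimes> ?a2 [^] (t * int p)"
      unfolding za by (rule int_pow_mult_distrib[OF c12 f f])
    also have "?a2 [^] (t * int p) = \<one>" by (rule pow_dvd_one[OF f pw]) simp_all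
    finally have zb: "commutator G z ?b = \<one>" using commutator_one_iff[OF zc f] zc by simp
    \<comment> \<open>s t = 1 modulo p and a has exponent p^2, so z^s = a^(s t p) = a^p.\<close>
    have r: "?a [^] int p = z [^] s_of e"
    proof -
      have "int p dvd t ^ (p - 1) - 1" by (rule fermat_int[OF p(1,4)])
      moreover have "p - 1 = Suc (p - 2)" using p by simp
      ultimately have "int p dvd t * s_of e - 1" unfolding F8 by simp
      then have "int p ^ 2 dvd int p * (t * s_of e - 1)" by (simp add: power2_eq_square)
      then have "?a [^] (int p * (t * s_of e - 1)) = \<one>" by (rule pow_dvd_one[OF f app])
      moreover have "z [^] s_of e = ?a [^] (int p * (t * s_of e - 1)) \<otimes> ?a [^] int p"
        unfolding za int_pow_pow[OF f] int_pow_mult[OF f, symmetric] by (simp add: algebra_simps)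
      ultimately show ?thesis using f by simp
    qed
    obtain \<psi> where psi: "\<psi> \<in> hom HG G" "\<psi> (0, 1, 0, 0, 0) = ?a" "\<psi> (0, 0, 1, 0, 0) = ?a2"
      "\<psi> (0, 0, 0, 1, 0) = ?a3" "\<psi> (0, 0, 0, 0, 1) = z" "\<psi> (1, 0, 0, 0, 0) = ?b"
      "\<psi> (0, int p, B2 (int p), B3 (int p), B4 (int p) - s_of e) = \<one>" "\<psi> (int p ^ m, 0, 0, 0, - 0) = \<one>"
      by (rule pres_6[OF p(1,2) f f a z_def zb, of "s_of e" m 0])
        (use c12 c13 c23 zz zp zc pw[of 2] pw[of 3] commutator_one_iff f r bm in \<open>simp_all\<close>)
    show ?thesis by (rule that[OF psi(1)]) (use psi in \<open>auto simp: F8\<close>)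
  qed
qed

text \<open>The second clause lets the recorded words for the Frattini subgroup, the derived
  subgroup and the centre be evaluated in coordinates.\<close>

lemma entry_marked:
  assumes e: "admissible e"
  obtains \<psi> where "marked (grp e) (prime_of e) (exponent_of e) (s_of e) (u_of e) \<psi>"
    "\<And>z. z \<in> gens e \<Longrightarrow> \<psi> (letter_coords z) = gen_class (gens e) (rels e) z"
proof -
  interpret P: group "grp e" by (simp add: grp_def)
  have R: "weval (grp e) (gen_class (gens e) (rels e)) l = weval (grp e) (gen_class (gens e) (rels e)) r"
    if "(l, r) \<in> rels e" for l r
    unfolding grp_def by (rule presented_relation[OF that rels_lists[OF that]])
  have c: "gen_class (gens e) (rels e) x \<in> carrier (grp e)" for x
    unfolding grp_def by (rule gen_class_closed)
  obtain \<psi> where psi: "\<psi> \<in> hom HG (grp e)" "\<And>z. z \<in> gens e \<Longrightarrow> \<psi> (letter_coords z) = gen_class (gens e) (rels e) z"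
    "\<psi> (0, int (prime_of e), B2 (int (prime_of e)), B3 (int (prime_of e)), B4 (int (prime_of e)) - s_of e) = \<one>\<^bsub>grp e\<^esub>"
    "\<psi> (int (prime_of e) ^ exponent_of e, 0, 0, 0, - u_of e) = \<one>\<^bsub>grp e\<^esub>"
    using P.pres_entry[OF c R e] by metis
  have p: "prime (prime_of e)" "exponent_of e \<ge> 1" using e by (cases e; simp)+
  have g: "GA 1 \<in> gens e" "GB \<in> gens e" by (cases e; simp)+
  note M = marked_model[OF p, of "s_of e" "u_of e"]
  have model: "weval (HG Mod K (prime_of e) (exponent_of e) (s_of e) (u_of e))
        (\<lambda>z. K (prime_of e) (exponent_of e) (s_of e) (u_of e) #>\<^bsub>HG\<^esub> letter_coords z) l =
      weval (HG Mod K (prime_of e) (exponent_of e) (s_of e) (u_of e))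
        (\<lambda>z. K (prime_of e) (exponent_of e) (s_of e) (u_of e) #>\<^bsub>HG\<^esub> letter_coords z) r"
    if rel: "(l, r) \<in> rels e" for l r
  proof (cases e)
    case (F1 m) show ?thesis by (rule model_2[of _ m _ _ _ e]) (use M rel F1 in simp_all)
  next
    case (F2 m) show ?thesis by (rule model_2[of _ m _ _ _ e]) (use M rel F2 in simp_all)
  next
    case (F3 m) show ?thesis by (rule model_2[of _ m _ _ _ e]) (use M rel F3 in simp_all)
  next
    case (F4 m t) show ?thesis by (rule model_3[of _ m _ _ _ e]) (use M rel F4 e in auto)
  next
    case (F5 m) show ?thesis by (rule model_3[of _ m _ _ _ e]) (use M rel F5 in simp_all)
  next
    case (F6 p m) show ?thesis by (rule model_5[of _ p m _ _ _ e]) (use M rel F6 e in simp_all)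
  next
    case (F7 p m) show ?thesis by (rule model_5[of _ p m _ _ _ e]) (use M rel F7 e in simp_all)
  next
    case (F8 p m t) show ?thesis by (rule model_5[of _ p m _ _ _ e t]) (use M rel F8 e in simp_all)
  qed
  have "marked (grp e) (prime_of e) (exponent_of e) (s_of e) (u_of e) \<psi>"
    unfolding grp_def
    by (rule marked_presented[where g = letter_coords and x = "GA 1" and y = GB and S = "gens e" and R = "rels e",
          OF p g(1) _ g(2) _ model psi(1,2,3,4)[unfolded grp_def]]) simp_all
  then show ?thesis using psi(2) that by blast
qed

section \<open>Abelian subgroups of index p\<close>

context group
begin

lemma inv_cancel:
  "x \<in> carrier G \<Longrightarrow> y \<in> carrier G \<Longrightarrow> inv x \<otimes> (x \<otimes> y) = y"
  "x \<in> carrier G \<Longrightarrow> y \<in> carrier G \<Longrightarrow> x \<otimes> (inv x \<otimes> y) = y"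
  by (simp_all add: m_assoc[symmetric])

lemma finite_rcosets: "finite (carrier G) \<Longrightarrow> subgroup H G \<Longrightarrow> finite (rcosets H)"
  using rcosets_subset_PowG[of H] finite_subset[of "rcosets H" "Pow (carrier G)"] by simp

lemma rcos_eq_iff:
  assumes "subgroup H G" "x \<in> carrier G" "y \<in> carrier G"
  shows "H #> x = H #> y \<longleftrightarrow> x \<otimes> inv y \<in> H"
proof
  have H: "H \<subseteq> carrier G" using assms(1) by (rule subgroup.subset)
  assume "H #> x = H #> y"
  then have "H #> (x \<otimes> inv y) = H" by (rule coset_mult_inv2[OF _ assms(2,3) H])
  then show "x \<otimes> inv y \<in> H" using coset_join1 assms by blast
next
  have H: "H \<subseteq> carrier G" using assms(1) by (rule subgroup.subset)
  assume "x \<otimes> inv y \<in> H"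
  then have "H #> (x \<otimes> inv y) = H" using coset_join2 assms by blast
  then show "H #> x = H #> y" by (rule coset_mult_inv1[OF _ assms(2,3) H])
qed

text \<open>In a p-group h is a power of h^k, the exponent being an inverse of k modulo the group
  order.\<close>

lemma pow_unit_mem:
  assumes p: "prime p" and ord: "order G = p ^ n"
    and H: "subgroup H G" and h: "h \<in> carrier G" "h [^] (k::int) \<in> H" and k: "\<not> int p dvd k"
  shows "h \<in> H"
proof -
  obtain k' :: nat where k': "k' > 0" "[k * int k' = 1] (mod int p ^ n)"
    using p k by (rule inverse_mod_prime)
  then have "int p ^ n dvd k * int k' - 1" by (simp add: cong_iff_dvd_diff)
  then obtain j where "k * int k' - 1 = int p ^ n * j" by (rule dvdE)
  then have j: "k * int k' = 1 + int (p ^ n) * j" by simp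
  have "h [^] int (p ^ n) = \<one>" unfolding int_pow_int using pow_order_eq_1[OF h(1)] ord by simp
  then have "h [^] (int (p ^ n) * j) = \<one>" using h(1) int_pow_pow[of h "int (p ^ n)" j] by simp
  then have "h [^] (k * int k') = h" unfolding j using h(1) by (simp add: int_pow_mult int_pow_1)
  moreover have "h [^] (k * int k') = (h [^] k) [^] int k'" using h(1) by (simp add: int_pow_pow)
  ultimately show ?thesis using subgroup_int_pow_closed[OF H h(2), of "int k'"] by simp
qed

text \<open>If \<open>h = g a g\<^sup>-\<^sup>1\<close> were outside of \<open>A\<close>, then \<open>A\<close> and the \<open>A g a ^ i\<close> for \<open>i < p\<close> would be
  \<open>p + 1\<close> distinct cosets.\<close>

lemma index_p_normal:
  assumes fin: "finite (carrier G)" and p: "prime p" and ord: "order G = p ^ n"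
    and A: "subgroup A G" and idx: "subgroup_index G A = p"
  shows "A \<lhd> G"
proof -
  have "g \<otimes> a \<otimes> inv g \<in> A" if ga: "g \<in> carrier G" "a \<in> A" for g a
  proof (rule ccontr)
    define h where "h = g \<otimes> a \<otimes> inv g"
    assume "g \<otimes> a \<otimes> inv g \<notin> A"
    then have nh: "h \<notin> A" by (simp add: h_def)
    have ac: "a \<in> carrier G" using subgroup.mem_carrier[OF A ga(2)] .
    have hc: "h \<in> carrier G" using ga ac by (simp add: h_def)
    have hg: "h [^] i \<otimes> g = g \<otimes> a [^] i" for i :: int
      by (rule conj_int_pow[OF hc ga(1) ac]) (use ga ac in \<open>simp add: h_def m_assoc\<close>)
    define F where "F i = A #> (h [^] int i \<otimes> g)" for i :: nat
    have inj: "inj_on F {..<p}"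
    proof (rule inj_onI)
      fix i j assume ij: "i \<in> {..<p}" "j \<in> {..<p}" "F i = F j"
      then have "h [^] int i \<otimes> g \<otimes> inv (h [^] int j \<otimes> g) \<in> A"
        using rcos_eq_iff[OF A] hc ga by (simp add: F_def)
      also have "h [^] int i \<otimes> g \<otimes> inv (h [^] int j \<otimes> g) = h [^] int i \<otimes> (g \<otimes> inv g) \<otimes> inv (h [^] int j)"
        using hc ga by (simp add: inv_mult_group m_assoc inv_cancel)
      also have "\<dots> = h [^] (int i - int j)" using hc ga by (simp add: int_pow_diff)
      finally have "int p dvd int i - int j" using pow_unit_mem[OF p ord A hc] nh by blast
      moreover have "\<bar>int i - int j\<bar> < int p" using ij by auto
      ultimately show "i = j" using zdvd_not_zless[of "\<bar>int i - int j\<bar>" "int p"] by auto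
    qed
    have notA: "A \<notin> F ` {..<p}"
    proof
      assume "A \<in> F ` {..<p}"
      then obtain i where "A #> (h [^] int i \<otimes> g) = A" unfolding F_def by auto
      then have "h [^] int i \<otimes> g \<in> A" by (rule coset_join1) (use hc ga A in auto)
      then have gA: "g \<otimes> a [^] int i \<in> A" unfolding hg .
      have "inv (a [^] int i) \<in> A"
        using subgroup_int_pow_closed[OF A ga(2)] subgroup.m_inv_closed[OF A] by blast
      then have "g \<otimes> a [^] int i \<otimes> inv (a [^] int i) \<in> A" using gA subgroup.m_closed[OF A] by blast
      then have "g \<in> A" using ga ac by (simp add: m_assoc)
      then have "h \<in> A" unfolding h_def using ga A by (simp add: subgroup.m_closed subgroup.m_inv_closed)
      then show False using nh by blast
    qed
    have "insert A (F ` {..<p}) \<subseteq> rcosets A"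
      unfolding F_def using hc ga rcosetsI[OF subgroup.subset[OF A]] subgroup.subgroup_in_rcosets[OF A is_group] by auto
    moreover have "finite (rcosets A)" using fin A by (rule finite_rcosets)
    ultimately have "card (insert A (F ` {..<p})) \<le> card (rcosets A)" by (intro card_mono)
    then show False using notA card_image[OF inj] idx by (simp add: subgroup_index_def)
  qed
  then show ?thesis using A normal_inv_iff by blast
qed

lemma index_p_pow:
  assumes "A \<lhd> G" "subgroup_index G A = p" "y \<in> carrier G"
  shows "y [^] p \<in> A"
proof -
  interpret A: normal A G by fact
  interpret Q: group "G Mod A" by (rule A.factorgroup_is_group)
  interpret h: group_hom G "G Mod A" "\<lambda>x. A #> x" using A.r_coset_hom_Mod by unfold_locales
  have "order (G Mod A) = p" using assms(2) by (simp add: order_def FactGroup_def subgroup_index_def)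
  then have "(A #> y) [^]\<^bsub>G Mod A\<^esub> p = \<one>\<^bsub>G Mod A\<^esub>" using Q.pow_order_eq_1[of "A #> y"] h.hom_closed[OF assms(3)] by simp
  then have "A #> (y [^] p) = A" using h.hom_nat_pow[OF assms(3), of p] by (simp add: FactGroup_def)
  then show ?thesis by (rule coset_join1) (use assms A.subgroup_axioms in auto)
qed

end

section \<open>The lower central series of a p-group with an abelian maximal subgroup\<close>

locale abelian_max = group G for G (structure) +
  fixes p n :: nat and A
  assumes prime: "prime p" and fin: "finite (carrier G)" and ord: "order G = p ^ n"
    and A: "subgroup A G" and A_comm: "\<And>x y. x \<in> A \<Longrightarrow> y \<in> A \<Longrightarrow> x \<otimes> y = y \<otimes> x"
    and idx: "subgroup_index G A = p"
begin

lemma Ac [simp]: "x \<in> A \<Longrightarrow> x \<in> carrier G" using subgroup.mem_carrier[OF A] .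

lemma Am: "x \<in> A \<Longrightarrow> y \<in> A \<Longrightarrow> x \<otimes> y \<in> A" and Ai: "x \<in> A \<Longrightarrow> inv x \<in> A"
  using subgroup.m_closed[OF A] subgroup.m_inv_closed[OF A] by auto

lemma Ap: "x \<in> A \<Longrightarrow> x [^] (i::int) \<in> A" using subgroup_int_pow_closed[OF A] .

lemma normalA: "A \<lhd> G" by (rule index_p_normal[OF fin prime ord A idx])

lemma Aconj: "v \<in> A \<Longrightarrow> y \<in> carrier G \<Longrightarrow> inv y \<otimes> v \<otimes> y \<in> A"
  using normal.inv_op_closed1[OF normalA] by blast

lemma Aconj2: "v \<in> A \<Longrightarrow> y \<in> carrier G \<Longrightarrow> y \<otimes> v \<otimes> inv y \<in> A"
  using normal.inv_op_closed2[OF normalA] by blast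

lemma p_gt: "p > 1" using prime_gt_1_nat[OF prime] .

lemma b_pow_A:
  assumes "b \<in> carrier G" "b \<notin> A"
  shows "b [^] (i::int) \<in> A \<longleftrightarrow> int p dvd i"
proof
  assume "b [^] i \<in> A"
  then show "int p dvd i" using pow_unit_mem[OF prime ord A assms(1)] assms(2) by blast
next
  assume "int p dvd i"
  then obtain j where "i = int p * j" by (rule dvdE)
  then have "b [^] i = (b [^] p) [^] j" using assms(1) by (simp add: int_pow_pow flip: int_pow_int)
  then show "b [^] i \<in> A" using Ap index_p_pow[OF normalA idx assms(1)] by simp
qed

lemma pow_ord:
  assumes "x \<in> carrier G"
  shows "x [^] (int (p ^ n) * j) = \<one>"
proof -
  have "x [^] int (p ^ n) = \<one>" unfolding int_pow_int using pow_order_eq_1[OF assms] ord by simp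
  then show ?thesis unfolding int_pow_pow[OF assms, symmetric] by simp
qed

text \<open>No power of b with exponent strictly between 0 and p lies in A, so the A b^i for i < p
  are p distinct cosets and hence all of them.\<close>

lemma decomp:
  assumes b: "b \<in> carrier G" "b \<notin> A" and y: "y \<in> carrier G"
  obtains i v where "v \<in> A" "y = v \<otimes> b [^] int i"
proof -
  define F where "F i = A #> b [^] int i" for i :: nat
  have "inj_on F {..<p}"
  proof (rule inj_onI)
    fix i j assume ij: "i \<in> {..<p}" "j \<in> {..<p}" "F i = F j"
    then have "b [^] int i \<otimes> inv (b [^] int j) \<in> A" using rcos_eq_iff[OF A] b by (simp add: F_def)
    then have "b [^] (int i - int j) \<in> A" using b by (simp add: int_pow_diff)
    then have "int p dvd int i - int j" using b_pow_A[OF b] by blast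
    moreover have "\<bar>int i - int j\<bar> < int p" using ij by auto
    ultimately show "i = j" using zdvd_not_zless[of "\<bar>int i - int j\<bar>" "int p"] by auto
  qed
  then have c: "card (F ` {..<p}) = card (rcosets A)" using idx by (simp add: card_image subgroup_index_def)
  have "F ` {..<p} \<subseteq> rcosets A" unfolding F_def using b rcosetsI[OF subgroup.subset[OF A]] by auto
  moreover have "finite (rcosets A)" using fin A by (rule finite_rcosets)
  ultimately have "F ` {..<p} = rcosets A" using c card_subset_eq by metis
  then have "A #> y \<in> F ` {..<p}" using rcosetsI[OF subgroup.subset[OF A] y] by simp
  then obtain i where "A #> y = A #> b [^] int i" unfolding F_def by blast
  then have "y \<otimes> inv (b [^] int i) \<in> A" using rcos_eq_iff[OF A y] b by simp
  moreover have "y = y \<otimes> inv (b [^] int i) \<otimes> b [^] int i" using y b by (simp add: m_assoc)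
  ultimately show ?thesis by (rule that)
qed

lemma commutator_eq: "v \<in> carrier G \<Longrightarrow> y \<in> carrier G \<Longrightarrow> commutator G v y = inv v \<otimes> (inv y \<otimes> v \<otimes> y)"
  by (simp add: commutator_def m_assoc)

lemma commutator_A: "v \<in> A \<Longrightarrow> y \<in> carrier G \<Longrightarrow> commutator G v y \<in> A"
  by (simp add: commutator_eq Am Ai Aconj)

text \<open>Modulo A the group is generated by b, so x y and y x can be written with the same power
  of b on the right and differ by an element of A.\<close>

lemma commutator_in_A:
  assumes "x \<in> carrier G" "y \<in> carrier G"
  shows "commutator G x y \<in> A"
proof -
  have "A \<noteq> carrier G"
  proof
    assume "A = carrier G"
    then have "subgroup_index G A * order G = order G"
      using lagrange[OF A] by (simp add: subgroup_index_def order_def)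
    then show False using idx p_gt ord by simp
  qed
  then obtain b where b: "b \<in> carrier G" "b \<notin> A" using subgroup.subset[OF A] by blast
  obtain i v where x: "v \<in> A" "x = v \<otimes> b [^] int i" using b assms(1) by (rule decomp)
  obtain j w where y: "w \<in> A" "y = w \<otimes> b [^] int j" using b assms(2) by (rule decomp)
  have e: "v1 \<otimes> b [^] k \<otimes> (v2 \<otimes> b [^] l) = v1 \<otimes> (b [^] k \<otimes> v2 \<otimes> inv (b [^] k)) \<otimes> b [^] (k + l)"
    if "v1 \<in> A" "v2 \<in> A" for v1 v2 and k l :: int
    using that b by (simp add: int_pow_mult m_assoc inv_cancel)
  define v1 where "v1 = v \<otimes> (b [^] int i \<otimes> w \<otimes> inv (b [^] int i))"
  define v2 where "v2 = w \<otimes> (b [^] int j \<otimes> v \<otimes> inv (b [^] int j))"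
  have vA: "v1 \<in> A" "v2 \<in> A" unfolding v1_def v2_def using x y b by (simp_all add: Am Aconj2)
  define c where "c = b [^] (int i + int j)"
  have cc: "c \<in> carrier G" unfolding c_def using b by simp
  have xy: "x \<otimes> y = v1 \<otimes> c" "y \<otimes> x = v2 \<otimes> c"
    unfolding x(2) y(2) e[OF x(1) y(1)] e[OF y(1) x(1)] v1_def v2_def c_def by (simp_all add: add.commute)
  have "commutator G x y = inv (y \<otimes> x) \<otimes> (x \<otimes> y)"
    using assms by (simp add: commutator_def inv_mult_group m_assoc)
  also have "\<dots> = inv c \<otimes> (inv v2 \<otimes> v1) \<otimes> c" unfolding xy using vA cc by (simp add: inv_mult_group m_assoc)
  also have "\<dots> \<in> A" using vA cc by (simp add: Aconj Am Ai)
  finally show ?thesis .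
qed

text \<open>On the abelian normal A, taking the commutator with b is an endomorphism: the operator x
  of the coordinate model.\<close>

lemma commutator_mult:
  assumes "v \<in> A" "w \<in> A" "b \<in> carrier G"
  shows "commutator G (v \<otimes> w) b = commutator G v b \<otimes> commutator G w b"
proof -
  let ?v = "inv b \<otimes> v \<otimes> b" and ?w = "inv b \<otimes> w \<otimes> b"
  have vw: "?v \<in> A" "?w \<in> A" using assms by (simp_all add: Aconj)
  have e: "inv b \<otimes> (v \<otimes> w) \<otimes> b = ?v \<otimes> ?w" using assms by (simp add: m_assoc inv_cancel)
  have "commutator G (v \<otimes> w) b = inv w \<otimes> (inv v \<otimes> ?v) \<otimes> ?w"
    using assms vw by (simp add: commutator_eq e inv_mult_group m_assoc)
  also have "inv w \<otimes> (inv v \<otimes> ?v) = (inv v \<otimes> ?v) \<otimes> inv w" by (rule A_comm) (use assms vw in \<open>simp_all add: Am Ai\<close>)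
  finally show ?thesis using assms vw by (simp add: commutator_eq m_assoc)
qed

text \<open>A fixed point free action of \<open>b\<close> on \<open>N - {1}\<close> would have all orbits of length \<open>p\<close>.\<close>

lemma commutators_proper:
  assumes b: "b \<in> carrier G" "b \<notin> A" and N: "subgroup N G" "N \<subseteq> A" "N \<noteq> {\<one>}"
    and cl: "\<And>v. v \<in> N \<Longrightarrow> commutator G v b \<in> N"
  shows "(\<lambda>v. commutator G v b) ` N \<noteq> N"
proof
  assume eq: "(\<lambda>v. commutator G v b) ` N = N"
  have finN: "finite N" using fin N(1) subgroup.subset finite_subset by blast
  have "inj_on (\<lambda>v. commutator G v b) N" by (rule finite_surj_inj[OF finN]) (use eq in simp)
  moreover have one: "\<one> \<in> N" "commutator G \<one> b = \<one>"
    using subgroup.one_closed[OF N(1)] b by (simp_all add: commutator_def)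
  ultimately have fixed: "v = \<one>" if "v \<in> N" "commutator G v b = \<one>" for v
    using that inj_onD by fastforce
  have NA: "v \<in> A" if "v \<in> N" for v using that N(2) by blast
  define cj where "cj i v = inv (b [^] i) \<otimes> v \<otimes> b [^] i" for i :: nat and v
  have bi: "b [^] i \<in> carrier G" for i :: nat using b by simp
  have cj_add: "cj i (cj j v) = cj (j + i) v" if "v \<in> N" for i j v
    unfolding cj_def using NA[OF that] bi by (simp add: nat_pow_mult[OF b(1), symmetric] inv_mult_group m_assoc)
  have cjN: "cj i v \<in> N" if v: "v \<in> N" for i v
  proof (induction i)
    case 0
    then show ?case using v NA by (simp add: cj_def)
  next
    case (Suc i)
    have "cj 1 (cj i v) = cj i v \<otimes> commutator G (cj i v) b"
      using NA[OF Suc] b by (simp add: cj_def commutator_eq m_assoc[symmetric])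
    moreover have "cj i v \<otimes> commutator G (cj i v) b \<in> N" by (rule subgroup.m_closed[OF N(1) Suc cl[OF Suc]])
    ultimately show ?case using cj_add[OF v, of 1 i] by simp
  qed
  have cent: "subgroup {y \<in> carrier G. v \<otimes> y = y \<otimes> v} G" if "v \<in> carrier G" for v
  proof (rule subgroupI)
    show "{y \<in> carrier G. v \<otimes> y = y \<otimes> v} \<noteq> {}" using that by (auto intro!: exI[of _ \<one>])
    fix y assume "y \<in> {y \<in> carrier G. v \<otimes> y = y \<otimes> v}"
    then have y: "y \<in> carrier G" "v \<otimes> y = y \<otimes> v" by auto
    have "inv y \<otimes> v = v \<otimes> inv y"
      using commute_pow_int[OF y(1) that y(2)[symmetric], of "-1"] y(1) by (simp add: int_pow_neg int_pow_1)
    then show "inv y \<in> {y \<in> carrier G. v \<otimes> y = y \<otimes> v}" using y(1) by simp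
    fix z assume "z \<in> {y \<in> carrier G. v \<otimes> y = y \<otimes> v}"
    then have z: "z \<in> carrier G" "v \<otimes> z = z \<otimes> v" by auto
    have "v \<otimes> (y \<otimes> z) = (y \<otimes> v) \<otimes> z" using y z that by (simp add: m_assoc[symmetric])
    also have "\<dots> = (y \<otimes> z) \<otimes> v" using y(1) z that by (simp add: m_assoc)
    finally show "y \<otimes> z \<in> {y \<in> carrier G. v \<otimes> y = y \<otimes> v}" using y z by simp
  qed auto
  \<comment> \<open>b^p lies in the abelian A and fixes v, while b itself fixes only 1; so every
    stabilizer consists of the multiples of p.\<close>
  have cj_fix: "cj i v = v \<longleftrightarrow> int p dvd int i" if v: "v \<in> N" "v \<noteq> \<one>" for i v
  proof
    have vc: "v \<in> carrier G" using NA[OF v(1)] by simp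
    have com: "cj i v = v \<longleftrightarrow> v \<otimes> b [^] i = b [^] i \<otimes> v"
      unfolding cj_def using vc bi[of i] inv_solve_left'[of v "b [^] i" "v \<otimes> b [^] i"] by (simp add: m_assoc)
    { assume "cj i v = v"
      then have "b [^] int i \<in> {y \<in> carrier G. v \<otimes> y = y \<otimes> v}" using com b by (simp add: int_pow_int)
      then have "\<not> int p dvd int i \<Longrightarrow> b \<in> {y \<in> carrier G. v \<otimes> y = y \<otimes> v}"
        by (rule pow_unit_mem[OF prime ord cent[OF vc] b(1)])
      moreover have "b \<notin> {y \<in> carrier G. v \<otimes> y = y \<otimes> v}"
        using fixed[OF v(1)] v(2) commutator_one_iff[OF vc b(1)] by auto
      ultimately show "int p dvd int i" by blast }
    { assume "int p dvd int i"
      then have "b [^] int i \<in> A" using b_pow_A[OF b] by blast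
      then have "v \<otimes> b [^] i = b [^] i \<otimes> v" using A_comm[OF NA[OF v(1)]] by (simp add: int_pow_int)
      then show "cj i v = v" using com by blast }
  qed
  define r where "r = {(v, w). v \<in> N - {\<one>} \<and> w \<in> N - {\<one>} \<and> (\<exists>i. w = cj i v)}"
  \<comment> \<open>b to the power p^n is 1, so the exponent i (p^n - 1) undoes conjugation by b^i;
    natural exponents suffice for symmetry.\<close>
  have cj_back: "cj (i * (p ^ n - 1)) (cj i v) = v" if "v \<in> N" for i v
  proof -
    have "cj (i * (p ^ n - 1)) (cj i v) = cj (i + i * (p ^ n - 1)) v" using cj_add[OF that] by simp
    also have "i + i * (p ^ n - 1) = p ^ n * i" using p_gt by (simp add: algebra_simps diff_mult_distrib2)
    also have "b [^] (p ^ n * i) = \<one>" using pow_order_eq_1[OF b(1)] ord b(1) by (simp add: nat_pow_pow[symmetric])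
    then have "cj (p ^ n * i) v = v" using NA[OF that] by (simp add: cj_def)
    finally show ?thesis .
  qed
  have equiv: "equiv (N - {\<one>}) r"
  proof (rule equivI)
    show "r \<subseteq> (N - {\<one>}) \<times> (N - {\<one>})" by (auto simp: r_def)
    show "refl_on (N - {\<one>}) r"
    proof (rule refl_onI)
      fix v assume v: "v \<in> N - {\<one>}"
      then have "v = cj 0 v" using NA by (simp add: cj_def)
      then show "(v, v) \<in> r" unfolding r_def using v by blast
    qed
    show "sym r"
    proof (rule symI)
      fix v w assume "(v, w) \<in> r"
      then obtain i where i: "v \<in> N - {\<one>}" "w \<in> N - {\<one>}" "w = cj i v" unfolding r_def by blast
      then have "v = cj (i * (p ^ n - 1)) w" using cj_back by simp
      then show "(w, v) \<in> r" unfolding r_def using i by blast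
    qed
    show "trans r"
    proof (rule transI)
      fix v w x assume "(v, w) \<in> r" "(w, x) \<in> r"
      then obtain i j where i: "v \<in> N - {\<one>}" "w = cj i v" and j: "x \<in> N - {\<one>}" "x = cj j w" unfolding r_def by blast
      then have "x = cj (i + j) v" using cj_add by simp
      then show "(v, x) \<in> r" unfolding r_def using i j by blast
    qed
  qed
  have "p dvd card (N - {\<one>})"
  proof (rule equiv_imp_dvd_card[OF _ equiv])
    fix X assume "X \<in> (N - {\<one>}) // r"
    then obtain v where v: "v \<in> N" "v \<noteq> \<one>" "X = r `` {v}" by (auto elim: quotientE)
    have vc: "v \<in> carrier G" using NA[OF v(1)] by simp
    have ne: "cj i v \<noteq> \<one>" for i
    proof
      assume "cj i v = \<one>"
      then have "cj (i * (p ^ n - 1)) (cj i v) = \<one>" using bi by (simp add: cj_def)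
      then show False using cj_back[OF v(1)] v(2) by simp
    qed
    have red: "cj i v = cj (i mod p) v" for i
    proof -
      have "cj i v = cj (i mod p) (cj (p * (i div p)) v)" unfolding cj_add[OF v(1)] by simp
      moreover have "cj (p * (i div p)) v = v" using cj_fix[OF v(1,2)] by simp
      ultimately show ?thesis by simp
    qed
    have "X = (\<lambda>i. cj i v) ` {..<p}"
    proof (intro equalityI subsetI)
      fix w assume "w \<in> X"
      then obtain i where "w = cj i v" unfolding v(3) r_def by auto
      then have "w = cj (i mod p) v" using red by simp
      moreover have "i mod p < p" using p_gt by simp
      ultimately show "w \<in> (\<lambda>i. cj i v) ` {..<p}" by blast
    next
      fix w assume "w \<in> (\<lambda>i. cj i v) ` {..<p}"
      then show "w \<in> X" unfolding v(3) r_def using v cjN[OF v(1)] ne by auto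
    qed
    moreover have "inj_on (\<lambda>i. cj i v) {..<p}"
    proof (rule linorder_inj_onI)
      fix i j assume ij: "i < j" "i \<in> {..<p}" "j \<in> {..<p}"
      show "cj i v \<noteq> cj j v"
      proof
        assume e: "cj i v = cj j v"
        have "cj (j - i) (cj i v) = cj j v" using cj_add[OF v(1), of "j - i" i] ij by simp
        then have "cj (j - i) (cj i v) = cj i v" using e by simp
        then have "int p dvd int (j - i)" using cj_fix[OF cjN[OF v(1)] ne] by blast
        then have "p dvd j - i" by (simp only: int_dvd_int_iff)
        then have "p \<le> j - i" using ij(1) dvd_imp_le[of p "j - i"] by simp
        then show False using ij by auto
      qed
    qed auto
    ultimately show "p dvd card X" by (simp add: card_image)
  qed (use finN in simp)
  moreover have "p dvd card N"
  proof -
    have "card N dvd p ^ n" using lagrange[OF N(1)] ord by (metis dvd_triv_right)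
    then obtain e where e: "card N = p ^ e" using divides_primepow_nat[OF prime] by blast
    have "e \<noteq> 0"
    proof
      assume "e = 0"
      then have "card N = 1" using e by simp
      then show False using N(3) one(1) by (metis card_1_singletonE singletonD)
    qed
    then show ?thesis using e by (simp add: dvd_power)
  qed
  moreover have "card N = card (N - {\<one>}) + 1" using card.remove[OF finN one(1)] by simp
  ultimately have "p dvd 1" using dvd_add_right_iff[of p "card (N - {\<one>})" 1] by simp
  then show False using p_gt by simp
qed

lemma lower_central_subgroup: "subgroup (lower_central G i) G"
proof (induction i)
  case (Suc i)
  then have "{commutator G x y |x y. x \<in> lower_central G i \<and> y \<in> carrier G} \<subseteq> carrier G"
    using subgroup.mem_carrier by fastforce
  then show ?case using generate_is_subgroup by simp
qed (simp add: subgroup_self)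

lemma lower_central_commutator:
  "x \<in> lower_central G i \<Longrightarrow> y \<in> carrier G \<Longrightarrow> commutator G x y \<in> lower_central G (Suc i)"
  by (auto intro!: generate.incl)

lemma lower_central_mono: "lower_central G (Suc i) \<subseteq> lower_central G i"
proof (induction i)
  case 0
  then show ?case using subgroup.subset[OF lower_central_subgroup[of "Suc 0"]] by simp
next
  case (Suc i)
  have "{commutator G x y |x y. x \<in> lower_central G (Suc i) \<and> y \<in> carrier G}
      \<subseteq> {commutator G x y |x y. x \<in> lower_central G i \<and> y \<in> carrier G}" using Suc by blast
  from mono_generate[OF this] show ?case by (simp only: lower_central.simps)
qed

lemma lower_central_A: "lower_central G (Suc i) \<subseteq> A"
proof (induction i)
  case 0
  have "generate G {commutator G x y |x y. x \<in> lower_central G 0 \<and> y \<in> carrier G} \<subseteq> A"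
    by (rule generate_subgroup_incl[OF _ A]) (use commutator_in_A in auto)
  then show ?case by simp
next
  case (Suc i)
  then show ?case using lower_central_mono[of "Suc i"] by blast
qed

lemma not_A: obtains b where "b \<in> carrier G" "b \<notin> A"
proof -
  have "A \<noteq> carrier G"
  proof
    assume "A = carrier G"
    then have "subgroup_index G A * order G = order G"
      using lagrange[OF A] by (simp add: subgroup_index_def order_def)
    then show False using idx p_gt ord by simp
  qed
  then show ?thesis using that subgroup.subset[OF A] by blast
qed

text \<open>The next term is contained in the image of the endomorphism [v, b], which is a proper
  subgroup by \<open>commutators_proper\<close>. Indeed [v, w b^j] = [v, b^j] for w in A, and this
  is a product of commutators with b.\<close>

lemma lower_central_proper:
  assumes "lower_central G (Suc i) \<noteq> {\<one>}"
  shows "lower_central G (Suc (Suc i)) \<subset> lower_central G (Suc i)"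
proof -
  obtain b where b: "b \<in> carrier G" "b \<notin> A" by (rule not_A)
  let ?N = "lower_central G (Suc i)" and ?c = "\<lambda>v. commutator G v b"
  note N = lower_central_subgroup[of "Suc i"] lower_central_A[of i]
  have NA: "v \<in> A" if "v \<in> ?N" for v using that N(2) by blast
  have cl: "?c v \<in> ?N" if "v \<in> ?N" for v
    using lower_central_commutator[OF that b(1)] lower_central_mono by blast
  have X: "subgroup (?c ` ?N) G"
  proof (rule subgroupI)
    show "?c ` ?N \<subseteq> carrier G" using cl subgroup.subset[OF N(1)] by blast
    show "?c ` ?N \<noteq> {}" using subgroup.one_closed[OF N(1)] by blast
    fix x assume "x \<in> ?c ` ?N"
    then obtain v where v: "v \<in> ?N" "x = ?c v" by blast
    have vi: "inv v \<in> ?N" using v(1) subgroup.m_inv_closed[OF N(1)] by blast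
    have "?c (inv v) \<otimes> x = ?c (inv v \<otimes> v)" unfolding v(2) using commutator_mult[OF NA[OF vi] NA[OF v(1)] b(1)] by simp
    also have "\<dots> = \<one>" using NA[OF v(1)] b by (simp add: commutator_def)
    finally have "inv x = ?c (inv v)"
      using inv_equality[of "?c (inv v)" x] v cl vi subgroup.mem_carrier[OF N(1)] by blast
    then show "inv x \<in> ?c ` ?N" using vi by blast
    fix y assume "y \<in> ?c ` ?N"
    then obtain w where w: "w \<in> ?N" "y = ?c w" by blast
    have "x \<otimes> y = ?c (v \<otimes> w)" unfolding v(2) w(2) using commutator_mult[OF NA[OF v(1)] NA[OF w(1)] b(1)] by simp
    then show "x \<otimes> y \<in> ?c ` ?N" using v(1) w(1) subgroup.m_closed[OF N(1)] by blast
  qed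
  have gen: "commutator G v y \<in> ?c ` ?N" if v: "v \<in> ?N" and y: "y \<in> carrier G" for v y
  proof -
    have vA: "v \<in> A" by (rule NA[OF v])
    obtain j w where w: "w \<in> A" "y = w \<otimes> b [^] int j" using b y by (rule decomp)
    have 1: "commutator G v y = commutator G v (b [^] j)"
    proof -
      have "inv w \<otimes> v \<otimes> w = v" using A_comm[OF vA w(1)] w(1) vA by (simp add: m_assoc)
        (simp add: m_assoc[symmetric])
      moreover have "inv y \<otimes> v \<otimes> y = inv (b [^] j) \<otimes> (inv w \<otimes> v \<otimes> w) \<otimes> b [^] j"
        unfolding w(2) int_pow_int using w(1) vA b by (simp add: inv_mult_group m_assoc)
      ultimately show ?thesis using y vA b by (simp add: commutator_eq)
    qed
    have "commutator G v (b [^] j) \<in> ?c ` ?N \<and> inv (b [^] j) \<otimes> v \<otimes> b [^] j \<in> ?N"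
    proof (induction j)
      case 0
      have "commutator G v (b [^] (0::nat)) = ?c \<one>" using vA b by (simp add: commutator_def)
      then show ?case using v vA subgroup.one_closed[OF N(1)] by auto
    next
      case (Suc j)
      define v' where "v' = inv (b [^] j) \<otimes> v \<otimes> b [^] j"
      have v': "v' \<in> ?N" using Suc by (simp add: v'_def)
      have v'c: "v' \<in> carrier G" using NA[OF v'] by simp
      have bj: "b [^] j \<in> carrier G" using b by simp
      have s: "inv (b [^] Suc j) \<otimes> v \<otimes> b [^] Suc j = inv b \<otimes> v' \<otimes> b"
        unfolding v'_def using vA b by (simp add: inv_mult_group m_assoc)
      also have "\<dots> = v' \<otimes> ?c v'" using v'c b by (simp add: commutator_eq m_assoc[symmetric])
      finally have e: "inv (b [^] Suc j) \<otimes> v \<otimes> b [^] Suc j = v' \<otimes> ?c v'" .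
      have "commutator G v (b [^] Suc j) = inv v \<otimes> (v' \<otimes> ?c v')"
        using commutator_eq[of v "b [^] Suc j"] vA b e by simp
      also have "\<dots> = commutator G v (b [^] j) \<otimes> ?c v'"
        using commutator_eq[of v "b [^] j"] vA b v'c by (simp add: v'_def[symmetric] m_assoc)
      finally have "commutator G v (b [^] Suc j) \<in> ?c ` ?N"
        using Suc v' subgroup.m_closed[OF X] by auto
      then show ?case using e v' cl subgroup.m_closed[OF N(1)] by simp
    qed
    then show ?thesis using 1 by simp
  qed
  have "lower_central G (Suc (Suc i)) \<subseteq> ?c ` ?N"
    unfolding lower_central.simps(2)[of G "Suc i"] by (rule generate_subgroup_incl[OF _ X]) (use gen in auto)
  moreover have "?c ` ?N \<noteq> ?N" by (rule commutators_proper[OF b N(1,2) assms cl])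
  moreover have "?c ` ?N \<subseteq> ?N" using cl by blast
  ultimately show ?thesis by blast
qed

text \<open>\<open>nilp_class\<close> is a least number and carries information only if the series
  reaches the trivial group at all.\<close>

lemma nilpotent: "\<exists>c. lower_central G c = {\<one>}"
proof (rule ccontr)
  assume "\<nexists>c. lower_central G c = {\<one>}"
  then have "lower_central G (Suc i) \<noteq> {\<one>}" for i by blast
  note ps = lower_central_proper[OF this]
  have f: "finite (lower_central G i)" for i
    by (rule finite_subset[OF subgroup.subset[OF lower_central_subgroup] fin])
  have "card (lower_central G (Suc i)) + i \<le> card (lower_central G (Suc 0))" for i
  proof (induction i)
    case (Suc i)
    then show ?case using psubset_card_mono[OF f ps[of i]] by simp
  qed simp
  from this[of "Suc (card (lower_central G (Suc 0)))"] show False by simp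
qed

lemma class_4D:
  assumes "nilp_class G = 4"
  shows "lower_central G 4 = {\<one>}" "lower_central G 3 \<noteq> {\<one>}"
proof -
  show "lower_central G 4 = {\<one>}" using LeastI_ex[OF nilpotent] assms unfolding nilp_class_def by simp
  show "lower_central G 3 \<noteq> {\<one>}"
  proof
    assume "lower_central G 3 = {\<one>}"
    then have "nilp_class G \<le> 3" unfolding nilp_class_def by (rule Least_le)
    then show False using assms by simp
  qed
qed

end

section \<open>Groups of class 4\<close>

locale class4 = abelian_max +
  assumes L3: "lower_central G 3 \<noteq> {\<one>}" and L4: "lower_central G 4 = {\<one>}"
    and A3: "\<And>H. subgroup H G \<Longrightarrow> subgroup_index G H = p ^ 3 \<Longrightarrow> abelian_sub G H"

text \<open>The element a_4 that belongs to the pair a, b.\<close>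

definition (in group) top :: "'a \<Rightarrow> 'a \<Rightarrow> 'a" where
  "top a b = commutator G (commutator G (commutator G a b) b) b"

context class4
begin

definition pair :: "'a \<Rightarrow> 'a \<Rightarrow> bool" where
  "pair a b \<longleftrightarrow> a \<in> A \<and> b \<in> carrier G \<and> b \<notin> A \<and> generate G {a, b} = carrier G"

lemma pairD: "pair a b \<Longrightarrow> a \<in> A" "pair a b \<Longrightarrow> b \<in> carrier G" "pair a b \<Longrightarrow> b \<notin> A"
  by (simp_all add: pair_def)

lemma pairI:
  assumes "pair a b" "a' \<in> A" "b' \<in> carrier G" "b' \<notin> A"
    and "\<And>H. subgroup H G \<Longrightarrow> a' \<in> H \<Longrightarrow> b' \<in> H \<Longrightarrow> a \<in> H \<and> b \<in> H"
  shows "pair a' b'"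
proof -
  have s: "{a', b'} \<subseteq> carrier G" using assms by simp
  have H: "subgroup (generate G {a', b'}) G" using s by (rule generate_is_subgroup)
  have "a \<in> generate G {a', b'} \<and> b \<in> generate G {a', b'}"
    by (rule assms(5)[OF H]) (auto intro: generate.incl)
  then have "generate G {a, b} \<subseteq> generate G {a', b'}" using generate_subgroup_incl[OF _ H] by simp
  then have "generate G {a', b'} = carrier G"
    using assms(1) subgroup.subset[OF H] by (auto simp: pair_def)
  then show ?thesis using assms by (simp add: pair_def)
qed

end

text \<open>A marking whose kernel is still unknown.\<close>

locale framed = class4 +
  fixes a b and \<phi> :: "coords \<Rightarrow> 'a"
  assumes hom: "\<phi> \<in> hom HG G" and surj: "range \<phi> = carrier G"
    and phi_a: "\<phi> (0, 1, 0, 0, 0) = a" and phi_b: "\<phi> (1, 0, 0, 0, 0) = b"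
    and aA: "a \<in> A" and bA: "b \<notin> A"

lemma (in class4) pair_framed:
  assumes "pair a b"
  obtains \<phi> where "framed G p n A a b \<phi>"
proof -
  let ?a2 = "commutator G a b" and ?a3 = "commutator G (commutator G a b) b"
    and ?a4 = "commutator G (commutator G (commutator G a b) b) b"
  note ab = pairD[OF assms]
  have A: "a \<in> A" "?a2 \<in> A" "?a3 \<in> A" "?a4 \<in> A" using ab by (simp_all add: commutator_A)
  have "a \<in> lower_central G 0" using A by simp
  note l1 = lower_central_commutator[OF this ab(2)]
  note l4 = lower_central_commutator[OF lower_central_commutator[OF lower_central_commutator[OF l1 ab(2)] ab(2)] ab(2)]
  then have "commutator G ?a4 b \<in> lower_central G 4" by (simp only: numeral_eq_Suc pred_numeral_simps BitM.simps)
  then have a5: "commutator G ?a4 b = \<one>" unfolding L4 by simp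
  obtain \<phi> where phi: "\<phi> \<in> hom HG G" "\<phi> (0, 1, 0, 0, 0) = a" "\<phi> (1, 0, 0, 0, 0) = b"
    using HG_lift[OF Ac[OF A(1)] ab(2) HOL.refl HOL.refl HOL.refl a5] A_comm A by metis
  have "range \<phi> = carrier G"
    using hom_HG_image[OF is_group phi(1)] phi(2,3) assms by (simp add: pair_def)
  then have "framed G p n A a b \<phi>" using phi ab by unfold_locales auto
  then show ?thesis by (rule that)
qed

section \<open>Relations forced by class 4 and by the condition on index p^3\<close>

context framed
begin

sublocale phi: group_hom HG G \<phi>
  using group_hom_HG[OF is_group hom] .

lemma phi_closed [simp]: "\<phi> h \<in> carrier G" using surj by auto

lemma phi_mult [simp]: "\<phi> g \<otimes> \<phi> h = \<phi> (hmul g h)"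
  using phi.hom_mult[of g h] by simp

lemma phi_inv [simp]: "inv (\<phi> h) = \<phi> (hinv h)"
  using phi.hom_inv[of h] by simp

lemma phi_one: "\<phi> (0, 0, 0, 0, 0) = \<one>"
  using phi.hom_one by simp

lemma phi_commutator: "commutator G (\<phi> g) (\<phi> h) = \<phi> (commutator HG g h)"
  by (simp add: commutator_def)

lemma bc [simp]: "b \<in> carrier G" using phi_b phi_closed by metis

lemma phi_b_pow: "\<phi> (k, 0, 0, 0, 0) = b [^] k"
  using phi.hom_int_pow[of "(1, 0, 0, 0, 0)" k] by (simp add: HG_pow_b phi_b)

lemma phi_vec_pow: "\<phi> (0, c1, c2, c3, c4) [^] (i::int) = \<phi> (0, i * c1, i * c2, i * c3, i * c4)"
  using phi.hom_int_pow[of "(0, c1, c2, c3, c4)" i] by (simp add: HG_pow_vec)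

lemma top_eq: "top a b = \<phi> (0, 0, 0, 0, 1)" "top a b [^] (c::int) = \<phi> (0, 0, 0, 0, c)"
proof -
  show t: "top a b = \<phi> (0, 0, 0, 0, 1)"
    unfolding top_def phi_a[symmetric] phi_b[symmetric] phi_commutator commutator_HG_shift ..
  show "top a b [^] c = \<phi> (0, 0, 0, 0, c)" unfolding t phi_vec_pow by simp
qed

lemma vec_A: "\<phi> (0, c1, c2, c3, c4) \<in> A"
proof -
  have sh: "\<phi> (0, 0, d1, d2, d3) \<in> A" if "\<phi> (0, d1, d2, d3, d4) \<in> A" for d1 d2 d3 d4
    using commutator_A[OF that bc] unfolding phi_b[symmetric] phi_commutator commutator_HG_shift .
  have 1: "\<phi> (0, 1, 0, 0, 0) \<in> A" unfolding phi_a by (rule aA)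
  note 2 = sh[OF 1] note 3 = sh[OF 2] note 4 = sh[OF 3]
  have "\<phi> (0, 1, 0, 0, 0) [^] c1 \<otimes> (\<phi> (0, 0, 1, 0, 0) [^] c2 \<otimes> (\<phi> (0, 0, 0, 1, 0) [^] c3 \<otimes> \<phi> (0, 0, 0, 0, 1) [^] c4)) \<in> A"
    using 1 2 3 4 by (intro Am Ap)
  then show ?thesis unfolding phi_vec_pow by simp
qed

lemma phi_A_iff: "\<phi> (k, c1, c2, c3, c4) \<in> A \<longleftrightarrow> int p dvd k"
proof -
  have e: "\<phi> (k, c1, c2, c3, c4) = b [^] k \<otimes> \<phi> (0, c1, c2, c3, c4)"
    unfolding phi_b_pow[symmetric] by simp
  have "b [^] k \<otimes> \<phi> (0, c1, c2, c3, c4) \<in> A \<longleftrightarrow> b [^] k \<in> A"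
  proof
    assume "b [^] k \<otimes> \<phi> (0, c1, c2, c3, c4) \<in> A"
    then have "b [^] k \<otimes> \<phi> (0, c1, c2, c3, c4) \<otimes> inv (\<phi> (0, c1, c2, c3, c4)) \<in> A" by (rule Am[OF _ Ai[OF vec_A]])
    then show "b [^] k \<in> A" using bc by (simp add: m_assoc del: phi_inv phi_mult)
  qed (simp add: Am vec_A)
  then show ?thesis unfolding e using b_pow_A[OF bc bA] by simp
qed

text \<open>The shifted vector is the commutator of the element with b. Applied to the identity it
  shows that the kernel is closed under shifts.\<close>

lemma shift_commute:
  assumes "\<phi> (k, c1, c2, c3, c4) \<otimes> b = b \<otimes> \<phi> (k, c1, c2, c3, c4)"
  shows "\<phi> (0, 0, c1, c2, c3) = \<one>"
proof -
  have "b \<otimes> \<phi> (k, c1, c2, c3, c4) \<otimes> \<phi> (0, 0, c1, c2, c3) = \<phi> (k, c1, c2, c3, c4) \<otimes> b"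
    unfolding phi_b[symmetric] by (simp add: algebra_simps)
  then have "b \<otimes> \<phi> (k, c1, c2, c3, c4) \<otimes> \<phi> (0, 0, c1, c2, c3) = b \<otimes> \<phi> (k, c1, c2, c3, c4)"
    unfolding assms .
  then show ?thesis by (metis bc l_cancel_one m_closed phi_closed)
qed

lemma shift_one: "\<phi> (k, c1, c2, c3, c4) = \<one> \<Longrightarrow> \<phi> (0, 0, c1, c2, c3) = \<one>"
  by (rule shift_commute[of k _ _ _ c4]) simp

text \<open>b^p lies in the abelian A and so commutes with a_1; in coordinates this is (1 + x)^p - 1
  = x N acting trivially. \<open>r3\<close> and \<open>r4\<close> are the shifts, the last one being
  a_4^p = 1.\<close>

lemma r2: "\<phi> (0, 0, int p, B2 p, B3 p) = \<one>"
proof -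
  have "\<phi> (int p, 0, 0, 0, 0) \<in> A" unfolding phi_A_iff by simp
  then have "\<phi> (0, 1, 0, 0, 0) \<otimes> \<phi> (int p, 0, 0, 0, 0) = \<phi> (int p, 0, 0, 0, 0) \<otimes> \<phi> (0, 1, 0, 0, 0)"
    by (rule A_comm[OF vec_A])
  then have "\<phi> (int p, 1, 0, 0, 0) \<otimes> \<phi> (0, 0, int p, B2 p, B3 p) = \<phi> (int p, 1, 0, 0, 0)" by simp
  then show ?thesis by (metis l_cancel_one phi_closed)
qed

lemma r3: "\<phi> (0, 0, 0, int p, B2 p) = \<one>" using shift_one[OF r2] .

lemma r4: "\<phi> (0, 0, 0, 0, int p) = \<one>" using shift_one[OF r3] .

lemma r_pow: "\<phi> (0, 0, int p * i, B2 p * i, B3 p * i) = \<one>" "\<phi> (0, 0, 0, int p * i, B2 p * i) = \<one>" "\<phi> (0, 0, 0, 0, int p * i) = \<one>"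
proof -
  have "\<phi> (0, 0, int p, B2 p, B3 p) [^] i = \<one>" "\<phi> (0, 0, 0, int p, B2 p) [^] i = \<one>" "\<phi> (0, 0, 0, 0, int p) [^] i = \<one>"
    unfolding r2 r3 r4 by simp_all
  then show "\<phi> (0, 0, int p * i, B2 p * i, B3 p * i) = \<one>" "\<phi> (0, 0, 0, int p * i, B2 p * i) = \<one>" "\<phi> (0, 0, 0, 0, int p * i) = \<one>"
    unfolding phi_vec_pow by (simp_all add: mult.commute)
qed

lemma a4_ne: "\<phi> (0, 0, 0, 0, 1) \<noteq> \<one>"
proof
  assume "\<phi> (0, 0, 0, 0, 1) = \<one>"
  then have "\<phi> (0, 0, 0, 0, c) = \<one>" for c using phi_vec_pow[of 0 0 0 1 c] by simp
  then have "lower_central G 3 \<subseteq> {\<one>}" using lower_central_HG(3)[OF is_group hom surj] by auto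
  then show False using L3 subgroup.one_closed[OF lower_central_subgroup[of 3]] by blast
qed

lemma a4_iff: "\<phi> (0, 0, 0, 0, c) = \<one> \<longleftrightarrow> int p dvd c"
proof
  assume c: "\<phi> (0, 0, 0, 0, c) = \<one>"
  have "\<phi> (0, 0, 0, 0, 1) [^] c \<in> {\<one>}" unfolding phi_vec_pow using c by simp
  then show "int p dvd c"
    using pow_unit_mem[OF prime ord triv_subgroup phi_closed, of _ c] a4_ne by blast
next
  assume "int p dvd c"
  then show "\<phi> (0, 0, 0, 0, c) = \<one>" using r_pow(3) by (elim dvdE) simp
qed

lemma mult_vec_one: "\<phi> (0, d1, d2, d3, d4) = \<one> \<Longrightarrow>
  \<phi> (k, c1 + d1, c2 + d2, c3 + d3, c4 + d4) = \<phi> (k, c1, c2, c3, c4)"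
proof -
  assume d: "\<phi> (0, d1, d2, d3, d4) = \<one>"
  have "\<phi> (k, c1 + d1, c2 + d2, c3 + d3, c4 + d4) = \<phi> (k, c1, c2, c3, c4) \<otimes> \<phi> (0, d1, d2, d3, d4)" by simp
  then show ?thesis unfolding d by simp
qed

text \<open>Three shifts bring c_1 to the place of a_4, which has order p. Two shifts bring c_2
  there, after c_1 has been removed by \<open>r3\<close>.\<close>

lemma kernel_dvd:
  assumes "\<phi> (k, c1, c2, c3, c4) = \<one>"
  obtains n1 n2 where "c1 = int p * n1" "c2 = B2 p * n1 + int p * n2"
proof -
  note s1 = shift_one[OF assms] note s2 = shift_one[OF s1] note s3 = shift_one[OF s2]
  obtain n1 where n1: "c1 = int p * n1" using s3 unfolding a4_iff by (rule dvdE)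
  have "\<phi> (0, 0, 0, 0 + int p * n1, (c2 - B2 p * n1) + B2 p * n1) = \<phi> (0, 0, 0, 0, c2 - B2 p * n1)"
    using mult_vec_one[OF r_pow(2)[of n1], of 0 0 0 0 "c2 - B2 p * n1"] by simp
  then have "int p dvd c2 - B2 p * n1" using s2 n1 unfolding a4_iff[symmetric] by simp
  then obtain n2 where "c2 - B2 p * n1 = int p * n2" by (rule dvdE)
  then have "c2 = B2 p * n1 + int p * n2" by simp
  with n1 show ?thesis by (rule that)
qed

lemma phi_pow_1: "\<phi> (1, c1, c2, c3, c4) [^] (i::nat) =
    \<phi> (int i, i * c1, i * c2 + B2 i * c1, i * c3 + B2 i * c2 + B3 i * c1,
     i * c4 + B2 i * c3 + B3 i * c2 + B4 i * c1)"
  using phi.hom_nat_pow[of "(1, c1, c2, c3, c4)" i] by (simp only: HG_pow_1 carrier_HG UNIV_I)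

lemma ba_pow: "(b \<otimes> a [^] (j::int)) [^] p = b [^] p \<otimes> \<phi> (0, int p, B2 p, B3 p, B4 p) [^] j"
proof -
  have "b \<otimes> a [^] j = \<phi> (1, j, 0, 0, 0)" unfolding phi_a[symmetric] phi_b[symmetric] phi_vec_pow by simp
  moreover have "b [^] p = \<phi> (int p, 0, 0, 0, 0)" unfolding phi_b_pow by (simp add: int_pow_int)
  ultimately show ?thesis unfolding phi_vec_pow phi_pow_1 by (simp add: phi_pow_1 mult.commute)
qed

text \<open>If the kernel satisfied p^2 | c_1 and p | c_2, these conditions would define a subgroup
  of index p^3 in \<open>G\<close>. It contains a_3 and b, which do not commute, contrary to
  \<open>A3\<close>.\<close>

lemma small_index:
  assumes T: "\<And>k c1 c2 c3 c4. \<phi> (k, c1, c2, c3, c4) = \<one> \<Longrightarrow> int p ^ 2 dvd c1 \<and> int p dvd c2"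
  shows False
proof -
  define T where "T = {(k::int, c1, c2, c3::int, c4::int). int p ^ 2 dvd c1 \<and> int p dvd c2}"
  have p2: "int p dvd c" if "int p ^ 2 dvd c" for c using that by (meson dvd_power dvd_trans pos2)
  have sT: "subgroup T HG"
  proof (rule group.subgroupI[OF group_HG])
    show "T \<noteq> {}" by (auto simp: T_def intro!: exI[of _ 0])
    fix x y assume xy: "x \<in> T" "y \<in> T"
    obtain k c1 c2 c3 c4 l d1 d2 d3 d4 where x: "x = (k, c1, c2, c3, c4)" and y: "y = (l, d1, d2, d3, d4)"
      by (metis surj_pair)
    have c: "int p ^ 2 dvd c1" "int p dvd c2" "int p ^ 2 dvd d1" "int p dvd d2"
      using xy unfolding x y T_def by simp_all
    have "int p ^ 2 dvd c1 + d1" "int p dvd c2 + l * c1 + d2"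
      by (intro dvd_add dvd_mult c p2[OF c(1)])+
    then show "x \<otimes>\<^bsub>HG\<^esub> y \<in> T" unfolding x y by (simp add: T_def)
    have "int p ^ 2 dvd - c1" "int p dvd - (c2 - k * c1)"
      unfolding dvd_minus_iff by (intro dvd_diff dvd_mult c p2[OF c(1)])+
    then show "inv\<^bsub>HG\<^esub> x \<in> T" unfolding x by (simp add: T_def)
  qed simp
  define S where "S = \<phi> ` T"
  have S: "subgroup S G" unfolding S_def using sT by (rule phi.subgroup_img_is_subgroup)
  have inS: "\<phi> (k, c1, c2, c3, c4) \<in> S \<longleftrightarrow> int p ^ 2 dvd c1 \<and> int p dvd c2" for k c1 c2 c3 c4
  proof
    assume "\<phi> (k, c1, c2, c3, c4) \<in> S"
    then obtain h where h: "h \<in> T" "\<phi> h = \<phi> (k, c1, c2, c3, c4)" unfolding S_def by force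
    obtain l d1 d2 d3 d4 where hd: "h = (l, d1, d2, d3, d4)" by (cases h)
    have d: "int p ^ 2 dvd d1" "int p dvd d2" using h(1) unfolding hd T_def by auto
    have "\<phi> (hmul (hinv h) (k, c1, c2, c3, c4)) = inv (\<phi> h) \<otimes> \<phi> (k, c1, c2, c3, c4)"
      by (simp del: hmul.simps hinv.simps)
    also have "\<dots> = \<one>" unfolding h(2) by (rule l_inv[OF phi_closed])
    finally have "int p ^ 2 dvd c1 - d1 \<and> int p dvd (l * d1 - d2) + k * (- d1) + c2"
      unfolding hd using T by (simp add: algebra_simps)
    then have e: "int p ^ 2 dvd c1 - d1" "int p dvd (l * d1 - d2) + k * (- d1) + c2" by auto
    have "int p dvd d2 - l * d1 + k * d1" by (intro dvd_add dvd_diff dvd_mult d p2[OF d(1)])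
    from dvd_add[OF e(1) d(1)] dvd_add[OF e(2) this] show "int p ^ 2 dvd c1 \<and> int p dvd c2" by simp
  next
    assume "int p ^ 2 dvd c1 \<and> int p dvd c2"
    then show "\<phi> (k, c1, c2, c3, c4) \<in> S" unfolding S_def T_def by blast
  qed
  let ?I = "{0..<int p ^ 2} \<times> {0..<int p}"
  let ?F = "\<lambda>(i, j). S #> \<phi> (0, i, j, 0, 0)"
  have eq: "S #> \<phi> (k, c1, c2, c3, c4) = S #> \<phi> (0, i, j, 0, 0) \<longleftrightarrow> int p ^ 2 dvd c1 - i \<and> int p dvd c2 - j"
    for k c1 c2 c3 c4 i j
    unfolding rcos_eq_iff[OF S phi_closed phi_closed] phi_inv hinv.simps phi_mult hmul.simps inS by simp
  have "bij_betw ?F ?I (rcosets S)"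
    unfolding bij_betw_def
  proof
    show "inj_on ?F ?I"
    proof (rule inj_onI)
      fix x y assume xy: "x \<in> ?I" "y \<in> ?I" "?F x = ?F y"
      obtain i j i' j' where ij: "x = (i, j)" "y = (i', j')" by (metis surj_pair)
      have "int p ^ 2 dvd i - i'" "int p dvd j - j'" using xy(3) eq unfolding ij by auto
      then have "i mod int p ^ 2 = i' mod int p ^ 2" "j mod int p = j' mod int p" by (simp_all add: mod_eq_dvd_iff)
      then show "x = y" using xy(1,2) unfolding ij by simp
    qed
    show "?F ` ?I = rcosets S"
    proof (intro equalityI subsetI)
      fix X assume "X \<in> ?F ` ?I"
      then show "X \<in> rcosets S" using rcosetsI[OF subgroup.subset[OF S]] by auto
    next
      fix X assume "X \<in> rcosets S"
      then obtain y where y: "y \<in> carrier G" "X = S #> y" unfolding RCOSETS_def by blast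
      then obtain h where "y = \<phi> h" using surj by blast
      moreover obtain k c1 c2 c3 c4 where "h = (k, c1, c2, c3, c4)" by (cases h)
      ultimately have X: "X = S #> \<phi> (k, c1, c2, c3, c4)" using y by simp
      show "X \<in> ?F ` ?I"
      proof (rule image_eqI)
        show "X = ?F (c1 mod int p ^ 2, c2 mod int p)"
          unfolding X prod.case eq by (simp add: minus_mod_eq_mult_div)
        show "(c1 mod int p ^ 2, c2 mod int p) \<in> ?I" using p_gt by simp
      qed
    qed
  qed
  then have "card ?I = card (rcosets S)" by (rule bij_betw_same_card)
  then have "card (rcosets S) = card ?I" by simp
  also have "\<dots> = p ^ 2 * p"
  proof -
    have "nat (int p ^ 2) = p ^ 2" by (metis nat_int of_nat_power)
    then show ?thesis by (simp add: card_cartesian_product)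
  qed
  also have "\<dots> = p ^ 3" by (simp add: numeral_eq_Suc)
  finally have "subgroup_index G S = p ^ 3" unfolding subgroup_index_def .
  then have ab: "abelian_sub G S" using A3[OF S] by blast
  have "\<phi> (0, 0, 0, 1, 0) \<in> S" "b \<in> S" unfolding phi_b[symmetric] inS by simp_all
  then have "\<phi> (0, 0, 0, 1, 0) \<otimes> b = b \<otimes> \<phi> (0, 0, 0, 1, 0)" using iffD1[OF abelian_sub_iff[OF S] ab] by blast
  then have "\<phi> (0, 0, 0, 0, 1) = \<one>" by (rule shift_commute)
  then show False using a4_ne by blast
qed

text \<open>A relation with c_1 equal to p times a unit exists; a power of it has c_1 = p. It says
  that N a_1 is a power of b times a vector f without a_1. As N a_1 commutes with b, so does f,
  which leaves only a power of a_4.\<close>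

lemma norm_eq: obtains \<kappa> \<sigma> where "\<phi> (0, int p, B2 p, B3 p, B4 p) = \<phi> (int p * \<kappa>, 0, 0, 0, \<sigma>)"
proof -
  \<comment> \<open>If n_1 were always divisible by p, \<open>kernel_dvd\<close> would give the
    divisibilities excluded by \<open>small_index\<close>.\<close>
  have "\<exists>k n1 c2 c3 c4. \<phi> (k, int p * n1, c2, c3, c4) = \<one> \<and> \<not> int p dvd n1"
  proof (rule ccontr)
    assume n: "\<not> ?thesis"
    have "int p ^ 2 dvd c1 \<and> int p dvd c2" if ker: "\<phi> (k, c1, c2, c3, c4) = \<one>" for k c1 c2 c3 c4
    proof -
      obtain n1 n2 where nn: "c1 = int p * n1" "c2 = B2 p * n1 + int p * n2" using ker by (rule kernel_dvd)
      then have "int p dvd n1" using n ker by blast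
      then show ?thesis unfolding nn by (simp add: power2_eq_square)
    qed
    then show False by (rule small_index)
  qed
  then obtain k n1 c2 c3 c4 where ker: "\<phi> (k, int p * n1, c2, c3, c4) = \<one>" and n1: "\<not> int p dvd n1" by blast
  obtain i :: nat where i: "i > 0" "[n1 * int i = 1] (mod int p ^ n)"
    using prime n1 by (rule inverse_mod_prime)
  then have "int p ^ n dvd n1 * int i - 1" by (simp add: cong_iff_dvd_diff)
  then obtain j where "n1 * int i - 1 = int p ^ n * j" by (rule dvdE)
  then have "n1 * int i = 1 + int (p ^ n) * j" by simp
  then have "int p * (n1 * int i) = int p * (1 + int (p ^ n) * j)" by (simp only:)
  then have j: "int i * (int p * n1) = int p + int (p ^ n) * (int p * j)" by (simp add: algebra_simps)
  obtain d2 d3 d4 where d: "(k, int p * n1, c2, c3, c4) [^]\<^bsub>HG\<^esub> i = (int i * k, int i * (int p * n1), d2, d3, d4)"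
    by (rule HG_pow_fst)
  have "\<phi> ((k, int p * n1, c2, c3, c4) [^]\<^bsub>HG\<^esub> i) = \<one>"
    using phi.hom_nat_pow[of "(k, int p * n1, c2, c3, c4)" i] ker by simp
  then have e1: "\<phi> (int i * k, int p + int (p ^ n) * (int p * j), d2, d3, d4) = \<one>" unfolding d j .
  define l where "l = int i * k"
  have "\<phi> (0, int (p ^ n) * (int p * j), 0, 0, 0) = \<phi> (0, 1, 0, 0, 0) [^] (int (p ^ n) * (int p * j))"
    unfolding phi_vec_pow by simp
  also have "\<dots> = \<one>" by (rule pow_ord[OF phi_closed])
  finally have "\<phi> (l, int p, d2, d3, d4) = \<one>"
    using mult_vec_one[of "int (p ^ n) * (int p * j)" 0 0 0 l "int p" d2 d3 d4] e1 by (simp add: l_def)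
  then have e2: "\<phi> (l, int p, B2 p, B3 p, B4 p) = \<phi> (0, 0, B2 p - d2, B3 p - d3, B4 p - d4)"
  proof -
    assume e: "\<phi> (l, int p, d2, d3, d4) = \<one>"
    have "\<phi> (l, int p, B2 p, B3 p, B4 p) = \<phi> (l, int p, d2, d3, d4) \<otimes> \<phi> (0, 0, B2 p - d2, B3 p - d3, B4 p - d4)"
      by simp
    then show ?thesis unfolding e by (simp only: l_one phi_closed)
  qed
  have lA: "int p dvd l"
  proof -
    have "\<phi> (l, int p, B2 p, B3 p, B4 p) \<in> A" unfolding e2 by (rule vec_A)
    then show ?thesis unfolding phi_A_iff .
  qed
  define f2 f3 f4 where "f2 = B2 p - d2" and "f3 = B3 p - d3" and "f4 = B4 p - d4"
  have e3: "\<phi> (l, int p, B2 p, B3 p, B4 p) = \<phi> (0, 0, f2, f3, f4)" using e2 by (simp add: f2_def f3_def f4_def)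
  \<comment> \<open>The commutator with b is the shift of N, that is, the relator
    \<open>r2\<close>.\<close>
  have com: "\<phi> (l, int p, B2 p, B3 p, B4 p) \<otimes> b = b \<otimes> \<phi> (l, int p, B2 p, B3 p, B4 p)"
  proof -
    have "\<phi> (l, int p, B2 p, B3 p, B4 p) \<otimes> b = b \<otimes> \<phi> (l, int p, B2 p, B3 p, B4 p) \<otimes> \<phi> (0, 0, int p, B2 p, B3 p)"
      unfolding phi_b[symmetric] by (simp add: algebra_simps)
    then show ?thesis unfolding r2 by simp
  qed
  have s1: "\<phi> (0, 0, 0, f2, f3) = \<one>" by (rule shift_commute[of 0 0 f2 f3 f4]) (use com in \<open>simp only: e3\<close>)
  have s2: "\<phi> (0, 0, 0, 0, f2) = \<one>" by (rule shift_one[OF s1])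
  obtain g2 where g2: "f2 = int p * g2" using s2 unfolding a4_iff by (rule dvdE)
  have "\<phi> (0, 0, 0, 0, f3 - B2 p * g2) = \<one>"
    using mult_vec_one[OF r_pow(2)[of g2], of 0 0 0 0 "f3 - B2 p * g2"] s1 g2 by simp
  then obtain g3 where g3: "f3 - B2 p * g2 = int p * g3" unfolding a4_iff by (rule dvdE)
  then have f3: "f3 = int p * g3 + B2 p * g2" by simp
  have "\<phi> (0, 0, f2, f3, f4) = \<phi> (0, 0, 0, int p * g3, f4 - B3 p * g2)"
    using mult_vec_one[OF r_pow(1)[of g2], of 0 0 0 "int p * g3" "f4 - B3 p * g2"] g2 f3 by simp
  also have "\<dots> = \<phi> (0, 0, 0, 0, f4 - B3 p * g2 - B2 p * g3)"
    using mult_vec_one[OF r_pow(2)[of g3], of 0 0 0 0 "f4 - B3 p * g2 - B2 p * g3"] by simp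
  finally have e4: "\<phi> (l, int p, B2 p, B3 p, B4 p) = \<phi> (0, 0, 0, 0, f4 - B3 p * g2 - B2 p * g3)" using e3 by simp
  have "\<phi> (0, int p, B2 p, B3 p, B4 p) = \<phi> (- l, 0, 0, 0, 0) \<otimes> \<phi> (l, int p, B2 p, B3 p, B4 p)" by simp
  also have "\<dots> = \<phi> (- l, 0, 0, 0, f4 - B3 p * g2 - B2 p * g3)" unfolding e4 by simp
  finally have e5: "\<phi> (0, int p, B2 p, B3 p, B4 p) = \<phi> (- l, 0, 0, 0, f4 - B3 p * g2 - B2 p * g3)" .
  obtain \<kappa> where "l = int p * \<kappa>" using lA by (rule dvdE)
  then have "- l = int p * (- \<kappa>)" by simp
  then show ?thesis using e5 that by metis
qed

text \<open>The four relators clear the a-coordinates of a kernel element one by one, leaving b^k as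
  a power of a_4. By the minimality in \<open>min\<close> this forces p^m to divide k.\<close>

lemma framed_marked:
  assumes m: "m \<ge> 1" and Na: "\<phi> (0, int p, B2 p, B3 p, B4 p) = \<phi> (0, 0, 0, 0, s)"
    and bm: "b [^] (int p ^ m) = \<phi> (0, 0, 0, 0, u)"
    and min: "\<And>c. b [^] (int p ^ (m - 1)) \<noteq> \<phi> (0, 0, 0, 0, c)"
  shows "marked G p m s u \<phi>"
proof
  have r1: "\<phi> (0, int p, B2 p, B3 p, B4 p - s) = \<one>"
  proof -
    have "\<phi> (0, int p, B2 p, B3 p, B4 p - s) = \<phi> (0, int p, B2 p, B3 p, B4 p) \<otimes> \<phi> (0, 0, 0, 0, - s)" by simp
    also have "\<dots> = \<one>" unfolding Na using phi_one by simp
    finally show ?thesis .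
  qed
  have bk: "\<phi> (int p ^ m, 0, 0, 0, - u) = \<one>"
  proof -
    have "\<phi> (int p ^ m, 0, 0, 0, - u) = \<phi> (int p ^ m, 0, 0, 0, 0) \<otimes> \<phi> (0, 0, 0, 0, - u)" by simp
    also have "\<dots> = \<one>" unfolding phi_b_pow bm using phi_one by simp
    finally show ?thesis .
  qed
  have r1_pow: "\<phi> (0, int p * i, B2 p * i, B3 p * i, (B4 p - s) * i) = \<one>" for i
  proof -
    have "\<phi> (0, int p, B2 p, B3 p, B4 p - s) [^] i = \<one>" unfolding r1 by simp
    then show ?thesis unfolding phi_vec_pow by (simp add: mult.commute)
  qed
  show "\<phi> h = \<one> \<longleftrightarrow> h \<in> K p m s u" for h
  proof
    assume "h \<in> K p m s u"
    then show "\<phi> h = \<one>" by (rule hom_HG_kills_K[OF is_group hom r1 bk])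
  next
    assume h1: "\<phi> h = \<one>"
    obtain k c1 c2 c3 c4 where h: "h = (k, c1, c2, c3, c4)" by (cases h)
    have e0: "\<phi> (k, c1, c2, c3, c4) = \<one>" using h1 h by simp
    obtain n1 n2 where n: "c1 = int p * n1" "c2 = B2 p * n1 + int p * n2" using e0 by (rule kernel_dvd)
    have e1: "\<phi> (k, 0, c2 - B2 p * n1, c3 - B3 p * n1, c4 - (B4 p - s) * n1) = \<one>"
      using mult_vec_one[OF r1_pow[of n1], of k 0 "c2 - B2 p * n1" "c3 - B3 p * n1" "c4 - (B4 p - s) * n1"]
        e0 n(1) by simp
    have e2: "\<phi> (k, 0, 0, c3 - B3 p * n1 - B2 p * n2, c4 - (B4 p - s) * n1 - B3 p * n2) = \<one>"
      using mult_vec_one[OF r_pow(1)[of n2], of k 0 0 "c3 - B3 p * n1 - B2 p * n2" "c4 - (B4 p - s) * n1 - B3 p * n2"]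
        e1 n(2) by simp
    note s1 = shift_one[OF e2]
    obtain n3 where n3: "c3 - B3 p * n1 - B2 p * n2 = int p * n3" using s1 unfolding a4_iff by (rule dvdE)
    define d where "d = c4 - (B4 p - s) * n1 - B3 p * n2 - B2 p * n3"
    have e3: "\<phi> (k, 0, 0, 0, d) = \<one>"
      using mult_vec_one[OF r_pow(2)[of n3], of k 0 0 0 "d"] e2 n3 by (simp add: d_def)
    have bkd: "b [^] k = \<phi> (0, 0, 0, 0, - d)"
    proof -
      have "\<phi> (k, 0, 0, 0, d) \<otimes> \<phi> (0, 0, 0, 0, - d) = \<phi> (k, 0, 0, 0, 0)" by simp
      then show ?thesis unfolding e3 phi_b_pow[symmetric] by simp
    qed
    have lin: "\<exists>c. b [^] (x * k + y * int p ^ m) = \<phi> (0, 0, 0, 0, c)" for x y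
    proof -
      have "b [^] (x * k + y * int p ^ m) = (b [^] k) [^] x \<otimes> (b [^] (int p ^ m)) [^] y"
        by (simp add: int_pow_mult int_pow_pow mult.commute)
      then show ?thesis unfolding bkd bm phi_vec_pow phi_mult by auto
    qed
    have "int p ^ m dvd k"
    proof (rule ccontr)
      assume nd: "\<not> int p ^ m dvd k"
      \<comment> \<open>The exponents that bring b into the group of a_4 form an ideal. It contains
        g, and g divides p^(m - 1) unless p^m divides k.\<close>
      define g where "g = gcd k (int p ^ m)"
      have "g dvd int p ^ m" by (simp add: g_def)
      moreover have "nat g dvd p ^ m"
        using calculation by (metis g_def gcd_ge_0_int int_dvd_int_iff nat_0_le of_nat_power)
      then obtain e where e: "e \<le> m" "nat g = p ^ e" using divides_primepow_nat[OF prime] by blast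
      have ge: "g = int p ^ e" using e(2) by (metis g_def gcd_ge_0_int nat_0_le of_nat_power)
      have "e \<noteq> m" using nd ge unfolding g_def by (metis gcd_dvd1)
      then have "e \<le> m - 1" using e(1) by simp
      then have "g dvd int p ^ (m - 1)" unfolding ge by (rule le_imp_power_dvd)
      then obtain q where q: "int p ^ (m - 1) = g * q" by (rule dvdE)
      obtain x y where xy: "x * k + y * int p ^ m = g" unfolding g_def using bezout_int by blast
      have "int p ^ (m - 1) = (q * x) * k + (q * y) * int p ^ m" unfolding q xy[symmetric] by (simp add: algebra_simps)
      then show False using lin[of "q * x" "q * y"] min by simp
    qed
    then obtain j where j: "k = int p ^ m * j" by (rule dvdE)
    have "b [^] k = (b [^] (int p ^ m)) [^] j" unfolding j by (simp add: int_pow_pow)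
    then have "\<phi> (0, 0, 0, 0, - d) = \<phi> (0, 0, 0, 0, u * j)" unfolding bkd bm phi_vec_pow by (simp add: mult.commute)
    then have "\<phi> (0, 0, 0, 0, u * j) \<otimes> \<phi> (0, 0, 0, 0, d) = \<phi> (0, 0, 0, 0, - d) \<otimes> \<phi> (0, 0, 0, 0, d)" by simp
    then have "\<phi> (0, 0, 0, 0, u * j + d) = \<one>" using phi_one by simp
    then obtain n4 where n4: "u * j + d = int p * n4" unfolding a4_iff by (rule dvdE)
    have "c4 + u * j = int p * n4 + B2 p * n3 + B3 p * n2 + (B4 p - s) * n1" using n4 by (simp add: d_def)
    moreover have "c3 = int p * n3 + B2 p * n2 + B3 p * n1" using n3 by simp
    moreover have "c2 = int p * n2 + B2 p * n1" using n(2) by simp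
    ultimately have "(c1, c2, c3, c4 + u * j) \<in> Lat p s" using LatI[of p n1 n2 n3 n4 s] n(1) by simp
    then show "h \<in> K p m s u" unfolding h K_iff using j by blast
  qed
qed (use prime m hom surj in auto)

end

section \<open>Normal forms\<close>

context class4
begin

lemma top_A: "pair a b \<Longrightarrow> top a b \<in> A"
  unfolding top_def by (intro commutator_A pairD)

text \<open>The last condition makes m the least exponent for which b^(p^m) is a power of a_4, so
  that the kernel is not larger than \<open>K p m s u\<close>.\<close>

definition good :: "'a \<Rightarrow> 'a \<Rightarrow> nat \<Rightarrow> int \<Rightarrow> int \<Rightarrow> bool" where
  "good a b m s u \<longleftrightarrow> pair a b \<and> m \<ge> 1 \<and> (b \<otimes> a) [^] p = b [^] p \<otimes> top a b [^] s \<and>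
     b [^] (int p ^ m) = top a b [^] u \<and> (\<forall>c::int. b [^] (int p ^ (m - 1)) \<noteq> top a b [^] c)"

lemma good_marked:
  assumes "good a b m s u"
  obtains \<phi> where "marked G p m s u \<phi>"
proof -
  have g: "pair a b" "m \<ge> 1" "(b \<otimes> a) [^] p = b [^] p \<otimes> top a b [^] s"
    "b [^] (int p ^ m) = top a b [^] u" "\<And>c::int. b [^] (int p ^ (m - 1)) \<noteq> top a b [^] c"
    using assms unfolding good_def by auto
  obtain \<phi> where "framed G p n A a b \<phi>" using g(1) by (rule pair_framed)
  then interpret framed G p n A a b \<phi> .
  have "b [^] p \<otimes> \<phi> (0, int p, B2 p, B3 p, B4 p) = b [^] p \<otimes> \<phi> (0, 0, 0, 0, s)"
    using ba_pow[of 1] g(3) aA unfolding top_eq(2) by (simp add: int_pow_1)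
  then have Na: "\<phi> (0, int p, B2 p, B3 p, B4 p) = \<phi> (0, 0, 0, 0, s)" by (simp del: phi_mult)
  have "marked G p m s u \<phi>"
    by (rule framed_marked[OF g(2) Na]) (use g(4,5) in \<open>simp_all only: top_eq(2) not_False_eq_True\<close>)
  then show ?thesis by (rule that)
qed

text \<open>(b a^j)^p is b^p times the j-th power of N a, and \<open>norm_eq\<close> gives N
  a.\<close>

lemma pair_norm:
  assumes "pair a b"
  obtains \<kappa> \<sigma> where "(b \<otimes> a) [^] p = b [^] p \<otimes> (b [^] (int p * \<kappa>) \<otimes> top a b [^] (\<sigma>::int))"
    "\<And>j::int. (b \<otimes> a [^] j) [^] p = b [^] p \<otimes> (b [^] (int p * \<kappa> * j) \<otimes> top a b [^] (\<sigma> * j))"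
proof -
  obtain \<phi> where "framed G p n A a b \<phi>" using assms by (rule pair_framed)
  then interpret framed G p n A a b \<phi> .
  obtain \<kappa> \<sigma> where ks: "\<phi> (0, int p, B2 p, B3 p, B4 p) = \<phi> (int p * \<kappa>, 0, 0, 0, \<sigma>)" by (rule norm_eq)
  have e: "\<phi> (int p * \<kappa>, 0, 0, 0, \<sigma>) = b [^] (int p * \<kappa>) \<otimes> top a b [^] \<sigma>"
    unfolding phi_b_pow[symmetric] top_eq(2) by simp
  have bA: "b [^] (int p * \<kappa>) \<in> A" using b_pow_A[OF bc bA] by simp
  have tA: "top a b \<in> A" by (rule top_A[OF assms])
  have ej: "\<phi> (int p * \<kappa>, 0, 0, 0, \<sigma>) [^] j = b [^] (int p * \<kappa> * j) \<otimes> top a b [^] (\<sigma> * j)" for j :: int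
  proof -
    have "\<phi> (int p * \<kappa>, 0, 0, 0, \<sigma>) [^] j = (b [^] (int p * \<kappa>)) [^] j \<otimes> (top a b [^] \<sigma>) [^] j"
      unfolding e by (rule int_pow_mult_distrib[OF A_comm[OF bA Ap[OF tA]] Ac[OF bA] Ac[OF Ap[OF tA]]])
    then show ?thesis unfolding int_pow_pow[OF bc] int_pow_pow[OF Ac[OF tA]] .
  qed
  have 1: "(b \<otimes> a [^] j) [^] p = b [^] p \<otimes> (b [^] (int p * \<kappa> * j) \<otimes> top a b [^] (\<sigma> * j))" for j :: int
    unfolding ba_pow ks ej ..
  have "(b \<otimes> a) [^] p = b [^] p \<otimes> (b [^] (int p * \<kappa>) \<otimes> top a b [^] \<sigma>)"
    using 1[of 1] aA by (simp add: int_pow_1)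
  then show ?thesis using 1 by (rule that)
qed

text \<open>Elements of A commute with a, so commutators with b and with b a^j agree on A.\<close>

lemma pair_shift:
  assumes "pair a b"
  shows "pair a (b \<otimes> a [^] (j::int))" "top a (b \<otimes> a [^] j) = top a b"
proof -
  note ab = pairD[OF assms]
  have aj: "a [^] j \<in> A" using ab by (simp add: Ap)
  have ac: "a \<in> carrier G" using ab by simp
  have b: "b = b \<otimes> a [^] j \<otimes> inv (a [^] j)" using ab ac by (simp add: m_assoc)
  show "pair a (b \<otimes> a [^] j)"
  proof (rule pairI[OF assms ab(1)])
    show "b \<otimes> a [^] j \<in> carrier G" using ab ac by simp
    show "b \<otimes> a [^] j \<notin> A"
    proof
      assume "b \<otimes> a [^] j \<in> A"
      then have "b \<in> A" using Am[OF _ Ai[OF aj]] b by metis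
      then show False using ab by simp
    qed
    fix H assume H: "subgroup H G" "a \<in> H" "b \<otimes> a [^] j \<in> H"
    have "a [^] j \<in> H" using subgroup_int_pow_closed[OF H(1,2)] .
    then have "b \<otimes> a [^] j \<otimes> inv (a [^] j) \<in> H" using H subgroup.m_closed subgroup.m_inv_closed by metis
    then show "a \<in> H \<and> b \<in> H" using H b by simp
  qed
  have c: "commutator G v (b \<otimes> a [^] j) = commutator G v b" if v: "v \<in> A" for v
  proof -
    have vb: "inv b \<otimes> v \<otimes> b \<in> A" using v ab by (simp add: Aconj)
    have "inv (b \<otimes> a [^] j) \<otimes> v \<otimes> (b \<otimes> a [^] j) = inv (a [^] j) \<otimes> ((inv b \<otimes> v \<otimes> b) \<otimes> a [^] j)"
      using v ab ac by (simp add: inv_mult_group m_assoc)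
    also have "(inv b \<otimes> v \<otimes> b) \<otimes> a [^] j = a [^] j \<otimes> (inv b \<otimes> v \<otimes> b)" by (rule A_comm[OF vb aj])
    also have "inv (a [^] j) \<otimes> (a [^] j \<otimes> (inv b \<otimes> v \<otimes> b)) = inv b \<otimes> v \<otimes> b"
      using vb ac by (simp add: inv_cancel)
    finally show ?thesis using v ab ac by (simp add: commutator_eq)
  qed
  show "top a (b \<otimes> a [^] j) = top a b"
    unfolding top_def using ab by (simp add: c commutator_A)
qed

text \<open>For p dividing k, b^k lies in A and commutes with b, so it is central: commutators do
  not see it and it splits off from powers.\<close>

lemma pair_central:
  assumes "pair a b" "int p dvd k"
  shows "pair (a \<otimes> b [^] k) b" "top (a \<otimes> b [^] k) b = top a b"
    "(b \<otimes> (a \<otimes> b [^] k)) [^] p = (b \<otimes> a) [^] p \<otimes> b [^] (k * int p)"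
proof -
  note ab = pairD[OF assms(1)]
  have ac: "a \<in> carrier G" using ab by simp
  have z: "b [^] k \<in> A" using b_pow_A[OF ab(2,3)] assms(2) by simp
  have zc: "b [^] k \<in> carrier G" using ab by simp
  have zb: "b [^] k \<otimes> b = b \<otimes> b [^] k" using commute_pow_int[OF ab(2,2) HOL.refl] .
  show "pair (a \<otimes> b [^] k) b"
  proof (rule pairI[OF assms(1) Am[OF ab(1) z] ab(2,3)])
    fix H assume H: "subgroup H G" "a \<otimes> b [^] k \<in> H" "b \<in> H"
    have "b [^] k \<in> H" using subgroup_int_pow_closed[OF H(1,3)] .
    then have "a \<otimes> b [^] k \<otimes> inv (b [^] k) \<in> H" using H subgroup.m_closed subgroup.m_inv_closed by metis
    then show "a \<in> H \<and> b \<in> H" using H ac zc by (simp add: m_assoc)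
  qed
  have "commutator G (b [^] k) b = \<one>" using commutator_one_iff[OF zc ab(2)] zb by simp
  then have "commutator G (a \<otimes> b [^] k) b = commutator G a b"
    unfolding commutator_mult[OF ab(1) z ab(2)] using ac ab by simp
  then show "top (a \<otimes> b [^] k) b = top a b" by (simp add: top_def)
  have com: "(b \<otimes> a) \<otimes> b [^] k = b [^] k \<otimes> (b \<otimes> a)"
  proof -
    have "(b \<otimes> a) \<otimes> b [^] k = b \<otimes> (b [^] k \<otimes> a)" using A_comm[OF ab(1) z] ab ac by (simp add: m_assoc)
    also have "\<dots> = b [^] k \<otimes> (b \<otimes> a)" using zb ab ac by (simp add: m_assoc[symmetric])
    finally show ?thesis .
  qed
  have "(b \<otimes> (a \<otimes> b [^] k)) [^] int p = (b \<otimes> a) [^] int p \<otimes> (b [^] k) [^] int p"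
    using int_pow_mult_distrib[OF com _ zc, of "int p"] ab ac by (simp add: m_assoc)
  then show "(b \<otimes> (a \<otimes> b [^] k)) [^] p = (b \<otimes> a) [^] p \<otimes> b [^] (k * int p)"
    using int_pow_pow[OF ab(2), of k "int p"] by (simp add: int_pow_int)
qed

lemma pair_power:
  assumes "pair a b" "\<not> int p dvd i"
  shows "pair (a [^] i) b" "top (a [^] i) b = top a b [^] i"
proof -
  note ab = pairD[OF assms(1)]
  show "pair (a [^] i) b"
  proof (rule pairI[OF assms(1) Ap[OF ab(1)] ab(2,3)])
    fix H assume H: "subgroup H G" "a [^] i \<in> H" "b \<in> H"
    then show "a \<in> H \<and> b \<in> H" using pow_unit_mem[OF prime ord H(1) Ac[OF ab(1)] H(2) assms(2)] by simp
  qed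
  obtain \<phi> where "framed G p n A a b \<phi>" using assms(1) by (rule pair_framed)
  then interpret framed G p n A a b \<phi> .
  show "top (a [^] i) b = top a b [^] i"
    unfolding top_eq(2) unfolding top_def phi_a[symmetric] phi_vec_pow
    unfolding phi_b[symmetric] phi_commutator commutator_HG_shift by simp
qed

text \<open>The new a is chosen so that its product with b^k is (b a)^k. Its first coordinate is k,
  and each of the three commutators with b^k contributes another factor k.\<close>

lemma pair_scale:
  fixes k :: nat
  assumes "pair a b" "\<not> int p dvd int k"
  shows "pair (inv (b [^] k) \<otimes> (b \<otimes> a) [^] k) (b [^] k)"
    "top (inv (b [^] k) \<otimes> (b \<otimes> a) [^] k) (b [^] k) = top a b [^] (int k ^ 4)"
proof -
  note ab = pairD[OF assms(1)]
  have ac: "a \<in> carrier G" using ab by simp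
  obtain \<phi> where "framed G p n A a b \<phi>" using assms(1) by (rule pair_framed)
  then interpret framed G p n A a b \<phi> .
  let ?a = "inv (b [^] k) \<otimes> (b \<otimes> a) [^] k" and ?b = "b [^] k"
  have b': "?b = \<phi> (int k, 0, 0, 0, 0)" unfolding phi_b_pow by (simp add: int_pow_int)
  have "b \<otimes> a = \<phi> (1, 1, 0, 0, 0)" unfolding phi_a[symmetric] phi_b[symmetric] by simp
  then have "(b \<otimes> a) [^] k = \<phi> (int k, int k, B2 k, B3 k, B4 k)" by (simp add: phi_pow_1)
  then have a': "?a = \<phi> (0, int k, B2 k, B3 k, B4 k)" unfolding b' by simp
  show "pair ?a ?b"
  proof (rule pairI[OF assms(1)])
    show "?a \<in> A" unfolding a' by (rule vec_A)
    show "?b \<in> carrier G" using ab by simp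
    show "?b \<notin> A" unfolding b' phi_A_iff by (rule assms(2))
    fix H assume H: "subgroup H G" "?a \<in> H" "?b \<in> H"
    have "?b \<otimes> ?a \<in> H" using H subgroup.m_closed by metis
    then have "(b \<otimes> a) [^] k \<in> H" using ab ac by (simp add: inv_cancel)
    then have ba: "b \<otimes> a \<in> H"
      using pow_unit_mem[OF prime ord H(1), of "b \<otimes> a" "int k"] assms(2) ab ac by (simp add: int_pow_int)
    have b: "b \<in> H"
      using pow_unit_mem[OF prime ord H(1), of b "int k"] assms(2) ab H(3) by (simp add: int_pow_int)
    then have "inv b \<otimes> (b \<otimes> a) \<in> H" using ba H subgroup.m_closed subgroup.m_inv_closed by metis
    then show "a \<in> H \<and> b \<in> H" using b ab ac by (simp add: inv_cancel)
  qed
  show "top ?a ?b = top a b [^] (int k ^ 4)"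
    unfolding top_eq(2) unfolding top_def b' a'[unfolded b'] phi_commutator commutator_HG_vec
    by (simp add: numeral_eq_Suc)
qed

text \<open>The factor b^(p \<kappa>) of N a has to be removed. If p divides
  \<open>\<kappa>\<close>, the central b^(- \<kappa>) is multiplied into a. Otherwise b is changed
  so that its p-th power becomes a power of a_4, and then so does every power of it that can occur
  in the norm.\<close>

lemma exists_norm:
  assumes "pair a b"
  obtains a' b' \<sigma> where "pair a' b'" "(b' \<otimes> a') [^] p = b' [^] p \<otimes> top a' b' [^] (\<sigma>::int)"
proof -
  note ab = pairD[OF assms]
  obtain \<kappa> \<sigma> where ks: "(b \<otimes> a) [^] p = b [^] p \<otimes> (b [^] (int p * \<kappa>) \<otimes> top a b [^] (\<sigma>::int))"
    "\<And>j::int. (b \<otimes> a [^] j) [^] p = b [^] p \<otimes> (b [^] (int p * \<kappa> * j) \<otimes> top a b [^] (\<sigma> * j))"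
    using assms by (rule pair_norm) blast
  have tA: "top a b \<in> A" by (rule top_A[OF assms])
  show ?thesis
  proof (cases "int p dvd \<kappa>")
    case True
    then have d: "int p dvd - \<kappa>" by simp
    note pc = pair_central[OF assms d]
    have bA: "b [^] (int p * \<kappa>) \<in> A" using b_pow_A[OF ab(2,3)] by simp
    have "(b \<otimes> (a \<otimes> b [^] (- \<kappa>))) [^] p = b [^] p \<otimes> (b [^] (int p * \<kappa>) \<otimes> top a b [^] \<sigma> \<otimes> b [^] (- \<kappa> * int p))"
      unfolding pc(3) ks(1) using ab tA by (simp add: m_assoc)
    also have "b [^] (int p * \<kappa>) \<otimes> top a b [^] \<sigma> = top a b [^] \<sigma> \<otimes> b [^] (int p * \<kappa>)"
      by (rule A_comm[OF bA Ap[OF tA]])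
    also have "top a b [^] \<sigma> \<otimes> b [^] (int p * \<kappa>) \<otimes> b [^] (- \<kappa> * int p) = top a b [^] \<sigma> \<otimes> b [^] (int p * \<kappa> + - \<kappa> * int p)"
      unfolding int_pow_mult[OF ab(2)] using ab tA by (simp add: m_assoc)
    also have "int p * \<kappa> + - \<kappa> * int p = 0" by simp
    also have "top a b [^] \<sigma> \<otimes> b [^] (0::int) = top a b [^] \<sigma>" using tA by simp
    finally show ?thesis using that[OF pc(1)] pc(2) by simp
  next
    case False
    obtain i :: nat where i: "i > 0" "[\<kappa> * int i = 1] (mod int p ^ n)"
      using prime False by (rule inverse_mod_prime)
    then have "int p ^ n dvd \<kappa> * int i - 1" by (simp add: cong_iff_dvd_diff)
    then obtain q where q: "\<kappa> * int i - 1 = int p ^ n * q" by (rule dvdE)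
    \<comment> \<open>j is minus the inverse of \<open>\<kappa>\<close>, so that b^p b^(p \<kappa>
      j) = 1.\<close>
    define j where "j = - int i"
    define b' where "b' = b \<otimes> a [^] j"
    note ps = pair_shift[OF assms, of j, folded b'_def]
    have kj: "int p + int p * \<kappa> * j = int (p ^ n) * (- q * int p)"
    proof -
      have "\<kappa> * j = - 1 - int p ^ n * q" using q by (simp add: j_def)
      then have "int p + int p * (\<kappa> * j) = int p + int p * (- 1 - int p ^ n * q)" by simp
      then show ?thesis by (simp add: algebra_simps)
    qed
    have "b' [^] p = b [^] (int p + int p * \<kappa> * j) \<otimes> top a b [^] (\<sigma> * j)"
      unfolding b'_def ks(2) using ab tA by (simp add: int_pow_mult m_assoc int_pow_int)
    then have bp: "b' [^] p = top a b [^] (\<sigma> * j)"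
      unfolding kj pow_ord[OF ab(2)] using tA by simp
    obtain \<kappa>' \<sigma>' where ks': "(b' \<otimes> a) [^] p = b' [^] p \<otimes> (b' [^] (int p * \<kappa>') \<otimes> top a b' [^] (\<sigma>'::int))"
      using ps(1) by (rule pair_norm) blast
    have "b' [^] (int p * \<kappa>') = (b' [^] p) [^] \<kappa>'"
      using pairD(2)[OF ps(1)] by (simp add: int_pow_pow flip: int_pow_int)
    also have "\<dots> = top a b' [^] (\<sigma> * j * \<kappa>')" unfolding bp ps(2) using tA by (simp add: int_pow_pow)
    finally have "(b' \<otimes> a) [^] p = b' [^] p \<otimes> top a b' [^] (\<sigma> * j * \<kappa>' + \<sigma>')"
      unfolding ks' ps(2) using tA by (simp add: int_pow_mult)
    then show ?thesis by (rule that[OF ps(1)])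
  qed
qed

lemma exists_good:
  assumes "pair a b"
  obtains a' b' m s u where "good a' b' m s u"
proof -
  obtain a' b' s where p: "pair a' b'" "(b' \<otimes> a') [^] p = b' [^] p \<otimes> top a' b' [^] (s::int)"
    using assms by (rule exists_norm)
  note ab = pairD[OF p(1)]
  let ?P = "\<lambda>m. \<exists>u::int. b' [^] (int p ^ m) = top a' b' [^] u"
  have "b' [^] (int p ^ n) = top a' b' [^] (0::int)" using pow_ord[OF ab(2), of 1] by simp
  then have ex: "?P n" by blast
  define m where "m = (LEAST m. ?P m)"
  have Pm: "?P m" unfolding m_def using ex by (rule LeastI)
  have m0: "m \<noteq> 0"
  proof
    assume "m = 0"
    then obtain u :: int where "b' [^] (1::int) = top a' b' [^] u" using Pm by auto
    then have "b' \<in> A" using Ap[OF top_A[OF p(1)], of u] ab(2) by (simp add: int_pow_1)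
    then show False using ab by simp
  qed
  then have "\<not> ?P (m - 1)" unfolding m_def by (intro not_less_Least) simp
  moreover obtain u :: int where "b' [^] (int p ^ m) = top a' b' [^] u" using Pm by blast
  ultimately have "good a' b' m s u" unfolding good_def using p m0 by auto
  then show ?thesis by (rule that)
qed

lemma top_pow_dvd:
  assumes "pair a b" "int p dvd c"
  shows "top a b [^] c = \<one>"
proof -
  obtain \<phi> where "framed G p n A a b \<phi>" using assms(1) by (rule pair_framed)
  then interpret framed G p n A a b \<phi> .
  show ?thesis unfolding top_eq(2) a4_iff by (rule assms(2))
qed

lemma top_pow_cong:
  assumes "pair a b" "[c = d] (mod int p)"
  shows "top a b [^] c = top a b [^] d"
proof -
  have t: "top a b \<in> carrier G" using top_A[OF assms(1)] by simp
  have "int p dvd c - d" using assms(2) by (simp add: cong_iff_dvd_diff)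
  then have "top a b [^] (c - d) = \<one>" by (rule top_pow_dvd[OF assms(1)])
  moreover have "top a b [^] c = top a b [^] (c - d) \<otimes> top a b [^] d"
    using t by (simp add: int_pow_mult[symmetric])
  ultimately show ?thesis using t by simp
qed

text \<open>p dividing u means b^(p^m) = 1, a relation that survives passing to a power of b, so
  only s changes.\<close>

lemma good_scale:
  assumes g: "good a b m s u" and u: "int p dvd u" and k: "\<not> int p dvd k" "[s' * k ^ 3 = s] (mod int p)"
  obtains \<phi> where "marked G p m s' 0 \<phi>"
proof -
  have pr: "pair a b" "m \<ge> 1" "(b \<otimes> a) [^] p = b [^] p \<otimes> top a b [^] s"
    "b [^] (int p ^ m) = top a b [^] u" "\<And>c::int. b [^] (int p ^ (m - 1)) \<noteq> top a b [^] c"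
    using g unfolding good_def by auto
  note ab = pairD[OF pr(1)]
  have ac: "a \<in> carrier G" using ab by simp
  have tA: "top a b \<in> A" by (rule top_A[OF pr(1)])
  define l where "l = nat (k mod int p)"
  have l: "int l = k mod int p" using p_gt by (simp add: l_def)
  have nl: "\<not> int p dvd int l" unfolding l using k(1) by (simp add: dvd_mod_iff)
  have "[int l = k] (mod int p)" unfolding l by (simp add: cong_def)
  then have "[s' * int l ^ 3 = s' * k ^ 3] (mod int p)" by (intro cong_mult cong_pow) simp_all
  then have sl: "[s' * int l ^ 3 = s] (mod int p)" using k(2) by (rule cong_trans)
  let ?a = "inv (b [^] l) \<otimes> (b \<otimes> a) [^] l" and ?b = "b [^] l"
  note ps = pair_scale[OF pr(1) nl]
  have bpA: "b [^] p \<in> A" using b_pow_A[OF ab(2,3), of "int p"] by (simp add: int_pow_int)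
  have "?b \<otimes> ?a = (b \<otimes> a) [^] l" using ab ac by (simp add: inv_cancel)
  then have "(?b \<otimes> ?a) [^] p = ((b \<otimes> a) [^] p) [^] l" using ab ac by (simp add: nat_pow_pow mult.commute)
  also have "\<dots> = (b [^] p) [^] l \<otimes> (top a b [^] s) [^] l"
    unfolding pr(3) using int_pow_mult_distrib[OF A_comm[OF bpA Ap[OF tA]] Ac[OF bpA] Ac[OF Ap[OF tA]], of s "int l"]
    by (simp add: int_pow_int)
  also have "(b [^] p) [^] l = ?b [^] p" using ab by (simp add: nat_pow_pow mult.commute)
  also have "(top a b [^] s) [^] l = top a b [^] (s * int l)"
    using tA by (simp add: int_pow_pow flip: int_pow_int)
  \<comment> \<open>a_4 is replaced by its power l^4 but the relation for the p-th power is only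
    raised to the power l; this is the origin of the cube.\<close>
  also have "\<dots> = top a b [^] (int l ^ 4 * s')"
  proof (rule top_pow_cong[OF pr(1)])
    have "[s * int l = s' * int l ^ 3 * int l] (mod int p)" using cong_sym[OF sl] by (intro cong_mult) simp_all
    then show "[s * int l = int l ^ 4 * s'] (mod int p)" by (simp add: numeral_eq_Suc ac_simps)
  qed
  also have "\<dots> = top ?a ?b [^] s'" unfolding ps(2) using tA by (simp add: int_pow_pow)
  finally have 1: "(?b \<otimes> ?a) [^] p = ?b [^] p \<otimes> top ?a ?b [^] s'" .
  have "b [^] (int p ^ m) = \<one>" unfolding pr(4) by (rule top_pow_dvd[OF pr(1) u])
  then have "?b [^] (int p ^ m) = \<one>"
    using ab int_pow_pow[of b "int p ^ m" "int l"] int_pow_pow[of b "int l" "int p ^ m"]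
    by (simp add: int_pow_int mult.commute)
  then have 2: "?b [^] (int p ^ m) = top ?a ?b [^] (0::int)" by simp
  have 3: "?b [^] (int p ^ (m - 1)) \<noteq> top ?a ?b [^] c" for c :: int
  proof
    assume "?b [^] (int p ^ (m - 1)) = top ?a ?b [^] c"
    then have e: "(b [^] (int p ^ (m - 1))) [^] int l = top a b [^] (int l ^ 4 * c)"
      unfolding ps(2) using ab tA int_pow_pow[of b "int p ^ (m - 1)" "int l"] int_pow_pow[of b "int l" "int p ^ (m - 1)"]
      by (simp add: int_pow_int int_pow_pow mult.commute)
    have sub: "subgroup {top a b [^] i | i :: int. i \<in> UNIV} G"
      using generate_pow[OF Ac[OF tA]] generate_is_subgroup[of "{top a b}"] tA by simp
    have "b [^] (int p ^ (m - 1)) \<in> {top a b [^] i | i :: int. i \<in> UNIV}"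
      by (rule pow_unit_mem[OF prime ord sub _ _ nl]) (use e ab in auto)
    then show False using pr(5) by auto
  qed
  have "good ?a ?b m s' 0" unfolding good_def using ps(1) pr(2) 1 2 3 by blast
  then show ?thesis using that by (rule good_marked)
qed

text \<open>Replacing a by a^u replaces a_4 by a_4^u and turns the exponent u into 1; s stays
  divisible by p.\<close>

lemma good_unit:
  assumes g: "good a b m s u" and s: "int p dvd s" and u: "\<not> int p dvd u"
  obtains \<phi> where "marked G p m 0 1 \<phi>"
proof -
  have pr: "pair a b" "m \<ge> 1" "(b \<otimes> a) [^] p = b [^] p \<otimes> top a b [^] s"
    "b [^] (int p ^ m) = top a b [^] u" "\<And>c::int. b [^] (int p ^ (m - 1)) \<noteq> top a b [^] c"
    using g unfolding good_def by auto
  note ab = pairD[OF pr(1)]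
  have tA: "top a b \<in> A" by (rule top_A[OF pr(1)])
  note pp = pair_power[OF pr(1) u]
  obtain \<phi> where "framed G p n A a b \<phi>" using pr(1) by (rule pair_framed)
  then interpret framed G p n A a b \<phi> .
  have "b [^] p \<otimes> \<phi> (0, int p, B2 p, B3 p, B4 p) = b [^] p \<otimes> \<one>"
    using ba_pow[of 1] pr(3) aA top_pow_dvd[OF pr(1) s] by (simp add: int_pow_1)
  then have "\<phi> (0, int p, B2 p, B3 p, B4 p) = \<one>" by (simp del: phi_mult)
  then have 1: "(b \<otimes> a [^] u) [^] p = b [^] p \<otimes> top (a [^] u) b [^] (0::int)" unfolding ba_pow by simp
  have 2: "b [^] (int p ^ m) = top (a [^] u) b [^] (1::int)" unfolding pp(2) pr(4) using tA by (simp add: int_pow_1)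
  have 3: "b [^] (int p ^ (m - 1)) \<noteq> top (a [^] u) b [^] c" for c :: int
    unfolding pp(2) using pr(5)[of "u * c"] tA by (simp add: int_pow_pow)
  have "good (a [^] u) b m 0 1" unfolding good_def using pp(1) pr(2) 1 2 3 by blast
  then show ?thesis using that by (rule good_marked)
qed

text \<open>For m = 1 the unit s removes u: (b a^j)^p = a_4^(u + s j), which is 1 for j s = - u
  modulo p.\<close>

lemma good_both_1:
  assumes g: "good a b 1 s u" and s: "\<not> int p dvd s"
  obtains a' b' where "good a' b' 1 s 0"
proof -
  have pr: "pair a b" "(b \<otimes> a) [^] p = b [^] p \<otimes> top a b [^] s" "b [^] int p = top a b [^] u"
    using g unfolding good_def by auto
  note ab = pairD[OF pr(1)]
  have tA: "top a b \<in> A" by (rule top_A[OF pr(1)])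
  obtain j t where j: "j * s = - u + int p * t" using prime s by (rule unit_mult_prime)
  define b' where "b' = b \<otimes> a [^] j"
  note ps = pair_shift[OF pr(1), of j, folded b'_def]
  obtain \<phi> where "framed G p n A a b \<phi>" using pr(1) by (rule pair_framed)
  then interpret framed G p n A a b \<phi> .
  have "b [^] p \<otimes> \<phi> (0, int p, B2 p, B3 p, B4 p) = b [^] p \<otimes> \<phi> (0, 0, 0, 0, s)"
    using ba_pow[of 1] pr(2) aA unfolding top_eq(2) by (simp add: int_pow_1)
  then have Na: "\<phi> (0, int p, B2 p, B3 p, B4 p) = \<phi> (0, 0, 0, 0, s)" by (simp del: phi_mult)
  have bi: "(b \<otimes> a [^] i) [^] p = top a b [^] (u + s * i)" for i :: int
    unfolding ba_pow Na using pr(3) unfolding int_pow_int top_eq(2) phi_vec_pow by (simp add: mult.commute)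
  have "b' [^] p = top a b [^] (u + s * j)" unfolding b'_def by (rule bi)
  also have "\<dots> = \<one>" by (rule top_pow_dvd[OF pr(1)]) (use j in \<open>simp add: mult.commute\<close>)
  finally have bp: "b' [^] p = \<one>" .
  have "b' \<otimes> a = b \<otimes> a [^] (j + 1)" unfolding b'_def using ab by (simp add: int_pow_mult int_pow_1 m_assoc)
  then have "(b' \<otimes> a) [^] p = top a b [^] (u + s * (j + 1))" using bi by simp
  also have "\<dots> = top a b [^] s" by (rule top_pow_cong[OF pr(1)]) (use j in \<open>simp add: cong_iff_dvd_diff algebra_simps\<close>)
  finally have 1: "(b' \<otimes> a) [^] p = b' [^] p \<otimes> top a b' [^] s" unfolding bp ps(2) using tA by simp
  have 2: "b' [^] (int p ^ 1) = top a b' [^] (0::int)" using bp by (simp add: int_pow_int)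
  have 3: "b' [^] (int p ^ (1 - 1)) \<noteq> top a b' [^] c" for c :: int
    using Ap[OF top_A[OF ps(1)], of c] pairD(2,3)[OF ps(1)] by (auto simp: int_pow_1)
  have "good a b' 1 s 0" unfolding good_def using ps(1) 1 2 3 by blast
  then show ?thesis by (rule that)
qed

text \<open>For \<open>m \<ge> 2\<close> the unit u removes s: multiplying a by b^k with k = j p^(m
  - 1) adds b^(k p) = a_4^(u j) to the norm. The bound on m makes p divide k, so that b^k is
  central.\<close>

lemma good_both:
  assumes g: "good a b m s u" and m: "m \<ge> 2" and u: "\<not> int p dvd u"
  obtains a' b' s' where "good a' b' m s' u" "int p dvd s'"
proof -
  have pr: "pair a b" "m \<ge> 1" "(b \<otimes> a) [^] p = b [^] p \<otimes> top a b [^] s"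
    "b [^] (int p ^ m) = top a b [^] u" "\<And>c::int. b [^] (int p ^ (m - 1)) \<noteq> top a b [^] c"
    using g unfolding good_def by auto
  note ab = pairD[OF pr(1)]
  have tA: "top a b \<in> A" by (rule top_A[OF pr(1)])
  obtain j t where j: "j * u = - s + int p * t" using prime u by (rule unit_mult_prime)
  have mm: "m - 1 = Suc (m - 2)" using m by simp
  define k where "k = j * int p ^ (m - 1)"
  have "int p dvd k" unfolding k_def mm by simp
  note pc = pair_central[OF pr(1) this]
  have kp: "k * int p = int p ^ m * j" unfolding k_def using m by (simp add: power_eq_if)
  have "b [^] (k * int p) = top a b [^] (u * j)" unfolding kp using ab tA pr(4) int_pow_pow[OF ab(2), of "int p ^ m" j]
    by (simp add: int_pow_pow)
  then have 1: "(b \<otimes> (a \<otimes> b [^] k)) [^] p = b [^] p \<otimes> top (a \<otimes> b [^] k) b [^] (s + u * j)"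
    unfolding pc(2,3) pr(3) using ab tA by (simp add: int_pow_mult m_assoc)
  have "good (a \<otimes> b [^] k) b m (s + u * j) u"
    unfolding good_def pc(2) using pc(1) pr 1[unfolded pc(2)] by blast
  moreover have "int p dvd s + u * j" using j by (simp add: mult.commute)
  ultimately show ?thesis by (rule that)
qed

text \<open>The second alternative offers every s' in the class of s modulo cubes, so that the
  representative can be taken from the list afterwards.\<close>

theorem classification:
  assumes "pair a b"
  shows "\<exists>m. (\<exists>\<phi>. marked G p m 0 1 \<phi>) \<or>
    (\<exists>s. \<forall>s' k. \<not> int p dvd k \<longrightarrow> [s' * k ^ 3 = s] (mod int p) \<longrightarrow> (\<exists>\<phi>. marked G p m s' 0 \<phi>))"
proof -
  obtain a' b' m s u where g: "good a' b' m s u" using assms by (rule exists_good)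
  have m: "m \<ge> 1" using g by (simp add: good_def)
  have scale: "\<exists>\<phi>. marked G p m s' 0 \<phi>"
    if "good a b m s u" "int p dvd u" "\<not> int p dvd k" "[s' * k ^ 3 = s] (mod int p)" for a b m s u s' k
    using that by (rule good_scale) blast
  have unit: "\<exists>\<phi>. marked G p m 0 1 \<phi>" if "good a b m s u" "int p dvd s" "\<not> int p dvd u" for a b m s u
    using that by (rule good_unit) blast
  show ?thesis
  proof (cases "int p dvd u")
    case True
    then show ?thesis using scale[OF g] by blast
  next
    case u: False
    show ?thesis
    proof (cases "int p dvd s")
      case True
      then show ?thesis using unit[OF g _ u] by blast
    next
      case s: False
      show ?thesis
      proof (cases "m = 1")
        case True
        then have g1: "good a' b' 1 s u" using g by simp
        obtain a2 b2 where "good a2 b2 1 s 0" using g1 s by (rule good_both_1)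
        then show ?thesis using scale[OF _ dvd_0_right] by blast
      next
        case False
        then have "m \<ge> 2" using m by simp
        obtain a2 b2 s2 where "good a2 b2 m s2 u" "int p dvd s2" using g \<open>m \<ge> 2\<close> u by (rule good_both)
        then show ?thesis using unit u by blast
      qed
    qed
  qed
qed

text \<open>One of two generators lies outside of A and serves as b; the other is moved into A by a
  power of b.\<close>

lemma exists_pair:
  assumes "min_gens G = 2"
  obtains a b where "pair a b"
proof -
  have ex: "\<exists>n. \<exists>S\<subseteq>carrier G. finite S \<and> card S = n \<and> generate G S = carrier G"
  proof -
    have "generate G (carrier G) = carrier G"
      using generate_incl[of "carrier G"] generate.incl[of _ "carrier G" G] by blast
    then show ?thesis using fin by blast
  qed
  have "\<exists>S\<subseteq>carrier G. finite S \<and> card S = 2 \<and> generate G S = carrier G"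
    using LeastI_ex[OF ex] assms unfolding min_gens_def by simp
  then obtain S where S: "S \<subseteq> carrier G" "card S = 2" "generate G S = carrier G" by blast
  obtain b0 where b0: "b0 \<in> carrier G" "b0 \<notin> A" by (rule not_A)
  have "\<not> S \<subseteq> A"
  proof
    assume "S \<subseteq> A"
    then have "generate G S \<subseteq> A" by (rule generate_subgroup_incl[OF _ A])
    then show False using S(3) b0 by blast
  qed
  then obtain b where b: "b \<in> S" "b \<notin> A" by blast
  obtain y where y: "S = {b, y}" using S(2) b(1) unfolding card_2_iff by auto
  have bc: "b \<in> carrier G" "y \<in> carrier G" using S(1) y by auto
  obtain i v where v: "v \<in> A" "y = v \<otimes> b [^] int i" using bc(1) b(2) bc(2) by (rule decomp)
  have sub: "{v, b} \<subseteq> carrier G" using v bc by simp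
  have H: "subgroup (generate G {v, b}) G" using sub by (rule generate_is_subgroup)
  have vb: "v \<in> generate G {v, b}" "b \<in> generate G {v, b}" by (auto intro: generate.incl)
  then have "y \<in> generate G {v, b}" unfolding v(2)
    using subgroup.m_closed[OF H] subgroup_int_pow_closed[OF H] by blast
  then have "generate G S \<subseteq> generate G {v, b}" using vb unfolding y by (intro generate_subgroup_incl[OF _ H]) simp
  then have "generate G {v, b} = carrier G" using S(3) subgroup.subset[OF H] by blast
  then have "pair v b" unfolding pair_def using v bc b by simp
  then show ?thesis by (rule that)
qed

end

lemma standing_marked:
  assumes "standing_hyp p G" "min_gens G = 2" "nilp_class G = 4"
  shows "\<exists>m. (\<exists>\<phi>. marked G p m 0 1 \<phi>) \<or>
    (\<exists>s. \<forall>s' k. \<not> int p dvd k \<longrightarrow> [s' * k ^ 3 = s] (mod int p) \<longrightarrow> (\<exists>\<phi>. marked G p m s' 0 \<phi>))"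
proof -
  have "A_group p (Suc 2) G" using assms(1) by (simp add: standing_hyp_def numeral_3_eq_3 numeral_2_eq_2)
  then have fp: "finite_p_group p G" and a3: "\<And>H. subgroup H G \<Longrightarrow> subgroup_index G H = p ^ 3 \<Longrightarrow> abelian_sub G H"
    unfolding A_group.simps by (auto simp: numeral_3_eq_3 numeral_2_eq_2)
  obtain A where A: "subgroup A G" "subgroup_index G A = p" "abelian_sub G A"
    using assms(1) unfolding standing_hyp_def by blast
  obtain n where n: "prime p" "group G" "finite (carrier G)" "order G = p ^ n"
    using fp unfolding finite_p_group_def by blast
  interpret group G by (rule n(2))
  have comm: "\<And>x y. x \<in> A \<Longrightarrow> y \<in> A \<Longrightarrow> x \<otimes>\<^bsub>G\<^esub> y = y \<otimes>\<^bsub>G\<^esub> x"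
    using A(3) abelian_sub_iff[OF A(1)] by simp
  interpret abelian_max G p n A by (intro abelian_max.intro abelian_max_axioms.intro) (rule n A(1,2) comm; assumption)+
  interpret class4 G p n A
    by (intro class4.intro class4_axioms.intro) (rule abelian_max_axioms class_4D[OF assms(3)] a3; assumption)+
  obtain a b where "pair a b" using assms(2) by (rule exists_pair)
  then show ?thesis by (rule classification)
qed

section \<open>Isomorphisms between the quotients\<close>

text \<open>Both markings have the same A, since \<open>mu p 0 G\<close> is 1. So the new a_1 has
  first coordinate divisible by p and the new b does not; comparing a_4, b^p, (b a_1)^p and b^(p^m)
  in both gives the congruences.\<close>

lemma two_markings:
  fixes G (structure)
  assumes "marked G p m s u \<phi>" "marked G p m s' u' \<phi>'"
  obtains i k w where "\<not> int p dvd k" "\<not> int p dvd i" "u = 0 \<Longrightarrow> [s = s' * k ^ 3] (mod int p)"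
    "[u' * (i * k ^ 3) = u * k + s * w * int p ^ (m - 1)] (mod int p)"
proof -
  interpret marked G p m s u \<phi> by fact
  interpret M: marked G p m s' u' \<phi>' by fact
  have A: "\<phi>' ` filt 1 1 = \<phi> ` filt 1 1"
  proof -
    obtain H where H: "{H \<in> A_subgroups p 0 G. subgroup_index G H = p} = {H}"
      using mu0 unfolding mu_def by (rule card_1_singletonE)
    have "\<phi> ` filt 1 1 \<in> {H \<in> A_subgroups p 0 G. subgroup_index G H = p}"
      using subgroup_filt[of 1 1] abelian_A fpg_sub[OF subgroup_filt, of 1 1] index_p_iff card_A
      by (simp add: A_subgroups_def)
    moreover have "\<phi>' ` filt 1 1 \<in> {H \<in> A_subgroups p 0 G. subgroup_index G H = p}"
      using M.subgroup_filt[of 1 1] M.abelian_A M.fpg_sub[OF M.subgroup_filt, of 1 1] M.index_p_iff M.card_A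
      by (simp add: A_subgroups_def)
    ultimately have "\<phi> ` filt 1 1 = H" "\<phi>' ` filt 1 1 = H" unfolding H by (simp_all only: singleton_iff)
    then show ?thesis by simp
  qed
  have "\<phi>' (0, 1, 0, 0, 0) \<in> \<phi> ` filt 1 1" unfolding A[symmetric] M.in_A_iff by simp
  then obtain l i c2 c3 c4 where a: "\<phi>' (0, 1, 0, 0, 0) = \<phi> (l, i, c2, c3, c4)" and l: "int p dvd l"
    by (rule A_E)
  have "\<phi>' (1, 0, 0, 0, 0) \<in> carrier G" by simp
  then obtain k w w2 w3 w4 where b: "\<phi>' (1, 0, 0, 0, 0) = \<phi> (k, w, w2, w3, w4)" by (rule carrier_cases)
  have "\<phi>' (1, 0, 0, 0, 0) \<notin> \<phi> ` filt 1 1"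
    unfolding A[symmetric] M.in_A_iff using p_pos by auto
  then have k: "\<not> int p dvd k" unfolding b in_A_iff .
  \<comment> \<open>The new a_4 is the commutator of the new a_1 with the new b three times: each
    step contributes k, the start contributes i.\<close>
  have top: "\<phi>' (0, 0, 0, 0, 1) = \<phi> (0, 0, 0, 0, i * k ^ 3)"
  proof -
    have "commutator G (commutator G (commutator G (\<phi>' (0, 1, 0, 0, 0)) (\<phi>' (1, 0, 0, 0, 0))) (\<phi>' (1, 0, 0, 0, 0)))
        (\<phi>' (1, 0, 0, 0, 0)) = \<phi>' (0, 0, 0, 0, 1)"
      by (simp add: M.commutator_A)
    then show ?thesis unfolding a b by (simp add: commutator_A l power3_eq_cube ac_simps)
  qed
  have tops: "\<phi>' (0, 0, 0, 0, n) = \<phi> (0, 0, 0, 0, n * (i * k ^ 3))" for n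
    using M.phi_vec_pow[of 0 0 0 1 n] phi_vec_pow[of 0 0 0 "i * k ^ 3" n] top by simp
  have i: "\<not> int p dvd i"
  proof
    assume "int p dvd i"
    then have "\<phi>' (0, 0, 0, 0, 1) = \<one>" unfolding top phi_eq_0 using p_pos by (simp add: Lat_last)
    then show False unfolding M.phi_eq_0 using p_pos by (simp add: Lat_last)
  qed
  have bp: "\<phi>' (int p, 0, 0, 0, 0) = \<phi> (int p * k, 0, 0, 0, s * w)"
    using M.pow_p[of 1 0 0 0 0] pow_p[OF k, of w w2 w3 w4] p_pos unfolding b by simp
  \<comment> \<open>The p-th powers of b and b a_1 are compared. The first coordinates force p^m to
    divide p l, and with u = 0 this power of b disappears; what remains is s i = s' i k^3.\<close>
  have s: "[s = s' * k ^ 3] (mod int p)" if u: "u = 0"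
  proof -
    have kl: "\<not> int p dvd k + l" using k l by (simp add: dvd_add_left_iff)
    have "\<phi>' (1, 0, 0, 0, 0) \<otimes> \<phi>' (0, 1, 0, 0, 0) = \<phi>' (1, 1, 0, 0, 0)" by simp
    moreover obtain d2 d3 d4 where "\<phi> (k, w, w2, w3, w4) \<otimes> \<phi> (l, i, c2, c3, c4) = \<phi> (k + l, w + i, d2, d3, d4)"
      by simp
    ultimately have "\<phi>' (1, 1, 0, 0, 0) = \<phi> (k + l, w + i, d2, d3, d4)" unfolding a b by simp
    then have "\<phi>' (int p, 0, 0, 0, s') = \<phi> (int p * (k + l), 0, 0, 0, s * (w + i))"
      using M.pow_p[of 1 1 0 0 0] pow_p[OF kl, of "w + i" d2 d3 d4] p_pos by simp
    moreover have "\<phi>' (int p, 0, 0, 0, s') = \<phi>' (int p, 0, 0, 0, 0) \<otimes> \<phi>' (0, 0, 0, 0, s')" by simp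
    ultimately have e: "\<phi> (int p * (k + l), 0, 0, 0, s * (w + i)) = \<phi> (int p * k, 0, 0, 0, s * w + s' * (i * k ^ 3))"
      unfolding bp tops by simp
    have "int p ^ m dvd int p * (k + l) - int p * k" using phi_eq_dvd(1)[OF e] .
    then have "int p ^ m dvd int p * l" by (simp add: algebra_simps)
    then obtain j where j: "int p * l = int p ^ m * j" by (rule dvdE)
    have "\<phi> (int p * (k + l), 0, 0, 0, s * (w + i)) = \<phi> (int p * k, 0, 0, 0, s * (w + i))"
      using phi_carry[of "int p * k" j 0 0 0 "s * (w + i)"] u by (simp add: distrib_left j)
    with e have "\<phi> (int p * k, 0, 0, 0, s * (w + i)) = \<phi> (int p * k, 0, 0, 0, s * w + s' * (i * k ^ 3))"
      by (simp only:)
    then have "(0, 0, 0, s * (w + i) - (s * w + s' * (i * k ^ 3))) \<in> Lat p s"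
      unfolding phi_eq_same by (simp only: diff_self)
    then have "int p dvd s * (w + i) - (s * w + s' * (i * k ^ 3))" using p_pos by (simp add: Lat_last)
    then have "int p dvd (s - s' * k ^ 3) * i" by (simp add: algebra_simps)
    then have "int p dvd s - s' * k ^ 3" using i prime_dvd_multD[OF prime_int] by blast
    then show ?thesis by (simp add: cong_iff_dvd_diff)
  qed
  have pw: "\<phi> (x, 0, 0, 0, c) [^] n = \<phi> (int n * x, 0, 0, 0, int n * c)" for x c and n :: nat
    by (induction n) (simp_all add: phi_one algebra_simps)
  have mm: "p ^ m = p * p ^ (m - 1)" using m by (simp add: power_eq_if)
  \<comment> \<open>The power p^m is taken as p first and p^(m - 1) afterwards; the term with s w
    matters modulo p only for m = 1.\<close>
  have "\<phi>' (int p ^ m, 0, 0, 0, 0) = \<phi>' (int p, 0, 0, 0, 0) [^] (p ^ (m - 1))"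
  proof -
    have "\<phi>' (int p, 0, 0, 0, 0) [^] (n::nat) = \<phi>' (int n * int p, 0, 0, 0, 0)" for n
      by (induction n) (simp_all add: M.phi_one algebra_simps)
    then show ?thesis using mm by (metis of_nat_mult of_nat_power mult.commute)
  qed
  also have "\<dots> = \<phi> (int (p ^ (m - 1)) * (int p * k), 0, 0, 0, int (p ^ (m - 1)) * (s * w))"
    unfolding bp pw ..
  also have "int (p ^ (m - 1)) * (int p * k) = 0 + int p ^ m * k"
    using mm by (metis of_nat_mult of_nat_power mult.commute mult.assoc add_0)
  finally have "\<phi> (0, 0, 0, 0, u' * (i * k ^ 3)) = \<phi> (0, 0, 0, 0, int (p ^ (m - 1)) * (s * w) + u * k)"
    unfolding M.phi_bm tops phi_carry .
  then have "int p dvd u' * (i * k ^ 3) - (int (p ^ (m - 1)) * (s * w) + u * k)"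
    unfolding phi_eq_same using p_pos by (simp add: Lat_last)
  then have "[u' * (i * k ^ 3) = u * k + s * w * int p ^ (m - 1)] (mod int p)"
    by (simp add: cong_iff_dvd_diff algebra_simps)
  with k i s show ?thesis by (rule that)
qed

text \<open>For the pairs (0, 1) and (s, 0) the last congruence of \<open>two_markings\<close> would
  make p divide the unit k, so they never describe the same group.\<close>

lemma normal_markings:
  assumes M: "marked G p m s u \<phi>" "marked G p m s' u' \<phi>'"
    and n: "u = 0 \<or> (u = 1 \<and> s = 0)" "u' = 0 \<or> (u' = 1 \<and> s' = 0)"
  shows "u = u'" "\<exists>k. \<not> int p dvd k \<and> [s = s' * k ^ 3] (mod int p)"
proof -
  have pr: "prime p" using M(1) by (simp add: marked_def marked_axioms_def)
  then have p1: "\<not> int p dvd 1" using prime_gt_1_nat by force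
  have no: False if mm: "marked G p m 0 1 \<phi>" "marked G p m s 0 \<phi>'" for s \<phi> \<phi>'
  proof -
    obtain i k w where "\<not> int p dvd k" "[0 * (i * k ^ 3) = 1 * k + 0 * w * int p ^ (m - 1)] (mod int p)"
      using mm by (rule two_markings) blast
    then show False by (simp add: cong_iff_dvd_diff)
  qed
  show u: "u = u'" using n M no by fastforce
  obtain i k w where "\<not> int p dvd k" "u = 0 \<Longrightarrow> [s = s' * k ^ 3] (mod int p)" using M by (rule two_markings) blast
  moreover have "[s = s' * 1 ^ 3] (mod int p)" if "u \<noteq> 0" using that n u by simp
  ultimately show "\<exists>k. \<not> int p dvd k \<and> [s = s' * k ^ 3] (mod int p)" using p1 by blast
qed

section \<open>Cosets of the cubes modulo p\<close>

lemma fermat_inverse: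
  assumes "prime p" "\<not> int p dvd t"
  shows "[t * t ^ (p - 2) = 1] (mod int p)"
proof -
  have "p - 1 = Suc (p - 2)" using prime_ge_2_nat[OF assms(1)] by simp
  then show ?thesis using fermat_int[OF assms] by (simp add: cong_iff_dvd_diff)
qed

text \<open>Membership in a coset of the cubes is translated into a congruence with a factor k^3;
  existence and uniqueness of the representative then become the last two claims.\<close>

lemma cube_coset_repsD:
  assumes T: "cube_coset_reps p T" and p: "prime p"
  shows "t \<in> T \<Longrightarrow> \<not> int p dvd t"
    and "\<not> int p dvd x \<Longrightarrow> \<exists>t\<in>T. \<exists>k. \<not> int p dvd k \<and> [t = x * k ^ 3] (mod int p)"
    and "t \<in> T \<Longrightarrow> t' \<in> T \<Longrightarrow> \<not> int p dvd k \<Longrightarrow> [t = t' * k ^ 3] (mod int p) \<Longrightarrow> t = t'"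
proof -
  define R where "R = residue_ring (int p)"
  interpret residues_prime p R using p by unfold_locales (auto simp: R_def)
  define F where "F = units_of R"
  define C where "C = {x [^]\<^bsub>F\<^esub> (3::nat) | x. x \<in> carrier F}"
  have F: "carrier F = {1..int p - 1}" using prime_gt_1_nat[OF p] by (simp add: F_def units_of_carrier res_prime_units_eq of_nat_diff)
  have mult: "x \<otimes>\<^bsub>F\<^esub> y = x * y mod int p" for x y
    by (simp add: F_def units_of_mult res_mult_eq)
  have cube: "x [^]\<^bsub>F\<^esub> (3::nat) = x ^ 3 mod int p" if "x \<in> carrier F" for x
  proof -
    have "x [^]\<^bsub>F\<^esub> (3::nat) = x [^]\<^bsub>R\<^esub> (3::nat)"
      using that units_of_pow[of x 3] by (simp add: F_def units_of_carrier)
    also have "\<dots> = (x mod int p) [^]\<^bsub>R\<^esub> (3::nat)" using that F by simp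
    finally show ?thesis by (simp add: pow_cong)
  qed
  have pp: "int p > 1" using prime_gt_1_nat[OF p] by simp
  have unit: "x mod int p \<in> carrier F" if "\<not> int p dvd x" for x
  proof -
    have "x mod int p \<noteq> 0" "x mod int p < int p" "x mod int p \<ge> 0" using that pp by (auto simp: dvd_eq_mod_eq_0)
    then show ?thesis unfolding F by simp
  qed
  have nd: "\<not> int p dvd x" if "x \<in> carrier F" for x using that zdvd_not_zless[of x "int p"] unfolding F by auto
  have T': "T \<subseteq> carrier F" "\<And>K. K \<in> rcosets\<^bsub>F\<^esub> C \<Longrightarrow> \<exists>!t. t \<in> T \<and> t \<in> K"
    using T unfolding cube_coset_reps_def Let_def C_def F_def R_def by auto
  have coset: "t \<in> C #>\<^bsub>F\<^esub> x \<longleftrightarrow> (\<exists>k. \<not> int p dvd k \<and> [t = x * k ^ 3] (mod int p))"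
    if t: "t \<in> carrier F" for t x
  proof
    assume "t \<in> C #>\<^bsub>F\<^esub> x"
    then obtain k where k: "k \<in> carrier F" "t = (k ^ 3 mod int p) * x mod int p"
      unfolding r_coset_def C_def mult by (auto simp: cube)
    then have "[t = x * k ^ 3] (mod int p)" by (simp add: cong_def mod_mult_right_eq mult.commute)
    then show "\<exists>k. \<not> int p dvd k \<and> [t = x * k ^ 3] (mod int p)" using nd[OF k(1)] by blast
  next
    assume "\<exists>k. \<not> int p dvd k \<and> [t = x * k ^ 3] (mod int p)"
    then obtain k where k: "\<not> int p dvd k" "[t = x * k ^ 3] (mod int p)" by blast
    have "(k mod int p) [^]\<^bsub>F\<^esub> (3::nat) \<in> C" using unit[OF k(1)] unfolding C_def by blast
    then have "k ^ 3 mod int p \<in> C" unfolding cube[OF unit[OF k(1)]] by (simp add: power_mod)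
    moreover have "t = (k ^ 3 mod int p) \<otimes>\<^bsub>F\<^esub> x"
    proof -
      have "t = t mod int p" using t F by simp
      then show ?thesis unfolding mult using k(2) by (simp add: cong_def mod_mult_right_eq mult.commute)
    qed
    ultimately show "t \<in> C #>\<^bsub>F\<^esub> x" unfolding r_coset_def by blast
  qed
  have rc: "C #>\<^bsub>F\<^esub> x \<in> rcosets\<^bsub>F\<^esub> C" if "x \<in> carrier F" for x
    using that unfolding RCOSETS_def by blast
  show "\<not> int p dvd t" if "t \<in> T" using that T'(1) nd by blast
  show "\<exists>t\<in>T. \<exists>k. \<not> int p dvd k \<and> [t = x * k ^ 3] (mod int p)" if nx: "\<not> int p dvd x"
  proof -
    obtain t where t: "t \<in> T" "t \<in> C #>\<^bsub>F\<^esub> (x mod int p)" using T'(2)[OF rc[OF unit[OF nx]]] by blast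
    obtain k where k: "\<not> int p dvd k" "[t = (x mod int p) * k ^ 3] (mod int p)"
      using t coset T'(1) by blast
    then have "[t = x * k ^ 3] (mod int p)" by (simp add: cong_def mod_mult_left_eq)
    then show ?thesis using t(1) k(1) by blast
  qed
  show "t = t'" if "t \<in> T" "t' \<in> T" "\<not> int p dvd k" "[t = t' * k ^ 3] (mod int p)"
  proof -
    have "t \<in> C #>\<^bsub>F\<^esub> t'" using that T'(1) coset by blast
    moreover have "\<not> int p dvd 1 \<and> [t' = t' * 1 ^ 3] (mod int p)" using pp by simp
    then have "t' \<in> C #>\<^bsub>F\<^esub> t'" using that(2) T'(1) coset by blast
    moreover have "t' \<in> carrier F" using that(2) T'(1) by blast
    ultimately show ?thesis using T'(2)[OF rc] that(1,2) by blast
  qed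
qed

section \<open>The list has no repetitions and is complete\<close>

lemma listed_admissible:
  assumes "cube_coset_choice T" "listed T e"
  shows "admissible e"
  using assms cube_coset_repsD(1) by (cases e) (auto simp: cube_coset_choice_def)

lemma adm_marked:
  assumes "admissible e"
  obtains \<psi> where "marked (grp e) (prime_of e) (exponent_of e) (s_of e) (u_of e) \<psi>"
  using assms by (rule entry_marked)

text \<open>The order gives p and m; u separates F3, F5, F7 from the rest; s modulo cubes separates
  what remains.\<close>

lemma isomorphic_listed_eq:
  assumes T: "cube_coset_choice T" and e: "listed T e" "listed T e'" "grp e \<cong> grp e'"
  shows "e = e'"
proof -
  obtain \<psi> where M: "marked (grp e) (prime_of e) (exponent_of e) (s_of e) (u_of e) \<psi>"
    using listed_admissible[OF T e(1)] by (rule adm_marked)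
  obtain \<psi>' where M': "marked (grp e') (prime_of e') (exponent_of e') (s_of e') (u_of e') \<psi>'"
    using listed_admissible[OF T e(2)] by (rule adm_marked)
  interpret g: marked "grp e" "prime_of e" "exponent_of e" "s_of e" "u_of e" \<psi> by (rule M)
  interpret h: marked "grp e'" "prime_of e'" "exponent_of e'" "s_of e'" "u_of e'" \<psi>' by (rule M')
  obtain \<theta> where th: "\<theta> \<in> iso (grp e) (grp e')" using e(3) unfolding is_iso_def by blast
  have "order (grp e) = order (grp e')" using iso_same_card[OF e(3)] by (simp add: order_def)
  then have o: "prime_of e ^ (exponent_of e + 4) = prime_of e' ^ (exponent_of e' + 4)"
    using g.order_G h.order_G by simp
  have pp: "prime_of e' = prime_of e"
    using prime_power_inj'(1)[OF g.prime h.prime o] by simp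
  have mm: "exponent_of e' = exponent_of e"
    using prime_power_inj'(2)[OF g.prime h.prime o] by simp
  have M1: "marked (grp e') (prime_of e) (exponent_of e) (s_of e) (u_of e) (\<theta> \<circ> \<psi>)"
    by (rule marked_iso[OF M th h.is_group])
  have n: "u_of e = 0 \<or> (u_of e = 1 \<and> s_of e = 0)" for e by (cases e) auto
  note nm = normal_markings[OF M1 M'[unfolded pp mm] n n]
  obtain k where k: "\<not> int (prime_of e) dvd k" "[s_of e = s_of e' * k ^ 3] (mod int (prime_of e))"
    using nm(2) by blast
  have k3: "\<not> int (prime_of e) dvd k ^ 3" using k(1) g.prime_int prime_dvd_power by blast
  \<comment> \<open>In F8 s is the inverse of t, so the cube factor between the two values of s
    reappears between t' and t.\<close>
  have eight: "t = t'" if "e = F8 p m t" "e' = F8 p m' t'" for p m m' t t'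
  proof -
    have pr: "prime p" "p \<ge> 5" "t \<in> T p" "t' \<in> T p" using e that by auto
    then have Tp: "cube_coset_reps p (T p)" using T by (simp add: cube_coset_choice_def)
    have nt: "\<not> int p dvd t" "\<not> int p dvd t'" using cube_coset_repsD(1)[OF Tp pr(1)] pr by auto
    have c: "[t ^ (p - 2) = t' ^ (p - 2) * k ^ 3] (mod int p)" "\<not> int p dvd k" using k that by auto
    have "[t' = t' * (t * t ^ (p - 2))] (mod int p)"
      using cong_mult[OF cong_refl[of t'] cong_sym[OF fermat_inverse[OF pr(1) nt(1)]]] by simp
    also have "[t' * (t * t ^ (p - 2)) = t' * (t * (t' ^ (p - 2) * k ^ 3))] (mod int p)"
      by (intro cong_mult cong_refl c(1))
    also have "t' * (t * (t' ^ (p - 2) * k ^ 3)) = (t' * t' ^ (p - 2)) * (t * k ^ 3)" by (simp add: ac_simps)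
    also have "[\<dots> = 1 * (t * k ^ 3)] (mod int p)" by (intro cong_mult cong_refl fermat_inverse pr nt)
    finally have "[t' = t * k ^ 3] (mod int p)" by simp
    then show ?thesis using cube_coset_repsD(3)[OF Tp pr(1,4,3) c(2)] by simp
  qed
  have nz: "\<not> int p dvd t ^ (p - 2)" if "prime p" "\<not> int p dvd t" for p t
    using that prime_dvd_power[of "int p" t] by auto
  have a: "admissible e" "admissible e'" using e listed_admissible[OF T] by auto
  \<comment> \<open>Divisibility of s by p is invariant; it separates F1 from F2, the two values of
    t in F4, and F6 from F8.\<close>
  have zero: "int (prime_of e) dvd s_of e \<longleftrightarrow> int (prime_of e) dvd s_of e'"
  proof -
    have "int (prime_of e) dvd s_of e \<longleftrightarrow> int (prime_of e) dvd s_of e' * k ^ 3"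
      using k(2) by (simp only: cong_def dvd_eq_mod_eq_0)
    then show ?thesis using k3 prime_dvd_mult_iff[OF g.prime_int] by blast
  qed
  show ?thesis
  proof (cases "(\<exists>p m t. e = F8 p m t) \<and> (\<exists>p m t. e' = F8 p m t)")
    case True
    then obtain p m t p' m' t' where F: "e = F8 p m t" "e' = F8 p' m' t'" by blast
    then have "p' = p" "m' = m" using pp mm by simp_all
    then show ?thesis using eight F by blast
  next
    case False
    show ?thesis using a pp mm nm(1) zero nz False by (cases e; cases e') (simp_all split: if_splits)
  qed
qed

lemma standing_listed:
  assumes T: "cube_coset_choice T" and G: "standing_hyp p G" "min_gens G = 2" "nilp_class G = 4"
  shows "\<exists>e. listed T e \<and> G \<cong> grp e"
proof -
  have red: "\<exists>e. listed T e \<and> G \<cong> grp e"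
    if mk: "marked G (prime_of e) (exponent_of e) (s_of e) (u_of e) \<phi>" and ls: "listed T e" for e \<phi>
  proof -
    obtain \<psi> where "marked (grp e) (prime_of e) (exponent_of e) (s_of e) (u_of e) \<psi>"
      using listed_admissible[OF T ls] by (rule adm_marked)
    then have "G \<cong> grp e" by (rule marked_unique[OF mk])
    then show ?thesis using ls by blast
  qed
  have pm: "prime p" "m \<ge> 1" if "marked G p m s u \<phi>" for m s u \<phi>
    using that by (auto simp: marked_def marked_axioms_def)
  have pr: "prime p" using G(1) by (auto simp: standing_hyp_def numeral_3_eq_3 finite_p_group_def)
  have p235: "p = 2 \<or> p = 3 \<or> p \<ge> 5"
  proof -
    have "p \<noteq> 4"
    proof
      assume p4: "p = 4"
      then have "2 = p" using primes_dvd_imp_eq[OF two_is_prime_nat pr] by simp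
      then show False using p4 by simp
    qed
    then show ?thesis using prime_ge_2_nat[OF pr] by arith
  qed
  have one: "\<not> int p dvd 1" using prime_gt_1_nat[OF pr] by force
  obtain m where "(\<exists>\<phi>. marked G p m 0 1 \<phi>) \<or>
    (\<exists>s. \<forall>s' k. \<not> int p dvd k \<longrightarrow> [s' * k ^ 3 = s] (mod int p) \<longrightarrow> (\<exists>\<phi>. marked G p m s' 0 \<phi>))"
    using standing_marked[OF G] by blast
  then show ?thesis
  proof (elim disjE exE)
    fix \<phi> assume M: "marked G p m 0 1 \<phi>"
    show ?thesis using p235 red[of "F3 m" \<phi>] red[of "F5 m" \<phi>] red[of "F7 p m" \<phi>] M pm[OF M] by auto
  next
    fix s assume "\<forall>s' k. \<not> int p dvd k \<longrightarrow> [s' * k ^ 3 = s] (mod int p) \<longrightarrow> (\<exists>\<phi>. marked G p m s' 0 \<phi>)"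
    then have M: "\<And>s' k. \<not> int p dvd k \<Longrightarrow> [s' * k ^ 3 = s] (mod int p) \<Longrightarrow> \<exists>\<phi>. marked G p m s' 0 \<phi>"
      by blast
    show ?thesis
    proof (cases "int p dvd s")
      case True
      then have "[0 * 1 ^ 3 = s] (mod int p)" by (simp add: cong_iff_dvd_diff)
      then obtain \<phi> where M0: "marked G p m 0 0 \<phi>" using M[OF one] by blast
      then show ?thesis using p235 red[of "F1 m" \<phi>] red[of "F4 m 2" \<phi>] red[of "F6 p m" \<phi>] pm[OF M0] by auto
    next
      case s: False
      show ?thesis
      proof (cases "p = 2 \<or> p = 3")
        case True
        \<comment> \<open>For p = 2 and p = 3 the cube of s is s modulo p, so k = s shows that every
          unit is in the class of 1.\<close>
        have "\<exists>k. \<not> int p dvd k \<and> [1 * k ^ 3 = s] (mod int p)"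
        proof -
          have "int p dvd s ^ (p - 1) - 1" by (rule fermat_int[OF pr s])
          then have "int p dvd s * (s ^ (p - 1) - 1) * (if p = 2 then s + 1 else 1)" by simp
          then have "int p dvd s ^ 3 - s"
            using True by (auto simp: algebra_simps power2_eq_square power3_eq_cube)
          then show ?thesis using s by (auto simp: cong_iff_dvd_diff)
        qed
        then obtain \<phi> where M1: "marked G p m 1 0 \<phi>" using M by blast
        then show ?thesis using True red[of "F2 m" \<phi>] red[of "F4 m 1" \<phi>] pm[OF M1] by auto
      next
        case False
        then have p5: "p \<ge> 5" using p235 by simp
        then have Tp: "cube_coset_reps p (T p)" using T pr by (simp add: cube_coset_choice_def)
        have "\<not> int p dvd s ^ (p - 2)" using s pr prime_dvd_power[of "int p" s] by auto
        \<comment> \<open>The representative is taken from the coset of the inverse of s, because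
          the parameter of F8 is the inverse of s.\<close>
        then obtain t k where t: "t \<in> T p" "\<not> int p dvd k" "[t = s ^ (p - 2) * k ^ 3] (mod int p)"
          using cube_coset_repsD(2)[OF Tp pr] by blast
        have nt: "\<not> int p dvd t" using cube_coset_repsD(1)[OF Tp pr t(1)] .
        have "[t ^ (p - 2) * k ^ 3 = t ^ (p - 2) * ((s * s ^ (p - 2)) * k ^ 3)] (mod int p)"
          using cong_mult[OF cong_refl cong_mult[OF cong_sym[OF fermat_inverse[OF pr s]] cong_refl], of "t ^ (p - 2)" "k ^ 3"] by simp
        also have "t ^ (p - 2) * ((s * s ^ (p - 2)) * k ^ 3) = t ^ (p - 2) * (s * (s ^ (p - 2) * k ^ 3))"
          by (simp add: ac_simps)
        also have "[\<dots> = t ^ (p - 2) * (s * t)] (mod int p)"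
          by (intro cong_mult cong_refl cong_sym[OF t(3)])
        also have "t ^ (p - 2) * (s * t) = s * (t * t ^ (p - 2))" by (simp add: ac_simps)
        also have "[\<dots> = s * 1] (mod int p)" by (intro cong_mult cong_refl fermat_inverse pr nt)
        finally have "[t ^ (p - 2) * k ^ 3 = s] (mod int p)" by simp
        then obtain \<phi> where M1: "marked G p m (t ^ (p - 2)) 0 \<phi>" using M[OF t(2)] by blast
        then show ?thesis using red[of "F8 p m t" \<phi>] pm[OF M1] p5 t(1) by auto
      qed
    qed
  qed
qed

lemma isomorphic_listed:
  assumes T: "cube_coset_choice T" and G: "standing_hyp p G" and e: "listed T e" "G \<cong> grp e"
  obtains \<phi> where "marked G p (exponent_of e) (s_of e) (u_of e) \<phi>"
proof -
  obtain \<psi> where M: "marked (grp e) (prime_of e) (exponent_of e) (s_of e) (u_of e) \<psi>"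
    using listed_admissible[OF T e(1)] by (rule adm_marked)
  interpret g: marked "grp e" "prime_of e" "exponent_of e" "s_of e" "u_of e" \<psi> by (rule M)
  have fp: "finite_p_group p G" using G by (simp add: standing_hyp_def numeral_3_eq_3)
  then obtain n where n: "prime p" "group G" "order G = p ^ n" by (auto simp: finite_p_group_def)
  have iso: "grp e \<cong> G" using group.iso_sym[OF n(2) e(2)] .
  then obtain \<theta> where th: "\<theta> \<in> iso (grp e) G" unfolding is_iso_def by blast
  have o: "prime_of e ^ (exponent_of e + 4) = p ^ n"
    using iso_same_card[OF iso] g.order_G n(3) by (simp add: order_def)
  then have "prime_of e dvd p ^ n" by (metis dvd_power add_gr_0 zero_less_numeral)
  then have "prime_of e = p" using g.prime n(1) prime_dvd_power primes_dvd_imp_eq by blast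
  then have "marked G p (exponent_of e) (s_of e) (u_of e) (\<theta> \<circ> \<psi>)"
    using marked_iso[OF M th n(2)] by simp
  then show ?thesis by (rule that)
qed

section \<open>Frattini subgroup, derived subgroup and centre\<close>

text \<open>Exponents modulo the given orders define a homomorphism from the product of cyclic
  groups; it is onto by generation and injective by counting. So no independence of the generators
  has to be checked.\<close>

lemma (in comm_group) iso_cyclic_product:
  assumes xs: "list_all2 (\<lambda>x n. x \<in> carrier G \<and> n > 0 \<and> x [^] int n = \<one>) xs ns"
    and gen: "carrier G \<subseteq> generate G (set xs)" and card: "order G = prod_list ns"
  shows "G \<cong> cyclic_product ns"
proof -
  let ?I = "{..<length ns}" and ?Z = "\<lambda>i. integer_mod_group (ns ! i)"
  have x: "xs ! i \<in> carrier G" "ns ! i > 0" "xs ! i [^] int (ns ! i) = \<one>" if "i \<in> ?I" for i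
    using that list_all2_nthD2[OF xs, of i] by auto
  have len: "length xs = length ns" using xs by (rule list_all2_lengthD)
  define f where "f v = finprod G (\<lambda>i. xs ! i [^] (v i :: int)) ?I" for v
  interpret C: group "cyclic_product ns" by (simp add: cyclic_product_def)
  have md: "xs ! i [^] (k mod int (ns ! i)) = xs ! i [^] k" if "i \<in> ?I" for i and k :: int
  proof -
    have "xs ! i [^] (k mod int (ns ! i)) \<otimes> xs ! i [^] (int (ns ! i) * (k div int (ns ! i))) =
        xs ! i [^] k"
      using x(1)[OF that] by (simp flip: int_pow_mult)
    moreover have "xs ! i [^] (int (ns ! i) * (k div int (ns ! i))) = \<one>"
      using x(3)[OF that] int_pow_pow[OF x(1)[OF that], of "int (ns ! i)"] by simp
    ultimately show ?thesis using x(1)[OF that] by simp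
  qed
  have hom: "f \<in> hom (cyclic_product ns) G"
  proof (rule homI)
    show "f v \<in> carrier G" for v unfolding f_def using x by (intro finprod_closed) auto
    fix v w
    have "f (v \<otimes>\<^bsub>cyclic_product ns\<^esub> w) = finprod G (\<lambda>i. xs ! i [^] v i \<otimes> xs ! i [^] w i) ?I"
      unfolding f_def using x md by (intro finprod_cong') (auto simp: cyclic_product_def int_pow_mult)
    also have "\<dots> = f v \<otimes> f w" unfolding f_def using x by (intro finprod_multf) auto
    finally show "f (v \<otimes>\<^bsub>cyclic_product ns\<^esub> w) = f v \<otimes> f w" .
  qed
  interpret f: group_hom "cyclic_product ns" G f
    using hom by unfold_locales
  have "xs ! i \<in> f ` carrier (cyclic_product ns)" if i: "i \<in> ?I" for i
  proof
    let ?v = "\<lambda>j\<in>?I. if j = i then 1 mod int (ns ! i) else 0"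
    show "?v \<in> carrier (cyclic_product ns)"
      using x(2) i by (auto simp: cyclic_product_def carrier_integer_mod_group PiE_iff)
    have "f ?v = finprod G (\<lambda>j. if i = j then xs ! j else \<one>) ?I"
      unfolding f_def using x md[OF i, of 1] by (intro finprod_cong') (auto simp: int_pow_1)
    also have "\<dots> = xs ! i" using x i by (intro finprod_singleton) auto
    finally show "xs ! i = f ?v" by simp
  qed
  then have "set xs \<subseteq> f ` carrier (cyclic_product ns)" by (auto simp: in_set_conv_nth len)
  then have "generate G (set xs) \<subseteq> f ` carrier (cyclic_product ns)"
    by (rule generate_subgroup_incl[OF _ f.img_is_subgroup])
  then have surj: "f ` carrier (cyclic_product ns) = carrier G" using gen f.hom_closed by blast
  have "card (carrier (cyclic_product ns)) = (\<Prod>i\<in>?I. card (carrier (?Z i)))"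
    by (simp add: cyclic_product_def card_PiE)
  also have "\<dots> = (\<Prod>i\<in>?I. ns ! i)"
    using x(2) by (intro prod.cong) (auto simp: carrier_integer_mod_group)
  also have "\<dots> = prod_list ns" by (simp add: prod.list_conv_set_nth lessThan_atLeast0)
  finally have c: "card (f ` carrier (cyclic_product ns)) = card (carrier (cyclic_product ns))"
    using card surj by (simp add: order_def)
  have "finite (carrier (cyclic_product ns))"
    unfolding cyclic_product_def carrier_product_group using x(2)
    by (intro finite_PiE) (auto simp: carrier_integer_mod_group)
  then have "inj_on f (carrier (cyclic_product ns))" using c by (rule eq_card_imp_inj_on)
  then have "f \<in> iso (cyclic_product ns) G" using hom surj by (auto simp: iso_def bij_betw_def)
  then have "cyclic_product ns \<cong> G" unfolding is_iso_def by blast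
  then show ?thesis by (rule C.iso_sym)
qed

section \<open>Bases of the Frattini subgroup, the derived subgroup and the centre\<close>

context marked
begin

lemma filt_A: "1 \<le> r \<Longrightarrow> \<phi> ` filt j r \<subseteq> \<phi> ` filt 1 1"
proof -
  assume "1 \<le> r"
  then have "int p dvd int p ^ r" by simp
  then show ?thesis unfolding filt_def by (intro image_mono) (auto intro: dvd_trans)
qed

lemma filt_type:
  assumes r: "1 \<le> r" "r \<le> m" and j: "j \<in> {1..4}"
    and xs: "list_all2 (\<lambda>x n. x \<in> \<phi> ` filt j r \<and> n > 0 \<and> x [^] int n = \<one>) xs ns"
    and gen: "\<phi> ` filt j r \<subseteq> generate G (set xs)" and card: "prod_list ns = p ^ (m - r) * p ^ (5 - j)"
  shows "G\<lparr>carrier := \<phi> ` filt j r\<rparr> \<cong> cyclic_product ns"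
proof -
  let ?B = "\<phi> ` filt j r"
  note B = subgroup_filt[of j r]
  have sub: "set xs \<subseteq> ?B" using xs by (auto simp: list_all2_conv_all_nth in_set_conv_nth)
  have "abelian_sub G ?B" unfolding abelian_sub_iff[OF B] by (intro ballI A_comm subsetD[OF filt_A[OF r(1)]])
  then interpret B: comm_group "G\<lparr>carrier := ?B\<rparr>" .
  show ?thesis
  proof (rule B.iso_cyclic_product)
    show "list_all2 (\<lambda>x n. x \<in> carrier (G\<lparr>carrier := ?B\<rparr>) \<and> n > 0 \<and>
        x [^]\<^bsub>G\<lparr>carrier := ?B\<rparr>\<^esub> int n = \<one>\<^bsub>G\<lparr>carrier := ?B\<rparr>\<^esub>) xs ns"
      using xs by (rule list_all2_mono) (simp add: int_pow_int flip: nat_pow_consistent)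
    show "carrier (G\<lparr>carrier := ?B\<rparr>) \<subseteq> generate (G\<lparr>carrier := ?B\<rparr>) (set xs)"
      using gen generate_consistent[OF sub B] by simp
    show "order (G\<lparr>carrier := ?B\<rparr>) = prod_list ns"
      using card card_phi_filt(1)[OF r(2) j] by (simp add: order_def)
  qed
qed

lemma pow_b: "\<phi> (l, 0, 0, 0, 0) [^] (n::int) = \<phi> (n * l, 0, 0, 0, 0)"
  using int_pow_pow[of "\<phi> (1, 0, 0, 0, 0)" l n] by (simp add: phi_b_pow mult.commute)

lemma filt2_subset:
  assumes H: "subgroup H G"
    and a: "\<phi> (0, 0, 1, 0, 0) \<in> H" "\<phi> (0, 0, 0, 1, 0) \<in> H" "\<phi> (0, 0, 0, 0, 1) \<in> H"
    and b: "\<phi> (int p ^ r, 0, 0, 0, 0) \<in> H"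
  shows "\<phi> ` filt 2 r \<subseteq> H"
proof
  fix x assume "x \<in> \<phi> ` filt 2 r"
  then obtain j c2 c3 c4 where x: "x = \<phi> (int p ^ r * j, 0, c2, c3, c4)" by (rule filtE2)
  have "x = \<phi> (int p ^ r, 0, 0, 0, 0) [^] j \<otimes> (\<phi> (0, 0, 1, 0, 0) [^] c2 \<otimes> (\<phi> (0, 0, 0, 1, 0) [^] c3 \<otimes>
      \<phi> (0, 0, 0, 0, 1) [^] c4))"
    unfolding x pow_b phi_vec_pow by (simp add: mult.commute)
  then show "x \<in> H" using sub_pow[OF H] a b subgroup.m_closed[OF H] by simp
qed

lemma filt4_subset:
  assumes H: "subgroup H G" and a: "\<phi> (0, 0, 0, 0, 1) \<in> H" and b: "\<phi> (int p ^ r, 0, 0, 0, 0) \<in> H"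
  shows "\<phi> ` filt 4 r \<subseteq> H"
proof
  fix x assume "x \<in> \<phi> ` filt 4 r"
  then obtain j c4 where x: "x = \<phi> (int p ^ r * j, 0, 0, 0, c4)" by (rule filtE4)
  have "x = \<phi> (int p ^ r, 0, 0, 0, 0) [^] j \<otimes> \<phi> (0, 0, 0, 0, 1) [^] c4"
    unfolding x pow_b phi_vec_pow by (simp add: mult.commute)
  then show "x \<in> H" using sub_pow[OF H] a b subgroup.m_closed[OF H] by simp
qed

text \<open>b^(p^m) is a power of a_4, so three elements are enough.\<close>

lemma derived_subset:
  assumes H: "subgroup H G"
    and a: "\<phi> (0, 0, 1, 0, 0) \<in> H" "\<phi> (0, 0, 0, 1, 0) \<in> H" "\<phi> (0, 0, 0, 0, 1) \<in> H"
  shows "\<phi> ` filt 2 m \<subseteq> H"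
proof (rule filt2_subset[OF H a])
  have "\<phi> (int p ^ m, 0, 0, 0, 0) = \<phi> (0, 0, 0, 0, 1) [^] u" unfolding phi_bm phi_vec_pow by simp
  then show "\<phi> (int p ^ m, 0, 0, 0, 0) \<in> H" using sub_pow[OF H a(3)] by simp
qed

lemma generate_filt:
  assumes "S \<subseteq> \<phi> ` filt j r" "\<phi> ` filt j r \<subseteq> generate G S"
  shows "\<phi> ` filt j r = generate G S"
  using assms generate_subgroup_incl[OF assms(1) subgroup_filt] by blast

lemma generate_sub: "S \<subseteq> carrier G \<Longrightarrow> subgroup (generate G S) G"
  by (rule generate_is_subgroup)

text \<open>The lattice relator solved for a_1^p: it lies in the derived subgroup.\<close>

lemma phi_a_p: "\<phi> (0, int p, 0, 0, 0) = \<phi> (0, 0, - B2 p, - B3 p, s - B4 p)"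
  unfolding phi_eq_same using LatI[of p 1 0 0 0 s] by (simp add: algebra_simps)

lemma a4_p: "\<phi> (0, 0, 0, 0, int p * c) = \<one>"
  unfolding phi_eq_0 using p_pos by (simp add: Lat_last)

lemma bp_pow: "\<phi> (int p, 0, 0, 0, 0) [^] (int p ^ (m - 1)) = \<phi> (0, 0, 0, 0, u)"
proof -
  have "int p ^ (m - 1) * int p = int p ^ m" using m by (simp add: power_eq_if)
  then show ?thesis unfolding pow_b by (simp add: phi_bm)
qed

text \<open>Since the derived subgroup has order p^3, such a list exhibits it as a direct product of
  cyclic groups.\<close>

definition derived_base :: "'a list \<Rightarrow> nat list \<Rightarrow> bool" where
  "derived_base ds ns \<longleftrightarrow> list_all2 (\<lambda>x n. x \<in> \<phi> ` filt 2 m \<and> n > 0 \<and> x [^] int n = \<one>) ds ns \<and>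
     prod_list ns = p ^ 3 \<and> \<phi> ` filt 2 m \<subseteq> generate G (set ds)"

lemma derived_baseD:
  assumes "derived_base ds ns"
  shows "derived G (carrier G) = generate G (set ds)"
    and "G\<lparr>carrier := derived G (carrier G)\<rparr> \<cong> cyclic_product ns"
    and "frattini G = generate G (insert (\<phi> (int p, 0, 0, 0, 0)) (set ds))"
proof -
  have d: "list_all2 (\<lambda>x n. x \<in> \<phi> ` filt 2 m \<and> n > 0 \<and> x [^] int n = \<one>) ds ns"
    "prod_list ns = p ^ 3" "\<phi> ` filt 2 m \<subseteq> generate G (set ds)"
    using assms unfolding derived_base_def by auto
  have ds: "set ds \<subseteq> \<phi> ` filt 2 m" using d(1) by (auto simp: list_all2_conv_all_nth in_set_conv_nth)
  show "derived G (carrier G) = generate G (set ds)"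
    unfolding derived_eq by (rule generate_filt[OF ds d(3)])
  show "G\<lparr>carrier := derived G (carrier G)\<rparr> \<cong> cyclic_product ns"
    unfolding derived_eq by (rule filt_type[OF m _ _ d(1,3)]) (simp_all add: d(2))
  let ?S = "insert (\<phi> (int p, 0, 0, 0, 0)) (set ds)"
  have m1: "\<phi> ` filt 2 m \<subseteq> \<phi> ` filt 2 1"
    unfolding filt_def using pm_dvd by (intro image_mono) auto
  have S: "?S \<subseteq> \<phi> ` filt 2 1" using filtI(2)[of 1 "int p" 0 0 0] ds m1 by auto
  then have "?S \<subseteq> carrier G" using subgroup.subset[OF subgroup_filt] by blast
  then have H: "subgroup (generate G ?S) G" by (rule generate_sub)
  have "generate G (set ds) \<subseteq> generate G ?S" by (rule mono_generate) auto
  then have f: "\<phi> ` filt 2 m \<subseteq> generate G ?S" using d(3) by blast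
  have "\<phi> ` filt 2 1 \<subseteq> generate G ?S"
  proof (rule filt2_subset[OF H])
    show "\<phi> (int p ^ 1, 0, 0, 0, 0) \<in> generate G ?S" by (auto intro: generate.incl)
  qed (use f filtI(2)[of m 0] in auto)
  then show "frattini G = generate G ?S" unfolding frattini_eq by (rule generate_filt[OF S])
qed

text \<open>With u = 0 the p^(m - 1)-th power of b^p is 1, so b^p contributes just the missing
  cyclic factor of order p^(m - 1).\<close>

lemma frattini_type_0:
  assumes "derived_base ds ns" and u: "u = 0"
  shows "G\<lparr>carrier := frattini G\<rparr> \<cong> cyclic_product (if m > 1 then ns @ [p ^ (m - 1)] else ns)"
proof (cases "m > 1")
  case True
  have d: "list_all2 (\<lambda>x n. x \<in> \<phi> ` filt 2 m \<and> n > 0 \<and> x [^] int n = \<one>) ds ns"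
    "prod_list ns = p ^ 3"
    using assms(1) unfolding derived_base_def by auto
  have m1: "\<phi> ` filt 2 m \<subseteq> \<phi> ` filt 2 1"
    unfolding filt_def using pm_dvd by (intro image_mono) auto
  have "list_all2 (\<lambda>x n. x \<in> \<phi> ` filt 2 1 \<and> n > 0 \<and> x [^] int n = \<one>) ds ns"
    using d(1) by (rule list_all2_mono) (use m1 in blast)
  moreover have "\<phi> (int p, 0, 0, 0, 0) \<in> \<phi> ` filt 2 1" by (rule filtI) simp
  ultimately have l: "list_all2 (\<lambda>x n. x \<in> \<phi> ` filt 2 1 \<and> n > 0 \<and> x [^] int n = \<one>)
      (ds @ [\<phi> (int p, 0, 0, 0, 0)]) (ns @ [p ^ (m - 1)])"
    using bp_pow u p_pos phi_one by (intro list_all2_appendI) simp_all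
  have "G\<lparr>carrier := \<phi> ` filt 2 1\<rparr> \<cong> cyclic_product (ns @ [p ^ (m - 1)])"
    by (rule filt_type[OF _ m _ l]) (use derived_baseD(3)[OF assms(1)] d(2) frattini_eq in \<open>auto simp: mult.commute\<close>)
  then show ?thesis using True by (simp add: frattini_eq)
next
  case False
  then have "m = 1" using m by simp
  then show ?thesis using derived_baseD(2)[OF assms(1)] by (simp add: frattini_eq derived_eq)
qed

text \<open>The element x is the generator of the group of a_4 in the notation of the family: a
  power of a_1, a power of a_2, or a_4 itself.\<close>

lemma centre_0:
  assumes u: "u = 0" and x: "x = \<phi> (0, 0, 0, 0, c)" "\<phi> (0, 0, 0, 0, 1) = x [^] (d::int)"
  shows "centre G = generate G {x, \<phi> (int p, 0, 0, 0, 0)}"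
    and "G\<lparr>carrier := centre G\<rparr> \<cong> cyclic_product (if m > 1 then [p, p ^ (m - 1)] else [p])"
proof -
  have S: "{x, \<phi> (int p, 0, 0, 0, 0)} \<subseteq> \<phi> ` filt 4 1" unfolding x by (simp add: filtI)
  have H: "subgroup (generate G {x, \<phi> (int p, 0, 0, 0, 0)}) G" unfolding x by (rule generate_sub) simp
  have "x \<in> generate G {x, \<phi> (int p, 0, 0, 0, 0)}" by (auto intro: generate.incl)
  then have a: "\<phi> (0, 0, 0, 0, 1) \<in> generate G {x, \<phi> (int p, 0, 0, 0, 0)}" unfolding x(2) by (rule sub_pow[OF H])
  have "\<phi> ` filt 4 1 \<subseteq> generate G {x, \<phi> (int p, 0, 0, 0, 0)}"
    by (rule filt4_subset[OF H a]) (auto intro: generate.incl)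
  then show "centre G = generate G {x, \<phi> (int p, 0, 0, 0, 0)}"
    unfolding centre_eq by (rule generate_filt[OF S])
  let ?a = "\<phi> (0, 0, 0, 0, 1)" and ?b = "\<phi> (int p, 0, 0, 0, 0)"
  have ap: "?a [^] int p = \<one>" using a4_p[of 1] by (simp add: phi_vec_pow)
  show "G\<lparr>carrier := centre G\<rparr> \<cong> cyclic_product (if m > 1 then [p, p ^ (m - 1)] else [p])"
  proof (cases "m > 1")
    case True
    have H: "subgroup (generate G {?a, ?b}) G" by (rule generate_sub) simp
    have "\<phi> ` filt 4 1 \<subseteq> generate G {?a, ?b}"
      by (rule filt4_subset[OF H]) (auto intro: generate.incl)
    moreover have "p * p ^ (m - 1) = p ^ (m - 1) * p ^ (5 - 4)" by simp
    ultimately have "G\<lparr>carrier := \<phi> ` filt 4 1\<rparr> \<cong> cyclic_product [p, p ^ (m - 1)]"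
      by (intro filt_type[where xs = "[?a, ?b]"]) (use m ap bp_pow u phi_one p_pos in \<open>simp_all add: filtI\<close>)
    then show ?thesis using True by (simp add: centre_eq)
  next
    case False
    then have m1: "m = 1" using m by simp
    have H: "subgroup (generate G {?a}) G" by (rule generate_sub) simp
    have "\<one> \<in> generate G {?a}" by (rule generate.one)
    then have "\<phi> ` filt 4 1 \<subseteq> generate G {?a}"
      using bp_pow u m1 phi_one by (intro filt4_subset[OF H]) (auto intro: generate.incl simp: int_pow_1)
    then have "G\<lparr>carrier := \<phi> ` filt 4 1\<rparr> \<cong> cyclic_product [p]"
      by (intro filt_type[where xs = "[?a]"]) (use m1 ap p_pos in \<open>simp_all add: filtI\<close>)
    then show ?thesis using m1 by (simp add: centre_eq)
  qed
qed

lemma top_in_b: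
  assumes "u = 1" and H: "subgroup H G" "\<phi> (int p, 0, 0, 0, 0) \<in> H"
  shows "\<phi> (0, 0, 0, 0, 1) \<in> H"
  using sub_pow[OF H, of "int p ^ (m - 1)"] bp_pow assms(1) by simp

lemma bp_order: "\<phi> (int p, 0, 0, 0, 0) [^] int (p ^ m) = \<one>"
  using phi_carry[of 0 "int p" 0 0 0 0] a4_p[of u] by (simp add: pow_b mult.commute)

lemma centre_1:
  assumes u: "u = 1"
  shows "centre G = generate G {\<phi> (int p, 0, 0, 0, 0)}"
    and "G\<lparr>carrier := centre G\<rparr> \<cong> cyclic_product [p ^ m]"
proof -
  let ?b = "\<phi> (int p, 0, 0, 0, 0)"
  have H: "subgroup (generate G {?b}) G" by (rule generate_sub) simp
  have b: "?b \<in> generate G {?b}" by (auto intro: generate.incl)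
  have sub: "\<phi> ` filt 4 1 \<subseteq> generate G {?b}"
    using b by (intro filt4_subset[OF H top_in_b[OF u H b]]) simp
  then show "centre G = generate G {?b}"
    unfolding centre_eq by (intro generate_filt) (simp_all add: filtI)
  have c: "prod_list [p ^ m] = p ^ (m - 1) * p ^ (5 - 4)" using m by (cases m) simp_all
  show "G\<lparr>carrier := centre G\<rparr> \<cong> cyclic_product [p ^ m]"
    unfolding centre_eq by (rule filt_type[where xs = "[?b]", OF _ m _ _ _ c])
      (use sub bp_order p_pos in \<open>simp_all add: filtI\<close>)
qed

lemma frattini_type_1:
  assumes u: "u = 1" and xs: "\<phi> (int p, 0, 0, 0, 0) \<in> generate G (set xs)"
    "\<phi> (0, 0, 1, 0, 0) \<in> generate G (set xs)" "\<phi> (0, 0, 0, 1, 0) \<in> generate G (set xs)"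
    "list_all2 (\<lambda>x n. x \<in> \<phi> ` filt 2 1 \<and> n > 0 \<and> x [^] int n = \<one>) xs ns"
    and ns: "prod_list ns = p ^ (m + 2)"
  shows "G\<lparr>carrier := frattini G\<rparr> \<cong> cyclic_product ns"
proof -
  have "set xs \<subseteq> \<phi> ` filt 2 1" using xs(4) by (auto simp: list_all2_conv_all_nth in_set_conv_nth)
  then have "set xs \<subseteq> carrier G" using subgroup.subset[OF subgroup_filt] by blast
  then have H: "subgroup (generate G (set xs)) G" by (rule generate_sub)
  have "\<phi> ` filt 2 1 \<subseteq> generate G (set xs)"
    using xs(1) by (intro filt2_subset[OF H xs(2,3) top_in_b[OF u H xs(1)]]) simp
  moreover have "m + 2 = (m - 1) + (5 - 2)" using m by simp
  then have "prod_list ns = p ^ (m - 1) * p ^ (5 - 2)" unfolding ns by (simp only: power_add)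
  ultimately show ?thesis unfolding frattini_eq by (intro filt_type[OF _ m _ xs(4)]) simp_all
qed

text \<open>A cyclic factor that meets \<open>\<langle>b ^ p\<rangle>\<close> is replaced by a complement: \<open>x\<close> is multiplied by
  the power \<open>b ^ k\<close> for which \<open>(b ^ k x) ^ n = 1\<close>.\<close>

lemma twisted:
  assumes "int p dvd k" "int n * k = int p ^ m * e" "\<phi> (0, c1, c2, c3, c4) [^] int n = \<phi> (0, 0, 0, 0, - e * u)"
  shows "(\<phi> (k, 0, 0, 0, 0) \<otimes> \<phi> (0, c1, c2, c3, c4)) [^] int n = \<one>"
proof -
  have A: "\<phi> (k, 0, 0, 0, 0) \<in> \<phi> ` filt 1 1" "\<phi> (0, c1, c2, c3, c4) \<in> \<phi> ` filt 1 1"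
    using assms(1) unfolding in_A_iff by simp_all
  have "(\<phi> (k, 0, 0, 0, 0) \<otimes> \<phi> (0, c1, c2, c3, c4)) [^] int n =
      \<phi> (k, 0, 0, 0, 0) [^] int n \<otimes> \<phi> (0, c1, c2, c3, c4) [^] int n"
    by (rule int_pow_mult_distrib[OF A_comm[OF A]]) simp_all
  also have "\<phi> (k, 0, 0, 0, 0) [^] int n = \<phi> (0, 0, 0, 0, u * e)"
    using phi_carry[of 0 e 0 0 0 0] by (simp add: pow_b assms(2))
  finally show ?thesis unfolding assms(3) using phi_one by (simp add: mult.commute)
qed

lemma twisted_generates:
  assumes H: "subgroup H G" "\<phi> (int p, 0, 0, 0, 0) \<in> H" "\<phi> (k, 0, 0, 0, 0) \<otimes> x \<in> H"
    and k: "int p dvd k" and x: "x \<in> carrier G"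
  shows "x \<in> H"
proof -
  obtain j where j: "k = int p * j" using k by (rule dvdE)
  have "\<phi> (k, 0, 0, 0, 0) \<in> H" using sub_pow[OF H(1,2), of j] by (simp add: pow_b j mult.commute)
  then have "inv (\<phi> (k, 0, 0, 0, 0)) \<otimes> (\<phi> (k, 0, 0, 0, 0) \<otimes> x) \<in> H"
    using H(1,3) subgroup.m_closed subgroup.m_inv_closed by metis
  then show ?thesis using x by (simp add: inv_cancel del: phi_inv)
qed

end

text \<open>Stated for any group and any assignment of the letters, so that it can be checked in the
  coordinates of a marking and then be transferred to the generators of the presented group.\<close>

definition described :: "('a, 'b) monoid_scheme \<Rightarrow> (letter \<Rightarrow> 'a) \<Rightarrow> entry \<Rightarrow> bool" where
  "described G f e \<longleftrightarrow>
     frattini G = generate G (weval G f ` frattini_gens e) \<and>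
     G\<lparr>carrier := frattini G\<rparr> \<cong> cyclic_product (frattini_type e) \<and>
     derived G (carrier G) = generate G (weval G f ` derived_gens e) \<and>
     G\<lparr>carrier := derived G (carrier G)\<rparr> \<cong> cyclic_product (derived_type e) \<and>
     centre G = generate G (weval G f ` centre_gens e) \<and>
     G\<lparr>carrier := centre G\<rparr> \<cong> cyclic_product (centre_type e)"

lemma described_2:
  fixes G (structure)
  assumes "marked G 2 m s u \<phi>" and e: "e \<in> {F1 m, F2 m, F3 m}" "s = s_of e" "u = u_of e"
  shows "described G (\<lambda>z. \<phi> (letter_coords z)) e"
proof -
  interpret marked G 2 m s u \<phi> by fact
  let ?x = "\<phi> (0, 2, 0, 0, 0)" and ?b = "\<phi> (2, 0, 0, 0, 0)"
  have s: "s = 0 \<or> s = 1" using e by auto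
  have 16: "\<phi> (0, 16, 0, 0, 0) = \<one>"
    unfolding phi_eq_0 by (rule LatI2[of _ 8 _ "-4" _ 2 _ "4 * s - 1"]) auto
  have a2: "\<phi> (0, 0, 1, 0, 0) = ?x [^] (if s = 0 then - 1 else 3 :: int)"
  proof (cases "s = 0")
    case True
    then show ?thesis unfolding phi_vec_pow phi_eq_same by (intro LatI2[of _ 1 _ 0 _ 0 _ 0]) auto
  next
    case False
    then show ?thesis using s unfolding phi_vec_pow phi_eq_same by (intro LatI2[of _ "-3" _ 2 _ "-1" _ "-1"]) auto
  qed
  have a3: "\<phi> (0, 0, 0, 1, 0) = ?x [^] (2::int)"
    unfolding phi_vec_pow phi_eq_same by (rule LatI2[of _ "-2" _ 1 _ 0 _ "- s"]) auto
  have a4: "\<phi> (0, 0, 0, 0, 1) = \<phi> (0, 8, 0, 0, 0)"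
    unfolding phi_eq_same by (rule LatI2[of _ "-4" _ 2 _ "-1" _ "1 - 2 * s"]) auto
  have a4': "\<phi> (0, 8, 0, 0, 0) = \<phi> (0, 0, 0, 0, - 1)"
    unfolding phi_eq_same by (rule LatI2[of _ 4 _ "-2" _ 1 _ "2 * s"]) auto
  have pw: "\<phi> (0, 8, 0, 0, 0) = ?x [^] (4::int)" "?x [^] (8::int) = \<one>" using 16 by (simp_all add: phi_vec_pow)
  have H: "\<phi> (0, 0, 1, 0, 0) \<in> H" "\<phi> (0, 0, 0, 1, 0) \<in> H" "\<phi> (0, 0, 0, 0, 1) \<in> H"
    if "subgroup H G" "?x \<in> H" for H
    unfolding a2 a3 a4 pw(1) by (rule sub_pow[OF that])+
  have xf: "?x \<in> \<phi> ` filt 2 r" for r using phi_a_p filtI(2)[of r 0] by simp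
  have g: "subgroup (generate G {?x}) G" "?x \<in> generate G {?x}"
    by (rule generate_sub, simp) (auto intro: generate.incl)
  have db: "derived_base [?x] [8]"
    unfolding derived_base_def using derived_subset[OF g(1) H[OF g]] pw xf by simp
  note d = derived_baseD[OF db]
  have e': "\<And>P. (e = F1 m \<Longrightarrow> P) \<Longrightarrow> (e = F2 m \<Longrightarrow> P) \<Longrightarrow> (e = F3 m \<Longrightarrow> P) \<Longrightarrow> P" using e(1) by blast
  show ?thesis
  proof (cases "u = 0")
    case True
    then have "e = F1 m \<or> e = F2 m" using e by auto
    then show ?thesis
      using d frattini_type_0[OF db True] centre_0[OF True a4[symmetric], of 1] a4
      unfolding described_def by (auto simp: model_simps insert_commute split: if_splits)
  next
    case False
    then have e3: "e = F3 m" and u: "u = 1" using e by auto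
    have bf: "?b \<in> \<phi> ` filt 2 1" using filtI(2)[of 1 2] by simp
    have t: "G\<lparr>carrier := frattini G\<rparr> \<cong> cyclic_product (frattini_type (F3 m))"
    proof -
      consider "m = 1" | "m = 2" | "m > 2" using m by linarith
      then show ?thesis
      proof cases
        case 1
        then show ?thesis using d(2) by (simp add: frattini_eq derived_eq)
      next
        case 2
        \<comment> \<open>For m = 2, b^4 = a_4 and a_1^8 is the inverse of a_4, so b^2 a_1^4 has
          square 1 and complements a_1^2.\<close>
        let ?y = "?b \<otimes> \<phi> (0, 4, 0, 0, 0)"
        have x2: "\<phi> (0, 4, 0, 0, 0) = ?x [^] (2::int)" by (simp add: phi_vec_pow)
        have y: "?y [^] int 2 = \<one>"
          by (rule twisted[where e = 1]) (use u 2 a4' in \<open>simp_all add: phi_vec_pow\<close>)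
        have "?y \<in> \<phi> ` filt 2 1"
          unfolding x2 by (rule subgroup.m_closed[OF subgroup_filt bf sub_pow[OF subgroup_filt xf]])
        then have l: "list_all2 (\<lambda>x n. x \<in> \<phi> ` filt 2 1 \<and> n > 0 \<and> x [^] int n = \<one>) [?x, ?y] [8, 2]"
          using xf pw y by (simp del: phi_mult)
        let ?H = "generate G (set [?x, ?y])"
        have gH: "subgroup ?H G" by (rule generate_sub) simp
        have xH: "?x \<in> ?H" "?y \<in> ?H" by (rule generate.incl, simp del: phi_mult)+
        have "?y \<otimes> inv (\<phi> (0, 4, 0, 0, 0)) \<in> ?H"
          unfolding x2 using xH sub_pow[OF gH xH(1)] subgroup.m_closed[OF gH] subgroup.m_inv_closed[OF gH]
          by (simp only: x2)
        then have "?b \<in> ?H" by (simp only: m_assoc phi_closed m_closed r_inv r_one inv_closed)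
        then have "G\<lparr>carrier := frattini G\<rparr> \<cong> cyclic_product [8, 2]"
          by (intro frattini_type_1[OF u _ H(1,2)[OF gH xH(1)] l]) (simp_all add: 2)
        then show ?thesis using 2 by simp
      next
        case 3
        \<comment> \<open>b^(2^m) = a_4 and a_1^8 is its inverse, so b^(2^(m - 2)) a_1^2 has fourth
          power 1; \<open>m > 2\<close> makes this exponent of b even, hence the power
          central.\<close>
        let ?k = "2 ^ (m - 2) :: int"
        let ?y = "\<phi> (?k, 0, 0, 0, 0) \<otimes> ?x"
        have "m - 2 = Suc (m - 3)" using 3 by simp
        then have k: "int 2 dvd ?k" by simp
        have "m = Suc (Suc (m - 2))" using 3 by simp
        then have "(2::int) ^ m = 2 * (2 * 2 ^ (m - 2))" by (metis power_Suc)
        then have k4: "int 4 * ?k = int 2 ^ m * 1" by simp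
        have y: "?y [^] int 4 = \<one>"
          by (rule twisted[OF k k4]) (use u a4' in \<open>simp add: phi_vec_pow\<close>)
        have "\<phi> (?k, 0, 0, 0, 0) \<in> \<phi> ` filt 2 1" using filtI(2)[of 1 ?k] k by simp
        then have "?y \<in> \<phi> ` filt 2 1" by (rule subgroup.m_closed[OF subgroup_filt _ xf])
        then have l: "list_all2 (\<lambda>x n. x \<in> \<phi> ` filt 2 1 \<and> n > 0 \<and> x [^] int n = \<one>) [?b, ?y] [2 ^ m, 2 ^ 2]"
          using bf y bp_order by (simp del: phi_mult)
        let ?H = "generate G (set [?b, ?y])"
        have gH: "subgroup ?H G" by (rule generate_sub) simp
        have bH: "?b \<in> ?H" "?y \<in> ?H" by (rule generate.incl, simp del: phi_mult)+
        have xH: "?x \<in> ?H" by (rule twisted_generates[OF gH _ bH(2) k]) (use bH(1) in simp_all)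
        have "G\<lparr>carrier := frattini G\<rparr> \<cong> cyclic_product [2 ^ m, 2 ^ 2]"
          by (rule frattini_type_1[OF u _ H(1,2)[OF gH xH] l]) (use bH(1) in simp_all)
        then show ?thesis using 3 by simp
      qed
    qed
    show ?thesis using d(1,2,3) centre_1[OF u] t
      unfolding described_def e3 by (simp add: model_simps insert_commute split: if_splits)
  qed
qed

lemma described_3:
  fixes G (structure)
  assumes "marked G 3 m s u \<phi>" and e: "e \<in> {F4 m 1, F4 m 2, F5 m}" "s = s_of e" "u = u_of e"
  shows "described G (\<lambda>z. \<phi> (letter_coords z)) e"
proof -
  interpret marked G 3 m s u \<phi> by fact
  let ?x = "\<phi> (0, 3, 0, 0, 0)" and ?a = "\<phi> (0, 0, 1, 0, 0)" and ?b = "\<phi> (3, 0, 0, 0, 0)"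
  have s: "s = 0 \<or> s = 1" using e by auto
  have x3: "?x [^] (3::int) = \<one>" unfolding phi_vec_pow phi_eq_0
    by simp (rule LatI3[of _ 3 _ "-3" _ 2 _ "s - 1"]; simp)
  have a9: "?a [^] (9::int) = \<one>" unfolding phi_vec_pow phi_eq_0
    by simp (rule LatI3[of _ 0 _ 3 _ "-3" _ 2]; simp)
  have a3: "\<phi> (0, 0, 0, 1, 0) = ?x [^] (- 1 :: int) \<otimes> ?a [^] (if s = 0 then 6 else 3 :: int)"
  proof (cases "s = 0")
    case True
    have "\<phi> (0, 0, 0, 1, 0) = \<phi> (0, - 3, 6, 0, 0)"
      unfolding phi_eq_same by (rule LatI3[of _ 1 _ "-3" _ 3 _ "-2"]) (use True in auto)
    then show ?thesis using True by (simp add: phi_vec_pow)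
  next
    case False
    have "\<phi> (0, 0, 0, 1, 0) = \<phi> (0, - 3, 3, 0, 0)"
      unfolding phi_eq_same by (rule LatI3[of _ 1 _ "-2" _ 2 _ "-1"]) (use False s in auto)
    then show ?thesis using False by (simp add: phi_vec_pow)
  qed
  have a4: "\<phi> (0, 0, 0, 0, 1) = \<phi> (0, 0, - 3, 0, 0)"
    unfolding phi_eq_same by (rule LatI3[of _ 0 _ 1 _ "-1" _ 1]) auto
  have a4': "\<phi> (0, 0, 3, 0, 0) = \<phi> (0, 0, 0, 0, - 1)"
    unfolding phi_eq_same by (rule LatI3[of _ 0 _ 1 _ "-1" _ 1]) auto
  have a4p: "\<phi> (0, 0, - 3, 0, 0) = ?a [^] (- 3 :: int)" by (simp add: phi_vec_pow)
  have H: "\<phi> (0, 0, 0, 1, 0) \<in> H" "\<phi> (0, 0, 0, 0, 1) \<in> H"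
    if "subgroup H G" "?x \<in> H" "?a \<in> H" for H
    unfolding a3 a4 a4p by (intro subgroup.m_closed[OF that(1)] sub_pow[OF that(1)] that)+
  have xf: "?x \<in> \<phi> ` filt 2 r" for r using phi_a_p filtI(2)[of r 0] by simp
  have af: "?a \<in> \<phi> ` filt 2 r" for r using filtI(2)[of r 0] by simp
  have g: "subgroup (generate G {?x, ?a}) G" "?x \<in> generate G {?x, ?a}" "?a \<in> generate G {?x, ?a}"
    by (rule generate_sub, simp) (auto intro: generate.incl)
  have sub: "\<phi> ` filt 2 m \<subseteq> generate G {?x, ?a}" by (rule derived_subset[OF g(1,3) H[OF g]])
  have db: "derived_base [?x, ?a] [3, 9]" "derived_base [?a, ?x] [9, 3]"
    unfolding derived_base_def using sub x3 a9 xf af by (simp_all add: insert_commute)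
  note d = derived_baseD[OF db(1)] derived_baseD[OF db(2)]
  show ?thesis
  proof (cases "u = 0")
    case True
    then obtain t where e4: "e = F4 m t" using e by auto
    have "G\<lparr>carrier := frattini G\<rparr> \<cong> cyclic_product (frattini_type e)"
      using frattini_type_0[OF db(1) True] unfolding e4 by auto
    moreover have "G\<lparr>carrier := centre G\<rparr> \<cong> cyclic_product (centre_type e)"
      using centre_0(2)[OF True a4', of "- 1"] a4 unfolding e4 by (auto simp: phi_vec_pow)
    moreover have "centre G = generate G {\<phi> (0, 0, 3, 0, 0), ?b}"
      using centre_0(1)[OF True a4', of "- 1"] a4 by (simp add: phi_vec_pow)
    ultimately show ?thesis
      using d unfolding described_def e4 by (simp add: model_simps insert_commute split: if_splits)
  next
    case False
    then have e5: "e = F5 m" and u: "u = 1" using e by auto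
    have bf: "?b \<in> \<phi> ` filt 2 1" using filtI(2)[of 1 3] by simp
    have t: "G\<lparr>carrier := frattini G\<rparr> \<cong> cyclic_product (frattini_type (F5 m))"
    proof (cases "m = 1")
      case True
      then show ?thesis using d(5) by (simp add: frattini_eq derived_eq)
    next
      case False
      then have m2: "m - 1 = Suc (m - 2)" "m = Suc (m - 1)" using m by simp_all
      \<comment> \<open>b^(3^m) = a_4 and a_2^3 is its inverse, so b^(3^(m - 1)) a_2 has cube 1;
        \<open>m > 1\<close> makes this power of b central.\<close>
      let ?k = "3 ^ (m - 1) :: int"
      let ?y = "\<phi> (?k, 0, 0, 0, 0) \<otimes> ?a"
      have k: "int 3 dvd ?k" unfolding m2(1) by simp
      have "(3::int) ^ m = 3 * 3 ^ (m - 1)" using m2(2) by (metis power_Suc)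
      then have k3: "int 3 * ?k = int 3 ^ m * 1" by simp
      have y: "?y [^] int 3 = \<one>"
        by (rule twisted[OF k k3]) (use u a4' in \<open>simp add: phi_vec_pow\<close>)
      have "\<phi> (?k, 0, 0, 0, 0) \<in> \<phi> ` filt 2 1" using filtI(2)[of 1 ?k] k by simp
      then have "?y \<in> \<phi> ` filt 2 1" by (rule subgroup.m_closed[OF subgroup_filt _ af])
      then have l: "list_all2 (\<lambda>x n. x \<in> \<phi> ` filt 2 1 \<and> n > 0 \<and> x [^] int n = \<one>) [?b, ?x, ?y] [3 ^ m, 3, 3]"
        using bf xf y x3 bp_order by (simp del: phi_mult)
      let ?H = "generate G (set [?b, ?x, ?y])"
      have gH: "subgroup ?H G" by (rule generate_sub) simp
      have bH: "?b \<in> ?H" "?x \<in> ?H" "?y \<in> ?H" by (rule generate.incl, simp del: phi_mult)+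
      have aH: "?a \<in> ?H" by (rule twisted_generates[OF gH _ bH(3) k]) (use bH(1) in simp_all)
      have "G\<lparr>carrier := frattini G\<rparr> \<cong> cyclic_product [3 ^ m, 3, 3]"
        by (rule frattini_type_1[OF u _ aH H(1)[OF gH bH(2) aH] l]) (use bH(1) in simp_all)
      then show ?thesis using False by simp
    qed
    show ?thesis using d centre_1[OF u] t
      unfolding described_def e5 by (simp add: model_simps insert_commute split: if_splits)
  qed
qed

lemma described_5:
  fixes G (structure)
  assumes "marked G p m s u \<phi>" and p: "p \<ge> 5"
    and e: "e = F6 p m \<or> e = F7 p m \<or> (e = F8 p m t \<and> \<not> int p dvd t)" "s = s_of e" "u = u_of e"
  shows "described G (\<lambda>z. \<phi> (letter_coords z)) e"
proof -
  interpret marked G p m s u \<phi> by fact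
  let ?a2 = "\<phi> (0, 0, 1, 0, 0)" and ?a3 = "\<phi> (0, 0, 0, 1, 0)" and ?a4 = "\<phi> (0, 0, 0, 0, 1)"
  let ?b = "\<phi> (int p, 0, 0, 0, 0)" and ?x = "\<phi> (0, int p, 0, 0, 0)"
  note L = LatI5[OF prime p]
  have pw: "?a2 [^] int p = \<one>" "?a3 [^] int p = \<one>" "?a4 [^] int p = \<one>"
    unfolding phi_vec_pow phi_eq_0 by (rule L[of _ 0]; simp)+
  have x: "?x = \<phi> (0, 0, 0, 0, s)" unfolding phi_eq_same by (rule L[of _ 1]) simp_all
  have xp: "?x [^] int p = \<one>" unfolding x phi_vec_pow using a4_p[of s] by simp
  have af: "?a2 \<in> \<phi> ` filt 2 r" "?a3 \<in> \<phi> ` filt 2 r" "?a4 \<in> \<phi> ` filt 2 r" "?x \<in> \<phi> ` filt 2 r" for r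
    unfolding x using filtI(2)[of r 0] by simp_all
  have bf: "?b \<in> \<phi> ` filt 2 1" using filtI(2)[of 1 "int p"] by simp
  have p3: "prod_list [p, p, p] = p ^ 3" by (simp add: power3_eq_cube)
  have db: "derived_base [?a2, ?a3, y] [p, p, p]"
    if y: "y \<in> \<phi> ` filt 2 m" "y [^] int p = \<one>" "?a4 = y [^] (d::int)" for y d
  proof -
    have "{?a2, ?a3, y} \<subseteq> carrier G" using y(1) subgroup.subset[OF subgroup_filt] by auto
    then have H: "subgroup (generate G {?a2, ?a3, y}) G" by (rule generate_sub)
    have i: "?a2 \<in> generate G {?a2, ?a3, y}" "?a3 \<in> generate G {?a2, ?a3, y}" "y \<in> generate G {?a2, ?a3, y}"
      by (auto intro: generate.incl)
    have "\<phi> ` filt 2 m \<subseteq> generate G {?a2, ?a3, y}"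
      by (rule derived_subset[OF H i(1,2)]) (unfold y(3), rule sub_pow[OF H i(3)])
    then show ?thesis unfolding derived_base_def using y(1,2) pw af p_pos p3 by simp
  qed
  have a41: "?a4 = ?a4 [^] (1::int)" by (simp add: phi_vec_pow)
  have db4: "derived_base [?a2, ?a3, ?a4] [p, p, p]" by (rule db[OF af(3) pw(3) a41])
  show ?thesis
    using e(1)
  proof (elim disjE conjE)
    assume e6: "e = F6 p m"
    then have u: "u = 0" using e by simp
    show ?thesis
      using derived_baseD[OF db4] frattini_type_0[OF db4 u] centre_0[OF u HOL.refl a41]
      unfolding described_def e6 by (simp add: model_simps insert_commute split: if_splits)
  next
    assume e7: "e = F7 p m"
    then have u: "u = 1" using e by simp
    have l: "list_all2 (\<lambda>x n. x \<in> \<phi> ` filt 2 1 \<and> n > 0 \<and> x [^] int n = \<one>) [?a2, ?a3, ?b] [p, p, p ^ m]"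
      using af bf pw bp_order p_pos by simp
    have i: "?a2 \<in> generate G (set [?a2, ?a3, ?b])" "?a3 \<in> generate G (set [?a2, ?a3, ?b])"
      "?b \<in> generate G (set [?a2, ?a3, ?b])" by (auto intro: generate.incl)
    have "prod_list [p, p, p ^ m] = p ^ (m + 2)" by (simp add: power_add power2_eq_square)
    then have t: "G\<lparr>carrier := frattini G\<rparr> \<cong> cyclic_product [p, p, p ^ m]"
      by (rule frattini_type_1[OF u i(3,1,2) l])
    have H: "subgroup (generate G (set [?a2, ?a3, ?b])) G" by (rule generate_sub) simp
    have "\<phi> ` filt 2 1 \<subseteq> generate G (set [?a2, ?a3, ?b])"
      by (rule filt2_subset[OF H i(1,2) top_in_b[OF u H i(3)]]) (use i(3) in simp)
    then have "frattini G = generate G (set [?a2, ?a3, ?b])"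
      unfolding frattini_eq using af bf by (intro generate_filt) simp_all
    then show ?thesis
      using derived_baseD(1,2)[OF db4] t centre_1[OF u] phi_bm u
      unfolding described_def e7 by (simp add: model_simps insert_commute split: if_splits)
  next
    assume e8: "e = F8 p m t" and nt: "\<not> int p dvd t"
    then have u: "u = 0" and s: "s = t ^ (p - 2)" using e by simp_all
    have "int p dvd 1 - t * s"
      using fermat_inverse[OF prime nt] unfolding s cong_iff_dvd_diff by (simp add: dvd_diff_commute)
    \<comment> \<open>F8 records a_1^p in place of a_4; this shows that both generate the same
      group.\<close>
    then have a4: "?a4 = ?x [^] t" unfolding x phi_vec_pow phi_eq_same using p_pos by (simp add: Lat_last)
    note db8 = db[OF af(4) xp a4]
    show ?thesis
      using derived_baseD[OF db8] frattini_type_0[OF db8 u] centre_0[OF u x a4]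
      unfolding described_def e8 by (simp add: model_simps insert_commute split: if_splits)
  qed
qed

lemma weval_cong:
  assumes "\<And>z. z \<in> S \<Longrightarrow> f z = g z" "w \<in> lists (S \<times> UNIV)"
  shows "weval G f w = weval G g w"
  using assms(2) by (induction w) (auto simp: weval_def letter_val_def assms(1))

lemma recorded_words:
  shows "frattini_gens e \<subseteq> lists (gens e \<times> UNIV)" "derived_gens e \<subseteq> lists (gens e \<times> UNIV)"
    "centre_gens e \<subseteq> lists (gens e \<times> UNIV)"
  by (cases e; simp add: wpow_lists)+

lemma described_grp:
  assumes "admissible e"
  shows "described (grp e) (gen_class (gens e) (rels e)) e"
proof -
  obtain \<psi> where M: "marked (grp e) (prime_of e) (exponent_of e) (s_of e) (u_of e) \<psi>"
    and g: "\<And>z. z \<in> gens e \<Longrightarrow> \<psi> (letter_coords z) = gen_class (gens e) (rels e) z"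
    by (rule entry_marked[OF assms]) (rule that, assumption, simp)
  have D: "described (grp e) (\<lambda>z. \<psi> (letter_coords z)) e"
  proof (cases "prime_of e \<ge> 5")
    case True
    then show ?thesis using M assms
      by (cases e) (auto intro: described_5)
  next
    case False
    then show ?thesis using M assms
      by (cases e) (auto intro: described_2 described_3)
  qed
  have "weval (grp e) (\<lambda>z. \<psi> (letter_coords z)) ` W = weval (grp e) (gen_class (gens e) (rels e)) ` W"
    if W: "W \<subseteq> lists (gens e \<times> UNIV)" for W
    using W by (intro image_cong weval_cong[OF g]) auto
  note w = this[OF recorded_words(1)] this[OF recorded_words(2)]
    this[OF recorded_words(3)]
  show ?thesis using D unfolding described_def w .
qed

lemma listed_description:
  assumes "admissible e"
  shows "order (grp e) = prime_of e ^ (exponent_of e + 4)"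
    "frattini (grp e) = span_of e (frattini_gens e)"
    "(grp e)\<lparr>carrier := frattini (grp e)\<rparr> \<cong> cyclic_product (frattini_type e)"
    "derived (grp e) (carrier (grp e)) = span_of e (derived_gens e)"
    "(grp e)\<lparr>carrier := derived (grp e) (carrier (grp e))\<rparr> \<cong> cyclic_product (derived_type e)"
    "centre (grp e) = span_of e (centre_gens e)"
    "(grp e)\<lparr>carrier := centre (grp e)\<rparr> \<cong> cyclic_product (centre_type e)"
proof -
  obtain \<psi> where M: "marked (grp e) (prime_of e) (exponent_of e) (s_of e) (u_of e) \<psi>"
    using assms by (rule adm_marked)
  show "order (grp e) = prime_of e ^ (exponent_of e + 4)" using M by (rule marked.order_G)
  have "weval (grp e) (gen_class (gens e) (rels e)) ` W = word_class (gens e) (rels e) ` W"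
    if W: "W \<subseteq> lists (gens e \<times> UNIV)" for W
    unfolding grp_def using W by (intro image_cong weval_presented) auto
  note w = this[OF recorded_words(1)] this[OF recorded_words(2)]
    this[OF recorded_words(3)]
  show "frattini (grp e) = span_of e (frattini_gens e)"
    "(grp e)\<lparr>carrier := frattini (grp e)\<rparr> \<cong> cyclic_product (frattini_type e)"
    "derived (grp e) (carrier (grp e)) = span_of e (derived_gens e)"
    "(grp e)\<lparr>carrier := derived (grp e) (carrier (grp e))\<rparr> \<cong> cyclic_product (derived_type e)"
    "centre (grp e) = span_of e (centre_gens e)"
    "(grp e)\<lparr>carrier := centre (grp e)\<rparr> \<cong> cyclic_product (centre_type e)"
    using described_grp[OF assms] unfolding described_def span_of_def w by blast+
qed

theorem theorem5p1:
  fixes T :: "nat \<Rightarrow> int set"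
  assumes T: "cube_coset_choice T"
  shows
    "(\<forall>p (G :: ('a, 'b) monoid_scheme). standing_hyp p G \<longrightarrow>
        (min_gens G = 2 \<and> nilp_class G = 4 \<longleftrightarrow> (\<exists>e. listed T e \<and> G \<cong> grp e)) \<and>
        (min_gens G = 2 \<and> nilp_class G = 4 \<longrightarrow>
           mu p 0 G = 1 \<and> mu p 1 G = 0 \<and> mu p 2 G = p \<and> alpha1 p G = p ^ 2)) \<and>
     (\<forall>e. listed T e \<longrightarrow> standing_hyp (prime_of e) (grp e)) \<and>
     (\<forall>e e'. listed T e \<and> listed T e' \<and> grp e \<cong> grp e' \<longrightarrow> e = e') \<and>
     (\<forall>e. listed T e \<longrightarrow>
        order (grp e) = prime_of e ^ (exponent_of e + 4) \<and>
        frattini (grp e) = span_of e (frattini_gens e) \<and>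
        (grp e)\<lparr>carrier := frattini (grp e)\<rparr> \<cong> cyclic_product (frattini_type e) \<and>
        derived (grp e) (carrier (grp e)) = span_of e (derived_gens e) \<and>
        (grp e)\<lparr>carrier := derived (grp e) (carrier (grp e))\<rparr> \<cong> cyclic_product (derived_type e) \<and>
        centre (grp e) = span_of e (centre_gens e) \<and>
        (grp e)\<lparr>carrier := centre (grp e)\<rparr> \<cong> cyclic_product (centre_type e))"
proof (intro conjI allI impI)
  fix p and G :: "('a, 'b) monoid_scheme"
  assume G: "standing_hyp p G"
  show "min_gens G = 2 \<and> nilp_class G = 4 \<longleftrightarrow> (\<exists>e. listed T e \<and> G \<cong> grp e)"
  proof
    assume "min_gens G = 2 \<and> nilp_class G = 4"
    then show "\<exists>e. listed T e \<and> G \<cong> grp e" using standing_listed[OF T G] by blast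
  next
    assume "\<exists>e. listed T e \<and> G \<cong> grp e"
    then obtain e where e: "listed T e" "G \<cong> grp e" by blast
    obtain \<phi> where "marked G p (exponent_of e) (s_of e) (u_of e) \<phi>"
      using T G e by (rule isomorphic_listed)
    then show "min_gens G = 2 \<and> nilp_class G = 4"
      using marked.min_gens_2 marked.class_4 by blast
  qed
  assume dc: "min_gens G = 2 \<and> nilp_class G = 4"
  obtain e where e: "listed T e" "G \<cong> grp e" using standing_listed[OF T G] dc by blast
  obtain \<phi> where M: "marked G p (exponent_of e) (s_of e) (u_of e) \<phi>"
    using T G e by (rule isomorphic_listed)
  show "mu p 0 G = 1" using M by (rule marked.mu0)
  show "mu p 1 G = 0" using M by (rule marked.mu1)
  show "mu p 2 G = p" using M by (rule marked.mu2)
  show "alpha1 p G = p ^ 2" using M by (rule marked.alpha1)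
next
  fix e assume "listed T e"
  then have "admissible e" by (rule listed_admissible[OF T])
  then obtain \<psi> where "marked (grp e) (prime_of e) (exponent_of e) (s_of e) (u_of e) \<psi>"
    by (rule adm_marked)
  then show "standing_hyp (prime_of e) (grp e)" by (rule marked.standing)
next
  fix e e' assume "listed T e \<and> listed T e' \<and> grp e \<cong> grp e'"
  then show "e = e'" using isomorphic_listed_eq[OF T] by blast
qed (rule listed_description, erule listed_admissible[OF T])+

end
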